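(* Assume that there is a constant $L>0$ such that for all $\mathbf{u},\mathbf{v}\in\mathbb{R}^d$ and $i=1,\dots,m$: $$\|\mathbf{F}(\mathbf{u})\|_2^2\le L(1+\|\mathbf{u}\|_2^2),\qquad \|\mathbf{g}_i(\mathbf{u})\|_2^2\le L(1+\|\mathbf{u}\|_2^2),$$ $$\|\mathbf{F}(\mathbf{u})-\mathbf{F}(\mathbf{v})\|_2\le L\|\mathbf{u}-\mathbf{v}\|_2,\qquad \|\mathbf{g}_i(\mathbf{u})-\mathbf{g}_i(\mathbf{v})\|_2\le L\|\mathbf{u}-\mathbf{v}\|_2 .$$ Let $\mathbf{u}(t)$ be the solution of the SDE $$d\mathbf{u}=(A\mathbf{u}+\mathbf{F}(\mathbf{u}))\,dt+\sum_{i=1}^m (B_i\mathbf{u}+\mathbf{g}_i(\mathbf{u}))\,dW_i(t),\qquad \mathbf{u}(0)=\mathbf{u}_0\in\mathbb{R}^d,$$ and let $\mathbf{u}_n$ be the approximation generated by the scheme EI0, i.e. starting from $\mathbf{u}_0$, $$\mathbf{u}_{n+1}=\mathbf{\Phi}_{t_{n+1},t_n}\Big(\mathbf{u}_n+\tilde{\mathbf{f}}(\mathbf{u}_n)\Delta t+\sum_{i=1}^m \mathbf{g}_i(\mathbf{u}_n)\Delta W_{i,n}\Big).$$ Then for $T>0$ there exists $K>0$ (independent of $\Delta t$) such that $$\sup_{0\le t_n\le T}\|\mathbf{u}(t_n)-\mathbf{u}_n\|_{L^2(\Omega,\mathbb{R}^d)}\le K\,\Delta t^{1/2}.$$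
   Context: $(\Omega,\mathcal{F},\mathbb{P})$ is a probability space with filtration $(\mathcal{F}_t)_{t\in[0,T]}$, and $W_1,\dots,W_m$ are iid (real-valued) Brownian motions. $\mathbf{F},\mathbf{g}_i:\mathbb{R}^d\to\mathbb{R}^d$, and the matrices $A,B_i\in\mathbb{R}^{d\times d}$ satisfy $[A,B_i]=0$ and $[B_j,B_i]=0$ for all $i,j=1,\dots,m$, where $[\cdot,\cdot]$ is the commutator. $T\in(0,\infty)$ is fixed and $0=t_0<t_1<\dots<t_N=T$ is a partition with constant step size $\Delta t=t_{j+1}-t_j$. $\Delta W_{i,n}=W_i(t_{n+1})-W_i(t_n)$. $\|\cdot\|_2$ is the Euclidean norm and $\|X\|_{L^2(\Omega,\mathbb{R}^d)}^2=\mathbb{E}[\|X\|_2^2]$. For $t\ge s$, $$\mathbf{\Phi}_{t,s}=\exp\Big(\big(A-\tfrac12\sum_{i=1}^m B_i^2\big)(t-s)+\sum_{i=1}^m B_i\,(W_i(t)-W_i(s))\Big),$$ and $\tilde{\mathbf{f}}(\mathbf{u})=\mathbf{F}(\mathbf{u})-\sum_{i=1}^m B_i\mathbf{g}_i(\mathbf{u})$. The SDE is in the Itô sense. *)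

theory Defs
  imports "HOL-Probability.Probability"
begin

section \<open>Matrices\<close>

definition commutator :: "real^'d^'d \<Rightarrow> real^'d^'d \<Rightarrow> real^('d::finite)^'d" where
  "commutator X Y = X ** Y - Y ** X"

text \<open>The ring operations of the type \<^typ>\<open>real^'d^'d\<close> are componentwise, so neither \<^const>\<open>power\<close>
  nor \<^const>\<open>exp\<close> gives the matrix version.\<close>

primrec matrix_pow :: "real^'d^'d \<Rightarrow> nat \<Rightarrow> real^('d::finite)^'d" where
  "matrix_pow X 0 = mat 1"
| "matrix_pow X (Suc k) = X ** matrix_pow X k"

definition matrix_exp :: "real^'d^'d \<Rightarrow> real^('d::finite)^'d" where
  "matrix_exp X = (\<Sum>k. (1 / fact k) *\<^sub>R matrix_pow X k)"


section \<open>Filtrations and Brownian motions on a compact time interval\<close>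

definition filtration_upto :: "'a measure \<Rightarrow> (real \<Rightarrow> 'a measure) \<Rightarrow> real \<Rightarrow> bool" where
  "filtration_upto M Fil T \<longleftrightarrow>
     (\<forall>t\<in>{0..T}. subalgebra M (Fil t)) \<and>
     (\<forall>s\<in>{0..T}. \<forall>t\<in>{0..T}. s \<le> t \<longrightarrow> sets (Fil s) \<subseteq> sets (Fil t))"

text \<open>Jointly measurable and adapted processes.\<close>

definition measurable_adapted ::
    "'a measure \<Rightarrow> (real \<Rightarrow> 'a measure) \<Rightarrow> real \<Rightarrow> (real \<Rightarrow> 'a \<Rightarrow> 'b::topological_space) \<Rightarrow> bool" where
  "measurable_adapted M Fil T X \<longleftrightarrow>
     (\<lambda>(t, \<omega>). X t \<omega>) \<in> borel_measurable (restrict_space borel {0..T} \<Otimes>\<^sub>M M) \<and>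
     (\<forall>t\<in>{0..T}. X t \<in> borel_measurable (Fil t))"

definition indep_of_sigma :: "'a measure \<Rightarrow> 'a measure \<Rightarrow> ('a \<Rightarrow> 'b::topological_space) \<Rightarrow> bool" where
  "indep_of_sigma M G X \<longleftrightarrow>
     prob_space.indep_set M (sets G) (sets (vimage_algebra (space M) X borel))"

definition brownian_motion ::
    "'a measure \<Rightarrow> (real \<Rightarrow> 'a measure) \<Rightarrow> real \<Rightarrow> (real \<Rightarrow> 'a \<Rightarrow> real) \<Rightarrow> bool" where
  "brownian_motion M Fil T W \<longleftrightarrow>
     (\<forall>t\<in>{0..T}. W t \<in> borel_measurable (Fil t)) \<and>
     (AE \<omega> in M. W 0 \<omega> = 0) \<and>
     (AE \<omega> in M. continuous_on {0..T} (\<lambda>t. W t \<omega>)) \<and>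
     (\<forall>s t. 0 \<le> s \<longrightarrow> s < t \<longrightarrow> t \<le> T \<longrightarrow>
        distributed M lborel (\<lambda>\<omega>. W t \<omega> - W s \<omega>) (normal_density 0 (sqrt (t - s))) \<and>
        indep_of_sigma M (Fil s) (\<lambda>\<omega>. W t \<omega> - W s \<omega>))"

text \<open>Independent Brownian motions with respect to a common filtration. As usual for a
  multi-dimensional Brownian motion, the \<^emph>\<open>vector\<close> of increments is independent of the past.\<close>

definition indep_brownian_motions ::
    "'a measure \<Rightarrow> (real \<Rightarrow> 'a measure) \<Rightarrow> real \<Rightarrow> ('m::finite \<Rightarrow> real \<Rightarrow> 'a \<Rightarrow> real) \<Rightarrow> bool" where
  "indep_brownian_motions M Fil T W \<longleftrightarrow>
     (\<forall>i. brownian_motion M Fil T (W i)) \<and>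
     prob_space.indep_vars M (\<lambda>_. \<Pi>\<^sub>M t\<in>{0..T}. borel) (\<lambda>i \<omega>. \<lambda>t\<in>{0..T}. W i t \<omega>) UNIV \<and>
     (\<forall>s t. 0 \<le> s \<longrightarrow> s < t \<longrightarrow> t \<le> T \<longrightarrow>
        indep_of_sigma M (Fil s) (\<lambda>\<omega>. \<chi> i. W i t \<omega> - W i s \<omega>))"


section \<open>The It\^o integral\<close>

text \<open>A simple process on the interval from 0 to \<open>t\<close> is given by grid points
  \<open>0 = p 0 \<le> \<dots> \<le> p n = t\<close> and bounded random variables \<open>\<xi> k\<close>, measurable with respect to
  the information at time \<open>p k\<close>; its value on the interval from \<open>p k\<close> (excluded) to
  \<open>p (Suc k)\<close> (included) is \<open>\<xi> k\<close>.\<close>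

definition simple_process ::
    "(real \<Rightarrow> 'a measure) \<Rightarrow> real \<Rightarrow> nat \<Rightarrow> (nat \<Rightarrow> real) \<Rightarrow> (nat \<Rightarrow> 'a \<Rightarrow> 'b::real_normed_vector) \<Rightarrow> bool"
  where
  "simple_process Fil t n p \<xi> \<longleftrightarrow>
     p 0 = 0 \<and> p n = t \<and> (\<forall>k<n. p k \<le> p (Suc k)) \<and>
     (\<forall>k<n. \<xi> k \<in> borel_measurable (Fil (p k)) \<and> (\<exists>C. \<forall>\<omega>\<in>space (Fil (p k)). norm (\<xi> k \<omega>) \<le> C))"

definition simple_value ::
    "nat \<Rightarrow> (nat \<Rightarrow> real) \<Rightarrow> (nat \<Rightarrow> 'a \<Rightarrow> 'b::real_normed_vector) \<Rightarrow> real \<Rightarrow> 'a \<Rightarrow> 'b" where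
  "simple_value n p \<xi> s \<omega> = (\<Sum>k<n. indicat_real {p k<..p (Suc k)} s *\<^sub>R \<xi> k \<omega>)"

definition simple_ito ::
    "(real \<Rightarrow> 'a \<Rightarrow> real) \<Rightarrow> nat \<Rightarrow> (nat \<Rightarrow> real) \<Rightarrow> (nat \<Rightarrow> 'a \<Rightarrow> 'b::real_normed_vector) \<Rightarrow> 'a \<Rightarrow> 'b" where
  "simple_ito W n p \<xi> \<omega> = (\<Sum>k<n. (W (p (Suc k)) \<omega> - W (p k) \<omega>) *\<^sub>R \<xi> k \<omega>)"

definition tendsto_in_prob ::
    "'a measure \<Rightarrow> (nat \<Rightarrow> 'a \<Rightarrow> 'b::metric_space) \<Rightarrow> ('a \<Rightarrow> 'b) \<Rightarrow> bool" where
  "tendsto_in_prob M X Y \<longleftrightarrow>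
     (\<forall>\<epsilon>>0. (\<lambda>j. measure M {\<omega>\<in>space M. \<epsilon> < dist (X j \<omega>) (Y \<omega>)}) \<longlonglongrightarrow> 0)"

text \<open>\<open>has_ito_integral M Fil W t \<phi> X\<close> states that \<open>X\<close> is (a version of) the It\^o integral of
  \<open>\<phi>\<close> against \<open>W\<close> from 0 to \<open>t\<close>. The integrands are the measurable adapted processes with almost
  surely square-integrable paths, and the integral is the limit in probability of the elementary
  integrals of simple processes that approximate \<open>\<phi>\<close>. The limit does not depend on
  the approximating sequence.\<close>

definition has_ito_integral ::
    "'a measure \<Rightarrow> (real \<Rightarrow> 'a measure) \<Rightarrow> (real \<Rightarrow> 'a \<Rightarrow> real) \<Rightarrow> real \<Rightarrow>
      (real \<Rightarrow> 'a \<Rightarrow> 'b::{banach, second_countable_topology}) \<Rightarrow> ('a \<Rightarrow> 'b) \<Rightarrow> bool" where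
  "has_ito_integral M Fil W t \<phi> X \<longleftrightarrow>
     measurable_adapted M Fil t \<phi> \<and>
     (AE \<omega> in M. set_integrable lborel {0..t} (\<lambda>s. (norm (\<phi> s \<omega>))\<^sup>2)) \<and>
     X \<in> borel_measurable M \<and>
     (\<exists>n p \<xi>.
        (\<forall>j. simple_process Fil t (n j) (p j) (\<xi> j)) \<and>
        tendsto_in_prob M
          (\<lambda>j \<omega>. LINT s:{0..t}|lborel. (norm (simple_value (n j) (p j) (\<xi> j) s \<omega> - \<phi> s \<omega>))\<^sup>2) (\<lambda>_. 0) \<and>
        tendsto_in_prob M (\<lambda>j. simple_ito W (n j) (p j) (\<xi> j)) X)"


section \<open>Stochastic differential equations\<close>

text \<open>Solutions of \<open>du = a(u) dt + \<Sum>\<^sub>i b\<^sub>i(u) dW\<^sub>i\<close>, \<open>u(0) = u\<^sub>0\<close>, in the It\^o sense.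
  The initial condition is the integral equation at time 0.\<close>

definition sde_solution ::
    "'a measure \<Rightarrow> (real \<Rightarrow> 'a measure) \<Rightarrow> real \<Rightarrow> ('m::finite \<Rightarrow> real \<Rightarrow> 'a \<Rightarrow> real) \<Rightarrow>
      (real^'d \<Rightarrow> real^'d) \<Rightarrow> ('m \<Rightarrow> real^'d \<Rightarrow> real^'d) \<Rightarrow> real^'d \<Rightarrow>
      (real \<Rightarrow> 'a \<Rightarrow> real^('d::finite)) \<Rightarrow> bool" where
  "sde_solution M Fil T W a b u0 u \<longleftrightarrow>
     measurable_adapted M Fil T u \<and>
     (AE \<omega> in M. continuous_on {0..T} (\<lambda>t. u t \<omega>)) \<and>
     (\<exists>J. \<forall>t\<in>{0..T}.
        (\<forall>i. has_ito_integral M Fil (W i) t (\<lambda>s \<omega>. b i (u s \<omega>)) (J i t)) \<and>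
        (AE \<omega> in M. u t \<omega> = u0 + (LINT s:{0..t}|lborel. a (u s \<omega>)) + (\<Sum>i\<in>UNIV. J i t \<omega>)))"


section \<open>The numerical scheme\<close>

definition uniform_partition :: "real \<Rightarrow> nat \<Rightarrow> (nat \<Rightarrow> real) \<Rightarrow> real \<Rightarrow> bool" where
  "uniform_partition T N t \<Delta>t \<longleftrightarrow>
     t 0 = 0 \<and> t N = T \<and> 0 < \<Delta>t \<and> (\<forall>j<N. t (Suc j) - t j = \<Delta>t)"

definition Phi ::
    "real^'d^'d \<Rightarrow> ('m::finite \<Rightarrow> real^'d^'d) \<Rightarrow> ('m \<Rightarrow> real \<Rightarrow> 'a \<Rightarrow> real) \<Rightarrow>
      real \<Rightarrow> real \<Rightarrow> 'a \<Rightarrow> real^('d::finite)^'d" where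
  "Phi A B W t s \<omega> = matrix_exp
     ((t - s) *\<^sub>R (A - (1/2) *\<^sub>R (\<Sum>i\<in>UNIV. B i ** B i)) + (\<Sum>i\<in>UNIV. (W i t \<omega> - W i s \<omega>) *\<^sub>R B i))"

definition f_tilde ::
    "('m::finite \<Rightarrow> real^'d^'d) \<Rightarrow> (real^'d \<Rightarrow> real^'d) \<Rightarrow> ('m \<Rightarrow> real^'d \<Rightarrow> real^'d) \<Rightarrow>
      real^'d \<Rightarrow> real^('d::finite)" where
  "f_tilde B F g x = F x - (\<Sum>i\<in>UNIV. B i *v g i x)"

primrec EI0 ::
    "real^'d^'d \<Rightarrow> ('m::finite \<Rightarrow> real^'d^'d) \<Rightarrow> (real^'d \<Rightarrow> real^'d) \<Rightarrow> ('m \<Rightarrow> real^'d \<Rightarrow> real^'d) \<Rightarrow>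
      ('m \<Rightarrow> real \<Rightarrow> 'a \<Rightarrow> real) \<Rightarrow> (nat \<Rightarrow> real) \<Rightarrow> real \<Rightarrow> real^'d \<Rightarrow> nat \<Rightarrow> 'a \<Rightarrow> real^('d::finite)" where
  "EI0 A B F g W t \<Delta>t u0 0 = (\<lambda>\<omega>. u0)"
| "EI0 A B F g W t \<Delta>t u0 (Suc n) = (\<lambda>\<omega>.
     Phi A B W (t (Suc n)) (t n) \<omega> *v
       (EI0 A B F g W t \<Delta>t u0 n \<omega> + \<Delta>t *\<^sub>R f_tilde B F g (EI0 A B F g W t \<Delta>t u0 n \<omega>) +
        (\<Sum>i\<in>UNIV. (W i (t (Suc n)) \<omega> - W i (t n) \<omega>) *\<^sub>R g i (EI0 A B F g W t \<Delta>t u0 n \<omega>))))"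

definition square_integrable :: "'a measure \<Rightarrow> ('a \<Rightarrow> 'b::real_normed_vector) \<Rightarrow> bool" where
  "square_integrable M X \<longleftrightarrow> X \<in> borel_measurable M \<and> integrable M (\<lambda>\<omega>. (norm (X \<omega>))\<^sup>2)"

text \<open>Meaningful for \<^const>\<open>square_integrable\<close> random variables only: otherwise the Bochner integral
  is 0 by convention.\<close>

definition L2_norm :: "'a measure \<Rightarrow> ('a \<Rightarrow> 'b::real_normed_vector) \<Rightarrow> real" where
  "L2_norm M X = sqrt (\<integral>\<omega>. (norm (X \<omega>))\<^sup>2 \<partial>M)"

end

theory Submission
  imports Defs
begin

text \<open>
  The whole argument takes place in discrete time. The stochastic integrals of a solution are only known
  as limits in probability of integrals of simple processes, so the solution has no moments to start with.
  The Euler--Maruyama scheme does have them, and it serves as an intermediary: the exponential scheme on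
  \<open>N\<close> steps is compared in mean square with the Euler--Maruyama scheme on \<open>N * R\<close> steps, with a bound that
  does not depend on \<open>R\<close>, and the fine Euler--Maruyama scheme converges to the solution in probability as
  \<open>R\<close> grows. A Fatou argument (\<open>L2_limit_in_prob\<close>) carries the bound over to the solution and shows at the
  same time that the error is square-integrable.

  \<^bold>\<open>The mean-square comparison.\<close> If an error grows in a step of length \<open>h\<close> by a drift part of mean square
  \<open>O(h\<^sup>2) (E|e|\<^sup>2 + r)\<close> and a martingale increment of mean square \<open>O(h) (E|e|\<^sup>2 + r)\<close>, then
  \<open>E|e|\<^sup>2 + r\<close> grows by a factor \<open>1 + O(h)\<close>, because the martingale part is orthogonal to the past
  (\<open>mean_square_gronwall\<close>). This one inequality is used with \<open>r = 1\<close> for the moments of the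
  Euler--Maruyama scheme, with the moment bound as \<open>r\<close> for its increments, with a small \<open>r\<close> for the
  convergence in probability, and with \<open>r = h\<close> for the error of the exponential scheme.

  \<^bold>\<open>One step of the exponential scheme\<close> is an Euler--Maruyama step plus a remainder (\<open>EI0_step\<close>), a sum
  of random matrices applied to functions of the current value. The exponent
  \<open>Z = (A - \<Sum>B\<^sub>i\<^sup>2 / 2) h + \<Sum>B\<^sub>i \<zeta>\<^sub>i\<close> has \<open>E Z = (A - \<Sum>B\<^sub>i\<^sup>2 / 2) h\<close> and \<open>E Z\<^sup>2 / 2 = h \<Sum>B\<^sub>i\<^sup>2 / 2 + O(h\<^sup>2)\<close>,
  so the mean of \<open>exp Z\<close> is \<open>1 + A h\<close> up to \<open>O(h powr (3/2))\<close>; likewise the products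
  \<open>B\<^sub>i \<zeta>\<^sub>i g\<^sub>j \<zeta>\<^sub>j\<close> have total mean \<open>h \<Sum>B\<^sub>i g\<^sub>i\<close>, which is exactly the correction in the modified drift. Hence every
  matrix of the remainder has mean square \<open>O(h\<^sup>2)\<close> and mean \<open>O(h powr (3/2))\<close> (\<open>small_coeff\<close>), which is
  what the inequality needs with \<open>r = h\<close>.

  \<^bold>\<open>Convergence in probability.\<close> A martingale sum whose quadratic variation is small with high
  probability has a small maximum with high probability (\<open>maximal_inequality\<close>); this is proved by cutting
  the integrand off as soon as the sum or its quadratic variation becomes large. It identifies the given
  stochastic integrals with limits of left Riemann sums (\<open>ito_integral_riemann\<close>), and, since a Riemann sum
  can be compared with a much finer one, it makes the convergence uniform over the grid
  (\<open>riemann_max_tendsto\<close>). Stopping at the first grid point where solution and Riemann sum differ by more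
  than \<open>\<eta>\<close>, the comparison with the Euler--Maruyama scheme becomes a mean-square recursion again
  (\<open>em_close_in_prob\<close>).
\<close>

section \<open>Square-integrable random vectors\<close>

lemma norm_add_square_le:
  fixes x y :: "'b::real_inner"
  shows "(norm (x + y))\<^sup>2 \<le> 2 * (norm x)\<^sup>2 + 2 * (norm y)\<^sup>2"
proof -
  have "0 \<le> (norm (x - y))\<^sup>2" by simp
  then show ?thesis by (simp add: power2_norm_eq_inner inner_add inner_diff inner_commute)
qed

lemma norm_diff_square_le:
  fixes x y :: "'b::real_inner"
  shows "(norm (x - y))\<^sup>2 \<le> 2 * (norm x)\<^sup>2 + 2 * (norm y)\<^sup>2"
  using norm_add_square_le[of x "- y"] by simp

lemma norm_sum_square_le:
  fixes f :: "'i \<Rightarrow> 'b::real_normed_vector"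
  assumes "finite I"
  shows "(norm (\<Sum>i\<in>I. f i))\<^sup>2 \<le> real (card I) * (\<Sum>i\<in>I. (norm (f i))\<^sup>2)"
proof -
  have "norm (\<Sum>i\<in>I. f i) \<le> (\<Sum>i\<in>I. 1 * norm (f i))" by (simp add: norm_sum)
  then have "(norm (\<Sum>i\<in>I. f i))\<^sup>2 \<le> (\<Sum>i\<in>I. 1 * norm (f i))\<^sup>2" by (intro power_mono) auto
  also have "\<dots> \<le> (\<Sum>i\<in>I. 1\<^sup>2) * (\<Sum>i\<in>I. (norm (f i))\<^sup>2)" by (rule Cauchy_Schwarz_ineq_sum)
  finally show ?thesis by simp
qed

text \<open>The constant that results when a step of length \<open>h \<le> T\<close> has drift and noise of relative size \<open>\<kappa>\<close>;
  see \<open>mean_square_step\<close>.\<close>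

definition gronwall_rate :: "real \<Rightarrow> real \<Rightarrow> real" where
  "gronwall_rate \<kappa> T = 1 + 3 * \<kappa> + 2 * \<kappa> * T"

context prob_space
begin

abbreviation "L2 \<equiv> square_integrable M"

abbreviation msq :: "('a \<Rightarrow> 'b::real_normed_vector) \<Rightarrow> real" where
  "msq X \<equiv> \<integral>\<omega>. (norm (X \<omega>))\<^sup>2 \<partial>M"

lemma L2_measurable[measurable_dest]: "L2 X \<Longrightarrow> X \<in> borel_measurable M"
  by (simp add: square_integrable_def)

lemma L2_integrable_square: "L2 X \<Longrightarrow> integrable M (\<lambda>\<omega>. (norm (X \<omega>))\<^sup>2)"
  by (simp add: square_integrable_def)

lemma msq_nonneg[simp]: "0 \<le> msq X"
  by simp

lemma L2_dominated:
  fixes X :: "'a \<Rightarrow> 'b::euclidean_space"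
  assumes "X \<in> borel_measurable M" "integrable M f" "\<And>\<omega>. (norm (X \<omega>))\<^sup>2 \<le> f \<omega>"
  shows "L2 X"
  unfolding square_integrable_def
proof
  note assms(1)[measurable]
  show "integrable M (\<lambda>\<omega>. (norm (X \<omega>))\<^sup>2)"
    by (rule Bochner_Integration.integrable_bound[OF assms(2)])
      (use assms(3) in \<open>auto intro!: AE_I2 order_trans[OF assms(3)]\<close>)
qed fact

lemma msq_dominated:
  fixes X :: "'a \<Rightarrow> 'b::euclidean_space"
  assumes "X \<in> borel_measurable M" "integrable M f" "\<And>\<omega>. (norm (X \<omega>))\<^sup>2 \<le> f \<omega>"
  shows "msq X \<le> integral\<^sup>L M f"
  using L2_dominated[OF assms] assms(2,3)
  by (intro integral_mono) (auto simp: square_integrable_def)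

lemma L2_const[simp]: "L2 (\<lambda>\<omega>. c :: 'b::euclidean_space)"
  by (simp add: square_integrable_def)

lemma L2_add:
  fixes X Y :: "'a \<Rightarrow> 'b::euclidean_space"
  assumes "L2 X" "L2 Y"
  shows "L2 (\<lambda>\<omega>. X \<omega> + Y \<omega>)" "msq (\<lambda>\<omega>. X \<omega> + Y \<omega>) \<le> 2 * msq X + 2 * msq Y"
proof -
  note assms[THEN L2_measurable, measurable] assms[THEN L2_integrable_square, simp]
  have *: "integrable M (\<lambda>\<omega>. 2 * (norm (X \<omega>))\<^sup>2 + 2 * (norm (Y \<omega>))\<^sup>2)" by simp
  show "L2 (\<lambda>\<omega>. X \<omega> + Y \<omega>)"
    by (rule L2_dominated[OF _ * norm_add_square_le]) measurable
  show "msq (\<lambda>\<omega>. X \<omega> + Y \<omega>) \<le> 2 * msq X + 2 * msq Y"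
    using msq_dominated[OF _ * norm_add_square_le] by simp
qed

lemma L2_scaleR:
  fixes X :: "'a \<Rightarrow> 'b::euclidean_space"
  assumes "L2 X"
  shows "L2 (\<lambda>\<omega>. c *\<^sub>R X \<omega>)"
  unfolding square_integrable_def
proof
  note L2_measurable[OF assms, measurable]
  show "(\<lambda>\<omega>. c *\<^sub>R X \<omega>) \<in> borel_measurable M" by measurable
  show "integrable M (\<lambda>\<omega>. (norm (c *\<^sub>R X \<omega>))\<^sup>2)"
    using L2_integrable_square[OF assms] by (simp add: power_mult_distrib)
qed

lemma L2_uminus:
  fixes X :: "'a \<Rightarrow> 'b::euclidean_space"
  shows "L2 X \<Longrightarrow> L2 (\<lambda>\<omega>. - X \<omega>)"
  by (simp add: square_integrable_def)

lemma L2_diff: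
  fixes X Y :: "'a \<Rightarrow> 'b::euclidean_space"
  assumes "L2 X" "L2 Y"
  shows "L2 (\<lambda>\<omega>. X \<omega> - Y \<omega>)" "msq (\<lambda>\<omega>. X \<omega> - Y \<omega>) \<le> 2 * msq X + 2 * msq Y"
  using L2_add[OF assms(1) L2_uminus[OF assms(2)]] by simp_all

lemma L2_sum:
  fixes X :: "'i \<Rightarrow> 'a \<Rightarrow> 'b::euclidean_space"
  assumes "finite I" "\<And>i. i \<in> I \<Longrightarrow> L2 (X i)"
  shows "L2 (\<lambda>\<omega>. \<Sum>i\<in>I. X i \<omega>)"
    "msq (\<lambda>\<omega>. \<Sum>i\<in>I. X i \<omega>) \<le> real (card I) * (\<Sum>i\<in>I. msq (X i))"
proof -
  have m: "(\<lambda>\<omega>. \<Sum>i\<in>I. X i \<omega>) \<in> borel_measurable M"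
    using assms by (auto intro!: borel_measurable_sum simp: square_integrable_def)
  have *: "integrable M (\<lambda>\<omega>. real (card I) * (\<Sum>i\<in>I. (norm (X i \<omega>))\<^sup>2))"
    using assms by (auto intro!: integrable_mult_right Bochner_Integration.integrable_sum simp: square_integrable_def)
  show "L2 (\<lambda>\<omega>. \<Sum>i\<in>I. X i \<omega>)"
    by (rule L2_dominated[OF m * norm_sum_square_le[OF assms(1)]])
  have "msq (\<lambda>\<omega>. \<Sum>i\<in>I. X i \<omega>) \<le> (\<integral>\<omega>. real (card I) * (\<Sum>i\<in>I. (norm (X i \<omega>))\<^sup>2) \<partial>M)"
    by (rule msq_dominated[OF m * norm_sum_square_le[OF assms(1)]])
  also have "\<dots> = real (card I) * (\<Sum>i\<in>I. msq (X i))"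
    using assms by (simp add: Bochner_Integration.integral_sum square_integrable_def)
  finally show "msq (\<lambda>\<omega>. \<Sum>i\<in>I. X i \<omega>) \<le> real (card I) * (\<Sum>i\<in>I. msq (X i))" .
qed

lemma L2_affine_bound:
  fixes X :: "'a \<Rightarrow> 'b::euclidean_space" and Y :: "'a \<Rightarrow> 'c::euclidean_space"
  assumes "X \<in> borel_measurable M" "L2 Y" "\<And>\<omega>. (norm (X \<omega>))\<^sup>2 \<le> C * (r + (norm (Y \<omega>))\<^sup>2)"
  shows "L2 X" "msq X \<le> C * (r + msq Y)"
proof -
  note assms(2)[THEN L2_integrable_square, simp]
  have *: "integrable M (\<lambda>\<omega>. C * (r + (norm (Y \<omega>))\<^sup>2))" by simp
  show "L2 X" by (rule L2_dominated[OF assms(1) * assms(3)])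
  show "msq X \<le> C * (r + msq Y)"
    using msq_dominated[OF assms(1) * assms(3)] by (simp add: prob_space)
qed

lemma L2_integrable_inner:
  fixes X Y :: "'a \<Rightarrow> 'b::euclidean_space"
  assumes "L2 X" "L2 Y"
  shows "integrable M (\<lambda>\<omega>. X \<omega> \<bullet> Y \<omega>)"
proof -
  note assms[THEN L2_measurable, measurable] assms[THEN L2_integrable_square, simp]
  have "norm (X \<omega> \<bullet> Y \<omega>) \<le> (norm (X \<omega>))\<^sup>2 + (norm (Y \<omega>))\<^sup>2" for \<omega>
  proof -
    have "norm (X \<omega> \<bullet> Y \<omega>) \<le> norm (X \<omega>) * norm (Y \<omega>)" by (simp add: Cauchy_Schwarz_ineq2)
    also have "\<dots> \<le> (norm (X \<omega>))\<^sup>2 + (norm (Y \<omega>))\<^sup>2"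
      using sum_squares_bound[of "norm (X \<omega>)" "norm (Y \<omega>)"]
        mult_nonneg_nonneg[OF norm_ge_zero[of "X \<omega>"] norm_ge_zero[of "Y \<omega>"]] by linarith
    finally show ?thesis .
  qed
  then have "AE \<omega> in M. norm (X \<omega> \<bullet> Y \<omega>) \<le> norm ((norm (X \<omega>))\<^sup>2 + (norm (Y \<omega>))\<^sup>2)" by simp
  then show ?thesis
    by (rule Bochner_Integration.integrable_bound[rotated 2]) simp_all
qed

lemma L2_integrable:
  fixes X :: "'a \<Rightarrow> 'b::euclidean_space"
  assumes "L2 X"
  shows "integrable M X"
proof -
  note assms[THEN L2_measurable, measurable] assms[THEN L2_integrable_square, simp]
  have "norm (X \<omega>) \<le> 1 + (norm (X \<omega>))\<^sup>2" for \<omega>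
    using sum_squares_bound[of 1 "norm (X \<omega>)"] norm_ge_zero[of "X \<omega>"]
    by (simp del: norm_ge_zero)
  then have "AE \<omega> in M. norm (X \<omega>) \<le> norm (1 + (norm (X \<omega>))\<^sup>2)" by simp
  then show ?thesis
    by (rule Bochner_Integration.integrable_bound[rotated 2]) simp_all
qed

lemma msq_add_eq:
  fixes X Y :: "'a \<Rightarrow> 'b::euclidean_space"
  assumes "L2 X" "L2 Y"
  shows "msq (\<lambda>\<omega>. X \<omega> + Y \<omega>) = msq X + 2 * (\<integral>\<omega>. X \<omega> \<bullet> Y \<omega> \<partial>M) + msq Y"
proof -
  have "(norm (X \<omega> + Y \<omega>))\<^sup>2 = (norm (X \<omega>))\<^sup>2 + 2 * (X \<omega> \<bullet> Y \<omega>) + (norm (Y \<omega>))\<^sup>2" for \<omega>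
    by (simp add: power2_norm_eq_inner inner_add inner_commute)
  then show ?thesis
    using assms[THEN L2_integrable_square] L2_integrable_inner[OF assms] by simp
qed

text \<open>Subtracting the mean removes its square from the second moment.\<close>

lemma msq_centered_le:
  fixes X :: "'a \<Rightarrow> 'b::euclidean_space"
  assumes "L2 X"
  shows "msq (\<lambda>\<omega>. X \<omega> - expectation X) \<le> msq X"
proof -
  let ?c = "expectation X"
  have i: "integrable M X" by (rule L2_integrable[OF assms])
  have "msq (\<lambda>\<omega>. X \<omega> + (- ?c)) = msq X + 2 * (\<integral>\<omega>. X \<omega> \<bullet> (- ?c) \<partial>M) + msq (\<lambda>\<omega>. - ?c)"
    by (rule msq_add_eq[OF assms L2_const])
  also have "(\<integral>\<omega>. X \<omega> \<bullet> (- ?c) \<partial>M) = - (norm ?c)\<^sup>2"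
    using i by (simp add: power2_norm_eq_inner)
  finally show ?thesis by (simp add: prob_space)
qed


section \<open>Martingale increments and a mean-square Gronwall inequality\<close>

text \<open>Orthogonality to all square-integrable functions of the past says that the conditional expectation
  vanishes, in the only form in which it is used.\<close>

definition mart_incr :: "'a measure \<Rightarrow> ('a \<Rightarrow> 'b::euclidean_space) \<Rightarrow> bool" where
  "mart_incr G S \<longleftrightarrow> L2 S \<and>
     (\<forall>Y. Y \<in> borel_measurable G \<longrightarrow> L2 Y \<longrightarrow> (\<integral>\<omega>. Y \<omega> \<bullet> S \<omega> \<partial>M) = 0)"

lemma mart_incr_L2: "mart_incr G S \<Longrightarrow> L2 S"
  by (simp add: mart_incr_def)

lemma mart_incr_orthogonal:
  "mart_incr G S \<Longrightarrow> Y \<in> borel_measurable G \<Longrightarrow> L2 Y \<Longrightarrow> (\<integral>\<omega>. Y \<omega> \<bullet> S \<omega> \<partial>M) = 0"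
  by (simp add: mart_incr_def)

lemma mart_incr_sum:
  assumes "finite I" "\<And>i. i \<in> I \<Longrightarrow> mart_incr G (S i)"
  shows "mart_incr G (\<lambda>\<omega>. \<Sum>i\<in>I. S i \<omega>)"
proof -
  have "(\<integral>\<omega>. Y \<omega> \<bullet> (\<Sum>i\<in>I. S i \<omega>) \<partial>M) = 0" if "Y \<in> borel_measurable G" "L2 Y" for Y
  proof -
    have "(\<integral>\<omega>. Y \<omega> \<bullet> (\<Sum>i\<in>I. S i \<omega>) \<partial>M) = (\<Sum>i\<in>I. \<integral>\<omega>. Y \<omega> \<bullet> S i \<omega> \<partial>M)"
      unfolding inner_sum_right
      by (rule Bochner_Integration.integral_sum)
        (use that assms in \<open>auto intro!: L2_integrable_inner dest: mart_incr_L2\<close>)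
    also have "\<dots> = 0"
      using mart_incr_orthogonal[OF assms(2) that] by simp
    finally show ?thesis .
  qed
  then show ?thesis
    using assms by (auto simp: mart_incr_def intro!: L2_sum(1))
qed

lemma mart_incr_add:
  assumes "mart_incr G X" "mart_incr G Y"
  shows "mart_incr G (\<lambda>\<omega>. X \<omega> + Y \<omega>)"
proof -
  have "mart_incr G (\<lambda>\<omega>. \<Sum>b\<in>UNIV. (if b then X else Y) \<omega>)"
    by (rule mart_incr_sum) (use assms in auto)
  then show ?thesis by (simp add: UNIV_bool add.commute)
qed

lemma mart_incr_uminus:
  assumes "mart_incr G X"
  shows "mart_incr G (\<lambda>\<omega>. - X \<omega>)"
  using assms by (auto simp: mart_incr_def intro: L2_uminus)

lemma mart_incr_mono:
  assumes "mart_incr G S" "sets H \<subseteq> sets G" "space H = space G"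
  shows "mart_incr H S"
proof -
  have "borel_measurable H \<subseteq> borel_measurable G"
    using assms(2,3) by (auto simp: measurable_def)
  then show ?thesis using assms(1) by (auto simp: mart_incr_def)
qed

text \<open>Each increment is orthogonal to the partial sum before it, so that no mixed terms remain: the discrete
  form of the isometry of the stochastic integral.\<close>

lemma msq_mart_sum:
  fixes S :: "nat \<Rightarrow> 'a \<Rightarrow> 'b::euclidean_space"
  assumes "\<And>k. k < n \<Longrightarrow> mart_incr (G k) (S k)"
    and "\<And>k. k < n \<Longrightarrow> (\<lambda>\<omega>. \<Sum>l<k. S l \<omega>) \<in> borel_measurable (G k)"
  shows "L2 (\<lambda>\<omega>. \<Sum>l<n. S l \<omega>) \<and> msq (\<lambda>\<omega>. \<Sum>l<n. S l \<omega>) = (\<Sum>l<n. msq (S l))"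
  using assms
proof (induction n)
  case (Suc n)
  have IH: "L2 (\<lambda>\<omega>. \<Sum>l<n. S l \<omega>)" "msq (\<lambda>\<omega>. \<Sum>l<n. S l \<omega>) = (\<Sum>l<n. msq (S l))"
    using Suc by auto
  have S: "mart_incr (G n) (S n)" and m: "(\<lambda>\<omega>. \<Sum>l<n. S l \<omega>) \<in> borel_measurable (G n)"
    using Suc.prems by auto
  have "msq (\<lambda>\<omega>. (\<Sum>l<n. S l \<omega>) + S n \<omega>) = (\<Sum>l<n. msq (S l)) + msq (S n)"
    using msq_add_eq[OF IH(1) mart_incr_L2[OF S]] mart_incr_orthogonal[OF S m IH(1)] IH(2) by simp
  then show ?case using L2_add(1)[OF IH(1) mart_incr_L2[OF S]] by simp
qed simp

text \<open>The martingale part meets the old error only in a mixed term that vanishes. This is why its mean square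
  may be of order \<open>h\<close>, whereas the drift part, whose mixed term has to be estimated, must have mean square of order \<open>h\<^sup>2\<close>.\<close>

lemma mean_square_step:
  fixes e D S :: "'a \<Rightarrow> 'b::euclidean_space"
  assumes e: "e \<in> borel_measurable G" "L2 e" and D: "L2 D" and S: "mart_incr G S"
    and h: "0 < h" "h \<le> T" and r: "0 \<le> r" "0 \<le> \<kappa>"
    and Db: "msq D \<le> \<kappa> * h\<^sup>2 * (msq e + r)" and Sb: "msq S \<le> \<kappa> * h * (msq e + r)"
  shows "msq (\<lambda>\<omega>. e \<omega> + D \<omega> + S \<omega>) + r \<le> (1 + gronwall_rate \<kappa> T * h) * (msq e + r)"
proof -
  note S2 = mart_incr_L2[OF S]
  note DS = L2_add[OF D S2]
  let ?x = "msq e"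
  have eq: "msq (\<lambda>\<omega>. e \<omega> + (D \<omega> + S \<omega>)) = ?x + 2 * (\<integral>\<omega>. e \<omega> \<bullet> (D \<omega> + S \<omega>) \<partial>M) + msq (\<lambda>\<omega>. D \<omega> + S \<omega>)"
    by (rule msq_add_eq[OF e(2) DS(1)])
  have "(\<integral>\<omega>. e \<omega> \<bullet> (D \<omega> + S \<omega>) \<partial>M) = (\<integral>\<omega>. e \<omega> \<bullet> D \<omega> \<partial>M) + (\<integral>\<omega>. e \<omega> \<bullet> S \<omega> \<partial>M)"
    unfolding inner_add_right
    by (intro Bochner_Integration.integral_add L2_integrable_inner e D S2)
  then have eq2: "(\<integral>\<omega>. e \<omega> \<bullet> (D \<omega> + S \<omega>) \<partial>M) = (\<integral>\<omega>. e \<omega> \<bullet> D \<omega> \<partial>M)"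
    using mart_incr_orthogonal[OF S e] by simp
  \<comment> \<open>Young's inequality with weight \<open>h\<close>: the mean part may be of size \<open>h\<close> only.\<close>
  have "2 * (\<integral>\<omega>. e \<omega> \<bullet> D \<omega> \<partial>M) = (\<integral>\<omega>. 2 * (e \<omega> \<bullet> D \<omega>) \<partial>M)" by simp
  also have "\<dots> \<le> (\<integral>\<omega>. h * (norm (e \<omega>))\<^sup>2 + (1/h) * (norm (D \<omega>))\<^sup>2 \<partial>M)"
  proof (rule integral_mono)
    show "integrable M (\<lambda>\<omega>. 2 * (e \<omega> \<bullet> D \<omega>))" using L2_integrable_inner[OF e(2) D] by simp
    show "integrable M (\<lambda>\<omega>. h * (norm (e \<omega>))\<^sup>2 + (1/h) * (norm (D \<omega>))\<^sup>2)"
      using e(2) D by (simp add: square_integrable_def)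
    fix \<omega>
    have "0 \<le> (norm (h *\<^sub>R e \<omega> - D \<omega>))\<^sup>2" by simp
    then have "2 * h * (e \<omega> \<bullet> D \<omega>) \<le> h\<^sup>2 * (norm (e \<omega>))\<^sup>2 + (norm (D \<omega>))\<^sup>2"
      unfolding power2_norm_eq_inner
      by (simp add: inner_diff inner_commute power2_eq_square)
    then have "(2 * h * (e \<omega> \<bullet> D \<omega>)) / h \<le> (h\<^sup>2 * (norm (e \<omega>))\<^sup>2 + (norm (D \<omega>))\<^sup>2) / h"
      using h by (intro divide_right_mono) auto
    then show "2 * (e \<omega> \<bullet> D \<omega>) \<le> h * (norm (e \<omega>))\<^sup>2 + (1/h) * (norm (D \<omega>))\<^sup>2"
      using h by (simp add: add_divide_distrib power2_eq_square)
  qed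
  also have "\<dots> = h * ?x + (1/h) * msq D"
    using e(2) D by (simp add: square_integrable_def)
  also have "(1/h) * msq D \<le> (1/h) * (\<kappa> * h\<^sup>2 * (?x + r))"
    using h Db by (intro mult_left_mono) auto
  also have "(1/h) * (\<kappa> * h\<^sup>2 * (?x + r)) = \<kappa> * h * (?x + r)"
    using h by (simp add: power2_eq_square)
  finally have i1: "2 * (\<integral>\<omega>. e \<omega> \<bullet> D \<omega> \<partial>M) \<le> h * ?x + \<kappa> * h * (?x + r)" by simp
  have xr: "0 \<le> ?x + r" using r by (simp add: add_nonneg_nonneg)
  have "h\<^sup>2 \<le> T * h" using h by (simp add: power2_eq_square)
  then have "\<kappa> * h\<^sup>2 * (?x + r) \<le> \<kappa> * (T * h) * (?x + r)"
    using r xr by (intro mult_right_mono mult_left_mono) auto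
  then have i2: "msq (\<lambda>\<omega>. D \<omega> + S \<omega>) \<le> 2 * (\<kappa> * (T * h) * (?x + r)) + 2 * (\<kappa> * h * (?x + r))"
    using DS(2) Db Sb by linarith
  have "msq (\<lambda>\<omega>. e \<omega> + D \<omega> + S \<omega>) + r \<le> ?x + r + h * ?x + \<kappa> * h * (?x + r)
      + 2 * (\<kappa> * (T * h) * (?x + r)) + 2 * (\<kappa> * h * (?x + r))"
    using eq eq2 i1 i2 by (simp add: add.assoc)
  also have "h * ?x \<le> h * (?x + r)" using h r by simp
  finally show ?thesis by (simp add: gronwall_rate_def algebra_simps)
qed

text \<open>The increments of all errors are estimated in this form, with bounds \<open>d\<close> and \<open>v\<close> for the mean squares of
  the two parts. The existential form allows bounds to be combined without naming the parts.\<close>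

definition drift_noise_split ::
    "'a measure \<Rightarrow> ('a \<Rightarrow> 'b::euclidean_space) \<Rightarrow> real \<Rightarrow> real \<Rightarrow> bool" where
  "drift_noise_split G Q d v \<longleftrightarrow> (\<exists>D S. (\<forall>\<omega>. Q \<omega> = D \<omega> + S \<omega>) \<and>
     L2 D \<and> msq D \<le> d \<and> mart_incr G S \<and> msq S \<le> v)"

lemma drift_noise_splitI:
  assumes "\<And>\<omega>. Q \<omega> = D \<omega> + S \<omega>" "L2 D" "msq D \<le> d" "mart_incr G S" "msq S \<le> v"
  shows "drift_noise_split G Q d v"
  unfolding drift_noise_split_def
  by (rule exI[of _ D], rule exI[of _ S]) (use assms in auto)

lemma drift_noise_splitE:
  assumes "drift_noise_split G Q d v"
  obtains D S where "\<And>\<omega>. Q \<omega> = D \<omega> + S \<omega>" "L2 D" "msq D \<le> d" "mart_incr G S" "msq S \<le> v"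
  using assms unfolding drift_noise_split_def by blast

lemma drift_noise_split_sum:
  fixes Q :: "'k::finite \<Rightarrow> 'a \<Rightarrow> 'b::euclidean_space"
  assumes "\<And>k. drift_noise_split G (Q k) (d k) (v k)"
  shows "drift_noise_split G (\<lambda>\<omega>. \<Sum>k\<in>UNIV. Q k \<omega>)
    (real CARD('k) * (\<Sum>k\<in>UNIV. d k)) (real CARD('k) * (\<Sum>k\<in>UNIV. v k))"
proof -
  have "\<forall>k. \<exists>DS. (\<forall>\<omega>. Q k \<omega> = fst DS \<omega> + snd DS \<omega>) \<and>
      L2 (fst DS) \<and> msq (fst DS) \<le> d k \<and> mart_incr G (snd DS) \<and> msq (snd DS) \<le> v k"
  proof
    fix k
    obtain D S where "\<And>\<omega>. Q k \<omega> = D \<omega> + S \<omega>" "L2 D" "msq D \<le> d k" "mart_incr G S" "msq S \<le> v k"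
      using drift_noise_splitE[OF assms[of k]] by blast
    then show "\<exists>DS. (\<forall>\<omega>. Q k \<omega> = fst DS \<omega> + snd DS \<omega>) \<and>
        L2 (fst DS) \<and> msq (fst DS) \<le> d k \<and> mart_incr G (snd DS) \<and> msq (snd DS) \<le> v k"
      by (intro exI[of _ "(D, S)"]) auto
  qed
  from choice[OF this] obtain DS where DS: "\<And>k. (\<forall>\<omega>. Q k \<omega> = fst (DS k) \<omega> + snd (DS k) \<omega>) \<and>
      L2 (fst (DS k)) \<and> msq (fst (DS k)) \<le> d k \<and> mart_incr G (snd (DS k)) \<and> msq (snd (DS k)) \<le> v k"
    by blast
  define D where "D k = fst (DS k)" for k
  define S where "S k = snd (DS k)" for k
  have eq: "Q k \<omega> = D k \<omega> + S k \<omega>" and DL: "L2 (D k)" and Db: "msq (D k) \<le> d k"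
    and Sm: "mart_incr G (S k)" and Sb: "msq (S k) \<le> v k" for k \<omega>
    using DS[of k] by (auto simp: D_def S_def)
  show ?thesis
  proof (rule drift_noise_splitI)
    show "(\<Sum>k\<in>UNIV. Q k \<omega>) = (\<Sum>k\<in>UNIV. D k \<omega>) + (\<Sum>k\<in>UNIV. S k \<omega>)" for \<omega>
      by (simp add: eq sum.distrib)
    show "L2 (\<lambda>\<omega>. \<Sum>k\<in>UNIV. D k \<omega>)" by (rule L2_sum(1)[OF finite DL])
    show "mart_incr G (\<lambda>\<omega>. \<Sum>k\<in>UNIV. S k \<omega>)" by (rule mart_incr_sum[OF finite Sm])
    show "msq (\<lambda>\<omega>. \<Sum>k\<in>UNIV. D k \<omega>) \<le> real CARD('k) * (\<Sum>k\<in>UNIV. d k)"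
      by (rule order_trans[OF L2_sum(2)[OF finite DL]]) (intro mult_left_mono sum_mono Db, simp)
    show "msq (\<lambda>\<omega>. \<Sum>k\<in>UNIV. S k \<omega>) \<le> real CARD('k) * (\<Sum>k\<in>UNIV. v k)"
      by (rule order_trans[OF L2_sum(2)[OF finite mart_incr_L2[OF Sm]]]) (intro mult_left_mono sum_mono Sb, simp)
  qed
qed

lemma mean_square_gronwall:
  fixes e :: "nat \<Rightarrow> 'a \<Rightarrow> 'b::euclidean_space"
  assumes e0: "L2 (e 0)"
    and adapted: "\<And>k. k < n \<Longrightarrow> e k \<in> borel_measurable (G k)"
    and h: "0 < h" "h \<le> T" and r: "0 \<le> r" "0 \<le> \<kappa>"
    and split: "\<And>k. k < n \<Longrightarrow> L2 (e k) \<Longrightarrow> drift_noise_split (G k) (\<lambda>\<omega>. e (Suc k) \<omega> - e k \<omega>)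
      (\<kappa> * h\<^sup>2 * (msq (e k) + r)) (\<kappa> * h * (msq (e k) + r))"
  shows "L2 (e n) \<and> msq (e n) + r \<le> exp (gronwall_rate \<kappa> T * (real n * h)) * (msq (e 0) + r)"
  using adapted split
proof (induction n)
  case (Suc n)
  let ?C = "gronwall_rate \<kappa> T"
  have IH: "L2 (e n)" "msq (e n) + r \<le> exp (?C * (real n * h)) * (msq (e 0) + r)"
    using Suc.IH Suc.prems by auto
  have "drift_noise_split (G n) (\<lambda>\<omega>. e (Suc n) \<omega> - e n \<omega>)
      (\<kappa> * h\<^sup>2 * (msq (e n) + r)) (\<kappa> * h * (msq (e n) + r))"
    by (rule Suc.prems(2)[OF _ IH(1)]) simp
  then obtain D S where DS: "\<And>\<omega>. e (Suc n) \<omega> - e n \<omega> = D \<omega> + S \<omega>" "L2 D" "msq D \<le> \<kappa> * h\<^sup>2 * (msq (e n) + r)"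
    "mart_incr (G n) S" "msq S \<le> \<kappa> * h * (msq (e n) + r)"
    by (rule drift_noise_splitE) (rule that)
  have eq: "e (Suc n) = (\<lambda>\<omega>. e n \<omega> + D \<omega> + S \<omega>)"
  proof
    fix \<omega> show "e (Suc n) \<omega> = e n \<omega> + D \<omega> + S \<omega>" using DS(1)[of \<omega>] by (simp add: algebra_simps)
  qed
  have "msq (e (Suc n)) + r \<le> (1 + ?C * h) * (msq (e n) + r)"
    unfolding eq
    by (rule mean_square_step[OF _ IH(1) DS(2,4) h r DS(3,5)]) (use Suc.prems(1) in simp)
  also have "\<dots> \<le> exp (?C * h) * (exp (?C * (real n * h)) * (msq (e 0) + r))"
    using IH(2) r by (intro mult_mono exp_ge_add_one_self) (auto simp: add_nonneg_nonneg)
  also have "\<dots> = exp (?C * (real (Suc n) * h)) * (msq (e 0) + r)"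
    by (simp add: exp_add[symmetric] algebra_simps)
  finally show ?case
    unfolding eq using L2_add(1)[OF L2_add(1)[OF IH(1) DS(2)] mart_incr_L2[OF DS(4)]] by blast
qed (use e0 in simp)

end


section \<open>Independence from the past\<close>

context prob_space
begin

text \<open>Independence of the \<open>\<sigma>\<close>-algebra generated by \<open>X\<close> passes to functions of \<open>X\<close>. The values are taken by
  \<open>Y\<close> and \<open>V\<close> in a common type because \<^const>\<open>indep_var\<close> requires it.\<close>

lemma indep_of_sigma_indep_var:
  assumes "indep_of_sigma M G X" "subalgebra M G" "X \<in> borel_measurable M"
    and Y: "Y \<in> measurable G N" and V: "V \<in> measurable borel N'"
  shows "indep_var N Y N' (\<lambda>\<omega>. V (X \<omega>))"
  unfolding indep_var_eq
proof (intro conjI)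
  show "random_variable N Y" by (rule measurable_from_subalg[OF assms(2) Y])
  show "random_variable N' (\<lambda>\<omega>. V (X \<omega>))" by (rule measurable_compose[OF assms(3) V])
  have sp: "space G = space M" using assms(2) by (simp add: subalgebra_def)
  have "sigma_sets (space M) {Y -` A \<inter> space M |A. A \<in> sets N} \<subseteq> sets G"
    using sets.sigma_sets_subset[of "{Y -` A \<inter> space M |A. A \<in> sets N}" G]
      measurable_sets[OF Y] unfolding sp by auto
  moreover have "sigma_sets (space M) {(\<lambda>\<omega>. V (X \<omega>)) -` A \<inter> space M |A. A \<in> sets N'}
      \<subseteq> sets (vimage_algebra (space M) X borel)"
    unfolding sets_vimage_algebra
  proof (rule sigma_sets_subseteq, safe)
    fix A assume "A \<in> sets N'"
    then have "V -` A \<in> sets borel" using measurable_sets[OF V] by auto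
    then show "\<exists>B. (\<lambda>\<omega>. V (X \<omega>)) -` A \<inter> space M = X -` B \<inter> space M \<and> B \<in> sets borel"
      by (intro exI[of _ "V -` A"]) auto
  qed
  ultimately show "indep_set (sigma_sets (space M) {Y -` A \<inter> space M |A. A \<in> sets N})
      (sigma_sets (space M) {(\<lambda>\<omega>. V (X \<omega>)) -` A \<inter> space M |A. A \<in> sets N'})"
    using assms(1) unfolding indep_of_sigma_def indep_sets2_eq by blast
qed

lemma indep_product_expectation:
  fixes U :: "'a \<Rightarrow> real" and V :: "'z::topological_space \<Rightarrow> real"
  assumes ind: "indep_of_sigma M G \<zeta>" "subalgebra M G" "\<zeta> \<in> borel_measurable M"
    and U: "U \<in> borel_measurable G" "integrable M U"
    and V: "V \<in> borel_measurable borel" "integrable M (\<lambda>\<omega>. V (\<zeta> \<omega>))"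
  shows "integrable M (\<lambda>\<omega>. V (\<zeta> \<omega>) * U \<omega>)"
    "(\<integral>\<omega>. V (\<zeta> \<omega>) * U \<omega> \<partial>M) = (\<integral>\<omega>. V (\<zeta> \<omega>) \<partial>M) * (\<integral>\<omega>. U \<omega> \<partial>M)"
proof -
  have i: "indep_var borel U borel (\<lambda>\<omega>. V (\<zeta> \<omega>))"
    by (rule indep_of_sigma_indep_var[OF ind U(1) V(1)])
  show "integrable M (\<lambda>\<omega>. V (\<zeta> \<omega>) * U \<omega>)"
    using indep_var_integrable[OF i U(2) V(2)] by (simp add: mult.commute)
  show "(\<integral>\<omega>. V (\<zeta> \<omega>) * U \<omega> \<partial>M) = (\<integral>\<omega>. V (\<zeta> \<omega>) \<partial>M) * (\<integral>\<omega>. U \<omega> \<partial>M)"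
    using indep_var_lebesgue_integral[OF i U(2) V(2)] by (simp add: mult.commute)
qed

lemma indep_bilinear_L2:
  fixes prod :: "'x::euclidean_space \<Rightarrow> 'c::euclidean_space \<Rightarrow> 'b::euclidean_space"
    and f :: "'z::topological_space \<Rightarrow> 'x"
  assumes bil: "bounded_bilinear prod" and le: "\<And>x y. norm (prod x y) \<le> norm x * norm y"
    and ind: "indep_of_sigma M G \<zeta>" "subalgebra M G" "\<zeta> \<in> borel_measurable M"
    and c: "c \<in> borel_measurable G" "L2 c"
    and f: "f \<in> borel_measurable borel" "L2 (\<lambda>\<omega>. f (\<zeta> \<omega>))"
  shows "L2 (\<lambda>\<omega>. prod (f (\<zeta> \<omega>)) (c \<omega>))"
    "msq (\<lambda>\<omega>. prod (f (\<zeta> \<omega>)) (c \<omega>)) \<le> msq (\<lambda>\<omega>. f (\<zeta> \<omega>)) * msq c"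
proof -
  note f(1)[measurable] ind(3)[measurable] c(1)[measurable]
  note L2_measurable[OF c(2), measurable]
  have pm[measurable]: "case_prod prod \<in> borel_measurable (borel \<Otimes>\<^sub>M borel)"
    unfolding borel_prod
    by (intro borel_measurable_continuous_onI)
      (auto simp: split_beta intro!: bounded_bilinear.continuous_on[OF bil] continuous_intros)
  have m: "(\<lambda>\<omega>. prod (f (\<zeta> \<omega>)) (c \<omega>)) \<in> borel_measurable M"
    using measurable_compose[OF _ pm, of "\<lambda>\<omega>. (f (\<zeta> \<omega>), c \<omega>)" M] by simp
  have mc: "(\<lambda>\<omega>. (norm (c \<omega>))\<^sup>2) \<in> borel_measurable G" by measurable
  have mf: "(\<lambda>z. (norm (f z))\<^sup>2) \<in> borel_measurable borel" by measurable
  note pr = indep_product_expectation[OF ind mc L2_integrable_square[OF c(2)] mf L2_integrable_square[OF f(2)]]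
  have b: "(norm (prod (f (\<zeta> \<omega>)) (c \<omega>)))\<^sup>2 \<le> (norm (f (\<zeta> \<omega>)))\<^sup>2 * (norm (c \<omega>))\<^sup>2" for \<omega>
    using power_mono[OF le, of "f (\<zeta> \<omega>)" "c \<omega>" 2] by (simp add: power_mult_distrib)
  show "L2 (\<lambda>\<omega>. prod (f (\<zeta> \<omega>)) (c \<omega>))" by (rule L2_dominated[OF m pr(1) b])
  show "msq (\<lambda>\<omega>. prod (f (\<zeta> \<omega>)) (c \<omega>)) \<le> msq (\<lambda>\<omega>. f (\<zeta> \<omega>)) * msq c"
    using msq_dominated[OF m pr(1) b] pr(2) by simp
qed

text \<open>Expanding the independent factor in a basis reduces the claim to products of real random variables, whose
  expectations factorise.\<close>

lemma indep_bilinear_mart_incr: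
  fixes prod :: "'x::euclidean_space \<Rightarrow> 'c::euclidean_space \<Rightarrow> 'b::euclidean_space"
    and f :: "'z::topological_space \<Rightarrow> 'x"
  assumes bil: "bounded_bilinear prod" and le: "\<And>x y. norm (prod x y) \<le> norm x * norm y"
    and ind: "indep_of_sigma M G \<zeta>" "subalgebra M G" "\<zeta> \<in> borel_measurable M"
    and c: "c \<in> borel_measurable G" "L2 c"
    and f: "f \<in> borel_measurable borel" "L2 (\<lambda>\<omega>. f (\<zeta> \<omega>))"
    and mean: "expectation (\<lambda>\<omega>. f (\<zeta> \<omega>)) = 0"
  shows "mart_incr G (\<lambda>\<omega>. prod (f (\<zeta> \<omega>)) (c \<omega>))"
  unfolding mart_incr_def
proof (intro conjI allI impI)
  show "L2 (\<lambda>\<omega>. prod (f (\<zeta> \<omega>)) (c \<omega>))"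
    by (rule indep_bilinear_L2[OF bil le ind c f])
  fix Y :: "'a \<Rightarrow> 'b" assume Y: "Y \<in> borel_measurable G" "L2 Y"
  note f(1)[measurable] ind(3)[measurable] c(1)[measurable] Y(1)[measurable]
  have fi: "integrable M (\<lambda>\<omega>. f (\<zeta> \<omega>))" by (rule L2_integrable[OF f(2)])
  have prodb_m: "prod b \<in> borel_measurable borel" for b
    by (intro borel_measurable_continuous_onI linear_continuous_on bounded_bilinear.bounded_linear_right[OF bil])
  have U: "(\<lambda>\<omega>. Y \<omega> \<bullet> prod b (c \<omega>)) \<in> borel_measurable G" "integrable M (\<lambda>\<omega>. Y \<omega> \<bullet> prod b (c \<omega>))" for b
  proof -
    note prodb_m[measurable]
    show "(\<lambda>\<omega>. Y \<omega> \<bullet> prod b (c \<omega>)) \<in> borel_measurable G" by measurable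
    have "(norm (prod b (c \<omega>)))\<^sup>2 \<le> (norm b)\<^sup>2 * (0 + (norm (c \<omega>))\<^sup>2)" for \<omega>
      using power_mono[OF le, of b "c \<omega>" 2] by (simp add: power_mult_distrib)
    then have "L2 (\<lambda>\<omega>. prod b (c \<omega>))"
      by (intro L2_affine_bound(1)[OF _ c(2)] measurable_compose[OF L2_measurable[OF c(2)] prodb_m])
    then show "integrable M (\<lambda>\<omega>. Y \<omega> \<bullet> prod b (c \<omega>))" by (intro L2_integrable_inner Y)
  qed
  have V: "(\<lambda>z. f z \<bullet> b) \<in> borel_measurable borel" "integrable M (\<lambda>\<omega>. f (\<zeta> \<omega>) \<bullet> b)"
    "expectation (\<lambda>\<omega>. f (\<zeta> \<omega>) \<bullet> b) = 0" for b
    using fi mean by (auto simp: integral_inner_left)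
  note pr = indep_product_expectation[OF ind U V(1,2)]
  have "prod x y = (\<Sum>b\<in>Basis. (x \<bullet> b) *\<^sub>R prod b y)" for x y
  proof -
    have "prod x y = prod (\<Sum>b\<in>Basis. (x \<bullet> b) *\<^sub>R b) y" by (simp add: euclidean_representation)
    then show ?thesis
      by (simp add: bounded_bilinear.sum_left[OF bil] bounded_bilinear.scaleR_left[OF bil])
  qed
  then have "(\<integral>\<omega>. Y \<omega> \<bullet> prod (f (\<zeta> \<omega>)) (c \<omega>) \<partial>M)
      = (\<integral>\<omega>. (\<Sum>b\<in>Basis. (f (\<zeta> \<omega>) \<bullet> b) * (Y \<omega> \<bullet> prod b (c \<omega>))) \<partial>M)"
    by (metis (no_types, lifting) inner_scaleR_right inner_sum_right sum.cong)
  also have "\<dots> = (\<Sum>b\<in>Basis. \<integral>\<omega>. (f (\<zeta> \<omega>) \<bullet> b) * (Y \<omega> \<bullet> prod b (c \<omega>)) \<partial>M)"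
    by (rule Bochner_Integration.integral_sum) (rule pr(1))
  also have "\<dots> = 0" by (simp add: pr(2) V(3))
  finally show "(\<integral>\<omega>. Y \<omega> \<bullet> prod (f (\<zeta> \<omega>)) (c \<omega>) \<partial>M) = 0" .
qed

lemma centered_normal_moments:
  assumes "0 < h" and D: "distributed M lborel X (normal_density 0 (sqrt h))"
  shows "integrable M X" "expectation X = 0" "integrable M (\<lambda>\<omega>. (X \<omega>)\<^sup>2)" "expectation (\<lambda>\<omega>. (X \<omega>)\<^sup>2) = h"
proof -
  have s: "0 < sqrt h" using assms by simp
  show e: "expectation X = 0" by (rule normal_distributed_expectation[OF s D])
  show "integrable M X"
    by (rule distributed_integrable_var[OF D]) (use integrable_normal_moment_nz_1[OF s] in auto)
  show "integrable M (\<lambda>\<omega>. (X \<omega>)\<^sup>2)"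
    using distributed_integrable[OF D, of "\<lambda>x. x\<^sup>2"] integrable_normal_moment[OF s, of 0 2] by simp
  show "expectation (\<lambda>\<omega>. (X \<omega>)\<^sup>2) = h"
    using normal_distributed_variance[OF s D] e assms(1) by simp
qed

text \<open>Multiplying the standard normal density by \<open>exp (a x)\<close> shifts it by \<open>a\<close> and scales it by \<open>exp (a\<^sup>2 / 2)\<close>.\<close>

lemma normal_exp_moment:
  assumes "0 < h" and D: "distributed M lborel X (normal_density 0 (sqrt h))"
  shows "integrable M (\<lambda>\<omega>. exp (c * (\<bar>X \<omega>\<bar> / sqrt h)))"
    "expectation (\<lambda>\<omega>. exp (c * (\<bar>X \<omega>\<bar> / sqrt h))) \<le> 2 * exp (c\<^sup>2 / 2)"
proof -
  have std: "distributed M lborel (\<lambda>\<omega>. (X \<omega> - 0) / sqrt h) std_normal_density"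
    using normal_standard_normal_convert[of "sqrt h" X 0] assms by simp
  have D': "distributed M lborel (\<lambda>\<omega>. X \<omega> / sqrt h) std_normal_density"
    using std by simp
  have m[measurable]: "X \<in> borel_measurable M"
    using distributed_measurable[OF D] by simp
  have tilt: "std_normal_density x * exp (a * x) = exp (a\<^sup>2 / 2) * normal_density a 1 x" for a x :: real
  proof -
    have "- x\<^sup>2 / 2 + a * x = a\<^sup>2 / 2 + - (x - a)\<^sup>2 / 2" by (simp add: power2_eq_square field_simps)
    then show ?thesis
      by (simp add: std_normal_density_def normal_density_def mult_exp_exp mult.commute mult.left_commute)
  qed
  have I: "integrable M (\<lambda>\<omega>. exp (a * (X \<omega> / sqrt h)))"
     "expectation (\<lambda>\<omega>. exp (a * (X \<omega> / sqrt h))) = exp (a\<^sup>2 / 2)" for a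
  proof -
    have "integrable lborel (\<lambda>x. std_normal_density x * exp (a * x))"
      unfolding tilt by (intro integrable_mult_right integrable_normal_density) simp
    then show "integrable M (\<lambda>\<omega>. exp (a * (X \<omega> / sqrt h)))"
      using distributed_integrable[OF D', of "\<lambda>x. exp (a * x)"] by simp
    have "(\<integral>x. std_normal_density x * exp (a * x) \<partial>lborel) = exp (a\<^sup>2 / 2)"
      unfolding tilt by (simp add: integral_normal_density)
    then show "expectation (\<lambda>\<omega>. exp (a * (X \<omega> / sqrt h))) = exp (a\<^sup>2 / 2)"
      using distributed_integral[OF D', of "\<lambda>x. exp (a * x)"] by simp
  qed
  have le: "exp (c * (\<bar>X \<omega>\<bar> / sqrt h)) \<le> exp (c * (X \<omega> / sqrt h)) + exp ((- c) * (X \<omega> / sqrt h))" for \<omega>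
    by (cases "X \<omega> \<ge> 0") (auto simp: abs_if)
  have i2: "integrable M (\<lambda>\<omega>. exp (c * (X \<omega> / sqrt h)) + exp ((- c) * (X \<omega> / sqrt h)))"
    by (intro Bochner_Integration.integrable_add I)
  have "AE \<omega> in M. norm (exp (c * (\<bar>X \<omega>\<bar> / sqrt h))) \<le> norm (exp (c * (X \<omega> / sqrt h)) + exp ((- c) * (X \<omega> / sqrt h)))"
    by (intro AE_I2) (use le in \<open>simp add: abs_of_pos add_pos_pos\<close>)
  then show i1: "integrable M (\<lambda>\<omega>. exp (c * (\<bar>X \<omega>\<bar> / sqrt h)))"
    by (rule Bochner_Integration.integrable_bound[OF i2, rotated]) measurable
  have "expectation (\<lambda>\<omega>. exp (c * (\<bar>X \<omega>\<bar> / sqrt h)))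
      \<le> expectation (\<lambda>\<omega>. exp (c * (X \<omega> / sqrt h)) + exp ((- c) * (X \<omega> / sqrt h)))"
    by (rule integral_mono[OF i1 i2 le])
  also have "\<dots> = exp (c\<^sup>2 / 2) + exp ((- c)\<^sup>2 / 2)"
    by (subst Bochner_Integration.integral_add[OF I(1) I(1)]) (simp only: I)
  finally show "expectation (\<lambda>\<omega>. exp (c * (\<bar>X \<omega>\<bar> / sqrt h))) \<le> 2 * exp (c\<^sup>2 / 2)" by simp
qed

end


section \<open>Brownian increments\<close>

lemma weak_grid_mono:
  fixes p :: "nat \<Rightarrow> real"
  assumes "\<And>k. k < n \<Longrightarrow> p k \<le> p (Suc k)" "j \<le> k" "k \<le> n"
  shows "p j \<le> p k"
  using assms(2,3)
proof (induction k)
  case (Suc k)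
  then show ?case using assms(1)[of k] by (cases "j = Suc k") auto
qed simp

lemma grid_mono:
  fixes r :: "nat \<Rightarrow> real"
  assumes "\<And>k. k < m \<Longrightarrow> r k < r (Suc k)" "j \<le> k" "k \<le> m"
  shows "r j \<le> r k"
  by (rule weak_grid_mono[of m r, OF less_imp_le[OF assms(1)] assms(2,3)])

lemma grid_strict_mono:
  fixes r :: "nat \<Rightarrow> real"
  assumes "\<And>k. k < m \<Longrightarrow> r k < r (Suc k)" "j < k" "k \<le> m"
  shows "r j < r k"
proof -
  have "r j < r (Suc j)" using assms by simp
  also have "r (Suc j) \<le> r k" by (rule grid_mono[of m r]) (use assms in auto)
  finally show ?thesis .
qed

locale brownian_noise = prob_space M
  for M :: "'a measure" +
  fixes Fil :: "real \<Rightarrow> 'a measure" and T :: real and W :: "'m::finite \<Rightarrow> real \<Rightarrow> 'a \<Rightarrow> real"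
  assumes T_pos: "0 < T"
    and filtration: "filtration_upto M Fil T"
    and noise: "indep_brownian_motions M Fil T W"
begin

lemma Fil_subalgebra: "0 \<le> t \<Longrightarrow> t \<le> T \<Longrightarrow> subalgebra M (Fil t)"
  using filtration by (simp add: filtration_upto_def)

lemma Fil_space: "0 \<le> t \<Longrightarrow> t \<le> T \<Longrightarrow> space (Fil t) = space M"
  using Fil_subalgebra by (simp add: subalgebra_def)

lemma Fil_mono: "0 \<le> s \<Longrightarrow> s \<le> t \<Longrightarrow> t \<le> T \<Longrightarrow> sets (Fil s) \<subseteq> sets (Fil t)"
  using filtration by (simp add: filtration_upto_def)

lemma measurable_Fil_mono:
  assumes "X \<in> measurable (Fil s) N" "0 \<le> s" "s \<le> t" "t \<le> T"
  shows "X \<in> measurable (Fil t) N"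
  using assms Fil_mono[of s t] Fil_space[of s] Fil_space[of t] by (auto simp: measurable_def)

lemma measurable_Fil_M:
  assumes "X \<in> measurable (Fil s) N" "0 \<le> s" "s \<le> T"
  shows "X \<in> measurable M N"
  using measurable_from_subalg[OF Fil_subalgebra] assms by auto

lemma W_brownian: "brownian_motion M Fil T (W i)"
  using noise unfolding indep_brownian_motions_def by blast

lemma W_adapted:
  assumes "0 \<le> s" "s \<le> t" "t \<le> T"
  shows "W i s \<in> borel_measurable (Fil t)"
proof -
  have "W i s \<in> borel_measurable (Fil s)"
    using W_brownian[of i] assms unfolding brownian_motion_def by simp
  then show ?thesis by (rule measurable_Fil_mono) (use assms in auto)
qed

lemma W_measurable: "0 \<le> s \<Longrightarrow> s \<le> T \<Longrightarrow> W i s \<in> borel_measurable M"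
  by (rule measurable_Fil_M[OF W_adapted[OF _ order_refl]])

text \<open>The increments of all components form one random vector, because it is this vector that is independent of
  the past.\<close>

definition incr :: "real \<Rightarrow> real \<Rightarrow> 'a \<Rightarrow> real^'m" where
  "incr s t \<omega> = (\<chi> i. W i t \<omega> - W i s \<omega>)"

lemma incr_nth[simp]: "incr s t \<omega> $ i = W i t \<omega> - W i s \<omega>"
  by (simp add: incr_def)

lemma incr_adapted:
  assumes "0 \<le> s" "s \<le> t" "t \<le> u" "u \<le> T"
  shows "incr s t \<in> borel_measurable (Fil u)"
proof -
  have "incr s t \<omega> = (\<Sum>i\<in>UNIV. (W i t \<omega> - W i s \<omega>) *\<^sub>R axis i 1)" for \<omega>
    by (simp add: vec_eq_iff axis_def sum.delta' if_distrib cong: if_cong)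
  moreover have "(\<lambda>\<omega>. \<Sum>i\<in>UNIV. (W i t \<omega> - W i s \<omega>) *\<^sub>R axis i (1::real)) \<in> borel_measurable (Fil u)"
    by (intro borel_measurable_sum borel_measurable_scaleR borel_measurable_diff W_adapted borel_measurable_const)
      (use assms in auto)
  ultimately show ?thesis by presburger
qed

lemma incr_measurable: "0 \<le> s \<Longrightarrow> s \<le> t \<Longrightarrow> t \<le> T \<Longrightarrow> incr s t \<in> borel_measurable M"
  by (rule measurable_Fil_M[OF incr_adapted[OF _ _ order_refl]]) auto

lemma incr_indep: "0 \<le> s \<Longrightarrow> s < t \<Longrightarrow> t \<le> T \<Longrightarrow> indep_of_sigma M (Fil s) (incr s t)"
  using noise unfolding indep_brownian_motions_def incr_def by simp

lemma W_increment_normal: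
  "0 \<le> s \<Longrightarrow> s < t \<Longrightarrow> t \<le> T \<Longrightarrow>
    distributed M lborel (\<lambda>\<omega>. W i t \<omega> - W i s \<omega>) (normal_density 0 (sqrt (t - s)))"
  using W_brownian[of i] unfolding brownian_motion_def by blast

lemma W_increment_moments:
  assumes "0 \<le> s" "s < t" "t \<le> T"
  shows "integrable M (\<lambda>\<omega>. W i t \<omega> - W i s \<omega>)" "expectation (\<lambda>\<omega>. W i t \<omega> - W i s \<omega>) = 0"
    "integrable M (\<lambda>\<omega>. (W i t \<omega> - W i s \<omega>)\<^sup>2)"
    "expectation (\<lambda>\<omega>. (W i t \<omega> - W i s \<omega>)\<^sup>2) = t - s"
  using centered_normal_moments[OF _ W_increment_normal[OF assms]] assms by auto

lemma W_increments_uncorrelated: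
  assumes "0 \<le> s" "s < t" "t \<le> T" "i \<noteq> j"
  shows "integrable M (\<lambda>\<omega>. (W i t \<omega> - W i s \<omega>) * (W j t \<omega> - W j s \<omega>))"
    "expectation (\<lambda>\<omega>. (W i t \<omega> - W i s \<omega>) * (W j t \<omega> - W j s \<omega>)) = 0"
proof -
  have "indep_vars (\<lambda>_. \<Pi>\<^sub>M t\<in>{0..T}. borel) (\<lambda>i \<omega>. \<lambda>t\<in>{0..T}. W i t \<omega>) (UNIV :: 'm set)"
    using noise by (simp add: indep_brownian_motions_def)
  then have "indep_vars (\<lambda>_. borel) (\<lambda>i \<omega>. (\<lambda>t\<in>{0..T}. W i t \<omega>) t - (\<lambda>t\<in>{0..T}. W i t \<omega>) s :: real) (UNIV :: 'm set)"
    by (rule indep_vars_compose2[where Y="\<lambda>_ x. x t - x s"])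
      (use assms in \<open>auto intro!: borel_measurable_diff measurable_component_singleton\<close>)
  then have iv: "indep_vars (\<lambda>_. borel) (\<lambda>i \<omega>. W i t \<omega> - W i s \<omega>) {i, j}"
    using assms by (auto intro: indep_vars_subset)
  have m: "integrable M (\<lambda>\<omega>. W i t \<omega> - W i s \<omega>)" "expectation (\<lambda>\<omega>. W i t \<omega> - W i s \<omega>) = 0" for i
    using W_increment_moments(1,2)[of s t i] assms by simp_all
  have "integrable M (\<lambda>\<omega>. \<Prod>k\<in>{i, j}. W k t \<omega> - W k s \<omega>)"
    by (rule indep_vars_integrable[OF _ iv m(1)]) simp
  then show "integrable M (\<lambda>\<omega>. (W i t \<omega> - W i s \<omega>) * (W j t \<omega> - W j s \<omega>))"
    using assms(4) by simp
  have "expectation (\<lambda>\<omega>. \<Prod>k\<in>{i, j}. W k t \<omega> - W k s \<omega>) = (\<Prod>k\<in>{i, j}. expectation (\<lambda>\<omega>. W k t \<omega> - W k s \<omega>))"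
    by (rule indep_vars_lebesgue_integral[OF _ iv m(1)]) simp
  then show "expectation (\<lambda>\<omega>. (W i t \<omega> - W i s \<omega>) * (W j t \<omega> - W j s \<omega>)) = 0"
    using assms(4) m(2) by simp
qed

text \<open>Since \<open>\<theta>\<close> is known at time \<open>s\<close>, this is an instance of the independence of increments; the increment itself is
  the function \<open>\<lambda>z. z $ i\<close> of the increment vector.\<close>

lemma ito_increment:
  fixes \<theta> :: "'a \<Rightarrow> 'b::euclidean_space"
  assumes "0 \<le> s" "s < t" "t \<le> T" "\<theta> \<in> borel_measurable (Fil s)" "L2 \<theta>"
  shows "mart_incr (Fil s) (\<lambda>\<omega>. (W i t \<omega> - W i s \<omega>) *\<^sub>R \<theta> \<omega>)"
    "msq (\<lambda>\<omega>. (W i t \<omega> - W i s \<omega>) *\<^sub>R \<theta> \<omega>) \<le> (t - s) * msq \<theta>"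
proof -
  note mom = W_increment_moments[OF assms(1-3), of i]
  have sub: "subalgebra M (Fil s)" by (rule Fil_subalgebra) (use assms in auto)
  have im: "incr s t \<in> borel_measurable M" by (rule incr_measurable) (use assms in auto)
  have fm: "(\<lambda>z::real^'m. z $ i) \<in> borel_measurable borel"
    by (intro borel_measurable_continuous_onI continuous_intros)
  have wm: "W i t \<in> borel_measurable M" "W i s \<in> borel_measurable M"
    using assms by (auto intro!: W_measurable)
  have f2: "L2 (\<lambda>\<omega>. incr s t \<omega> $ i)"
    using mom(3) wm by (simp add: square_integrable_def)
  show "mart_incr (Fil s) (\<lambda>\<omega>. (W i t \<omega> - W i s \<omega>) *\<^sub>R \<theta> \<omega>)"
    using indep_bilinear_mart_incr[OF bounded_bilinear_scaleR _ incr_indep[OF assms(1-3)] sub im assms(4,5) fm f2] mom(2)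
    by simp
  show "msq (\<lambda>\<omega>. (W i t \<omega> - W i s \<omega>) *\<^sub>R \<theta> \<omega>) \<le> (t - s) * msq \<theta>"
    using indep_bilinear_L2(2)[OF bounded_bilinear_scaleR _ incr_indep[OF assms(1-3)] sub im assms(4,5) fm f2] mom(4)
    by simp
qed

definition disc_ito :: "'m \<Rightarrow> (nat \<Rightarrow> real) \<Rightarrow> (nat \<Rightarrow> 'a \<Rightarrow> 'b::real_normed_vector) \<Rightarrow> nat \<Rightarrow> 'a \<Rightarrow> 'b" where
  "disc_ito i r \<theta> k \<omega> = (\<Sum>l<k. (W i (r (Suc l)) \<omega> - W i (r l) \<omega>) *\<^sub>R \<theta> l \<omega>)"

text \<open>The quadratic variation of \<^term>\<open>disc_ito i r \<theta>\<close>, with the random squares of the increments replaced by their means.\<close>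

definition disc_energy :: "(nat \<Rightarrow> real) \<Rightarrow> (nat \<Rightarrow> 'a \<Rightarrow> 'b::real_normed_vector) \<Rightarrow> nat \<Rightarrow> 'a \<Rightarrow> real" where
  "disc_energy r \<theta> k \<omega> = (\<Sum>l<k. (r (Suc l) - r l) * (norm (\<theta> l \<omega>))\<^sup>2)"

lemma disc_adapted:
  fixes \<theta> :: "nat \<Rightarrow> 'a \<Rightarrow> 'b::euclidean_space"
  assumes r: "0 \<le> r 0" "\<And>k. k < m \<Longrightarrow> r k < r (Suc k)" "r m \<le> T"
    and \<theta>: "\<And>k. k < m \<Longrightarrow> \<theta> k \<in> borel_measurable (Fil (r k))"
    and k: "k \<le> j" "j \<le> m"
  shows "disc_ito i r \<theta> k \<in> borel_measurable (Fil (r j))"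
    "k < m \<Longrightarrow> disc_energy r \<theta> (Suc k) \<in> borel_measurable (Fil (r j))"
    "disc_energy r \<theta> k \<in> borel_measurable (Fil (r j))"
proof -
  note mono = grid_mono[of m r, OF r(2)]
  have b: "0 \<le> r l" "r l \<le> T" if "l \<le> m" for l
    using mono[of 0 l] mono[of l m] that r by auto
  have W: "W i (r l) \<in> borel_measurable (Fil (r j))" if "l \<le> j" for l
    using W_adapted[of "r l" "r j"] mono[of l j] b that k by auto
  have th: "\<theta> l \<in> borel_measurable (Fil (r j))" if "l \<le> j" "l < m" for l
    using measurable_Fil_mono[OF \<theta>[OF that(2)], of "r j"] mono[of l j] b that k by auto
  show "disc_ito i r \<theta> k \<in> borel_measurable (Fil (r j))"
    unfolding disc_ito_def[abs_def]
    by (intro borel_measurable_sum borel_measurable_scaleR borel_measurable_diff W th) (use k in auto)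
  show "disc_energy r \<theta> k \<in> borel_measurable (Fil (r j))"
    unfolding disc_energy_def[abs_def]
    by (intro borel_measurable_sum borel_measurable_times borel_measurable_power
        borel_measurable_norm[THEN measurable_compose[rotated]] borel_measurable_const th) (use k in auto)
  show "disc_energy r \<theta> (Suc k) \<in> borel_measurable (Fil (r j))" if "k < m"
    unfolding disc_energy_def[abs_def]
    by (intro borel_measurable_sum borel_measurable_times borel_measurable_power
        borel_measurable_norm[THEN measurable_compose[rotated]] borel_measurable_const th) (use k that in auto)
qed

text \<open>A discrete form of Lenglart's inequality. The integrand is replaced by 0 from the first moment on at which the energy
  exceeds \<open>\<eta>\<close> or the sum exceeds \<open>\<epsilon>\<close>. The new integrand is adapted, since the energy over a step is known at its
  beginning, and bounded, although nothing is assumed about moments of \<open>\<theta>\<close>. Its total sum has mean square at most \<open>\<eta>\<close>, and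
  it keeps the first value beyond \<open>\<epsilon>\<close> as its final value if the energy never exceeds \<open>\<eta>\<close>.\<close>

lemma maximal_inequality:
  fixes \<theta> :: "nat \<Rightarrow> 'a \<Rightarrow> 'b::euclidean_space"
  assumes r: "0 \<le> r 0" "\<And>k. k < m \<Longrightarrow> r k < r (Suc k)" "r m \<le> T"
    and \<theta>: "\<And>k. k < m \<Longrightarrow> \<theta> k \<in> borel_measurable (Fil (r k))"
    and eps: "0 < \<epsilon>" "0 \<le> \<eta>"
  shows "prob {\<omega>\<in>space M. \<exists>k\<le>m. \<epsilon> < norm (disc_ito i r \<theta> k \<omega>)}
     \<le> \<eta> / \<epsilon>\<^sup>2 + prob {\<omega>\<in>space M. \<eta> < disc_energy r \<theta> m \<omega>}"
proof -
  note mono = grid_mono[of m r, OF r(2)]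
  have b: "0 \<le> r l" "r l \<le> T" if "l \<le> m" for l
    using mono[of 0 l] mono[of l m] that r by auto
  have rle: "r k \<le> r (Suc k)" if "k < m" for k
    using r(2)[OF that] by simp
  define c where "c k \<omega> \<longleftrightarrow> disc_energy r \<theta> (Suc k) \<omega> \<le> \<eta> \<and> (\<forall>j\<le>k. norm (disc_ito i r \<theta> j \<omega>) \<le> \<epsilon>)" for k \<omega>
  define \<theta>' where "\<theta>' k \<omega> = (if c k \<omega> then \<theta> k \<omega> else 0)" for k \<omega>
  have \<theta>'_adapted: "\<theta>' k \<in> borel_measurable (Fil (r k))" if k: "k < m" for k
  proof -
    have [measurable]: "\<theta> k \<in> borel_measurable (Fil (r k))"
      "disc_energy r \<theta> (Suc k) \<in> borel_measurable (Fil (r k))"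
      "\<And>j. j \<in> {..k} \<Longrightarrow> disc_ito i r \<theta> j \<in> borel_measurable (Fil (r k))"
      using \<theta> k disc_adapted[OF r \<theta>] by auto
    have "(\<lambda>\<omega>. if disc_energy r \<theta> (Suc k) \<omega> \<le> \<eta> \<and> (\<forall>j\<in>{..k}. norm (disc_ito i r \<theta> j \<omega>) \<le> \<epsilon>) then \<theta> k \<omega> else 0)
       \<in> borel_measurable (Fil (r k))"
      by measurable
    then show ?thesis unfolding \<theta>'_def[abs_def] c_def by (simp add: Ball_def)
  qed
  have \<theta>'_M: "\<theta>' k \<in> borel_measurable M" if "k < m" for k
    using measurable_Fil_M[OF \<theta>'_adapted[OF that]] b[of k] that by auto
  have ef: "disc_energy r \<theta> k \<omega> \<le> disc_energy r \<theta> l \<omega>" if "k \<le> l" "l \<le> m" for k l \<omega>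
    unfolding disc_energy_def
    by (rule sum_mono2) (use that rle in \<open>auto intro!: mult_nonneg_nonneg\<close>)
  \<comment> \<open>As long as \<open>c\<close> holds the energy is still below \<open>\<eta>\<close>; afterwards nothing is added.\<close>
  have energy: "disc_energy r \<theta>' k \<omega> \<le> \<eta>" if "k \<le> m" for k \<omega>
    using that
  proof (induction k)
    case (Suc k)
    show ?case
    proof (cases "c k \<omega>")
      case True
      have "disc_energy r \<theta>' (Suc k) \<omega> \<le> disc_energy r \<theta> (Suc k) \<omega>"
        unfolding disc_energy_def
        by (rule sum_mono) (use Suc.prems rle in \<open>auto simp: \<theta>'_def\<close>)
      then show ?thesis using True by (simp add: c_def)
    next
      case False
      then show ?thesis using Suc by (simp add: disc_energy_def \<theta>'_def)
    qed
  qed (use eps in \<open>simp add: disc_energy_def\<close>)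
  have \<theta>'_L2: "L2 (\<theta>' k)" if k: "k < m" for k
  proof (rule L2_dominated[OF \<theta>'_M[OF k], of "\<lambda>_. \<eta> / (r (Suc k) - r k)"])
    fix \<omega>
    have "(r (Suc k) - r k) * (norm (\<theta>' k \<omega>))\<^sup>2 \<le> disc_energy r \<theta>' (Suc k) \<omega>"
      unfolding disc_energy_def
      using k rle by (auto intro!: sum_nonneg mult_nonneg_nonneg)
    also have "\<dots> \<le> \<eta>" using energy k by simp
    finally show "(norm (\<theta>' k \<omega>))\<^sup>2 \<le> \<eta> / (r (Suc k) - r k)"
      using r(2)[OF k] by (simp add: field_simps)
  qed simp
  define S where "S k \<omega> = (W i (r (Suc k)) \<omega> - W i (r k) \<omega>) *\<^sub>R \<theta>' k \<omega>" for k \<omega>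
  have S: "mart_incr (Fil (r k)) (S k)" "msq (S k) \<le> (r (Suc k) - r k) * msq (\<theta>' k)" if k: "k < m" for k
    unfolding S_def[abs_def]
    using ito_increment[OF _ _ _ \<theta>'_adapted[OF k] \<theta>'_L2[OF k], of "r (Suc k)" i] b[of k] b[of "Suc k"] r(2) k
    by auto
  have Ssum: "(\<Sum>l<k. S l \<omega>) = disc_ito i r \<theta>' k \<omega>" for k \<omega>
    by (simp add: S_def disc_ito_def)
  have iso: "L2 (disc_ito i r \<theta>' m)" "msq (disc_ito i r \<theta>' m) = (\<Sum>l<m. msq (S l))"
  proof -
    have "(\<lambda>\<omega>. \<Sum>l<k. S l \<omega>) \<in> borel_measurable (Fil (r k))" if "k < m" for k
      unfolding Ssum using disc_adapted(1)[OF r \<theta>'_adapted, of k k i] that by simp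
    then have "L2 (\<lambda>\<omega>. \<Sum>l<m. S l \<omega>) \<and> msq (\<lambda>\<omega>. \<Sum>l<m. S l \<omega>) = (\<Sum>l<m. msq (S l))"
      using S(1) by (intro msq_mart_sum[where G="\<lambda>k. Fil (r k)"]) auto
    then show "L2 (disc_ito i r \<theta>' m)" "msq (disc_ito i r \<theta>' m) = (\<Sum>l<m. msq (S l))"
      unfolding Ssum by simp_all
  qed
  note iso(2)
  also have "(\<Sum>l<m. msq (S l)) \<le> (\<Sum>l<m. (r (Suc l) - r l) * msq (\<theta>' l))"
    by (rule sum_mono) (use S(2) in auto)
  also have "\<dots> = (\<integral>\<omega>. disc_energy r \<theta>' m \<omega> \<partial>M)"
    unfolding disc_energy_def
    using \<theta>'_L2[THEN L2_integrable_square] by (subst Bochner_Integration.integral_sum) auto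
  also have "\<dots> \<le> (\<integral>\<omega>. \<eta> \<partial>M)"
    unfolding disc_energy_def
    using \<theta>'_L2[THEN L2_integrable_square] energy[of m]
    by (intro integral_mono) (auto simp: disc_energy_def)
  finally have msqI: "msq (disc_ito i r \<theta>' m) \<le> \<eta>" by (simp add: prob_space)
  \<comment> \<open>The cut-off sum freezes at the first index where the original sum exceeds \<open>\<epsilon>\<close>.\<close>
  have stopped: "\<epsilon> < norm (disc_ito i r \<theta>' m \<omega>)"
    if Q: "disc_energy r \<theta> m \<omega> \<le> \<eta>" and ex: "\<exists>k\<le>m. \<epsilon> < norm (disc_ito i r \<theta> k \<omega>)" for \<omega>
  proof -
    define k where "k = (LEAST k. k \<le> m \<and> \<epsilon> < norm (disc_ito i r \<theta> k \<omega>))"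
    have k: "k \<le> m" "\<epsilon> < norm (disc_ito i r \<theta> k \<omega>)"
      using LeastI_ex[OF ex] by (auto simp: k_def)
    have least: "norm (disc_ito i r \<theta> j \<omega>) \<le> \<epsilon>" if "j < k" for j
      using not_less_Least[OF that[unfolded k_def]] that k by auto
    have c1: "c l \<omega>" if "l < k" for l
      using ef[of "Suc l" m \<omega>] Q least that k by (auto simp: c_def)
    have c0: "\<not> c l \<omega>" if "k \<le> l" for l
      using k that by (auto simp: c_def not_le)
    have "disc_ito i r \<theta>' m \<omega> = (\<Sum>l<m. if l < k then (W i (r (Suc l)) \<omega> - W i (r l) \<omega>) *\<^sub>R \<theta> l \<omega> else 0)"
      unfolding disc_ito_def by (rule sum.cong) (use c0 c1 in \<open>auto simp: \<theta>'_def not_less\<close>)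
    also have "\<dots> = (\<Sum>l\<in>{l\<in>{..<m}. l < k}. (W i (r (Suc l)) \<omega> - W i (r l) \<omega>) *\<^sub>R \<theta> l \<omega>)"
      by (simp add: sum.If_cases Int_def)
    also have "{l\<in>{..<m}. l < k} = {..<k}" using k by auto
    finally show ?thesis using k by (simp add: disc_ito_def)
  qed
  have mI[measurable]: "disc_ito i r \<theta>' m \<in> borel_measurable M" using iso(1) by (rule L2_measurable)
  have mE[measurable]: "disc_energy r \<theta> m \<in> borel_measurable M"
    using measurable_Fil_M[OF disc_adapted(3)[OF r \<theta>, of m m]] b[of m] by auto
  have "prob {\<omega>\<in>space M. \<exists>k\<le>m. \<epsilon> < norm (disc_ito i r \<theta> k \<omega>)}
     \<le> prob ({\<omega>\<in>space M. \<epsilon>\<^sup>2 \<le> (norm (disc_ito i r \<theta>' m \<omega>))\<^sup>2} \<union> {\<omega>\<in>space M. \<eta> < disc_energy r \<theta> m \<omega>})"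
  proof (rule finite_measure_mono)
    show "{\<omega>\<in>space M. \<exists>k\<le>m. \<epsilon> < norm (disc_ito i r \<theta> k \<omega>)}
      \<subseteq> {\<omega>\<in>space M. \<epsilon>\<^sup>2 \<le> (norm (disc_ito i r \<theta>' m \<omega>))\<^sup>2} \<union> {\<omega>\<in>space M. \<eta> < disc_energy r \<theta> m \<omega>}"
    proof
      fix \<omega> assume w: "\<omega> \<in> {\<omega>\<in>space M. \<exists>k\<le>m. \<epsilon> < norm (disc_ito i r \<theta> k \<omega>)}"
      show "\<omega> \<in> {\<omega>\<in>space M. \<epsilon>\<^sup>2 \<le> (norm (disc_ito i r \<theta>' m \<omega>))\<^sup>2} \<union> {\<omega>\<in>space M. \<eta> < disc_energy r \<theta> m \<omega>}"
      proof (cases "\<eta> < disc_energy r \<theta> m \<omega>")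
        case False
        then have "\<epsilon> < norm (disc_ito i r \<theta>' m \<omega>)" using stopped[of \<omega>] w by auto
        then have "\<epsilon>\<^sup>2 \<le> (norm (disc_ito i r \<theta>' m \<omega>))\<^sup>2" using eps by (intro power_mono) auto
        then show ?thesis using w by simp
      qed (use w in simp)
    qed
  qed measurable
  also have "\<dots> \<le> prob {\<omega>\<in>space M. \<epsilon>\<^sup>2 \<le> (norm (disc_ito i r \<theta>' m \<omega>))\<^sup>2} + prob {\<omega>\<in>space M. \<eta> < disc_energy r \<theta> m \<omega>}"
    by (rule measure_Un_le) measurable
  also have "prob {\<omega>\<in>space M. \<epsilon>\<^sup>2 \<le> (norm (disc_ito i r \<theta>' m \<omega>))\<^sup>2} \<le> msq (disc_ito i r \<theta>' m) / \<epsilon>\<^sup>2"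
    using iso(1) eps integral_Markov_inequality_measure[of M "\<lambda>\<omega>. (norm (disc_ito i r \<theta>' m \<omega>))\<^sup>2" "space M" "\<epsilon>\<^sup>2"]
    by (auto simp: L2_integrable_square)
  also have "\<dots> \<le> \<eta> / \<epsilon>\<^sup>2" using msqI eps by (intro divide_right_mono) auto
  finally show ?thesis by simp
qed

end


section \<open>Step processes on the time axis\<close>

definition ugrid :: "real \<Rightarrow> nat \<Rightarrow> nat \<Rightarrow> real" where
  "ugrid t m l = real l * t / real m"

lemma ugrid_simps: "ugrid t m 0 = 0" "0 < m \<Longrightarrow> ugrid t m m = t"
  "ugrid t m (Suc l) - ugrid t m l = t / real m"
  by (simp_all add: ugrid_def diff_divide_distrib[symmetric] algebra_simps)

lemma ugrid_less: "0 < t \<Longrightarrow> 0 < m \<Longrightarrow> ugrid t m l < ugrid t m (Suc l)"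
  by (simp add: ugrid_def divide_strict_right_mono)

lemma ugrid_bounds: "0 \<le> t \<Longrightarrow> l \<le> m \<Longrightarrow> 0 \<le> ugrid t m l \<and> ugrid t m l \<le> t"
  by (cases "m = 0") (auto simp: ugrid_def divide_le_eq mult.commute[of t] intro!: mult_right_mono)

lemma step_index:
  fixes p :: "nat \<Rightarrow> real"
  assumes "p 0 < s" "s \<le> p n"
  obtains k where "k < n" "p k < s" "s \<le> p (Suc k)"
proof -
  have "\<exists>k<n. p k < s \<and> s \<le> p (Suc k)"
    using assms
  proof (induction n)
    case (Suc n)
    show ?case
    proof (cases "s \<le> p n")
      case True
      then show ?thesis using Suc by (meson less_Suc_eq)
    next
      case False
      then show ?thesis using Suc.prems by (intro exI[of _ n]) auto
    qed
  qed simp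
  then show ?thesis using that by blast
qed

text \<open>The intervals of a step process are pairwise disjoint, so at most one summand is nonzero.\<close>

lemma simple_value_eq:
  assumes "\<And>k. k < n \<Longrightarrow> p k \<le> p (Suc k)" "k < n" "p k < s" "s \<le> p (Suc k)"
  shows "simple_value n p \<xi> s \<omega> = \<xi> k \<omega>"
proof -
  have "indicat_real {p j<..p (Suc j)} s = (if j = k then 1 else 0)" if "j < n" for j
  proof -
    consider "j < k" | "j = k" | "k < j" by linarith
    then show ?thesis
    proof cases
      case 1
      then have "p (Suc j) \<le> p k" using weak_grid_mono[of n p "Suc j" k] assms by auto
      then show ?thesis using assms 1 by (auto simp: indicator_def)
    next
      case 3
      then have "p (Suc k) \<le> p j" using weak_grid_mono[of n p "Suc k" j] assms that by auto
      then show ?thesis using assms 3 by (auto simp: indicator_def)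
    qed (use assms in auto)
  qed
  then have "simple_value n p \<xi> s \<omega> = (\<Sum>j<n. (if j = k then 1 else 0) *\<^sub>R \<xi> j \<omega>)"
    unfolding simple_value_def by (intro sum.cong) auto
  also have "\<dots> = (\<Sum>j<n. if j = k then \<xi> j \<omega> else 0)"
    by (intro sum.cong) auto
  also have "\<dots> = \<xi> k \<omega>" using assms(2) by simp
  finally show ?thesis .
qed

text \<open>Uniform continuity of the path on the compact time interval.\<close>

lemma step_approximates_continuous:
  fixes \<phi> :: "real \<Rightarrow> 'a \<Rightarrow> 'b::real_normed_vector"
  assumes t: "0 < t" and c: "continuous_on {0..t} (\<lambda>s. \<phi> s \<omega>)" and e: "0 < e"
  obtains m0 where "0 < m0"
    "\<And>m s. m0 \<le> m \<Longrightarrow> 0 < s \<Longrightarrow> s \<le> t \<Longrightarrow> norm (simple_value m (ugrid t m) (\<lambda>l. \<phi> (ugrid t m l)) s \<omega> - \<phi> s \<omega>) \<le> e"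
proof -
  have "uniformly_continuous_on {0..t} (\<lambda>s. \<phi> s \<omega>)"
    by (intro compact_uniformly_continuous c) simp
  then obtain d where d: "d > 0"
    "\<And>x y. x \<in> {0..t} \<Longrightarrow> y \<in> {0..t} \<Longrightarrow> dist x y < d \<Longrightarrow> dist (\<phi> x \<omega>) (\<phi> y \<omega>) < e"
    using e unfolding uniformly_continuous_on_def by (metis dist_commute)
  obtain m0 where m0: "t / d < real m0" using reals_Archimedean2 by blast
  have "0 < t / d" using t d by simp
  then have m0_pos: "0 < m0" using m0 by (cases m0) auto
  show ?thesis
  proof (rule that[OF m0_pos])
    fix m s assume m: "m0 \<le> m" and s: "0 < s" "s \<le> t"
    have mp: "0 < m" using m m0_pos by simp
    obtain k where k: "k < m" "ugrid t m k < s" "s \<le> ugrid t m (Suc k)"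
      using step_index[of "ugrid t m" s m] s mp by (auto simp: ugrid_simps)
    have sv: "simple_value m (ugrid t m) (\<lambda>l. \<phi> (ugrid t m l)) s \<omega> = \<phi> (ugrid t m k) \<omega>"
      using k by (intro simple_value_eq less_imp_le[OF ugrid_less[OF t mp]])
    have "t / real m \<le> t / real m0" using m m0_pos t by (intro divide_left_mono) auto
    also have "\<dots> < d" using m0 d m0_pos by (simp add: field_simps)
    finally have "t / real m < d" .
    then have "dist (ugrid t m k) s < d"
      using k ugrid_simps(3)[of t m k] by (simp add: dist_real_def)
    then have "dist (\<phi> (ugrid t m k) \<omega>) (\<phi> s \<omega>) < e"
      using d(2) s ugrid_bounds[of t k m] t k by auto
    then show "norm (simple_value m (ugrid t m) (\<lambda>l. \<phi> (ugrid t m l)) s \<omega> - \<phi> s \<omega>) \<le> e"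
      unfolding sv by (simp add: dist_norm)
  qed
qed

lemma set_integrable_bounded:
  fixes f :: "real \<Rightarrow> 'b::{banach, second_countable_topology}"
  assumes f: "f \<in> borel_measurable (restrict_space borel {0..t})"
    and b: "\<And>s. 0 \<le> s \<Longrightarrow> s \<le> t \<Longrightarrow> norm (f s) \<le> C"
  shows "set_integrable lborel {0..t} f"
proof -
  have m: "set_borel_measurable lborel {0..t} f"
    using f unfolding set_borel_measurable_def
    by (subst (asm) borel_measurable_restrict_space_iff) auto
  have "set_integrable lborel {0..t} (\<lambda>_. C)"
    unfolding set_integrable_def by (auto intro!: integrable_real_indicator simp: emeasure_lborel_Icc_eq)
  then show ?thesis
    by (rule set_integrable_bound[OF _ m]) (use b in \<open>auto intro!: AE_I2 order_trans[OF b abs_ge_self]\<close>)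
qed

lemma simple_value_measurable_time:
  fixes \<xi> :: "nat \<Rightarrow> 'a \<Rightarrow> 'b::euclidean_space"
  shows "(\<lambda>s. simple_value n p \<xi> s \<omega>) \<in> borel_measurable (restrict_space borel A)"
  unfolding simple_value_def
  by (intro borel_measurable_sum borel_measurable_scaleR borel_measurable_const measurable_restrict_space1) simp

lemma simple_value_bounded:
  "norm (simple_value n p \<xi> s \<omega>) \<le> (\<Sum>k<n. norm (\<xi> k \<omega>))"
  unfolding simple_value_def
  by (rule order_trans[OF norm_sum], rule sum_mono) (simp add: indicator_def)

lemma continuous_bounded:
  fixes f :: "real \<Rightarrow> 'b::euclidean_space"
  assumes "continuous_on {0..t} f"
  obtains C where "\<And>s. 0 \<le> s \<Longrightarrow> s \<le> t \<Longrightarrow> norm (f s) \<le> C"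
proof -
  have "bounded (f ` {0..t})"
    by (intro compact_imp_bounded compact_continuous_image assms) simp
  then obtain C where "\<And>y. y \<in> f ` {0..t} \<Longrightarrow> norm y \<le> C" unfolding bounded_iff by blast
  then show ?thesis by (intro that[of C]) auto
qed

text \<open>The difference of a step process and a continuous or step function is bounded and measurable in
  time, so that its square is integrable.\<close>

lemma step_square_integrable:
  fixes \<xi> :: "nat \<Rightarrow> 'a \<Rightarrow> 'b::euclidean_space"
  assumes f: "f \<in> borel_measurable (restrict_space borel {0..t})"
    and b: "\<And>s. 0 \<le> s \<Longrightarrow> s \<le> t \<Longrightarrow> norm (f s) \<le> C"
  shows "set_integrable lborel {0..t} (\<lambda>s. (norm (simple_value n p \<xi> s \<omega> - f s))\<^sup>2)"
    "set_integrable lborel {0..t} (\<lambda>s. simple_value n p \<xi> s \<omega> - f s)"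
proof -
  note f[measurable] simple_value_measurable_time[measurable]
  let ?B = "(\<Sum>k<n. norm (\<xi> k \<omega>)) + C"
  have b': "norm (simple_value n p \<xi> s \<omega> - f s) \<le> ?B" if "0 \<le> s" "s \<le> t" for s
    using norm_triangle_ineq4[of "simple_value n p \<xi> s \<omega>" "f s"] simple_value_bounded[of n p \<xi> s \<omega>] b[OF that]
    by linarith
  show "set_integrable lborel {0..t} (\<lambda>s. (norm (simple_value n p \<xi> s \<omega> - f s))\<^sup>2)"
    by (rule set_integrable_bounded[where C="?B\<^sup>2"]) (use b' in \<open>auto intro!: power_mono\<close>)
  show "set_integrable lborel {0..t} (\<lambda>s. simple_value n p \<xi> s \<omega> - f s)"
    by (rule set_integrable_bounded[where C="?B"]) (use b' in auto)
qed

lemma step_square_error_tendsto: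
  fixes \<phi> :: "real \<Rightarrow> 'a \<Rightarrow> 'b::euclidean_space"
  assumes t: "0 < t" and c: "continuous_on {0..t} (\<lambda>s. \<phi> s \<omega>)"
  shows "(\<lambda>m. LINT s:{0..t}|lborel. (norm (simple_value m (ugrid t m) (\<lambda>l. \<phi> (ugrid t m l)) s \<omega> - \<phi> s \<omega>))\<^sup>2) \<longlonglongrightarrow> 0"
proof (rule LIMSEQ_I)
  fix r :: real assume r: "0 < r"
  define e where "e = sqrt (r / (2 * t))"
  have e: "0 < e" "t * e\<^sup>2 = r / 2" using r t by (auto simp: e_def)
  obtain m0 where m0: "\<And>m s. m0 \<le> m \<Longrightarrow> 0 < s \<Longrightarrow> s \<le> t \<Longrightarrow>
      norm (simple_value m (ugrid t m) (\<lambda>l. \<phi> (ugrid t m l)) s \<omega> - \<phi> s \<omega>) \<le> e"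
    using step_approximates_continuous[of t \<phi> \<omega> e, OF t c e(1)] by metis
  obtain C where C: "\<And>s. 0 \<le> s \<Longrightarrow> s \<le> t \<Longrightarrow> norm (\<phi> s \<omega>) \<le> C"
    using continuous_bounded[OF c] by metis
  note int = step_square_integrable(1)[OF borel_measurable_continuous_on_restrict[OF c] C]
  show "\<exists>m0. \<forall>m\<ge>m0. norm ((LINT s:{0..t}|lborel. (norm (simple_value m (ugrid t m) (\<lambda>l. \<phi> (ugrid t m l)) s \<omega> - \<phi> s \<omega>))\<^sup>2) - 0) < r"
  proof (intro exI allI impI)
    fix m assume m: "m0 \<le> m"
    let ?I = "LINT s:{0..t}|lborel. (norm (simple_value m (ugrid t m) (\<lambda>l. \<phi> (ugrid t m l)) s \<omega> - \<phi> s \<omega>))\<^sup>2"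
    have "?I \<le> (LINT s:{0..t}|lborel. e\<^sup>2)"
    proof (rule set_integral_mono_AE[OF int])
      show "set_integrable lborel {0..t} (\<lambda>_. e\<^sup>2)" 
        by (auto simp: set_integrable_def intro!: integrable_real_indicator simp: emeasure_lborel_Icc_eq)
      show "AE s\<in>{0..t} in lborel. (norm (simple_value m (ugrid t m) (\<lambda>l. \<phi> (ugrid t m l)) s \<omega> - \<phi> s \<omega>))\<^sup>2 \<le> e\<^sup>2"
        using AE_lborel_singleton[of 0]
        by eventually_elim (use m0[OF m] in \<open>auto intro!: power_mono\<close>)
    qed
    also have "\<dots> = r / 2" using t e by (simp add: set_integral_const)
    finally have "?I < r" using r by simp
    moreover have "0 \<le> ?I" by (auto simp: set_lebesgue_integral_def intro!: integral_nonneg_AE)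
    ultimately show "norm (?I - 0) < r" by simp
  qed
qed

lemma simple_value_integral:
  fixes \<xi> :: "nat \<Rightarrow> 'a \<Rightarrow> 'b::euclidean_space"
  assumes "p 0 = 0" "p n = t" "\<And>k. k < n \<Longrightarrow> p k \<le> p (Suc k)"
  shows "(LINT s:{0..t}|lborel. simple_value n p \<xi> s \<omega>) = (\<Sum>k<n. (p (Suc k) - p k) *\<^sub>R \<xi> k \<omega>)"
proof -
  have sub: "{p k<..p (Suc k)} \<subseteq> {0..t}" if "k < n" for k
    using weak_grid_mono[of n p 0 k] weak_grid_mono[of n p "Suc k" n] assms that by auto
  have "indicat_real {0..t} s *\<^sub>R simple_value n p \<xi> s \<omega> = (\<Sum>k<n. indicat_real {p k<..p (Suc k)} s *\<^sub>R \<xi> k \<omega>)" for s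
    unfolding simple_value_def scaleR_sum_right
  proof (rule sum.cong)
    fix k assume "k \<in> {..<n}"
    then have "s \<in> {p k<..p (Suc k)} \<Longrightarrow> s \<in> {0..t}" using sub[of k] by blast
    then show "indicat_real {0..t} s *\<^sub>R indicat_real {p k<..p (Suc k)} s *\<^sub>R \<xi> k \<omega>
        = indicat_real {p k<..p (Suc k)} s *\<^sub>R \<xi> k \<omega>"
      by (auto simp: indicator_def)
  qed simp
  then have "(LINT s:{0..t}|lborel. simple_value n p \<xi> s \<omega>)
      = (\<integral>s. (\<Sum>k<n. indicat_real {p k<..p (Suc k)} s *\<^sub>R \<xi> k \<omega>) \<partial>lborel)"
    by (simp add: set_lebesgue_integral_def)
  also have "\<dots> = (\<Sum>k<n. \<integral>s. indicat_real {p k<..p (Suc k)} s *\<^sub>R \<xi> k \<omega> \<partial>lborel)"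
    by (rule Bochner_Integration.integral_sum)
      (use assms(3) in \<open>auto intro!: integrable_scaleR_left integrable_real_indicator\<close>)
  also have "\<dots> = (\<Sum>k<n. (p (Suc k) - p k) *\<^sub>R \<xi> k \<omega>)"
    by (rule sum.cong) (use assms(3) in auto)
  finally show ?thesis .
qed

lemma riemann_sum_tendsto:
  fixes \<phi> :: "real \<Rightarrow> 'a \<Rightarrow> 'b::euclidean_space"
  assumes t: "0 < t" and c: "continuous_on {0..t} (\<lambda>s. \<phi> s \<omega>)"
  shows "(\<lambda>m. \<Sum>l<m. (t / real m) *\<^sub>R \<phi> (ugrid t m l) \<omega>) \<longlonglongrightarrow> (LINT s:{0..t}|lborel. \<phi> s \<omega>)"
proof (rule LIMSEQ_I)
  fix r :: real assume r: "0 < r"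
  define e where "e = r / (2 * t)"
  have e: "0 < e" "t * e = r / 2" using r t by (auto simp: e_def)
  obtain m0 where m0_pos: "0 < m0" and m0: "\<And>m s. m0 \<le> m \<Longrightarrow> 0 < s \<Longrightarrow> s \<le> t \<Longrightarrow>
      norm (simple_value m (ugrid t m) (\<lambda>l. \<phi> (ugrid t m l)) s \<omega> - \<phi> s \<omega>) \<le> e"
    using step_approximates_continuous[of t \<phi> \<omega> e, OF t c e(1)] by metis
  obtain C where C: "\<And>s. 0 \<le> s \<Longrightarrow> s \<le> t \<Longrightarrow> norm (\<phi> s \<omega>) \<le> C"
    using continuous_bounded[OF c] by metis
  note cm = borel_measurable_continuous_on_restrict[OF c]
  note int = step_square_integrable(2)[OF cm C]
  have intc: "set_integrable lborel {0..t} (\<lambda>s. \<phi> s \<omega>)" by (rule set_integrable_bounded[OF cm C])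
  show "\<exists>m0. \<forall>m\<ge>m0. norm ((\<Sum>l<m. (t / real m) *\<^sub>R \<phi> (ugrid t m l) \<omega>) - (LINT s:{0..t}|lborel. \<phi> s \<omega>)) < r"
  proof (intro exI allI impI)
    fix m assume m: "m0 \<le> m"
    have mp: "0 < m" using m m0_pos by simp
    let ?sv = "\<lambda>s. simple_value m (ugrid t m) (\<lambda>l. \<phi> (ugrid t m l)) s \<omega>"
    have "set_integrable lborel {0..t} (\<lambda>s. (?sv s - \<phi> s \<omega>) + \<phi> s \<omega>)"
      by (intro set_integral_add int intc)
    then have intsv: "set_integrable lborel {0..t} ?sv" by simp
    have "(LINT s:{0..t}|lborel. ?sv s) = (\<Sum>l<m. (t / real m) *\<^sub>R \<phi> (ugrid t m l) \<omega>)"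
      using simple_value_integral[of "ugrid t m" m t] ugrid_simps[where t=t and m=m] ugrid_less[OF t mp] mp
      by (simp add: less_imp_le)
    then have "(\<Sum>l<m. (t / real m) *\<^sub>R \<phi> (ugrid t m l) \<omega>) - (LINT s:{0..t}|lborel. \<phi> s \<omega>)
        = (LINT s:{0..t}|lborel. ?sv s - \<phi> s \<omega>)"
      using set_integral_diff(2)[OF intsv intc] by simp
    also have "norm \<dots> \<le> (LINT s:{0..t}|lborel. norm (?sv s - \<phi> s \<omega>))"
      by (rule set_integral_norm_bound[OF int])
    also have "\<dots> \<le> (LINT s:{0..t}|lborel. e)"
    proof (rule set_integral_mono_AE)
      show "set_integrable lborel {0..t} (\<lambda>s. norm (?sv s - \<phi> s \<omega>))" by (rule set_integrable_norm[OF int])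
      show "set_integrable lborel {0..t} (\<lambda>_. e)" 
        by (auto simp: set_integrable_def intro!: integrable_real_indicator simp: emeasure_lborel_Icc_eq)
      show "AE s\<in>{0..t} in lborel. norm (?sv s - \<phi> s \<omega>) \<le> e"
        using AE_lborel_singleton[of 0] by eventually_elim (use m0[OF m] in auto)
    qed
    also have "\<dots> = r / 2" using t e by (simp add: set_integral_const)
    finally show "norm ((\<Sum>l<m. (t / real m) *\<^sub>R \<phi> (ugrid t m l) \<omega>) - (LINT s:{0..t}|lborel. \<phi> s \<omega>)) < r"
      using r by simp
  qed
qed

text \<open>By Fubini. Without it the events in the definition of the stochastic integral might fail to be measurable and their
  probabilities would be 0 by convention.\<close>

lemma (in prob_space) step_square_error_measurable:
  fixes \<phi> :: "real \<Rightarrow> 'a \<Rightarrow> 'b::euclidean_space"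
  assumes \<phi>: "(\<lambda>(s, \<omega>). \<phi> s \<omega>) \<in> borel_measurable (restrict_space borel {0..t} \<Otimes>\<^sub>M M)"
    and \<xi>: "\<And>k. k < n \<Longrightarrow> \<xi> k \<in> borel_measurable M"
  shows "(\<lambda>\<omega>. LINT s:{0..t}|lborel. (norm (simple_value n p \<xi> s \<omega> - \<phi> s \<omega>))\<^sup>2) \<in> borel_measurable M"
proof -
  interpret S: sigma_finite_measure "restrict_space lborel {0..t}"
    by (rule sigma_finite_measure_restrict_space) (simp_all add: lborel.sigma_finite_measure_axioms)
  have s[measurable]: "fst \<in> borel_measurable (restrict_space borel {0..t} \<Otimes>\<^sub>M M)"
    by (rule measurable_compose[OF measurable_fst measurable_restrict_space1]) simp
  have sv: "(\<lambda>x. simple_value n p \<xi> (fst x) (snd x)) \<in> borel_measurable (restrict_space borel {0..t} \<Otimes>\<^sub>M M)"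
    unfolding simple_value_def
    by (intro borel_measurable_sum borel_measurable_scaleR measurable_compose[OF s] measurable_compose[OF measurable_snd \<xi>])
      auto
  have \<phi>': "(\<lambda>x. \<phi> (fst x) (snd x)) \<in> borel_measurable (restrict_space borel {0..t} \<Otimes>\<^sub>M M)"
    using \<phi> by (simp add: split_beta)
  note sv[measurable] \<phi>'[measurable]
  have "(\<lambda>x. (norm (simple_value n p \<xi> (fst x) (snd x) - \<phi> (fst x) (snd x)))\<^sup>2)
      \<in> borel_measurable (restrict_space borel {0..t} \<Otimes>\<^sub>M M)"
    by measurable
  also have "borel_measurable (restrict_space borel {0..t} \<Otimes>\<^sub>M M) = borel_measurable (restrict_space lborel {0..t} \<Otimes>\<^sub>M M)"
    by (intro measurable_cong_sets sets_pair_measure_cong sets_restrict_space_cong) auto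
  finally have "(\<lambda>(\<omega>, s). (norm (simple_value n p \<xi> s \<omega> - \<phi> s \<omega>))\<^sup>2) \<in> borel_measurable (M \<Otimes>\<^sub>M restrict_space lborel {0..t})"
    by (drule_tac measurable_pair_swap) (simp add: split_beta)
  then have "(\<lambda>\<omega>. LINT s|restrict_space lborel {0..t}. (norm (simple_value n p \<xi> s \<omega> - \<phi> s \<omega>))\<^sup>2) \<in> borel_measurable M"
    by (intro S.borel_measurable_lebesgue_integral) (simp add: split_beta)
  then show ?thesis
    by (simp add: integral_restrict_space set_lebesgue_integral_def)
qed

text \<open>Integrals of two step processes can be subtracted only on a common refinement of their grids. It is obtained by
  sorting the union of the grid points.\<close>

lemma merged_grid:
  fixes S :: "real set"
  assumes "finite S" "S \<subseteq> {0..t}" "0 \<in> S" "t \<in> S"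
  obtains r m where "r 0 = 0" "r m = t" "\<And>k. k < m \<Longrightarrow> r k < r (Suc k)"
    "\<And>x. x \<in> S \<Longrightarrow> \<exists>a\<le>m. r a = x"
proof -
  define xs where "xs = sorted_list_of_set S"
  have set: "set xs = S" using assms by (simp add: xs_def)
  have sorted: "sorted_wrt (<) xs" by (simp add: xs_def)
  have ne: "xs \<noteq> []" using set assms by auto
  define m where "m = length xs - 1"
  have len: "length xs = Suc m" using ne by (cases xs) (auto simp: m_def)
  have incr: "xs ! j < xs ! k" if "j < k" "k \<le> m" for j k
    using sorted_wrt_nth_less[OF sorted] that len by auto
  have ex: "\<exists>a\<le>m. xs ! a = x" if "x \<in> S" for x
    using that set len by (metis in_set_conv_nth less_Suc_eq_le)
  have mem: "xs ! k \<in> {0..t}" if "k \<le> m" for k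
    using that assms(2) set len nth_mem[of k xs] by auto
  show ?thesis
  proof (rule that[of "(!) xs" m])
    obtain a where "a \<le> m" "xs ! a = 0" using ex[OF assms(3)] by auto
    then show "xs ! 0 = 0" using incr[of 0 a] mem[of 0] by (cases "a = 0") auto
    obtain a where "a \<le> m" "xs ! a = t" using ex[OF assms(4)] by auto
    then show "xs ! m = t" using incr[of a m] mem[of m] by (cases "a = m") auto
  qed (use incr ex in auto)
qed

text \<open>The value of a step process immediately to the right of \<open>s\<close>: it is constant on the interval between two
  neighbouring points of a refined grid, and equal there to its right value at the left end, which is known at that time.\<close>

definition right_value ::
    "nat \<Rightarrow> (nat \<Rightarrow> real) \<Rightarrow> (nat \<Rightarrow> 'a \<Rightarrow> 'b::real_normed_vector) \<Rightarrow> real \<Rightarrow> 'a \<Rightarrow> 'b" where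
  "right_value n p \<xi> s \<omega> = (\<Sum>k<n. indicat_real {p k..<p (Suc k)} s *\<^sub>R \<xi> k \<omega>)"

lemma grid_telescope:
  fixes X :: "nat \<Rightarrow> real"
  assumes r: "\<And>k. k < m \<Longrightarrow> r k < (r (Suc k) :: real)" and ab: "a \<le> m" "b \<le> m" "r a \<le> r b"
  shows "(\<Sum>l<m. (X (Suc l) - X l) * indicat_real {r a..<r b} (r l)) = X b - X a"
proof -
  note less = grid_strict_mono[of m r, OF r]
  have le: "a \<le> b" using less[of b a] ab by (cases "b < a") auto
  have "indicat_real {r a..<r b} (r l) = (if a \<le> l \<and> l < b then 1 else 0)" if "l < m" for l
  proof -
    have "r a \<le> r l \<longleftrightarrow> a \<le> l"
      using less[of a l] less[of l a] that ab by (cases a l rule: linorder_cases) auto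
    moreover have "r l < r b \<longleftrightarrow> l < b"
      using less[of l b] less[of b l] that ab by (cases l b rule: linorder_cases) auto
    ultimately show ?thesis by (simp add: indicator_def)
  qed
  then have "(\<Sum>l<m. (X (Suc l) - X l) * indicat_real {r a..<r b} (r l))
      = (\<Sum>l<m. if a \<le> l \<and> l < b then X (Suc l) - X l else 0)"
    by (intro sum.cong) auto
  also have "\<dots> = sum (\<lambda>l. X (Suc l) - X l) {a..<b}"
    using ab by (intro sum.mono_neutral_cong_right) auto
  also have "\<dots> = X b - X a" by (rule sum_Suc_diff'[OF le])
  finally show ?thesis .
qed

text \<open>No point of the grid \<open>p\<close> lies strictly between neighbouring points of the refined grid \<open>r\<close>.\<close>

lemma simple_value_right_value:
  assumes r: "\<And>k. k < m \<Longrightarrow> r k < (r (Suc k) :: real)"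
    and p: "\<And>k. k \<le> n \<Longrightarrow> \<exists>a\<le>m. r a = p k"
    and s: "l < m" "r l < s" "s \<le> r (Suc l)"
  shows "simple_value n p \<xi> s \<omega> = right_value n p \<xi> (r l) \<omega>"
proof -
  note less = grid_strict_mono[of m r, OF r]
  have cut: "p k < s \<longleftrightarrow> p k \<le> r l" if k: "k \<le> n" for k
  proof -
    obtain a where a: "a \<le> m" "r a = p k" using p[OF k] by auto
    show ?thesis
    proof (cases "a \<le> l")
      case True
      then have "r a \<le> r l" using less[of a l] s by (cases "a = l") auto
      then show ?thesis using a s by auto
    next
      case False
      then have "r (Suc l) \<le> r a" using less[of "Suc l" a] a by (cases "a = Suc l") auto
      then show ?thesis using a s by auto
    qed
  qed
  have "indicat_real {p k<..p (Suc k)} s = indicat_real {p k..<p (Suc k)} (r l)" if "k < n" for k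
    using cut[of k] cut[of "Suc k"] that by (auto simp: indicator_def)
  then show ?thesis
    unfolding simple_value_def right_value_def by (intro sum.cong) auto
qed

context prob_space
begin

lemma AE_tendsto_zero_in_prob:
  fixes X :: "nat \<Rightarrow> 'a \<Rightarrow> real"
  assumes m: "\<And>j. X j \<in> borel_measurable M" and c: "AE \<omega> in M. (\<lambda>j. X j \<omega>) \<longlonglongrightarrow> 0" and e: "0 < \<epsilon>"
  shows "(\<lambda>j. prob {\<omega>\<in>space M. \<epsilon> < X j \<omega>}) \<longlonglongrightarrow> 0"
proof -
  note m[measurable]
  let ?I = "\<lambda>j \<omega>. indicat_real {\<omega>\<in>space M. \<epsilon> < X j \<omega>} \<omega>"
  have "(\<lambda>j. \<integral>\<omega>. ?I j \<omega> \<partial>M) \<longlonglongrightarrow> (\<integral>\<omega>. 0 \<partial>M)"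
  proof (rule integral_dominated_convergence[where w="\<lambda>_. 1"])
    show "AE \<omega> in M. (\<lambda>j. ?I j \<omega>) \<longlonglongrightarrow> 0"
      using c
    proof eventually_elim
      case (elim \<omega>)
      have "eventually (\<lambda>j. X j \<omega> < \<epsilon>) sequentially"
        using order_tendstoD(2)[OF elim e] .
      then have "eventually (\<lambda>j. ?I j \<omega> = 0) sequentially"
        by eventually_elim (auto simp: indicator_def)
      then show ?case by (rule tendsto_eventually)
    qed
  qed (auto simp: indicator_def)
  then show ?thesis by (simp add: Int_def cong: conj_cong)
qed

end

context brownian_noise
begin

text \<open>Simple processes without boundedness: the values of a solution at grid points need not be bounded.\<close>

definition adapted_step ::
    "real \<Rightarrow> nat \<Rightarrow> (nat \<Rightarrow> real) \<Rightarrow> (nat \<Rightarrow> 'a \<Rightarrow> 'b::euclidean_space) \<Rightarrow> bool" where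
  "adapted_step t n p \<xi> \<longleftrightarrow> p 0 = 0 \<and> p n = t \<and> (\<forall>k<n. p k \<le> p (Suc k)) \<and>
     (\<forall>k<n. \<xi> k \<in> borel_measurable (Fil (p k)))"

lemma adapted_step_bounds:
  assumes "adapted_step t n p \<xi>" "k \<le> n"
  shows "0 \<le> p k" "p k \<le> t"
  using weak_grid_mono[of n p 0 k] weak_grid_mono[of n p k n] assms by (auto simp: adapted_step_def)

lemma adapted_step_measurable:
  assumes "adapted_step t n p \<xi>" "t \<le> T" "k < n"
  shows "\<xi> k \<in> borel_measurable M"
  using assms adapted_step_bounds[OF assms(1), of k] measurable_Fil_M[of "\<xi> k" "p k"]
  by (auto simp: adapted_step_def)

lemma simple_ito_measurable:
  assumes "adapted_step t n p \<xi>" "t \<le> T"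
  shows "simple_ito (W i) n p \<xi> \<in> borel_measurable M"
proof -
  have "W i (p k) \<in> borel_measurable M" if "k \<le> n" for k
    using adapted_step_bounds[OF assms(1) that] assms(2) by (intro W_measurable) auto
  then show ?thesis
    unfolding simple_ito_def[abs_def]
    by (intro borel_measurable_sum borel_measurable_scaleR borel_measurable_diff
        adapted_step_measurable[OF assms]) auto
qed

lemma right_value_adapted:
  assumes \<xi>: "adapted_step t n p \<xi>" and s: "0 \<le> s" "s \<le> T"
  shows "right_value n p \<xi> s \<in> borel_measurable (Fil s)"
  unfolding right_value_def[abs_def]
proof (intro borel_measurable_sum)
  fix k assume k: "k \<in> {..<n}"
  have pk: "0 \<le> p k" using adapted_step_bounds[OF \<xi>, of k] k by simp
  have m: "\<xi> k \<in> borel_measurable (Fil (p k))" using \<xi> k by (simp add: adapted_step_def)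
  show "(\<lambda>\<omega>. indicat_real {p k..<p (Suc k)} s *\<^sub>R \<xi> k \<omega>) \<in> borel_measurable (Fil s)"
  proof (cases "p k \<le> s")
    case True
    then have "\<xi> k \<in> borel_measurable (Fil s)"
      by (rule measurable_Fil_mono[OF m pk _ s(2)])
    then show ?thesis by (intro borel_measurable_scaleR borel_measurable_const)
  qed (simp add: indicator_def)
qed

lemma simple_ito_refined:
  assumes \<xi>: "adapted_step t n p \<xi>"
    and r: "\<And>k. k < m \<Longrightarrow> r k < r (Suc k)" and p: "\<And>k. k \<le> n \<Longrightarrow> \<exists>a\<le>m. r a = p k"
  shows "simple_ito (W i) n p \<xi> \<omega> = disc_ito i r (\<lambda>l. right_value n p \<xi> (r l)) m \<omega>"
proof -
  have "(\<Sum>l<m. ((W i (r (Suc l)) \<omega> - W i (r l) \<omega>) * indicat_real {p k..<p (Suc k)} (r l)))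
      = W i (p (Suc k)) \<omega> - W i (p k) \<omega>" if k: "k < n" for k
  proof -
    obtain a b where ab: "a \<le> m" "r a = p k" "b \<le> m" "r b = p (Suc k)"
      using p[of k] p[of "Suc k"] k by auto
    have "r a \<le> r b" using \<xi> k ab by (simp add: adapted_step_def)
    then show ?thesis
      using grid_telescope[of m r a b "\<lambda>l. W i (r l) \<omega>", OF r ab(1,3)] ab by simp
  qed
  then have "simple_ito (W i) n p \<xi> \<omega>
      = (\<Sum>k<n. (\<Sum>l<m. ((W i (r (Suc l)) \<omega> - W i (r l) \<omega>) * indicat_real {p k..<p (Suc k)} (r l))) *\<^sub>R \<xi> k \<omega>)"
    unfolding simple_ito_def by (intro sum.cong) auto
  also have "\<dots> = (\<Sum>k<n. \<Sum>l<m. ((W i (r (Suc l)) \<omega> - W i (r l) \<omega>) * indicat_real {p k..<p (Suc k)} (r l)) *\<^sub>R \<xi> k \<omega>)"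
    by (simp only: scaleR_sum_left)
  also have "\<dots> = (\<Sum>l<m. \<Sum>k<n. ((W i (r (Suc l)) \<omega> - W i (r l) \<omega>) * indicat_real {p k..<p (Suc k)} (r l)) *\<^sub>R \<xi> k \<omega>)"
    by (rule sum.swap)
  also have "\<dots> = disc_ito i r (\<lambda>l. right_value n p \<xi> (r l)) m \<omega>"
    by (simp only: disc_ito_def right_value_def scaleR_sum_right scaleR_scaleR)
  finally show ?thesis .
qed

text \<open>On a common refinement the difference of the integrals is a discrete integral, and the squared distance of the step
  processes in time is its energy. This turns \<open>maximal_inequality\<close> into a continuity statement for the elementary integral.\<close>

lemma step_ito_close:
  fixes \<xi> \<xi>' :: "nat \<Rightarrow> 'a \<Rightarrow> 'b::euclidean_space"
  assumes \<xi>: "adapted_step t n p \<xi>" and \<xi>': "adapted_step t n' p' \<xi>'"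
    and t: "0 < t" "t \<le> T" and eps: "0 < \<epsilon>" "0 \<le> \<eta>"
  shows "prob {\<omega>\<in>space M. \<epsilon> < norm (simple_ito (W i) n p \<xi> \<omega> - simple_ito (W i) n' p' \<xi>' \<omega>)}
    \<le> \<eta> / \<epsilon>\<^sup>2 + prob {\<omega>\<in>space M. \<eta> < (LINT s:{0..t}|lborel. (norm (simple_value n p \<xi> s \<omega> - simple_value n' p' \<xi>' s \<omega>))\<^sup>2)}"
proof -
  define S where "S = p ` {..n} \<union> p' ` {..n'}"
  have "finite S" by (simp add: S_def)
  moreover have "S \<subseteq> {0..t}"
    using adapted_step_bounds[OF \<xi>] adapted_step_bounds[OF \<xi>'] by (auto simp: S_def)
  moreover have "p 0 = 0" "p n = t" using \<xi> by (simp_all add: adapted_step_def)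
  then have "0 \<in> S" "t \<in> S"
    unfolding S_def by (auto intro!: image_eqI[of 0 p 0] image_eqI[of t p n])
  ultimately obtain r m where r: "r 0 = 0" "r m = t" "\<And>k. k < m \<Longrightarrow> r k < r (Suc k)"
    and ex: "\<And>x. x \<in> S \<Longrightarrow> \<exists>a\<le>m. r a = x"
    using merged_grid by metis
  have p: "\<And>k. k \<le> n \<Longrightarrow> \<exists>a\<le>m. r a = p k" and p': "\<And>k. k \<le> n' \<Longrightarrow> \<exists>a\<le>m. r a = p' k"
    using ex by (auto simp: S_def)
  define \<theta> where "\<theta> l \<omega> = right_value n p \<xi> (r l) \<omega> - right_value n' p' \<xi>' (r l) \<omega>" for l \<omega>
  have rb: "0 \<le> r l" "r l \<le> T" if "l \<le> m" for l
    using grid_mono[of m r 0 l] grid_mono[of m r l m] r t that by auto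
  have \<theta>: "\<theta> k \<in> borel_measurable (Fil (r k))" if "k < m" for k
    unfolding \<theta>_def[abs_def]
    by (intro borel_measurable_diff right_value_adapted[OF \<xi>] right_value_adapted[OF \<xi>'])
      (use that rb[of k] in auto)
  have ito: "disc_ito i r \<theta> m \<omega> = simple_ito (W i) n p \<xi> \<omega> - simple_ito (W i) n' p' \<xi>' \<omega>" for \<omega>
  proof -
    have "simple_ito (W i) n p \<xi> \<omega> = disc_ito i r (\<lambda>l. right_value n p \<xi> (r l)) m \<omega>"
      by (rule simple_ito_refined[OF \<xi>]) (use r(3) p in auto)
    moreover have "simple_ito (W i) n' p' \<xi>' \<omega> = disc_ito i r (\<lambda>l. right_value n' p' \<xi>' (r l)) m \<omega>"
      by (rule simple_ito_refined[OF \<xi>']) (use r(3) p' in auto)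
    ultimately show ?thesis by (simp add: disc_ito_def \<theta>_def scaleR_diff_right sum_subtractf)
  qed
  have energy: "disc_energy r \<theta> m \<omega> = (LINT s:{0..t}|lborel. (norm (simple_value n p \<xi> s \<omega> - simple_value n' p' \<xi>' s \<omega>))\<^sup>2)" for \<omega>
  proof -
    have le: "r k \<le> r (Suc k)" if "k < m" for k using r(3)[OF that] by simp
    have "disc_energy r \<theta> m \<omega> = (LINT s:{0..t}|lborel. simple_value m r (\<lambda>l \<omega>. (norm (\<theta> l \<omega>))\<^sup>2) s \<omega>)"
      unfolding disc_energy_def using simple_value_integral[of r m t "\<lambda>l \<omega>. (norm (\<theta> l \<omega>))\<^sup>2" \<omega>] r le by simp
    also have "\<dots> = (LINT s:{0..t}|lborel. (norm (simple_value n p \<xi> s \<omega> - simple_value n' p' \<xi>' s \<omega>))\<^sup>2)"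
    proof (rule set_lebesgue_integral_cong)
      show "\<forall>s. s \<in> {0..t} \<longrightarrow> simple_value m r (\<lambda>l \<omega>. (norm (\<theta> l \<omega>))\<^sup>2) s \<omega>
          = (norm (simple_value n p \<xi> s \<omega> - simple_value n' p' \<xi>' s \<omega>))\<^sup>2"
      proof (intro allI impI)
        fix s assume s: "s \<in> {0..t}"
        show "simple_value m r (\<lambda>l \<omega>. (norm (\<theta> l \<omega>))\<^sup>2) s \<omega>
          = (norm (simple_value n p \<xi> s \<omega> - simple_value n' p' \<xi>' s \<omega>))\<^sup>2"
        proof (cases "s = 0")
          case True
          have "simple_value n p \<xi> s \<omega> = 0"
            unfolding simple_value_def True
            by (rule sum.neutral) (use adapted_step_bounds[OF \<xi>] in \<open>auto simp: indicator_def not_less\<close>)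
          moreover have "simple_value n' p' \<xi>' s \<omega> = 0"
            unfolding simple_value_def True
            by (rule sum.neutral) (use adapted_step_bounds[OF \<xi>'] in \<open>auto simp: indicator_def not_less\<close>)
          moreover have "simple_value m r (\<lambda>l \<omega>. (norm (\<theta> l \<omega>))\<^sup>2) s \<omega> = 0"
            unfolding simple_value_def True
            by (rule sum.neutral) (use rb in \<open>auto simp: indicator_def not_less\<close>)
          ultimately show ?thesis by simp
        next
          case False
          then obtain l where l: "l < m" "r l < s" "s \<le> r (Suc l)"
            using step_index[of r s m] r s by auto
          have "simple_value m r (\<lambda>l \<omega>. (norm (\<theta> l \<omega>))\<^sup>2) s \<omega> = (norm (\<theta> l \<omega>))\<^sup>2"
            using simple_value_eq[of m r l s "\<lambda>l \<omega>. (norm (\<theta> l \<omega>))\<^sup>2" \<omega>] le l by auto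
          then show ?thesis
            using simple_value_right_value[of m r n p l s \<xi> \<omega>]
              simple_value_right_value[of m r n' p' l s \<xi>' \<omega>] r(3) p p' l
            by (simp add: \<theta>_def)
        qed
      qed
    qed simp
    finally show ?thesis .
  qed
  have "prob {\<omega>\<in>space M. \<epsilon> < norm (disc_ito i r \<theta> m \<omega>)} \<le> prob {\<omega>\<in>space M. \<exists>k\<le>m. \<epsilon> < norm (disc_ito i r \<theta> k \<omega>)}"
  proof (rule finite_measure_mono)
    have "disc_ito i r \<theta> k \<in> borel_measurable M" if k: "k \<in> {..m}" for k
    proof (rule measurable_Fil_M)
      show "disc_ito i r \<theta> k \<in> borel_measurable (Fil (r k))"
        by (rule disc_adapted(1)[where m=m]) (use r t k \<theta> in auto)
    qed (use rb k in auto)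
    note this[measurable (raw)]
    have "{\<omega>\<in>space M. \<exists>k\<in>{..m}. \<epsilon> < norm (disc_ito i r \<theta> k \<omega>)} \<in> events" by measurable
    then show "{\<omega>\<in>space M. \<exists>k\<le>m. \<epsilon> < norm (disc_ito i r \<theta> k \<omega>)} \<in> events"
      by (simp add: Bex_def)
  qed auto
  also have "\<dots> \<le> \<eta> / \<epsilon>\<^sup>2 + prob {\<omega>\<in>space M. \<eta> < disc_energy r \<theta> m \<omega>}"
    by (rule maximal_inequality) (use r t \<theta> eps in auto)
  finally show ?thesis unfolding ito energy .
qed

text \<open>The approximating simple processes in the definition of the integral and the left Riemann approximations are both
  close to \<open>\<phi>\<close> in the mean square over time, hence close to each other, so that \<open>step_ito_close\<close> applies.\<close>

lemma ito_integral_riemann: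
  fixes \<phi> :: "real \<Rightarrow> 'a \<Rightarrow> 'b::euclidean_space"
  assumes ito: "has_ito_integral M Fil (W i) t \<phi> J"
    and cont: "AE \<omega> in M. continuous_on {0..t} (\<lambda>s. \<phi> s \<omega>)"
    and t: "0 < t" "t \<le> T" and eps: "0 < \<epsilon>"
  shows "(\<lambda>m. prob {\<omega>\<in>space M. \<epsilon> < norm (simple_ito (W i) m (ugrid t m) (\<lambda>l. \<phi> (ugrid t m l)) \<omega> - J \<omega>)}) \<longlonglongrightarrow> 0"
proof (rule LIMSEQ_I)
  fix \<gamma> :: real assume \<gamma>: "0 < \<gamma>"
  define \<eta> where "\<eta> = \<gamma> * \<epsilon>\<^sup>2 / 16"
  \<comment> \<open>Four error probabilities are kept below \<open>\<gamma> / 4\<close> each.\<close>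
  have \<eta>: "0 < \<eta>" "\<eta> / (\<epsilon>/2)\<^sup>2 = \<gamma> / 4" using \<gamma> eps by (auto simp: \<eta>_def power_divide)
  from ito obtain n p \<xi> where
    \<phi>: "measurable_adapted M Fil t \<phi>" and J[measurable]: "J \<in> borel_measurable M"
    and simple: "\<And>j. simple_process Fil t (n j) (p j) (\<xi> j)"
    and lim1: "tendsto_in_prob M (\<lambda>j \<omega>. LINT s:{0..t}|lborel. (norm (simple_value (n j) (p j) (\<xi> j) s \<omega> - \<phi> s \<omega>))\<^sup>2) (\<lambda>_. 0)"
    and lim2: "tendsto_in_prob M (\<lambda>j. simple_ito (W i) (n j) (p j) (\<xi> j)) J"
    unfolding has_ito_integral_def by blast
  have step: "adapted_step t (n j) (p j) (\<xi> j)" for j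
    using simple[of j] by (simp add: simple_process_def adapted_step_def)
  have ustep: "adapted_step t m (ugrid t m) (\<lambda>l. \<phi> (ugrid t m l))" if "0 < m" for m
    using \<phi> that ugrid_less[OF t(1) that] ugrid_bounds[of t _ m] t
    by (auto simp: adapted_step_def ugrid_simps measurable_adapted_def less_imp_le)
  let ?D = "\<lambda>j \<omega>. LINT s:{0..t}|lborel. (norm (simple_value (n j) (p j) (\<xi> j) s \<omega> - \<phi> s \<omega>))\<^sup>2"
  let ?E = "\<lambda>m \<omega>. LINT s:{0..t}|lborel. (norm (simple_value m (ugrid t m) (\<lambda>l. \<phi> (ugrid t m l)) s \<omega> - \<phi> s \<omega>))\<^sup>2"
  have joint: "(\<lambda>(s, \<omega>). \<phi> s \<omega>) \<in> borel_measurable (restrict_space borel {0..t} \<Otimes>\<^sub>M M)"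
    using \<phi> by (simp add: measurable_adapted_def)
  have D_m[measurable]: "?D j \<in> borel_measurable M" for j
    by (rule step_square_error_measurable[OF joint adapted_step_measurable[OF step t(2)]])
  have E_m[measurable]: "?E m \<in> borel_measurable M" for m
  proof (cases "m = 0")
    case False
    then show ?thesis
      using adapted_step_measurable[OF ustep t(2), of m] by (intro step_square_error_measurable[OF joint]) auto
  next
    case True
    then show ?thesis by (intro step_square_error_measurable[OF joint]) auto
  qed
  have D_nonneg: "0 \<le> ?D j \<omega>" for j \<omega>
    by (auto simp: set_lebesgue_integral_def intro!: integral_nonneg_AE)
  have "(\<lambda>j. prob {\<omega>\<in>space M. \<eta>/4 < ?D j \<omega>}) \<longlonglongrightarrow> 0"
    using lim1[unfolded tendsto_in_prob_def, rule_format, of "\<eta>/4"] \<eta>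
    unfolding dist_real_def diff_0_right abs_of_nonneg[OF D_nonneg] by simp
  then have ev1: "eventually (\<lambda>j. prob {\<omega>\<in>space M. \<eta>/4 < ?D j \<omega>} < \<gamma>/4) sequentially"
    by (rule order_tendstoD) (use \<gamma> in auto)
  have "(\<lambda>j. prob {\<omega>\<in>space M. \<epsilon>/2 < norm (simple_ito (W i) (n j) (p j) (\<xi> j) \<omega> - J \<omega>)}) \<longlonglongrightarrow> 0"
    using lim2[unfolded tendsto_in_prob_def, rule_format, of "\<epsilon>/2"] eps
    unfolding dist_norm by simp
  then have ev2: "eventually (\<lambda>j. prob {\<omega>\<in>space M. \<epsilon>/2 < norm (simple_ito (W i) (n j) (p j) (\<xi> j) \<omega> - J \<omega>)} < \<gamma>/4) sequentially"
    by (rule order_tendstoD) (use \<gamma> in auto)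
  obtain j where j: "prob {\<omega>\<in>space M. \<eta>/4 < ?D j \<omega>} < \<gamma>/4"
    "prob {\<omega>\<in>space M. \<epsilon>/2 < norm (simple_ito (W i) (n j) (p j) (\<xi> j) \<omega> - J \<omega>)} < \<gamma>/4"
    using eventually_happens[OF eventually_conj[OF ev1 ev2]] by auto
  have "(\<lambda>m. prob {\<omega>\<in>space M. \<eta>/4 < ?E m \<omega>}) \<longlonglongrightarrow> 0"
  proof (rule AE_tendsto_zero_in_prob[OF E_m])
    show "AE \<omega> in M. (\<lambda>m. ?E m \<omega>) \<longlonglongrightarrow> 0"
      using cont by eventually_elim (rule step_square_error_tendsto[OF t(1)])
  qed (use \<eta> in simp)
  then have "eventually (\<lambda>m. prob {\<omega>\<in>space M. \<eta>/4 < ?E m \<omega>} < \<gamma>/4) sequentially"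
    by (rule order_tendstoD) (use \<gamma> in auto)
  then obtain m0 where m0: "\<And>m. m0 \<le> m \<Longrightarrow> prob {\<omega>\<in>space M. \<eta>/4 < ?E m \<omega>} < \<gamma>/4"
    unfolding eventually_sequentially by auto
  show "\<exists>m0. \<forall>m\<ge>m0. norm (prob {\<omega>\<in>space M. \<epsilon> < norm (simple_ito (W i) m (ugrid t m) (\<lambda>l. \<phi> (ugrid t m l)) \<omega> - J \<omega>)} - 0) < \<gamma>"
  proof (intro exI[of _ "Suc m0"] allI impI)
    fix m assume "Suc m0 \<le> m"
    then have m: "0 < m" "m0 \<le> m" by auto
    note us = ustep[OF m(1)]
    let ?R = "simple_ito (W i) m (ugrid t m) (\<lambda>l. \<phi> (ugrid t m l))"
    let ?S = "simple_ito (W i) (n j) (p j) (\<xi> j)"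
    let ?V = "\<lambda>s. simple_value m (ugrid t m) (\<lambda>l. \<phi> (ugrid t m l)) s"
    let ?U = "\<lambda>s. simple_value (n j) (p j) (\<xi> j) s"
    note simple_ito_measurable[OF us t(2), measurable] simple_ito_measurable[OF step t(2), measurable]
    have "prob {\<omega>\<in>space M. \<epsilon> < norm (?R \<omega> - J \<omega>)}
      \<le> prob ({\<omega>\<in>space M. \<epsilon>/2 < norm (?R \<omega> - ?S \<omega>)} \<union> {\<omega>\<in>space M. \<epsilon>/2 < norm (?S \<omega> - J \<omega>)})"
    proof (rule finite_measure_mono)
      show "{\<omega>\<in>space M. \<epsilon> < norm (?R \<omega> - J \<omega>)}
        \<subseteq> {\<omega>\<in>space M. \<epsilon>/2 < norm (?R \<omega> - ?S \<omega>)} \<union> {\<omega>\<in>space M. \<epsilon>/2 < norm (?S \<omega> - J \<omega>)}"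
      proof
        fix \<omega> assume w: "\<omega> \<in> {\<omega>\<in>space M. \<epsilon> < norm (?R \<omega> - J \<omega>)}"
        have "norm (?R \<omega> - J \<omega>) \<le> norm (?R \<omega> - ?S \<omega>) + norm (?S \<omega> - J \<omega>)"
          using norm_triangle_ineq[of "?R \<omega> - ?S \<omega>" "?S \<omega> - J \<omega>"] by simp
        then show "\<omega> \<in> {\<omega>\<in>space M. \<epsilon>/2 < norm (?R \<omega> - ?S \<omega>)} \<union> {\<omega>\<in>space M. \<epsilon>/2 < norm (?S \<omega> - J \<omega>)}"
          using w by (simp, linarith)
      qed
    qed measurable
    also have "\<dots> \<le> prob {\<omega>\<in>space M. \<epsilon>/2 < norm (?R \<omega> - ?S \<omega>)} + prob {\<omega>\<in>space M. \<epsilon>/2 < norm (?S \<omega> - J \<omega>)}"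
      by (rule measure_Un_le) measurable
    also have "prob {\<omega>\<in>space M. \<epsilon>/2 < norm (?R \<omega> - ?S \<omega>)}
      \<le> \<eta> / (\<epsilon>/2)\<^sup>2 + prob {\<omega>\<in>space M. \<eta> < (LINT s:{0..t}|lborel. (norm (?V s \<omega> - ?U s \<omega>))\<^sup>2)}"
      by (rule step_ito_close[OF us step t]) (use eps \<eta> in auto)
    also have "prob {\<omega>\<in>space M. \<eta> < (LINT s:{0..t}|lborel. (norm (?V s \<omega> - ?U s \<omega>))\<^sup>2)}
      \<le> prob ({\<omega>\<in>space M. \<eta>/4 < ?E m \<omega>} \<union> {\<omega>\<in>space M. \<eta>/4 < ?D j \<omega>})"
    proof (rule finite_measure_mono_AE)
      show "AE \<omega> in M. \<omega> \<in> {\<omega>\<in>space M. \<eta> < (LINT s:{0..t}|lborel. (norm (?V s \<omega> - ?U s \<omega>))\<^sup>2)} \<longrightarrow>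
        \<omega> \<in> {\<omega>\<in>space M. \<eta>/4 < ?E m \<omega>} \<union> {\<omega>\<in>space M. \<eta>/4 < ?D j \<omega>}"
        using cont
      proof eventually_elim
        case (elim \<omega>)
        obtain C where C: "\<And>s. 0 \<le> s \<Longrightarrow> s \<le> t \<Longrightarrow> norm (\<phi> s \<omega>) \<le> C"
          using continuous_bounded[OF elim] by metis
        note int = step_square_integrable(1)[OF borel_measurable_continuous_on_restrict[OF elim] C]
        have int3: "set_integrable lborel {0..t} (\<lambda>s. (norm (?V s \<omega> - ?U s \<omega>))\<^sup>2)"
          by (rule step_square_integrable(1)[OF simple_value_measurable_time simple_value_bounded])
        have "(LINT s:{0..t}|lborel. (norm (?V s \<omega> - ?U s \<omega>))\<^sup>2)
          \<le> (LINT s:{0..t}|lborel. 2 * (norm (?V s \<omega> - \<phi> s \<omega>))\<^sup>2 + 2 * (norm (?U s \<omega> - \<phi> s \<omega>))\<^sup>2)"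
        proof (rule set_integral_mono[OF int3])
          show "set_integrable lborel {0..t} (\<lambda>s. 2 * (norm (?V s \<omega> - \<phi> s \<omega>))\<^sup>2 + 2 * (norm (?U s \<omega> - \<phi> s \<omega>))\<^sup>2)"
            by (intro set_integral_add set_integrable_mult_right int)
          show "(norm (?V s \<omega> - ?U s \<omega>))\<^sup>2 \<le> 2 * (norm (?V s \<omega> - \<phi> s \<omega>))\<^sup>2 + 2 * (norm (?U s \<omega> - \<phi> s \<omega>))\<^sup>2" for s
            using norm_diff_square_le[of "?V s \<omega> - \<phi> s \<omega>" "?U s \<omega> - \<phi> s \<omega>"] by simp
        qed
        also have "\<dots> = 2 * ?E m \<omega> + 2 * ?D j \<omega>"
          by (subst set_integral_add(2)) (auto intro!: int)
        finally show ?case by (auto simp: not_less)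
      qed
    qed measurable
    also have "\<dots> \<le> prob {\<omega>\<in>space M. \<eta>/4 < ?E m \<omega>} + prob {\<omega>\<in>space M. \<eta>/4 < ?D j \<omega>}"
      by (rule measure_Un_le) measurable
    finally have "prob {\<omega>\<in>space M. \<epsilon> < norm (?R \<omega> - J \<omega>)} < \<gamma>"
      using j m0[OF m(2)] \<eta>(2) by linarith
    then show "norm (prob {\<omega>\<in>space M. \<epsilon> < norm (?R \<omega> - J \<omega>)} - 0) < \<gamma>" by simp
  qed
qed

end


section \<open>Riemann sums of the solution\<close>

lemma squeeze_to_zero:
  fixes f g :: "nat \<Rightarrow> real"
  assumes "g \<longlonglongrightarrow> 0" "\<And>n. f n \<le> g n" "\<And>n. 0 \<le> f n"
  shows "f \<longlonglongrightarrow> 0"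
  by (rule tendsto_sandwich[OF _ _ tendsto_const assms(1)]) (use assms in auto)

lemma filterlim_times_right: "0 < (k::nat) \<Longrightarrow> filterlim (\<lambda>R. k * R) sequentially sequentially"
  by (rule filterlim_subseq) (auto simp: strict_mono_def)

context prob_space
begin

lemma prob_exists_sum_bound:
  fixes X :: "'i \<Rightarrow> nat \<Rightarrow> 'a \<Rightarrow> 'b::euclidean_space"
  assumes I: "finite I" "I \<noteq> {}" and X: "\<And>i k. i \<in> I \<Longrightarrow> k \<le> n \<Longrightarrow> X i k \<in> borel_measurable M"
  shows "prob {\<omega>\<in>space M. \<exists>k\<le>n. \<epsilon> < norm (\<Sum>i\<in>I. X i k \<omega>)}
    \<le> (\<Sum>i\<in>I. prob {\<omega>\<in>space M. \<exists>k\<le>n. \<epsilon> / real (card I) < norm (X i k \<omega>)})"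
proof -
  have ev: "{\<omega>\<in>space M. \<exists>k\<le>n. c < norm (X i k \<omega>)} \<in> events" if i: "i \<in> I" for i c
  proof -
    have "{\<omega>\<in>space M. c < norm (X i k \<omega>)} \<in> events" if "k \<le> n" for k
    proof -
      note X[OF i that, measurable]
      show ?thesis by measurable
    qed
    then have "(\<Union>k\<in>{..n}. {\<omega>\<in>space M. c < norm (X i k \<omega>)}) \<in> events"
      by (intro sets.finite_UN) auto
    also have "(\<Union>k\<in>{..n}. {\<omega>\<in>space M. c < norm (X i k \<omega>)}) = {\<omega>\<in>space M. \<exists>k\<le>n. c < norm (X i k \<omega>)}"
      by auto
    finally show ?thesis .
  qed
  have "prob {\<omega>\<in>space M. \<exists>k\<le>n. \<epsilon> < norm (\<Sum>i\<in>I. X i k \<omega>)}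
    \<le> prob (\<Union>i\<in>I. {\<omega>\<in>space M. \<exists>k\<le>n. \<epsilon> / real (card I) < norm (X i k \<omega>)})"
  proof (rule finite_measure_mono)
    show "{\<omega>\<in>space M. \<exists>k\<le>n. \<epsilon> < norm (\<Sum>i\<in>I. X i k \<omega>)}
      \<subseteq> (\<Union>i\<in>I. {\<omega>\<in>space M. \<exists>k\<le>n. \<epsilon> / real (card I) < norm (X i k \<omega>)})"
    proof
      fix \<omega> assume "\<omega> \<in> {\<omega>\<in>space M. \<exists>k\<le>n. \<epsilon> < norm (\<Sum>i\<in>I. X i k \<omega>)}"
      then obtain k where k: "\<omega> \<in> space M" "k \<le> n" "\<epsilon> < norm (\<Sum>i\<in>I. X i k \<omega>)" by auto
      have "\<exists>i\<in>I. \<epsilon> / real (card I) < norm (X i k \<omega>)"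
      proof (rule ccontr)
        assume "\<not> ?thesis"
        then have "norm (X i k \<omega>) \<le> \<epsilon> / real (card I)" if "i \<in> I" for i using that by force
        then have "(\<Sum>i\<in>I. norm (X i k \<omega>)) \<le> real (card I) * (\<epsilon> / real (card I))"
          by (rule sum_bounded_above)
        moreover have "norm (\<Sum>i\<in>I. X i k \<omega>) \<le> (\<Sum>i\<in>I. norm (X i k \<omega>))" by (rule norm_sum)
        moreover have "real (card I) * (\<epsilon> / real (card I)) = \<epsilon>" using I by simp
        ultimately show False using k(3) by linarith
      qed
      then show "\<omega> \<in> (\<Union>i\<in>I. {\<omega>\<in>space M. \<exists>k\<le>n. \<epsilon> / real (card I) < norm (X i k \<omega>)})"
        using k(1,2) by (simp, blast)
    qed
    show "(\<Union>i\<in>I. {\<omega>\<in>space M. \<exists>k\<le>n. \<epsilon> / real (card I) < norm (X i k \<omega>)}) \<in> events"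
      by (rule sets.finite_UN[OF I(1) ev])
  qed
  also have "\<dots> \<le> (\<Sum>i\<in>I. prob {\<omega>\<in>space M. \<exists>k\<le>n. \<epsilon> / real (card I) < norm (X i k \<omega>)})"
    by (rule finite_measure_subadditive_finite[OF I(1)]) (rule image_subsetI[OF ev])
  finally show ?thesis .
qed

end

context brownian_noise
begin

lemma maximal_inequality_tendsto:
  fixes \<theta> :: "nat \<Rightarrow> nat \<Rightarrow> 'a \<Rightarrow> 'b::euclidean_space"
  assumes r: "\<And>K. 0 \<le> r K 0" "\<And>K k. k < m K \<Longrightarrow> r K k < r K (Suc k)" "\<And>K. r K (m K) \<le> T"
    and \<theta>: "\<And>K k. k < m K \<Longrightarrow> \<theta> K k \<in> borel_measurable (Fil (r K k))"
    and energy: "AE \<omega> in M. (\<lambda>K. disc_energy (r K) (\<theta> K) (m K) \<omega>) \<longlonglongrightarrow> 0"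
    and eps: "0 < \<epsilon>"
  shows "(\<lambda>K. prob {\<omega>\<in>space M. \<exists>k\<le>m K. \<epsilon> < norm (disc_ito i (r K) (\<theta> K) k \<omega>)}) \<longlonglongrightarrow> 0"
proof (rule LIMSEQ_I)
  fix \<gamma> :: real assume \<gamma>: "0 < \<gamma>"
  define \<eta> where "\<eta> = \<gamma> * \<epsilon>\<^sup>2 / 2"
  have \<eta>: "0 < \<eta>" "\<eta> / \<epsilon>\<^sup>2 = \<gamma> / 2" using \<gamma> eps by (auto simp: \<eta>_def)
  have rT: "0 \<le> r K (m K)" for K using grid_mono[of "m K" "r K" 0 "m K", OF r(2)] r(1)[of K] by auto
  have "disc_energy (r K) (\<theta> K) (m K) \<in> borel_measurable M" for K
    by (rule measurable_Fil_M[OF disc_adapted(3)[where j="m K" and m="m K"]]) (use r \<theta> rT in auto)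
  then have "(\<lambda>K. prob {\<omega>\<in>space M. \<eta> < disc_energy (r K) (\<theta> K) (m K) \<omega>}) \<longlonglongrightarrow> 0"
    by (rule AE_tendsto_zero_in_prob[OF _ energy \<eta>(1)])
  then have "eventually (\<lambda>K. prob {\<omega>\<in>space M. \<eta> < disc_energy (r K) (\<theta> K) (m K) \<omega>} < \<gamma> / 2) sequentially"
    by (rule order_tendstoD) (use \<gamma> in auto)
  then obtain K0 where K0: "\<And>K. K0 \<le> K \<Longrightarrow> prob {\<omega>\<in>space M. \<eta> < disc_energy (r K) (\<theta> K) (m K) \<omega>} < \<gamma> / 2"
    unfolding eventually_sequentially by auto
  show "\<exists>K0. \<forall>K\<ge>K0. norm (prob {\<omega>\<in>space M. \<exists>k\<le>m K. \<epsilon> < norm (disc_ito i (r K) (\<theta> K) k \<omega>)} - 0) < \<gamma>"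
  proof (intro exI[of _ K0] allI impI)
    fix K assume K: "K0 \<le> K"
    have "prob {\<omega>\<in>space M. \<exists>k\<le>m K. \<epsilon> < norm (disc_ito i (r K) (\<theta> K) k \<omega>)}
      \<le> \<eta> / \<epsilon>\<^sup>2 + prob {\<omega>\<in>space M. \<eta> < disc_energy (r K) (\<theta> K) (m K) \<omega>}"
      by (rule maximal_inequality) (use r \<theta> eps \<eta> in auto)
    then have "prob {\<omega>\<in>space M. \<exists>k\<le>m K. \<epsilon> < norm (disc_ito i (r K) (\<theta> K) k \<omega>)} < \<gamma>"
      using K0[OF K] \<eta>(2) by linarith
    then show "norm (prob {\<omega>\<in>space M. \<exists>k\<le>m K. \<epsilon> < norm (disc_ito i (r K) (\<theta> K) k \<omega>)} - 0) < \<gamma>" by simp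
  qed
qed

text \<open>All grid points of a partition of \<open>{0..0}\<close> coincide, so every elementary integral vanishes.\<close>

lemma ito_integral_at_0:
  fixes \<phi> :: "real \<Rightarrow> 'a \<Rightarrow> 'b::euclidean_space"
  assumes "has_ito_integral M Fil (W i) 0 \<phi> J"
  shows "AE \<omega> in M. J \<omega> = 0"
proof -
  from assms obtain n p \<xi> where J[measurable]: "J \<in> borel_measurable M"
    and simple: "\<And>j. simple_process Fil 0 (n j) (p j) (\<xi> j)"
    and lim: "tendsto_in_prob M (\<lambda>j. simple_ito (W i) (n j) (p j) (\<xi> j)) J"
    unfolding has_ito_integral_def by blast
  have "simple_ito (W i) (n j) (p j) (\<xi> j) \<omega> = 0" for j \<omega>
  proof -
    have step: "adapted_step 0 (n j) (p j) (\<xi> j)"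
      using simple[of j] by (simp add: simple_process_def adapted_step_def)
    have "p j k = 0" if "k \<le> n j" for k
      using adapted_step_bounds[OF step that] by simp
    then show ?thesis by (simp add: simple_ito_def)
  qed
  then have "(\<lambda>j::nat. prob {\<omega>\<in>space M. e < norm (J \<omega>)}) \<longlonglongrightarrow> 0" if "0 < e" for e
    using lim[unfolded tendsto_in_prob_def, rule_format, OF that] by simp
  then have z: "prob {\<omega>\<in>space M. e < norm (J \<omega>)} = 0" if "0 < e" for e
    using that LIMSEQ_const_iff by blast
  have "AE \<omega> in M. \<forall>k::nat. \<not> inverse (real (Suc k)) < norm (J \<omega>)"
    unfolding AE_all_countable
  proof
    fix k :: nat
    have "{\<omega>\<in>space M. inverse (real (Suc k)) < norm (J \<omega>)} \<in> null_sets M"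
      using z[of "inverse (real (Suc k))"] by (intro null_setsI) (auto simp: emeasure_eq_measure)
    then show "AE \<omega> in M. \<not> inverse (real (Suc k)) < norm (J \<omega>)"
      by (rule AE_I') auto
  qed
  then show ?thesis
  proof eventually_elim
    case (elim \<omega>)
    show ?case
    proof (rule ccontr)
      assume "J \<omega> \<noteq> 0"
      then have "0 < norm (J \<omega>)" by simp
      then obtain k where "inverse (real (Suc k)) < norm (J \<omega>)" using reals_Archimedean by blast
      then show False using elim by blast
    qed
  qed
qed

end

text \<open>The coefficients are general here; the splitting into linear and nonlinear parts matters only for the exponential scheme.\<close>

locale lipschitz_sde = brownian_noise M Fil T W
  for M :: "'a measure" and Fil T and W :: "'m::finite \<Rightarrow> real \<Rightarrow> 'a \<Rightarrow> real" +
  fixes a :: "real^'d \<Rightarrow> real^'d" and b :: "'m \<Rightarrow> real^'d \<Rightarrow> real^('d::finite)"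
    and u0 :: "real^'d" and u :: "real \<Rightarrow> 'a \<Rightarrow> real^'d" and \<Lambda> :: real
  assumes a_lipschitz: "norm (a x - a y) \<le> \<Lambda> * norm (x - y)"
    and b_lipschitz: "norm (b i x - b i y) \<le> \<Lambda> * norm (x - y)"
    and solution: "sde_solution M Fil T W a b u0 u"
begin

lemma Lambda_nonneg: "0 \<le> \<Lambda>"
proof -
  obtain x :: "real^'d" where x: "x \<in> Basis" using nonempty_Basis by blast
  have "0 \<le> \<Lambda> * norm (x - 0)" using a_lipschitz[of x 0] norm_ge_zero order_trans by blast
  then show ?thesis using x by simp
qed

lemma a_continuous: "continuous_on S a"
proof (rule continuous_on_subset[OF lipschitz_on_continuous_on])
  show "\<Lambda>-lipschitz_on UNIV a" by (rule lipschitz_onI) (auto simp: dist_norm a_lipschitz Lambda_nonneg)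
qed simp

lemma b_continuous: "continuous_on S (b i)"
proof (rule continuous_on_subset[OF lipschitz_on_continuous_on])
  show "\<Lambda>-lipschitz_on UNIV (b i)" by (rule lipschitz_onI) (auto simp: dist_norm b_lipschitz Lambda_nonneg)
qed simp

lemma a_measurable[measurable]: "a \<in> borel_measurable borel"
  and b_measurable[measurable]: "b i \<in> borel_measurable borel"
  by (auto intro!: borel_measurable_continuous_onI a_continuous b_continuous)

lemma u_adapted:
  assumes "0 \<le> t" "t \<le> T" shows "u t \<in> borel_measurable (Fil t)"
  using solution assms unfolding sde_solution_def measurable_adapted_def by simp

lemma u_measurable:
  assumes "0 \<le> t" "t \<le> T" shows "u t \<in> borel_measurable M"
  by (rule measurable_Fil_M[OF u_adapted[OF assms] assms])

lemma u_continuous: "AE \<omega> in M. continuous_on {0..T} (\<lambda>t. u t \<omega>)"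
  using solution unfolding sde_solution_def by blast

lemma continuous_along_u:
  fixes f :: "real^'d \<Rightarrow> 'b::topological_space"
  assumes "continuous_on UNIV f" "continuous_on {0..T} (\<lambda>t. u t \<omega>)" "t \<le> T"
  shows "continuous_on {0..t} (\<lambda>s. f (u s \<omega>))"
  by (rule continuous_on_compose2[OF assms(1) continuous_on_subset[OF assms(2)]]) (use assms(3) in auto)

text \<open>The left Riemann sums of the integral equation of \<open>u\<close>. In contrast to the Euler--Maruyama scheme the coefficients are
  evaluated along the solution.\<close>

definition riemann :: "nat \<Rightarrow> nat \<Rightarrow> 'a \<Rightarrow> real^'d" where
  "riemann K k \<omega> = u0 + (\<Sum>l<k. (T / real K) *\<^sub>R a (u (ugrid T K l) \<omega>)) +
     (\<Sum>i\<in>UNIV. disc_ito i (ugrid T K) (\<lambda>l \<omega>. b i (u (ugrid T K l) \<omega>)) k \<omega>)"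

lemma ugrid_T_bounds: "l \<le> K \<Longrightarrow> 0 \<le> ugrid T K l" "l \<le> K \<Longrightarrow> ugrid T K l \<le> T"
  using ugrid_bounds[of T l K] T_pos by auto

lemma disc_ito_adapted_ugrid:
  fixes \<theta> :: "nat \<Rightarrow> 'a \<Rightarrow> real^'d"
  assumes "0 < K" "k \<le> K" "\<And>l. l < K \<Longrightarrow> \<theta> l \<in> borel_measurable (Fil (ugrid T K l))"
  shows "disc_ito i (ugrid T K) \<theta> k \<in> borel_measurable (Fil (ugrid T K k))"
  by (rule disc_adapted(1)[where m=K])
    (use assms ugrid_T_bounds ugrid_less[OF T_pos assms(1)] in auto)

lemma riemann_adapted:
  assumes "0 < K" "k \<le> K"
  shows "riemann K k \<in> borel_measurable (Fil (ugrid T K k))"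
proof -
  have u: "u (ugrid T K l) \<in> borel_measurable (Fil (ugrid T K l))" if "l < K" for l
    by (rule u_adapted) (use that ugrid_T_bounds in auto)
  have ak: "(\<lambda>\<omega>. a (u (ugrid T K l) \<omega>)) \<in> borel_measurable (Fil (ugrid T K k))" if l: "l < k" for l
  proof (rule measurable_Fil_mono)
    show "(\<lambda>\<omega>. a (u (ugrid T K l) \<omega>)) \<in> borel_measurable (Fil (ugrid T K l))"
      using u[of l] l assms by (intro measurable_compose[OF _ a_measurable]) auto
    show "ugrid T K l \<le> ugrid T K k"
      by (rule grid_mono[of K]) (use l assms ugrid_less[OF T_pos assms(1)] in auto)
  qed (use l assms ugrid_T_bounds in auto)
  show ?thesis
    unfolding riemann_def[abs_def]
    by (intro borel_measurable_add borel_measurable_sum borel_measurable_scaleR borel_measurable_const ak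
        disc_ito_adapted_ugrid measurable_compose[OF u b_measurable] assms) auto
qed

lemma riemann_measurable:
  assumes "k \<le> K" shows "riemann K k \<in> borel_measurable M"
proof (cases "K = 0")
  case True
  then show ?thesis using assms by (simp add: riemann_def[abs_def] disc_ito_def)
next
  case False
  show ?thesis
    by (rule measurable_Fil_M[OF riemann_adapted]) (use False assms ugrid_T_bounds in auto)
qed

lemma u_initial: "AE \<omega> in M. u 0 \<omega> = u0"
proof -
  from solution obtain J where J: "\<And>t. t \<in> {0..T} \<Longrightarrow>
        (\<forall>i. has_ito_integral M Fil (W i) t (\<lambda>s \<omega>. b i (u s \<omega>)) (J i t)) \<and>
        (AE \<omega> in M. u t \<omega> = u0 + (LINT s:{0..t}|lborel. a (u s \<omega>)) + (\<Sum>i\<in>UNIV. J i t \<omega>))"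
    unfolding sde_solution_def by blast
  have z: "(LINT s:{0..0}|lborel. f s) = 0" for f :: "real \<Rightarrow> real^'d"
    unfolding set_lebesgue_integral_def
  proof (rule integral_eq_zero_AE)
    show "AE s in lborel. indicat_real {0..0} s *\<^sub>R f s = 0"
      using AE_lborel_singleton[of 0] by eventually_elim simp
  qed
  have "has_ito_integral M Fil (W i) 0 (\<lambda>s \<omega>. b i (u s \<omega>)) (J i 0)" for i
    using J[of 0] T_pos by simp
  then have "AE \<omega> in M. J i 0 \<omega> = 0" for i by (rule ito_integral_at_0)
  then have "AE \<omega> in M. \<forall>i\<in>UNIV. J i 0 \<omega> = 0"
    by (intro AE_finite_allI) auto
  moreover have "AE \<omega> in M. u 0 \<omega> = u0 + (LINT s:{0..0}|lborel. a (u s \<omega>)) + (\<Sum>i\<in>UNIV. J i 0 \<omega>)"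
    using J[of 0] T_pos by auto
  ultimately show ?thesis by eventually_elim (simp add: z[simplified])
qed

text \<open>At a fixed time the integral equation is approached by its Riemann sums. The index type \<open>'m option\<close> collects the drift
  integral and the stochastic integrals.\<close>

lemma refined_riemann_tendsto:
  assumes k: "k \<le> K" "0 < K" and eps: "0 < \<epsilon>"
  shows "(\<lambda>R. prob {\<omega>\<in>space M. \<epsilon> < norm (riemann (K * R) (k * R) \<omega> - u (ugrid T K k) \<omega>)}) \<longlonglongrightarrow> 0"
proof (cases "k = 0")
  case True
  have "prob {\<omega>\<in>space M. \<epsilon> < norm (riemann (K * R) (k * R) \<omega> - u (ugrid T K k) \<omega>)} = prob {}" for R
  proof (rule measure_eq_AE)
    have "u 0 \<in> borel_measurable M" by (rule u_measurable) (use T_pos in auto)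
    note this[measurable]
    show "{\<omega>\<in>space M. \<epsilon> < norm (riemann (K * R) (k * R) \<omega> - u (ugrid T K k) \<omega>)} \<in> events"
      unfolding True by (simp add: riemann_def disc_ito_def ugrid_simps)
    show "AE \<omega> in M. (\<omega> \<in> {\<omega>\<in>space M. \<epsilon> < norm (riemann (K * R) (k * R) \<omega> - u (ugrid T K k) \<omega>)}) = (\<omega> \<in> {})"
      using u_initial by eventually_elim (use eps in \<open>simp add: True riemann_def disc_ito_def ugrid_simps\<close>)
  qed simp
  then show ?thesis by simp
next
  case False
  define t where "t = ugrid T K k"
  have t: "0 < t" "t \<le> T"
    using False k T_pos ugrid_T_bounds(2)[of k K] by (auto simp: t_def ugrid_def)
  have grid: "ugrid t (k * R) l = ugrid T (K * R) l" for R l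
    using False k by (simp add: t_def ugrid_def)
  have mesh: "T / real (K * R) = t / real (k * R)" for R
    using False k by (simp add: t_def ugrid_def)
  from solution obtain J where
    ito: "\<And>i. has_ito_integral M Fil (W i) t (\<lambda>s \<omega>. b i (u s \<omega>)) (J i t)" and
    eq: "AE \<omega> in M. u t \<omega> = u0 + (LINT s:{0..t}|lborel. a (u s \<omega>)) + (\<Sum>i\<in>UNIV. J i t \<omega>)"
    using t unfolding sde_solution_def by fastforce
  have Jm: "J i t \<in> borel_measurable M" for i
    using ito[of i] unfolding has_ito_integral_def by blast
  have um: "u t \<in> borel_measurable M" by (rule u_measurable) (use t in auto)
  define D where "D R \<omega> = (\<Sum>l<k * R. (t / real (k * R)) *\<^sub>R a (u (ugrid t (k * R) l) \<omega>)) - (u t \<omega> - u0 - (\<Sum>i\<in>UNIV. J i t \<omega>))" for R \<omega>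
  define S where "S i R \<omega> = simple_ito (W i) (k * R) (ugrid t (k * R)) (\<lambda>l \<omega>. b i (u (ugrid t (k * R) l) \<omega>)) \<omega> - J i t \<omega>" for i R \<omega>
  define X where "X j R = (case j of None \<Rightarrow> D R | Some i \<Rightarrow> S i R)" for j R
  have umR: "u (ugrid t (k * R) l) \<in> borel_measurable M" if "l \<le> k * R" for R l
  proof (rule u_measurable)
    show "0 \<le> ugrid t (k * R) l" "ugrid t (k * R) l \<le> T"
      using ugrid_bounds[of t l "k * R"] t that by auto
  qed
  have D_m: "D R \<in> borel_measurable M" for R
    unfolding D_def[abs_def]
    by (intro borel_measurable_diff borel_measurable_sum borel_measurable_scaleR borel_measurable_const
        measurable_compose[OF umR a_measurable] um Jm) auto
  have S_m: "S i R \<in> borel_measurable M" for i R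
  proof -
    have w: "W i (ugrid t (k * R) l) \<in> borel_measurable M" if "l \<le> k * R" for l
      by (rule W_measurable) (use ugrid_bounds[of t l "k * R"] t that in auto)
    show ?thesis
      unfolding S_def[abs_def] simple_ito_def
      by (intro borel_measurable_diff borel_measurable_sum borel_measurable_scaleR
          measurable_compose[OF umR b_measurable] w Jm) auto
  qed
  have X_m: "X j R \<in> borel_measurable M" for j R
    unfolding X_def using D_m S_m by (auto split: option.split)
  have dec: "riemann (K * R) (k * R) \<omega> - u t \<omega> = (\<Sum>j\<in>UNIV. X j R \<omega>)" for R \<omega>
  proof -
    have g: "ugrid T (K * R) = ugrid t (k * R)" by (rule ext) (simp add: grid)
    have "(\<Sum>j\<in>UNIV. X j R \<omega>) = D R \<omega> + (\<Sum>i\<in>UNIV. S i R \<omega>)"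
      by (simp add: UNIV_option_conv sum.reindex X_def)
    moreover have "riemann (K * R) (k * R) \<omega> = u0 + (\<Sum>l<k * R. (t / real (k * R)) *\<^sub>R a (u (ugrid t (k * R) l) \<omega>))
       + (\<Sum>i\<in>UNIV. simple_ito (W i) (k * R) (ugrid t (k * R)) (\<lambda>l \<omega>. b i (u (ugrid t (k * R) l) \<omega>)) \<omega>)"
      by (simp only: riemann_def g mesh disc_ito_def simple_ito_def)
    ultimately show ?thesis by (simp add: D_def S_def sum_subtractf)
  qed
  define \<delta> where "\<delta> = \<epsilon> / real (card (UNIV :: 'm option set))"
  have \<delta>: "0 < \<delta>" using eps by (simp add: \<delta>_def card_gt_0_iff del: card_UNIV_option)
  have D_lim: "(\<lambda>R. prob {\<omega>\<in>space M. \<delta> < norm (D R \<omega>)}) \<longlonglongrightarrow> 0"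
  proof (rule AE_tendsto_zero_in_prob)
    show "AE \<omega> in M. (\<lambda>R. norm (D R \<omega>)) \<longlonglongrightarrow> 0"
      using eq u_continuous
    proof eventually_elim
      case (elim \<omega>)
      have "(\<lambda>m. \<Sum>l<m. (t / real m) *\<^sub>R a (u (ugrid t m l) \<omega>)) \<longlonglongrightarrow> (LINT s:{0..t}|lborel. a (u s \<omega>))"
        by (rule riemann_sum_tendsto[OF t(1)]) (rule continuous_along_u[OF a_continuous elim(2) t(2)])
      then have "(\<lambda>R. \<Sum>l<k * R. (t / real (k * R)) *\<^sub>R a (u (ugrid t (k * R) l) \<omega>)) \<longlonglongrightarrow> (LINT s:{0..t}|lborel. a (u s \<omega>))"
        by (rule filterlim_compose[OF _ filterlim_times_right]) (use False in simp)
      then have "(\<lambda>R. D R \<omega>) \<longlonglongrightarrow> (LINT s:{0..t}|lborel. a (u s \<omega>)) - (u t \<omega> - u0 - (\<Sum>i\<in>UNIV. J i t \<omega>))"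
        unfolding D_def by (intro tendsto_diff tendsto_const)
      moreover have "(LINT s:{0..t}|lborel. a (u s \<omega>)) - (u t \<omega> - u0 - (\<Sum>i\<in>UNIV. J i t \<omega>)) = 0"
        using elim(1) by simp
      ultimately show ?case by (simp add: tendsto_norm_zero_iff)
    qed
  qed (use D_m \<delta> in auto)
  have S_lim: "(\<lambda>R. prob {\<omega>\<in>space M. \<delta> < norm (S i R \<omega>)}) \<longlonglongrightarrow> 0" for i
    unfolding S_def
  proof (rule filterlim_compose[where f="\<lambda>R. k * R" and g="\<lambda>m. prob {\<omega>\<in>space M. \<delta> < norm (simple_ito (W i) m (ugrid t m) (\<lambda>l \<omega>. b i (u (ugrid t m l) \<omega>)) \<omega> - J i t \<omega>)}"])
    have "AE \<omega> in M. continuous_on {0..t} (\<lambda>s. b i (u s \<omega>))"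
      using u_continuous by eventually_elim (rule continuous_along_u[OF b_continuous _ t(2)])
    then show "(\<lambda>m. prob {\<omega>\<in>space M. \<delta> < norm (simple_ito (W i) m (ugrid t m) (\<lambda>l \<omega>. b i (u (ugrid t m l) \<omega>)) \<omega> - J i t \<omega>)}) \<longlonglongrightarrow> 0"
      by (rule ito_integral_riemann[OF ito _ t \<delta>])
  qed (rule filterlim_times_right, use False in simp)
  have X_lim: "(\<lambda>R. prob {\<omega>\<in>space M. \<delta> < norm (X j R \<omega>)}) \<longlonglongrightarrow> 0" for j
    using D_lim S_lim by (cases j) (auto simp: X_def)
  have upper: "prob {\<omega>\<in>space M. \<epsilon> < norm (riemann (K * R) (k * R) \<omega> - u t \<omega>)} \<le> (\<Sum>j\<in>UNIV. prob {\<omega>\<in>space M. \<delta> < norm (X j R \<omega>)})" for R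
    unfolding dec \<delta>_def
    using prob_exists_sum_bound[of "UNIV :: 'm option set" 0 "\<lambda>j k. X j R" \<epsilon>, OF _ _ X_m] by simp
  have "(\<lambda>R. \<Sum>j\<in>UNIV. prob {\<omega>\<in>space M. \<delta> < norm (X j R \<omega>)}) \<longlonglongrightarrow> (\<Sum>j\<in>(UNIV :: 'm option set). 0)"
    by (intro tendsto_sum X_lim)
  then have "(\<lambda>R. \<Sum>j\<in>UNIV. prob {\<omega>\<in>space M. \<delta> < norm (X j R \<omega>)}) \<longlonglongrightarrow> 0" by simp
  then show ?thesis
    unfolding t_def[symmetric]
    by (rule squeeze_to_zero[OF _ upper measure_nonneg])
qed

lemma block_div: "l \<in> {j * R ..< j * R + R} \<Longrightarrow> l div R = (j::nat)"
  by (auto intro!: div_nat_eqI simp: mult.commute)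

lemma mesh_sum: "0 < n \<Longrightarrow> (\<Sum>l<n. (T / real n) * c) = T * c"
  by simp

lemma ugrid_refine: "0 < R \<Longrightarrow> ugrid T (K * R) (j * R) = ugrid T K j"
  by (simp add: ugrid_def)

lemma ugrid_block_close:
  assumes "0 < R" "0 < K"
  shows "\<bar>ugrid T K (l div R) - ugrid T (K * R) l\<bar> \<le> T / real K"
proof -
  have "ugrid T K (l div R) = ugrid T (K * R) (l div R * R)" by (rule ugrid_refine[OF assms(1), symmetric])
  moreover have "real l = real (l div R * R) + real (l mod R)"
    by (metis div_mult_mod_eq of_nat_add)
  ultimately have e: "ugrid T (K * R) l - ugrid T K (l div R) = real (l mod R) * T / real (K * R)"
    by (simp add: ugrid_def add_divide_distrib distrib_right)
  have "real (l mod R) * T / real (K * R) \<le> real R * T / real (K * R)"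
    using assms T_pos by (intro divide_right_mono mult_right_mono) (auto intro: less_imp_le)
  also have "real R * T / real (K * R) = T / real K" using assms by simp
  finally have le: "real (l mod R) * T / real (K * R) \<le> T / real K" .
  have "0 \<le> real (l mod R) * T / real (K * R)" using T_pos by simp
  then show ?thesis using e le by (simp only: abs_minus_commute[of "ugrid T K (l div R)"] e abs_of_nonneg)
qed

lemma u_oscillation:
  fixes f :: "real^'d \<Rightarrow> 'b::real_normed_vector"
  assumes f: "continuous_on UNIV f" and c: "continuous_on {0..T} (\<lambda>t. u t \<omega>)" and e: "0 < e"
  obtains K0 where "0 < K0" "\<And>K R l. K0 \<le> K \<Longrightarrow> 0 < R \<Longrightarrow> l < K * R \<Longrightarrow>
    norm (f (u (ugrid T K (l div R)) \<omega>) - f (u (ugrid T (K * R) l) \<omega>)) \<le> e"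
proof -
  have "uniformly_continuous_on {0..T} (\<lambda>s. f (u s \<omega>))"
    by (intro compact_uniformly_continuous continuous_along_u[OF f c]) auto
  then obtain d where d: "d > 0"
    "\<And>x y. x \<in> {0..T} \<Longrightarrow> y \<in> {0..T} \<Longrightarrow> dist x y < d \<Longrightarrow> dist (f (u x \<omega>)) (f (u y \<omega>)) < e"
    using e unfolding uniformly_continuous_on_def by (metis dist_commute)
  obtain K0 where K0: "T / d < real K0" using reals_Archimedean2 by blast
  have "0 < T / d" using T_pos d by simp
  then have K0_pos: "0 < K0" using K0 by (cases K0) auto
  show ?thesis
  proof (rule that[OF K0_pos])
    fix K R l assume K: "K0 \<le> K" and R: "0 < R" and l: "l < K * R"
    have "T / real K \<le> T / real K0" using K K0_pos T_pos by (intro divide_left_mono) auto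
    also have "\<dots> < d" using K0 d K0_pos by (simp add: field_simps)
    finally have "dist (ugrid T K (l div R)) (ugrid T (K * R) l) < d"
      using ugrid_block_close[OF R, of K l] K K0_pos by (simp add: dist_real_def)
    moreover have "l div R \<le> K" using l R by (simp add: less_mult_imp_div_less less_imp_le)
    then have "ugrid T K (l div R) \<in> {0..T}" using ugrid_T_bounds[of "l div R" K] by simp
    moreover have "ugrid T (K * R) l \<in> {0..T}" using ugrid_T_bounds[of l "K * R"] l by simp
    ultimately have "dist (f (u (ugrid T K (l div R)) \<omega>)) (f (u (ugrid T (K * R) l) \<omega>)) < e"
      by (intro d(2))
    then show "norm (f (u (ugrid T K (l div R)) \<omega>) - f (u (ugrid T (K * R) l) \<omega>)) \<le> e"
      by (simp add: dist_norm)
  qed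
qed

lemma disc_ito_refine:
  assumes "0 < R"
  shows "disc_ito i (ugrid T K) \<theta> k \<omega> = disc_ito i (ugrid T (K * R)) (\<lambda>l. \<theta> (l div R)) (k * R) \<omega>"
proof -
  let ?g = "ugrid T (K * R)"
  have "(\<Sum>l = j * R..<j * R + R. (W i (?g (Suc l)) \<omega> - W i (?g l) \<omega>) *\<^sub>R \<theta> (l div R) \<omega>)
    = (W i (ugrid T K (Suc j)) \<omega> - W i (ugrid T K j) \<omega>) *\<^sub>R \<theta> j \<omega>" for j
  proof -
    have "(\<Sum>l = j * R..<j * R + R. (W i (?g (Suc l)) \<omega> - W i (?g l) \<omega>) *\<^sub>R \<theta> (l div R) \<omega>)
      = (\<Sum>l = j * R..<j * R + R. (W i (?g (Suc l)) \<omega> - W i (?g l) \<omega>)) *\<^sub>R \<theta> j \<omega>"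
      unfolding scaleR_sum_left by (intro sum.cong) (auto simp: block_div)
    also have "(\<Sum>l = j * R..<j * R + R. (W i (?g (Suc l)) \<omega> - W i (?g l) \<omega>))
      = W i (?g (j * R + R)) \<omega> - W i (?g (j * R)) \<omega>"
      by (rule sum_Suc_diff') simp
    also have "?g (j * R + R) = ugrid T K (Suc j)"
      using ugrid_refine[OF assms, of K "Suc j"] by (simp add: add.commute)
    also have "?g (j * R) = ugrid T K j" by (rule ugrid_refine[OF assms])
    finally show ?thesis .
  qed
  then show ?thesis
    unfolding disc_ito_def sum.nat_group[symmetric] by simp
qed

lemma drift_sum_refine:
  fixes f :: "nat \<Rightarrow> 'b::real_vector"
  assumes "0 < R"
  shows "(\<Sum>l<k. (T / real K) *\<^sub>R f l) = (\<Sum>l<k * R. (T / real (K * R)) *\<^sub>R f (l div R))"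
proof -
  have "(\<Sum>l = j * R..<j * R + R. (T / real (K * R)) *\<^sub>R f (l div R)) = (T / real K) *\<^sub>R f j" for j
  proof -
    have "(\<Sum>l = j * R..<j * R + R. (T / real (K * R)) *\<^sub>R f (l div R))
      = (\<Sum>l = j * R..<j * R + R. (T / real (K * R)) *\<^sub>R f j)"
      by (intro sum.cong) (auto simp: block_div)
    also have "\<dots> = (T / real K) *\<^sub>R f j"
      using assms by (simp add: sum_constant_scaleR)
    finally show ?thesis .
  qed
  then show ?thesis
    unfolding sum.nat_group[symmetric] by simp
qed

text \<open>The coarse Riemann sums are rewritten as sums over the fine grid, where the integrands differ only by the oscillation of
  continuous paths over one coarse step. The function \<open>R\<close> is arbitrary, so the fine grid may be chosen as fine as needed.\<close>

lemma riemann_refinement_tendsto: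
  assumes R: "\<And>K. 0 < R K" and eps: "0 < \<epsilon>"
  shows "(\<lambda>K. prob {\<omega>\<in>space M. \<exists>k\<le>Suc K. \<epsilon> < norm (riemann (Suc K) k \<omega> - riemann (Suc K * R K) (k * R K) \<omega>)}) \<longlonglongrightarrow> 0"
proof -
  let ?m = "\<lambda>K. Suc K * R K"
  let ?r = "\<lambda>K. ugrid T (Suc K * R K)"
  have m: "0 < ?m K" for K using R[of K] by simp
  define \<theta> where "\<theta> i K l \<omega> = b i (u (ugrid T (Suc K) (l div R K)) \<omega>) - b i (u (?r K l) \<omega>)" for i K l \<omega>
  define \<alpha> where "\<alpha> K l \<omega> = (T / real (?m K)) *\<^sub>R (a (u (ugrid T (Suc K) (l div R K)) \<omega>) - a (u (?r K l) \<omega>))" for K l \<omega>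
  define X where "X K j k \<omega> = (case j of None \<Rightarrow> \<Sum>l<k * R K. \<alpha> K l \<omega> | Some i \<Rightarrow> disc_ito i (?r K) (\<theta> i K) (k * R K) \<omega>)" for K j k \<omega>
  have dec: "riemann (Suc K) k \<omega> - riemann (?m K) (k * R K) \<omega> = (\<Sum>j\<in>UNIV. X K j k \<omega>)" for K k \<omega>
  proof -
    have 1: "(\<Sum>l<k * R K. \<alpha> K l \<omega>) = (\<Sum>l<k. (T / real (Suc K)) *\<^sub>R a (u (ugrid T (Suc K) l) \<omega>))
        - (\<Sum>l<k * R K. (T / real (?m K)) *\<^sub>R a (u (?r K l) \<omega>))"
      unfolding drift_sum_refine[OF R[of K], where K="Suc K" and k=k and f="\<lambda>l. a (u (ugrid T (Suc K) l) \<omega>)"] \<alpha>_def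
      by (simp only: scaleR_diff_right sum_subtractf)
    have 2: "disc_ito i (?r K) (\<theta> i K) (k * R K) \<omega> = disc_ito i (ugrid T (Suc K)) (\<lambda>l \<omega>. b i (u (ugrid T (Suc K) l) \<omega>)) k \<omega>
        - disc_ito i (?r K) (\<lambda>l \<omega>. b i (u (?r K l) \<omega>)) (k * R K) \<omega>" for i
      unfolding disc_ito_refine[OF R[of K], where K="Suc K" and k=k and \<theta>="\<lambda>l \<omega>. b i (u (ugrid T (Suc K) l) \<omega>)"]
      unfolding disc_ito_def \<theta>_def
      by (simp only: scaleR_diff_right sum_subtractf)
    have "(\<Sum>j\<in>UNIV. X K j k \<omega>) = (\<Sum>l<k * R K. \<alpha> K l \<omega>) + (\<Sum>i\<in>UNIV. disc_ito i (?r K) (\<theta> i K) (k * R K) \<omega>)"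
      by (simp add: UNIV_option_conv sum.reindex X_def)
    then show ?thesis unfolding 1 2 riemann_def by (simp add: sum_subtractf)
  qed
  have rb: "0 \<le> ?r K l" "?r K l \<le> T" if "l \<le> ?m K" for K l
    using ugrid_T_bounds[OF that] by auto
  have u1: "u (ugrid T (Suc K) (l div R K)) \<in> borel_measurable (Fil (?r K l))" if l: "l < ?m K" for K l
  proof (rule measurable_Fil_mono)
    have "l div R K \<le> Suc K" using l R[of K] by (simp add: less_mult_imp_div_less less_imp_le)
    then show "0 \<le> ugrid T (Suc K) (l div R K)"
      and "u (ugrid T (Suc K) (l div R K)) \<in> borel_measurable (Fil (ugrid T (Suc K) (l div R K)))"
      using ugrid_T_bounds[of "l div R K" "Suc K"] u_adapted by auto
    show "ugrid T (Suc K) (l div R K) \<le> ?r K l"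
    proof -
      have "ugrid T (Suc K) (l div R K) = ?r K (l div R K * R K)"
        by (rule ugrid_refine[OF R[of K], symmetric])
      also have "\<dots> \<le> ?r K l"
        by (rule grid_mono[of "?m K"]) (use l ugrid_less[OF T_pos m] in auto)
      finally show ?thesis .
    qed
    show "?r K l \<le> T" using rb l by auto
  qed
  have u2: "u (?r K l) \<in> borel_measurable (Fil (?r K l))" if "l < ?m K" for K l
    by (rule u_adapted) (use rb that in auto)
  have \<theta>_m: "\<theta> i K l \<in> borel_measurable (Fil (?r K l))" if "l < ?m K" for i K l
    unfolding \<theta>_def[abs_def]
    by (intro borel_measurable_diff measurable_compose[OF u1 b_measurable] measurable_compose[OF u2 b_measurable] that)
  have \<alpha>_m: "\<alpha> K l \<in> borel_measurable M" if "l < ?m K" for K l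
  proof -
    have "\<alpha> K l \<in> borel_measurable (Fil (?r K l))"
      unfolding \<alpha>_def[abs_def]
      by (intro borel_measurable_diff borel_measurable_scaleR borel_measurable_const
          measurable_compose[OF u1 a_measurable] measurable_compose[OF u2 a_measurable] that)
    then show ?thesis by (rule measurable_Fil_M) (use rb that in auto)
  qed
  have kR: "k * R K \<le> ?m K" if "k \<le> Suc K" for k K using that by (rule mult_le_mono1)
  have I_m: "disc_ito i (?r K) (\<theta> i K) l \<in> borel_measurable M" if l: "l \<le> ?m K" for i K l
    by (rule measurable_Fil_M[OF disc_ito_adapted_ugrid[OF m l \<theta>_m]]) (use rb l in auto)
  have X_m: "X K j k \<in> borel_measurable M" if "k \<le> Suc K" for K j k
  proof (cases j)
    case None
    have "(\<lambda>\<omega>. \<Sum>l<k * R K. \<alpha> K l \<omega>) \<in> borel_measurable M"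
      by (rule borel_measurable_sum) (use \<alpha>_m kR[OF that] in auto)
    then show ?thesis unfolding X_def[abs_def] None by simp
  next
    case (Some i)
    show ?thesis unfolding X_def[abs_def] Some using I_m[OF kR[OF that]] by simp
  qed
  define \<delta> where "\<delta> = \<epsilon> / real (card (UNIV :: 'm option set))"
  have \<delta>: "0 < \<delta>" using eps by (simp add: \<delta>_def card_gt_0_iff del: card_UNIV_option)
  have X_lim: "(\<lambda>K. prob {\<omega>\<in>space M. \<exists>k\<le>Suc K. \<delta> < norm (X K j k \<omega>)}) \<longlonglongrightarrow> 0" for j
  proof (cases j)
    case (Some i)
    have ev: "{\<omega>\<in>space M. \<exists>l\<le>?m K. \<delta> < norm (disc_ito i (?r K) (\<theta> i K) l \<omega>)} \<in> events" for K
    proof -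
      have "{\<omega>\<in>space M. \<delta> < norm (disc_ito i (?r K) (\<theta> i K) l \<omega>)} \<in> events" if "l \<le> ?m K" for l
        using I_m[OF that, of i] by measurable
      then have "(\<Union>l\<in>{..?m K}. {\<omega>\<in>space M. \<delta> < norm (disc_ito i (?r K) (\<theta> i K) l \<omega>)}) \<in> events"
        by (intro sets.finite_UN) auto
      also have "(\<Union>l\<in>{..?m K}. {\<omega>\<in>space M. \<delta> < norm (disc_ito i (?r K) (\<theta> i K) l \<omega>)})
        = {\<omega>\<in>space M. \<exists>l\<le>?m K. \<delta> < norm (disc_ito i (?r K) (\<theta> i K) l \<omega>)}" by auto
      finally show ?thesis .
    qed
    have "(\<lambda>K. prob {\<omega>\<in>space M. \<exists>l\<le>?m K. \<delta> < norm (disc_ito i (?r K) (\<theta> i K) l \<omega>)}) \<longlonglongrightarrow> 0"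
    proof (rule maximal_inequality_tendsto)
      show "AE \<omega> in M. (\<lambda>K. disc_energy (?r K) (\<theta> i K) (?m K) \<omega>) \<longlonglongrightarrow> 0"
        using u_continuous
      proof eventually_elim
        case (elim \<omega>)
        show ?case
        proof (rule LIMSEQ_I)
          fix c :: real assume c: "0 < c"
          define e where "e = sqrt (c / (2 * T))"
          have e: "0 < e" "T * e\<^sup>2 = c / 2" using c T_pos by (auto simp: e_def)
          obtain K0 where K0: "\<And>K R l. K0 \<le> K \<Longrightarrow> 0 < R \<Longrightarrow> l < K * R \<Longrightarrow>
              norm (b i (u (ugrid T K (l div R)) \<omega>) - b i (u (ugrid T (K * R) l) \<omega>)) \<le> e"
            using u_oscillation[OF b_continuous elim e(1)] by metis
          show "\<exists>K0. \<forall>K\<ge>K0. norm (disc_energy (?r K) (\<theta> i K) (?m K) \<omega> - 0) < c"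
          proof (intro exI[of _ K0] allI impI)
            fix K assume K: "K0 \<le> K"
            have "disc_energy (?r K) (\<theta> i K) (?m K) \<omega> \<le> (\<Sum>l<?m K. (T / real (?m K)) * e\<^sup>2)"
              unfolding disc_energy_def
            proof (rule sum_mono)
              fix l assume "l \<in> {..<?m K}"
              then have "norm (\<theta> i K l \<omega>) \<le> e" unfolding \<theta>_def using K0[of "Suc K" "R K" l] K R by auto
              then have "(norm (\<theta> i K l \<omega>))\<^sup>2 \<le> e\<^sup>2" by (intro power_mono) auto
              then show "(?r K (Suc l) - ?r K l) * (norm (\<theta> i K l \<omega>))\<^sup>2 \<le> (T / real (?m K)) * e\<^sup>2"
                unfolding ugrid_simps(3) using T_pos by (intro mult_left_mono) auto
            qed
            also have "\<dots> = T * e\<^sup>2" by (rule mesh_sum[OF m])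
            finally have "disc_energy (?r K) (\<theta> i K) (?m K) \<omega> < c" using e c by simp
            moreover have "0 \<le> disc_energy (?r K) (\<theta> i K) (?m K) \<omega>"
              unfolding disc_energy_def ugrid_simps(3) using T_pos by (intro sum_nonneg mult_nonneg_nonneg) auto
            ultimately show "norm (disc_energy (?r K) (\<theta> i K) (?m K) \<omega> - 0) < c" by simp
          qed
        qed
      qed
    qed (use rb \<theta>_m \<delta> ugrid_less[OF T_pos m] in auto)
    then show ?thesis
    proof (rule squeeze_to_zero)
      fix K
      show "prob {\<omega>\<in>space M. \<exists>k\<le>Suc K. \<delta> < norm (X K j k \<omega>)}
        \<le> prob {\<omega>\<in>space M. \<exists>l\<le>?m K. \<delta> < norm (disc_ito i (?r K) (\<theta> i K) l \<omega>)}"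
      proof (rule finite_measure_mono[OF _ ev])
        show "{\<omega>\<in>space M. \<exists>k\<le>Suc K. \<delta> < norm (X K j k \<omega>)}
          \<subseteq> {\<omega>\<in>space M. \<exists>l\<le>?m K. \<delta> < norm (disc_ito i (?r K) (\<theta> i K) l \<omega>)}"
          using kR unfolding X_def Some by fastforce
      qed
    qed (rule measure_nonneg)
  next
    case None
    have A_m: "(\<lambda>\<omega>. \<Sum>l<?m K. norm (\<alpha> K l \<omega>)) \<in> borel_measurable M" for K
      by (intro borel_measurable_sum measurable_compose[OF \<alpha>_m borel_measurable_norm]) auto
    have "(\<lambda>K. prob {\<omega>\<in>space M. \<delta> < (\<Sum>l<?m K. norm (\<alpha> K l \<omega>))}) \<longlonglongrightarrow> 0"
    proof (rule AE_tendsto_zero_in_prob[OF A_m _ \<delta>])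
      show "AE \<omega> in M. (\<lambda>K. \<Sum>l<?m K. norm (\<alpha> K l \<omega>)) \<longlonglongrightarrow> 0"
        using u_continuous
      proof eventually_elim
        case (elim \<omega>)
        show ?case
        proof (rule LIMSEQ_I)
          fix c :: real assume c: "0 < c"
          define e where "e = c / (2 * T)"
          have e: "0 < e" "T * e = c / 2" using c T_pos by (auto simp: e_def)
          obtain K0 where K0: "\<And>K R l. K0 \<le> K \<Longrightarrow> 0 < R \<Longrightarrow> l < K * R \<Longrightarrow>
              norm (a (u (ugrid T K (l div R)) \<omega>) - a (u (ugrid T (K * R) l) \<omega>)) \<le> e"
            using u_oscillation[OF a_continuous elim e(1)] by metis
          show "\<exists>K0. \<forall>K\<ge>K0. norm ((\<Sum>l<?m K. norm (\<alpha> K l \<omega>)) - 0) < c"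
          proof (intro exI[of _ K0] allI impI)
            fix K assume K: "K0 \<le> K"
            have "(\<Sum>l<?m K. norm (\<alpha> K l \<omega>)) \<le> (\<Sum>l<?m K. (T / real (?m K)) * e)"
            proof (rule sum_mono)
              fix l assume "l \<in> {..<?m K}"
              then have "norm (a (u (ugrid T (Suc K) (l div R K)) \<omega>) - a (u (?r K l) \<omega>)) \<le> e"
                using K0[of "Suc K" "R K" l] K R by auto
              moreover have "0 \<le> T / real (?m K)" using T_pos by simp
              ultimately show "norm (\<alpha> K l \<omega>) \<le> (T / real (?m K)) * e"
                unfolding \<alpha>_def norm_scaleR by (simp only: abs_of_nonneg mult_left_mono)
            qed
            also have "\<dots> = T * e" by (rule mesh_sum[OF m])
            finally have "(\<Sum>l<?m K. norm (\<alpha> K l \<omega>)) < c" using e c by simp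
            moreover have "0 \<le> (\<Sum>l<?m K. norm (\<alpha> K l \<omega>))" by (intro sum_nonneg norm_ge_zero)
            ultimately show "norm ((\<Sum>l<?m K. norm (\<alpha> K l \<omega>)) - 0) < c" by simp
          qed
        qed
      qed
    qed
    then show ?thesis
    proof (rule squeeze_to_zero)
      fix K
      show "prob {\<omega>\<in>space M. \<exists>k\<le>Suc K. \<delta> < norm (X K j k \<omega>)} \<le> prob {\<omega>\<in>space M. \<delta> < (\<Sum>l<?m K. norm (\<alpha> K l \<omega>))}"
      proof (rule finite_measure_mono)
        show "{\<omega>\<in>space M. \<exists>k\<le>Suc K. \<delta> < norm (X K j k \<omega>)} \<subseteq> {\<omega>\<in>space M. \<delta> < (\<Sum>l<?m K. norm (\<alpha> K l \<omega>))}"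
        proof
          fix \<omega> assume "\<omega> \<in> {\<omega>\<in>space M. \<exists>k\<le>Suc K. \<delta> < norm (X K j k \<omega>)}"
          then obtain k where k: "\<omega> \<in> space M" "k \<le> Suc K" "\<delta> < norm (\<Sum>l<k * R K. \<alpha> K l \<omega>)"
            unfolding X_def None by auto
          have "norm (\<Sum>l<k * R K. \<alpha> K l \<omega>) \<le> (\<Sum>l<k * R K. norm (\<alpha> K l \<omega>))" by (rule norm_sum)
          also have "\<dots> \<le> (\<Sum>l<?m K. norm (\<alpha> K l \<omega>))"
            using kR[OF k(2)] by (intro sum_mono2) auto
          finally show "\<omega> \<in> {\<omega>\<in>space M. \<delta> < (\<Sum>l<?m K. norm (\<alpha> K l \<omega>))}" using k by simp
        qed
        show "{\<omega>\<in>space M. \<delta> < (\<Sum>l<?m K. norm (\<alpha> K l \<omega>))} \<in> events"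
          using A_m[of K] by (rule borel_measurable_less[OF borel_measurable_const])
      qed
    qed (rule measure_nonneg)
  qed
  have "(\<lambda>K. \<Sum>j\<in>UNIV. prob {\<omega>\<in>space M. \<exists>k\<le>Suc K. \<delta> < norm (X K j k \<omega>)}) \<longlonglongrightarrow> (\<Sum>j\<in>(UNIV :: 'm option set). 0)"
    by (intro tendsto_sum X_lim)
  then have "(\<lambda>K. \<Sum>j\<in>UNIV. prob {\<omega>\<in>space M. \<exists>k\<le>Suc K. \<delta> < norm (X K j k \<omega>)}) \<longlonglongrightarrow> 0" by simp
  then show ?thesis
  proof (rule squeeze_to_zero)
    fix K
    show "prob {\<omega>\<in>space M. \<exists>k\<le>Suc K. \<epsilon> < norm (riemann (Suc K) k \<omega> - riemann (?m K) (k * R K) \<omega>)}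
      \<le> (\<Sum>j\<in>UNIV. prob {\<omega>\<in>space M. \<exists>k\<le>Suc K. \<delta> < norm (X K j k \<omega>)})"
      unfolding dec \<delta>_def by (rule prob_exists_sum_bound) (use X_m in auto)
  qed (rule measure_nonneg)
qed

text \<open>For each of the finitely many grid points there is a fine grid whose Riemann sum is close to the solution, by
  \<open>refined_riemann_tendsto\<close>; one \<open>R K\<close> serves all of them. The maximal inequality, hidden in
  \<open>riemann_refinement_tendsto\<close>, replaces uniformity in time.\<close>

lemma riemann_max_tendsto:
  assumes eps: "0 < \<epsilon>"
  shows "(\<lambda>K. prob {\<omega>\<in>space M. \<exists>k\<le>Suc K. \<epsilon> < norm (u (ugrid T (Suc K) k) \<omega> - riemann (Suc K) k \<omega>)}) \<longlonglongrightarrow> 0"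
proof -
  have ex: "\<exists>R>0. \<forall>k\<le>Suc K. prob {\<omega>\<in>space M. \<epsilon>/2 < norm (riemann (Suc K * R) (k * R) \<omega> - u (ugrid T (Suc K) k) \<omega>)} < 1 / (real (Suc (Suc K)))\<^sup>2" for K
  proof -
    have "eventually (\<lambda>R. \<forall>k\<in>{..Suc K}. prob {\<omega>\<in>space M. \<epsilon>/2 < norm (riemann (Suc K * R) (k * R) \<omega> - u (ugrid T (Suc K) k) \<omega>)} < 1 / (real (Suc (Suc K)))\<^sup>2) sequentially"
    proof (rule eventually_ball_finite)
      show "\<forall>k\<in>{..Suc K}. eventually (\<lambda>R. prob {\<omega>\<in>space M. \<epsilon>/2 < norm (riemann (Suc K * R) (k * R) \<omega> - u (ugrid T (Suc K) k) \<omega>)} < 1 / (real (Suc (Suc K)))\<^sup>2) sequentially"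
      proof
        fix k assume "k \<in> {..Suc K}"
        then have "(\<lambda>R. prob {\<omega>\<in>space M. \<epsilon>/2 < norm (riemann (Suc K * R) (k * R) \<omega> - u (ugrid T (Suc K) k) \<omega>)}) \<longlonglongrightarrow> 0"
          using eps by (intro refined_riemann_tendsto) auto
        then show "eventually (\<lambda>R. prob {\<omega>\<in>space M. \<epsilon>/2 < norm (riemann (Suc K * R) (k * R) \<omega> - u (ugrid T (Suc K) k) \<omega>)} < 1 / (real (Suc (Suc K)))\<^sup>2) sequentially"
          by (rule order_tendstoD) simp
      qed
    qed simp
    then have "eventually (\<lambda>R. 0 < R \<and> (\<forall>k\<in>{..Suc K}. prob {\<omega>\<in>space M. \<epsilon>/2 < norm (riemann (Suc K * R) (k * R) \<omega> - u (ugrid T (Suc K) k) \<omega>)} < 1 / (real (Suc (Suc K)))\<^sup>2)) sequentially"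
      by (intro eventually_conj eventually_gt_at_top)
    from eventually_happens[OF this] obtain R where "0 < R \<and> (\<forall>k\<in>{..Suc K}. prob {\<omega>\<in>space M. \<epsilon>/2 < norm (riemann (Suc K * R) (k * R) \<omega> - u (ugrid T (Suc K) k) \<omega>)} < 1 / (real (Suc (Suc K)))\<^sup>2)"
      by auto
    then show ?thesis by (intro exI[of _ R]) auto
  qed
  define R where "R K = (SOME R. 0 < R \<and> (\<forall>k\<le>Suc K. prob {\<omega>\<in>space M. \<epsilon>/2 < norm (riemann (Suc K * R) (k * R) \<omega> - u (ugrid T (Suc K) k) \<omega>)} < 1 / (real (Suc (Suc K)))\<^sup>2))" for K
  have R_props: "0 < R K \<and> (\<forall>k\<le>Suc K. prob {\<omega>\<in>space M. \<epsilon>/2 < norm (riemann (Suc K * R K) (k * R K) \<omega> - u (ugrid T (Suc K) k) \<omega>)} < 1 / (real (Suc (Suc K)))\<^sup>2)" for K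
    unfolding R_def by (rule someI_ex[OF ex])
  have R: "0 < R K" for K using R_props[of K] by blast
  have close: "prob {\<omega>\<in>space M. \<epsilon>/2 < norm (riemann (Suc K * R K) (k * R K) \<omega> - u (ugrid T (Suc K) k) \<omega>)} < 1 / (real (Suc (Suc K)))\<^sup>2"
    if "k \<le> Suc K" for K k
    using R_props[of K] that by blast
  have rm: "riemann (Suc K * R K) (k * R K) \<in> borel_measurable M" if "k \<le> Suc K" for K k
    by (rule riemann_measurable) (rule mult_le_mono1[OF that])
  have rm': "riemann (Suc K) k \<in> borel_measurable M" if "k \<le> Suc K" for K k
    by (rule riemann_measurable[OF that])
  have um: "u (ugrid T (Suc K) k) \<in> borel_measurable M" if "k \<le> Suc K" for K k
    by (rule u_measurable) (use ugrid_T_bounds[OF that] in auto)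
  let ?P = "\<lambda>K. prob {\<omega>\<in>space M. \<exists>k\<le>Suc K. \<epsilon>/2 < norm (riemann (Suc K) k \<omega> - riemann (Suc K * R K) (k * R K) \<omega>)}"
  have "(\<lambda>K. 1 / real (Suc (Suc K)) + ?P K) \<longlonglongrightarrow> 0 + 0"
  proof (intro tendsto_add)
    show "(\<lambda>K. 1 / real (Suc (Suc K))) \<longlonglongrightarrow> 0"
      using LIMSEQ_Suc[OF LIMSEQ_inverse_real_of_nat] by (simp add: inverse_eq_divide)
    show "?P \<longlonglongrightarrow> 0" using riemann_refinement_tendsto[of R "\<epsilon>/2", OF R] eps by simp
  qed
  then have "(\<lambda>K. 1 / real (Suc (Suc K)) + ?P K) \<longlonglongrightarrow> 0" by simp
  then show ?thesis
  proof (rule squeeze_to_zero)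
    fix K
    let ?A = "\<lambda>k. {\<omega>\<in>space M. \<epsilon>/2 < norm (riemann (Suc K * R K) (k * R K) \<omega> - u (ugrid T (Suc K) k) \<omega>)}"
    let ?B = "\<lambda>k. {\<omega>\<in>space M. \<epsilon>/2 < norm (riemann (Suc K) k \<omega> - riemann (Suc K * R K) (k * R K) \<omega>)}"
    let ?B' = "{\<omega>\<in>space M. \<exists>k\<le>Suc K. \<epsilon>/2 < norm (riemann (Suc K) k \<omega> - riemann (Suc K * R K) (k * R K) \<omega>)}"
    have A: "?A k \<in> events" if k: "k \<le> Suc K" for k
    proof -
      note rm[OF k, measurable] um[OF k, measurable]
      show ?thesis by measurable
    qed
    have B: "?B k \<in> events" if k: "k \<le> Suc K" for k
    proof -
      note rm[OF k, measurable] rm'[OF k, measurable]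
      show ?thesis by measurable
    qed
    have "?B' = (\<Union>k\<in>{..Suc K}. ?B k)" by auto
    also have "\<dots> \<in> events" by (rule sets.finite_UN[OF finite_atMost B]) simp
    finally have B': "?B' \<in> events" .
    have UA: "(\<Union>k\<in>{..Suc K}. ?A k) \<in> events" by (rule sets.finite_UN[OF finite_atMost A]) simp
    have "prob {\<omega>\<in>space M. \<exists>k\<le>Suc K. \<epsilon> < norm (u (ugrid T (Suc K) k) \<omega> - riemann (Suc K) k \<omega>)}
      \<le> prob ((\<Union>k\<in>{..Suc K}. ?A k) \<union> ?B')"
    proof (rule finite_measure_mono)
      show "{\<omega>\<in>space M. \<exists>k\<le>Suc K. \<epsilon> < norm (u (ugrid T (Suc K) k) \<omega> - riemann (Suc K) k \<omega>)} \<subseteq> (\<Union>k\<in>{..Suc K}. ?A k) \<union> ?B'"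
      proof
        fix \<omega> assume "\<omega> \<in> {\<omega>\<in>space M. \<exists>k\<le>Suc K. \<epsilon> < norm (u (ugrid T (Suc K) k) \<omega> - riemann (Suc K) k \<omega>)}"
        then obtain k where k: "\<omega> \<in> space M" "k \<le> Suc K" "\<epsilon> < norm (u (ugrid T (Suc K) k) \<omega> - riemann (Suc K) k \<omega>)"
          by blast
        have "norm (u (ugrid T (Suc K) k) \<omega> - riemann (Suc K) k \<omega>)
          \<le> norm (riemann (Suc K * R K) (k * R K) \<omega> - u (ugrid T (Suc K) k) \<omega>)
            + norm (riemann (Suc K) k \<omega> - riemann (Suc K * R K) (k * R K) \<omega>)"
          using norm_triangle_ineq[of "riemann (Suc K * R K) (k * R K) \<omega> - u (ugrid T (Suc K) k) \<omega>"
            "riemann (Suc K) k \<omega> - riemann (Suc K * R K) (k * R K) \<omega>"]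
          by (simp add: norm_minus_commute)
        then have "\<epsilon>/2 < norm (riemann (Suc K * R K) (k * R K) \<omega> - u (ugrid T (Suc K) k) \<omega>)
          \<or> \<epsilon>/2 < norm (riemann (Suc K) k \<omega> - riemann (Suc K * R K) (k * R K) \<omega>)"
          using k(3) by linarith
        then show "\<omega> \<in> (\<Union>k\<in>{..Suc K}. ?A k) \<union> ?B'" using k(1,2) by blast
      qed
    qed (rule sets.Un[OF UA B'])
    also have "\<dots> \<le> prob (\<Union>k\<in>{..Suc K}. ?A k) + prob ?B'" by (rule measure_Un_le[OF UA B'])
    also have "prob (\<Union>k\<in>{..Suc K}. ?A k) \<le> (\<Sum>k\<in>{..Suc K}. prob (?A k))"
      by (rule finite_measure_subadditive_finite[OF finite_atMost]) (rule image_subsetI, rule A, simp)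
    also have "\<dots> \<le> (\<Sum>k\<in>{..Suc K}. 1 / (real (Suc (Suc K)))\<^sup>2)"
      by (rule sum_mono, rule less_imp_le, rule close) simp
    also have "\<dots> = 1 / real (Suc (Suc K))" by (simp add: power2_eq_square)
    finally show "prob {\<omega>\<in>space M. \<exists>k\<le>Suc K. \<epsilon> < norm (u (ugrid T (Suc K) k) \<omega> - riemann (Suc K) k \<omega>)}
      \<le> 1 / real (Suc (Suc K)) + ?P K" by simp
  qed (rule measure_nonneg)
qed

end


section \<open>The Euler--Maruyama scheme\<close>

lemma lipschitz_square_growth:
  fixes f :: "'b::real_inner \<Rightarrow> 'c::real_inner"
  assumes "\<And>x y. norm (f x - f y) \<le> K * norm (x - y)"
  shows "(norm (f x))\<^sup>2 \<le> (2 * (norm (f 0))\<^sup>2 + 2 * K\<^sup>2) * (1 + (norm x)\<^sup>2)"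
proof -
  have "(norm (f 0 + (f x - f 0)))\<^sup>2 \<le> 2 * (norm (f 0))\<^sup>2 + 2 * (norm (f x - f 0))\<^sup>2"
    by (rule norm_add_square_le)
  also have "(norm (f x - f 0))\<^sup>2 \<le> (K * norm x)\<^sup>2"
    using assms[of x 0] by (intro power_mono) auto
  finally have "(norm (f x))\<^sup>2 \<le> 2 * (norm (f 0))\<^sup>2 + 2 * (K\<^sup>2 * (norm x)\<^sup>2)"
    by (simp add: power_mult_distrib)
  also have "\<dots> \<le> 2 * (norm (f 0))\<^sup>2 + 2 * (K\<^sup>2 * (norm x)\<^sup>2) + (2 * ((norm (f 0))\<^sup>2 * (norm x)\<^sup>2) + 2 * K\<^sup>2)" by simp
  also have "\<dots> = (2 * (norm (f 0))\<^sup>2 + 2 * K\<^sup>2) * (1 + (norm x)\<^sup>2)" by (simp add: algebra_simps)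
  finally show ?thesis .
qed

lemma exp_diff_le:
  fixes y z :: real
  assumes "0 \<le> y" "y \<le> z"
  shows "exp y - 1 \<le> y * exp z"
proof -
  have "1 + (- y) \<le> exp (- y)" by (rule exp_ge_add_one_self)
  then have "(1 - y) * exp y \<le> exp (- y) * exp y" by (intro mult_right_mono) auto
  then have "exp y - 1 \<le> y * exp y" by (simp add: exp_add[symmetric] left_diff_distrib)
  also have "\<dots> \<le> y * exp z" using assms by (intro mult_left_mono) auto
  finally show ?thesis .
qed

text \<open>A form of Fatou's lemma. Truncating \<open>|X|\<^sup>2\<close> at the level \<open>R\<close> makes the event of small probability negligible, and monotone
  convergence removes the truncation. The factor 2 and the fixed \<open>\<epsilon>\<close> avoid passing to an almost surely convergent subsequence.\<close>

lemma (in prob_space) L2_limit_in_prob: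
  fixes X :: "'a \<Rightarrow> 'b::euclidean_space"
  assumes X[measurable]: "X \<in> borel_measurable M" and Y: "\<And>j. L2 (Y j)" "\<And>j. msq (Y j) \<le> c"
    and lim: "(\<lambda>j. prob {\<omega>\<in>space M. \<epsilon> < norm (X \<omega> - Y j \<omega>)}) \<longlonglongrightarrow> 0"
  shows "L2 X" "msq X \<le> 2 * c + 2 * \<epsilon>\<^sup>2"
proof -
  let ?f = "\<lambda>R \<omega>. min ((norm (X \<omega>))\<^sup>2) (real R)"
  have fi: "integrable M (?f R)" for R
    by (rule integrable_const_bound[where B="real R"]) auto
  have trunc: "expectation (?f R) \<le> 2 * c + 2 * \<epsilon>\<^sup>2" for R
  proof -
    have "expectation (?f R) \<le> 2 * c + 2 * \<epsilon>\<^sup>2 + real R * prob {\<omega>\<in>space M. \<epsilon> < norm (X \<omega> - Y j \<omega>)}" for j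
    proof -
      note L2_measurable[OF Y(1)[of j], measurable] L2_integrable_square[OF Y(1)[of j], simp]
      let ?A = "{\<omega>\<in>space M. \<epsilon> < norm (X \<omega> - Y j \<omega>)}"
      have A: "?A \<in> events" by measurable
      have "expectation (?f R) \<le> (\<integral>\<omega>. 2 * (norm (Y j \<omega>))\<^sup>2 + 2 * \<epsilon>\<^sup>2 + real R * indicat_real ?A \<omega> \<partial>M)"
      proof (rule integral_mono[OF fi])
        show "integrable M (\<lambda>\<omega>. 2 * (norm (Y j \<omega>))\<^sup>2 + 2 * \<epsilon>\<^sup>2 + real R * indicat_real ?A \<omega>)"
          using A by (simp add: emeasure_eq_measure)
        fix \<omega> assume w: "\<omega> \<in> space M"
        show "?f R \<omega> \<le> 2 * (norm (Y j \<omega>))\<^sup>2 + 2 * \<epsilon>\<^sup>2 + real R * indicat_real ?A \<omega>"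
        proof (cases "\<omega> \<in> ?A")
          case True
          have "?f R \<omega> \<le> real R" by simp
          moreover have "0 \<le> 2 * (norm (Y j \<omega>))\<^sup>2 + 2 * \<epsilon>\<^sup>2" by simp
          ultimately have "?f R \<omega> \<le> 2 * (norm (Y j \<omega>))\<^sup>2 + 2 * \<epsilon>\<^sup>2 + real R * 1" by linarith
          then show ?thesis by (simp only: indicator_simps(1)[OF True])
        next
          case False
          then have n: "norm (X \<omega> - Y j \<omega>) \<le> \<epsilon>" using w by auto
          have "?f R \<omega> \<le> (norm (Y j \<omega> + (X \<omega> - Y j \<omega>)))\<^sup>2" by simp
          also have "\<dots> \<le> 2 * (norm (Y j \<omega>))\<^sup>2 + 2 * (norm (X \<omega> - Y j \<omega>))\<^sup>2" by (rule norm_add_square_le)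
          also have "(norm (X \<omega> - Y j \<omega>))\<^sup>2 \<le> \<epsilon>\<^sup>2" using n by (intro power_mono) auto
          finally show ?thesis using False by simp
        qed
      qed
      also have "\<dots> = 2 * msq (Y j) + 2 * \<epsilon>\<^sup>2 + real R * prob ?A"
        using A by (simp add: emeasure_eq_measure prob_space)
      finally show ?thesis using Y(2)[of j] by simp
    qed
    moreover have "(\<lambda>j. 2 * c + 2 * \<epsilon>\<^sup>2 + real R * prob {\<omega>\<in>space M. \<epsilon> < norm (X \<omega> - Y j \<omega>)})
        \<longlonglongrightarrow> 2 * c + 2 * \<epsilon>\<^sup>2 + real R * 0"
      by (intro tendsto_intros lim)
    ultimately show ?thesis
      by (intro LIMSEQ_le_const[of _ "2 * c + 2 * \<epsilon>\<^sup>2"]) auto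
  qed
  have mono: "expectation (?f m) \<le> expectation (?f n)" if "m \<le> n" for m n
    by (rule integral_mono[OF fi fi]) (use that in auto)
  have "convergent (\<lambda>R. expectation (?f R))"
  proof (rule Bseq_mono_convergent)
    have "0 \<le> expectation (?f R)" for R by (rule integral_nonneg_AE) auto
    then show "Bseq (\<lambda>R. expectation (?f R))"
      using trunc by (intro BseqI'[where K="2 * c + 2 * \<epsilon>\<^sup>2"]) simp
  qed (use mono in auto)
  then obtain x where x: "(\<lambda>R. expectation (?f R)) \<longlonglongrightarrow> x" by (auto simp: convergent_def)
  have point: "(\<lambda>R. ?f R \<omega>) \<longlonglongrightarrow> (norm (X \<omega>))\<^sup>2" for \<omega>
  proof (rule tendsto_eventually)
    obtain R0 where "(norm (X \<omega>))\<^sup>2 \<le> real R0" using real_arch_simple by blast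
    then show "eventually (\<lambda>R. ?f R \<omega> = (norm (X \<omega>))\<^sup>2) sequentially"
      unfolding eventually_sequentially by (intro exI[of _ R0]) (auto simp: min_def)
  qed
  have mono': "AE \<omega> in M. mono (\<lambda>R. ?f R \<omega>)" by (intro AE_I2 monoI) auto
  have "integrable M (\<lambda>\<omega>. (norm (X \<omega>))\<^sup>2)"
    by (rule integrable_monotone_convergence[OF fi mono' _ x]) (auto intro: point)
  then show "L2 X" by (simp add: square_integrable_def)
  have "msq X = x"
    by (rule integral_monotone_convergence[OF fi mono' _ x]) (auto intro: point)
  also have "x \<le> 2 * c + 2 * \<epsilon>\<^sup>2" by (rule LIMSEQ_le_const2[OF x]) (use trunc in auto)
  finally show "msq X \<le> 2 * c + 2 * \<epsilon>\<^sup>2" .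
qed

lemma (in prob_space) msq_scaleR: "msq (\<lambda>\<omega>. c *\<^sub>R X \<omega>) = c\<^sup>2 * msq X"
  by (simp add: power_mult_distrib)

text \<open>The crude factor \<open>(CARD('m))\<^sup>2\<close> comes from the triangle inequality over the components.\<close>

lemma (in brownian_noise) noise_increment:
  fixes \<theta> :: "'m \<Rightarrow> 'a \<Rightarrow> 'b::euclidean_space"
  assumes st: "0 \<le> s" "s < t" "t \<le> T"
    and \<theta>: "\<And>i. \<theta> i \<in> borel_measurable (Fil s)" "\<And>i. L2 (\<theta> i)" "\<And>i. msq (\<theta> i) \<le> c"
  shows "mart_incr (Fil s) (\<lambda>\<omega>. \<Sum>i\<in>UNIV. (W i t \<omega> - W i s \<omega>) *\<^sub>R \<theta> i \<omega>)"
    "msq (\<lambda>\<omega>. \<Sum>i\<in>UNIV. (W i t \<omega> - W i s \<omega>) *\<^sub>R \<theta> i \<omega>) \<le> (real CARD('m))\<^sup>2 * (t - s) * c"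
proof -
  note ii = ito_increment[OF st \<theta>(1,2)]
  show "mart_incr (Fil s) (\<lambda>\<omega>. \<Sum>i\<in>UNIV. (W i t \<omega> - W i s \<omega>) *\<^sub>R \<theta> i \<omega>)"
    by (rule mart_incr_sum[OF finite ii(1)])
  have "msq (\<lambda>\<omega>. \<Sum>i\<in>UNIV. (W i t \<omega> - W i s \<omega>) *\<^sub>R \<theta> i \<omega>)
    \<le> real CARD('m) * (\<Sum>i\<in>UNIV. msq (\<lambda>\<omega>. (W i t \<omega> - W i s \<omega>) *\<^sub>R \<theta> i \<omega>))"
    by (rule L2_sum(2)[OF finite mart_incr_L2[OF ii(1)]])
  also have "(\<Sum>i\<in>UNIV. msq (\<lambda>\<omega>. (W i t \<omega> - W i s \<omega>) *\<^sub>R \<theta> i \<omega>)) \<le> (\<Sum>i\<in>(UNIV::'m set). (t - s) * c)"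
  proof (rule sum_mono)
    fix i
    have "msq (\<lambda>\<omega>. (W i t \<omega> - W i s \<omega>) *\<^sub>R \<theta> i \<omega>) \<le> (t - s) * msq (\<theta> i)" by (rule ii(2))
    also have "\<dots> \<le> (t - s) * c" using st \<theta>(3) by (intro mult_left_mono) auto
    finally show "msq (\<lambda>\<omega>. (W i t \<omega> - W i s \<omega>) *\<^sub>R \<theta> i \<omega>) \<le> (t - s) * c" .
  qed
  finally show "msq (\<lambda>\<omega>. \<Sum>i\<in>UNIV. (W i t \<omega> - W i s \<omega>) *\<^sub>R \<theta> i \<omega>) \<le> (real CARD('m))\<^sup>2 * (t - s) * c"
    by (simp add: power2_eq_square mult.assoc)
qed

context lipschitz_sde
begin

primrec em :: "nat \<Rightarrow> nat \<Rightarrow> 'a \<Rightarrow> real^'d" where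
  "em K 0 = (\<lambda>\<omega>. u0)"
| "em K (Suc k) = (\<lambda>\<omega>. em K k \<omega> + (T / real K) *\<^sub>R a (em K k \<omega>) +
     (\<Sum>i\<in>UNIV. (W i (ugrid T K (Suc k)) \<omega> - W i (ugrid T K k) \<omega>) *\<^sub>R b i (em K k \<omega>)))"

lemma em_adapted:
  assumes K: "0 < K"
  shows "k \<le> K \<Longrightarrow> em K k \<in> borel_measurable (Fil (ugrid T K k))"
proof (induction k)
  case (Suc k)
  have g: "0 \<le> ugrid T K k" "ugrid T K k \<le> ugrid T K (Suc k)" "ugrid T K (Suc k) \<le> T"
    using ugrid_T_bounds[of k K] ugrid_T_bounds[of "Suc k" K] ugrid_less[OF T_pos K, of k] Suc.prems by auto
  have e: "em K k \<in> borel_measurable (Fil (ugrid T K (Suc k)))"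
    by (rule measurable_Fil_mono[OF Suc.IH]) (use Suc.prems g in auto)
  have w: "W i (ugrid T K k) \<in> borel_measurable (Fil (ugrid T K (Suc k)))"
     "W i (ugrid T K (Suc k)) \<in> borel_measurable (Fil (ugrid T K (Suc k)))" for i
    using g by (auto intro!: W_adapted)
  show ?case
    unfolding em.simps
    by (intro borel_measurable_add borel_measurable_sum borel_measurable_scaleR borel_measurable_diff
      borel_measurable_const e w measurable_compose[OF e a_measurable] measurable_compose[OF e b_measurable])
qed simp

definition growth :: real where
  "growth = 2 * \<Lambda>\<^sup>2 + 2 * (norm (a 0))\<^sup>2 + (\<Sum>i\<in>UNIV. 2 * (norm (b i 0))\<^sup>2)"

lemma growth_nonneg: "0 \<le> growth"
  unfolding growth_def by (intro add_nonneg_nonneg sum_nonneg) auto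

lemma a_growth: "(norm (a x))\<^sup>2 \<le> growth * (1 + (norm x)\<^sup>2)"
proof (rule order_trans[OF lipschitz_square_growth[OF a_lipschitz]], rule mult_right_mono)
  have "0 \<le> (\<Sum>i\<in>UNIV. 2 * (norm (b i 0))\<^sup>2)" by (intro sum_nonneg) auto
  then show "2 * (norm (a 0))\<^sup>2 + 2 * \<Lambda>\<^sup>2 \<le> growth" by (simp add: growth_def)
qed simp

lemma b_growth: "(norm (b i x))\<^sup>2 \<le> growth * (1 + (norm x)\<^sup>2)"
proof (rule order_trans[OF lipschitz_square_growth[OF b_lipschitz]], rule mult_right_mono)
  have "2 * (norm (b i 0))\<^sup>2 \<le> (\<Sum>i\<in>UNIV. 2 * (norm (b i 0))\<^sup>2)"
    by (rule member_le_sum) auto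
  moreover have "0 \<le> 2 * (norm (a 0))\<^sup>2" by simp
  ultimately show "2 * (norm (b i 0))\<^sup>2 + 2 * \<Lambda>\<^sup>2 \<le> growth" unfolding growth_def by linarith
qed simp

definition em_kappa :: real where "em_kappa = growth * (1 + (real CARD('m))\<^sup>2)"
definition em_rate :: real where "em_rate = gronwall_rate em_kappa T"
definition em_bound :: real where "em_bound = exp (em_rate * T) * ((norm u0)\<^sup>2 + 1)"

lemma em_kappa: "0 \<le> em_kappa" "growth \<le> em_kappa" "(real CARD('m))\<^sup>2 * growth \<le> em_kappa"
  using growth_nonneg by (auto simp: em_kappa_def algebra_simps)

lemma em_rate_pos: "0 < em_rate"
  using em_kappa T_pos by (simp add: em_rate_def gronwall_rate_def add_pos_nonneg)

lemma em_bound_ge_1: "1 \<le> em_bound"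
proof -
  have "1 * 1 \<le> exp (em_rate * T) * ((norm u0)\<^sup>2 + 1)"
    using em_rate_pos T_pos by (intro mult_mono) auto
  then show ?thesis by (simp add: em_bound_def)
qed

lemma mesh_pos: "0 < K \<Longrightarrow> 0 < T / real K"
  using T_pos by simp

lemma mesh_le: "0 < K \<Longrightarrow> T / real K \<le> T"
  using T_pos by (simp add: divide_le_eq)

lemma mesh_times_le: "k \<le> K \<Longrightarrow> real k * (T / real K) \<le> T"
  using ugrid_T_bounds(2)[of k K] by (simp add: ugrid_def)

text \<open>The bound \<open>\<gamma>\<close> is separate from the second moment of \<open>X\<close> so that the same step can be used for the moments of the
  scheme, where \<open>\<gamma>\<close> contains the current moment, and for its increments, where \<open>\<gamma>\<close> is the moment bound.\<close>

lemma coefficient_step: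
  assumes K: "0 < K" "k < K" and X: "X \<in> borel_measurable (Fil (ugrid T K k))" "L2 X"
    and \<gamma>: "1 + msq X \<le> \<gamma>"
  shows "drift_noise_split (Fil (ugrid T K k))
    (\<lambda>\<omega>. (T / real K) *\<^sub>R a (X \<omega>) +
      (\<Sum>i\<in>UNIV. (W i (ugrid T K (Suc k)) \<omega> - W i (ugrid T K k) \<omega>) *\<^sub>R b i (X \<omega>)))
    (em_kappa * (T / real K)\<^sup>2 * \<gamma>) (em_kappa * (T / real K) * \<gamma>)"
proof (rule drift_noise_splitI)
  have XM: "X \<in> borel_measurable M" by (rule L2_measurable[OF X(2)])
  have ga: "growth * (1 + msq X) \<le> growth * \<gamma>" using \<gamma> growth_nonneg by (intro mult_left_mono)
  have g0: "0 \<le> \<gamma>" by (rule order_trans[OF _ \<gamma>]) (simp add: add_nonneg_nonneg)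
  have aX: "L2 (\<lambda>\<omega>. a (X \<omega>))" "msq (\<lambda>\<omega>. a (X \<omega>)) \<le> growth * (1 + msq X)"
    using L2_affine_bound[OF measurable_compose[OF XM a_measurable] X(2) a_growth] by auto
  have bX: "L2 (\<lambda>\<omega>. b i (X \<omega>))" "msq (\<lambda>\<omega>. b i (X \<omega>)) \<le> growth * (1 + msq X)" for i
    using L2_affine_bound[OF measurable_compose[OF XM b_measurable] X(2) b_growth] by auto
  let ?D = "\<lambda>\<omega>. (T / real K) *\<^sub>R a (X \<omega>)"
  let ?S = "\<lambda>\<omega>. \<Sum>i\<in>UNIV. (W i (ugrid T K (Suc k)) \<omega> - W i (ugrid T K k) \<omega>) *\<^sub>R b i (X \<omega>)"
  show "?D \<omega> + ?S \<omega> = ?D \<omega> + ?S \<omega>" for \<omega> by (rule refl)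
  show "L2 ?D" by (rule L2_scaleR[OF aX(1)])
  have "msq (\<lambda>\<omega>. (T / real K) *\<^sub>R a (X \<omega>)) = (T / real K)\<^sup>2 * msq (\<lambda>\<omega>. a (X \<omega>))"
    by (rule msq_scaleR)
  also have "\<dots> \<le> (T / real K)\<^sup>2 * (em_kappa * \<gamma>)"
  proof (rule mult_left_mono)
    have "growth * \<gamma> \<le> em_kappa * \<gamma>" using em_kappa(2) g0 by (rule mult_right_mono)
    then show "msq (\<lambda>\<omega>. a (X \<omega>)) \<le> em_kappa * \<gamma>" using aX(2) ga by linarith
  qed simp
  finally show "msq (\<lambda>\<omega>. (T / real K) *\<^sub>R a (X \<omega>)) \<le> em_kappa * (T / real K)\<^sup>2 * \<gamma>" by (simp add: mult_ac)
  have st: "0 \<le> ugrid T K k" "ugrid T K k < ugrid T K (Suc k)" "ugrid T K (Suc k) \<le> T"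
    using ugrid_T_bounds[of k K] ugrid_T_bounds[of "Suc k" K] ugrid_less[OF T_pos K(1), of k] K by auto
  have bm: "(\<lambda>\<omega>. b i (X \<omega>)) \<in> borel_measurable (Fil (ugrid T K k))" for i
    by (rule measurable_compose[OF X(1) b_measurable])
  have bX2: "msq (\<lambda>\<omega>. b i (X \<omega>)) \<le> growth * \<gamma>" for i using bX(2)[of i] ga by linarith
  show "mart_incr (Fil (ugrid T K k)) (\<lambda>\<omega>. \<Sum>i\<in>UNIV. (W i (ugrid T K (Suc k)) \<omega> - W i (ugrid T K k) \<omega>) *\<^sub>R b i (X \<omega>))"
    by (rule noise_increment(1)[OF st bm bX(1) bX2])
  have "msq (\<lambda>\<omega>. \<Sum>i\<in>UNIV. (W i (ugrid T K (Suc k)) \<omega> - W i (ugrid T K k) \<omega>) *\<^sub>R b i (X \<omega>))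
    \<le> (real CARD('m))\<^sup>2 * (T / real K) * (growth * \<gamma>)"
    using noise_increment(2)[OF st bm bX(1) bX2] by (simp only: ugrid_simps(3))
  also have "\<dots> = ((real CARD('m))\<^sup>2 * growth) * ((T / real K) * \<gamma>)" by (simp add: mult_ac)
  also have "\<dots> \<le> em_kappa * ((T / real K) * \<gamma>)"
    using em_kappa(3) g0 mesh_pos[OF K(1)] by (intro mult_right_mono mult_nonneg_nonneg) auto
  finally show "msq (\<lambda>\<omega>. \<Sum>i\<in>UNIV. (W i (ugrid T K (Suc k)) \<omega> - W i (ugrid T K k) \<omega>) *\<^sub>R b i (X \<omega>)) \<le> em_kappa * (T / real K) * \<gamma>"
    by (simp add: mult.assoc)
qed

lemma em_moment:
  assumes K: "0 < K" "k \<le> K"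
  shows "L2 (em K k)" "msq (em K k) + 1 \<le> em_bound"
proof -
  have *: "L2 (em K k) \<and> msq (em K k) + 1 \<le> exp (em_rate * (real k * (T / real K))) * (msq (em K 0) + 1)"
    unfolding em_rate_def
  proof (rule mean_square_gronwall[where e="em K" and G="\<lambda>k. Fil (ugrid T K k)"])
    fix j assume j: "j < k"
    show ad: "em K j \<in> borel_measurable (Fil (ugrid T K j))" by (rule em_adapted) (use j K in auto)
    assume L: "L2 (em K j)"
    have jK: "j < K" using j K by simp
    have "1 + msq (em K j) \<le> msq (em K j) + 1" by simp
    from coefficient_step[OF K(1) jK ad L this]
    show "drift_noise_split (Fil (ugrid T K j)) (\<lambda>\<omega>. em K (Suc j) \<omega> - em K j \<omega>)
      (em_kappa * (T / real K)\<^sup>2 * (msq (em K j) + 1)) (em_kappa * (T / real K) * (msq (em K j) + 1))"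
      by simp
  qed (use em_kappa mesh_pos[OF K(1)] mesh_le[OF K(1)] in auto)
  then show "L2 (em K k)" by simp
  have "em_rate * (real k * (T / real K)) \<le> em_rate * T"
    using mesh_times_le[OF K(2)] em_rate_pos by (intro mult_left_mono) auto
  then have "exp (em_rate * (real k * (T / real K))) \<le> exp (em_rate * T)"
    by (simp only: exp_le_cancel_iff)
  then have "exp (em_rate * (real k * (T / real K))) * ((norm u0)\<^sup>2 + 1) \<le> em_bound"
    unfolding em_bound_def by (intro mult_right_mono) auto
  then show "msq (em K k) + 1 \<le> em_bound" using * by (simp add: prob_space)
qed

text \<open>The increment starts from 0 and satisfies the same recursion with the moment bound as \<open>r\<close>, so that
  \<open>exp y - 1 = O(y)\<close> yields the linear growth.\<close>

lemma em_increment: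
  assumes K: "0 < K" "j + n \<le> K"
  shows "msq (\<lambda>\<omega>. em K (j + n) \<omega> - em K j \<omega>) \<le> em_bound * em_rate * exp (em_rate * T) * (real n * (T / real K))"
proof -
  let ?e = "\<lambda>l \<omega>. em K (j + l) \<omega> - em K j \<omega>"
  have *: "L2 (?e n) \<and> msq (?e n) + em_bound \<le> exp (em_rate * (real n * (T / real K))) * (msq (?e 0) + em_bound)"
    unfolding em_rate_def
  proof (rule mean_square_gronwall[where e="?e" and G="\<lambda>l. Fil (ugrid T K (j + l))"])
    fix l assume l: "l < n"
    have ad: "em K (j + l) \<in> borel_measurable (Fil (ugrid T K (j + l)))" by (rule em_adapted) (use l K in auto)
    have "em K j \<in> borel_measurable (Fil (ugrid T K (j + l)))"
    proof (rule measurable_Fil_mono[OF em_adapted])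
      show "ugrid T K j \<le> ugrid T K (j + l)"
        by (rule grid_mono[of K]) (use l K ugrid_less[OF T_pos K(1)] in auto)
    qed (use l K ugrid_T_bounds in auto)
    then show "?e l \<in> borel_measurable (Fil (ugrid T K (j + l)))" using ad by (intro borel_measurable_diff)
    have jK: "j + l < K" using l K by simp
    have mom: "L2 (em K (j + l))" "1 + msq (em K (j + l)) \<le> msq (?e l) + em_bound"
    proof -
      show "L2 (em K (j + l))" by (rule em_moment) (use K jK in auto)
      have "msq (em K (j + l)) + 1 \<le> em_bound" by (rule em_moment) (use K jK in auto)
      moreover have "0 \<le> msq (?e l)" by (rule msq_nonneg)
      ultimately show "1 + msq (em K (j + l)) \<le> msq (?e l) + em_bound" by linarith
    qed
    from coefficient_step[OF K(1) jK ad mom]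
    show "drift_noise_split (Fil (ugrid T K (j + l))) (\<lambda>\<omega>. ?e (Suc l) \<omega> - ?e l \<omega>)
      (em_kappa * (T / real K)\<^sup>2 * (msq (?e l) + em_bound)) (em_kappa * (T / real K) * (msq (?e l) + em_bound))"
      by simp
  next
    show "0 \<le> em_bound" using em_bound_ge_1 by simp
  qed (use em_kappa mesh_pos[OF K(1)] mesh_le[OF K(1)] in auto)
  let ?y = "em_rate * (real n * (T / real K))"
  have "msq (?e n) + em_bound \<le> exp ?y * em_bound" using * by simp
  then have "msq (?e n) \<le> em_bound * (exp ?y - 1)" by (simp add: algebra_simps)
  also have "\<dots> \<le> em_bound * (?y * exp (em_rate * T))"
  proof (rule mult_left_mono[OF exp_diff_le])
    show "0 \<le> ?y" using em_rate_pos T_pos by simp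
    show "?y \<le> em_rate * T" using mesh_times_le[of n K] K em_rate_pos by (intro mult_left_mono) auto
  qed (use em_bound_ge_1 in simp)
  finally show ?thesis by (simp add: mult_ac)
qed

definition difference_kappa :: real where
  "difference_kappa = 2 * \<Lambda>\<^sup>2 * (1 + (real CARD('m))\<^sup>2)"

text \<open>The recursion for the difference of Riemann sum and scheme is stopped at the first grid point where the solution is
  further than \<open>\<eta>\<close> from its Riemann sum. Until then the solution may be replaced by the Riemann sum at the cost of \<open>\<eta>\<close>, which
  enters the recursion as \<open>r = \<eta>\<^sup>2\<close>; that the recursion was stopped at all has small probability.\<close>

lemma em_close_in_prob:
  assumes K: "0 < K" "k \<le> K" and eta: "0 < \<eta>" "2 * \<eta> \<le> \<epsilon>"
  shows "prob {\<omega>\<in>space M. \<epsilon> < norm (u (ugrid T K k) \<omega> - em K k \<omega>)}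
    \<le> prob {\<omega>\<in>space M. \<exists>j\<le>K. \<eta> < norm (u (ugrid T K j) \<omega> - riemann K j \<omega>)}
      + exp (gronwall_rate difference_kappa T * T) * 4 * \<eta>\<^sup>2 / \<epsilon>\<^sup>2"
proof -
  define \<kappa> where "\<kappa> = difference_kappa"
  define C where "C = gronwall_rate \<kappa> T"
  have \<kappa>: "0 \<le> \<kappa>" "2 * \<Lambda>\<^sup>2 \<le> \<kappa>" "(real CARD('m))\<^sup>2 * (2 * \<Lambda>\<^sup>2) \<le> \<kappa>"
    by (auto simp: \<kappa>_def difference_kappa_def algebra_simps)
  have C: "0 \<le> C" using \<kappa>(1) T_pos by (simp add: C_def gronwall_rate_def)
  let ?g = "ugrid T K"
  define h where "h = T / real K"
  have h: "0 < h" "h \<le> T" using mesh_pos[OF K(1)] mesh_le[OF K(1)] by (auto simp: h_def)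
  define c where "c l \<omega> \<longleftrightarrow> (\<forall>j\<le>l. norm (u (?g j) \<omega> - riemann K j \<omega>) \<le> \<eta>)" for l \<omega>
  define D where "D l \<omega> = (if c l \<omega> then h *\<^sub>R (a (u (?g l) \<omega>) - a (em K l \<omega>)) else 0)" for l \<omega>
  define \<theta> where "\<theta> l i \<omega> = (if c l \<omega> then b i (u (?g l) \<omega>) - b i (em K l \<omega>) else 0)" for l i \<omega>
  define S where "S l \<omega> = (\<Sum>i\<in>UNIV. (W i (?g (Suc l)) \<omega> - W i (?g l) \<omega>) *\<^sub>R \<theta> l i \<omega>)" for l \<omega>
  define e where "e n \<omega> = (\<Sum>l<n. D l \<omega> + S l \<omega>)" for n \<omega>
  have gb: "0 \<le> ?g l" "?g l \<le> T" if "l \<le> K" for l using ugrid_T_bounds[OF that] by auto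
  have gm: "?g j \<le> ?g l" if "j \<le> l" "l \<le> K" for j l
    by (rule grid_mono[of K]) (use that ugrid_less[OF T_pos K(1)] in auto)
  have ad: "u (?g j) \<in> borel_measurable (Fil (?g l))" "riemann K j \<in> borel_measurable (Fil (?g l))"
    "em K j \<in> borel_measurable (Fil (?g l))" if "j \<le> l" "l \<le> K" for j l
  proof -
    have j: "j \<le> K" using that by simp
    show "u (?g j) \<in> borel_measurable (Fil (?g l))"
      by (rule measurable_Fil_mono[OF u_adapted]) (use gb[OF j] gb[OF that(2)] gm[OF that] in auto)
    show "riemann K j \<in> borel_measurable (Fil (?g l))"
      by (rule measurable_Fil_mono[OF riemann_adapted[OF K(1) j]]) (use gb[OF j] gb[OF that(2)] gm[OF that] in auto)
    show "em K j \<in> borel_measurable (Fil (?g l))"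
      by (rule measurable_Fil_mono[OF em_adapted[OF K(1) j]]) (use gb[OF j] gb[OF that(2)] gm[OF that] in auto)
  qed
  have c_pred: "{\<omega>\<in>space (Fil (?g l)). c l \<omega>} \<in> sets (Fil (?g l))" if l: "l \<le> K" for l
  proof -
    have "{\<omega>\<in>space (Fil (?g l)). norm (u (?g j) \<omega> - riemann K j \<omega>) \<le> \<eta>} \<in> sets (Fil (?g l))" if "j \<in> {..l}" for j
    proof -
      have jl: "j \<le> l" using that by simp
      note ad(1,2)[OF jl l, measurable]
      show ?thesis by measurable
    qed
    then have "{\<omega>\<in>space (Fil (?g l)). \<forall>j\<in>{..l}. norm (u (?g j) \<omega> - riemann K j \<omega>) \<le> \<eta>} \<in> sets (Fil (?g l))"
      by (rule sets.sets_Collect_finite_All[OF _ finite_atMost])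
    moreover have "c l \<omega> \<longleftrightarrow> (\<forall>j\<in>{..l}. norm (u (?g j) \<omega> - riemann K j \<omega>) \<le> \<eta>)" for \<omega>
      unfolding c_def by blast
    ultimately show ?thesis by presburger
  qed
  have D_ad: "D l \<in> borel_measurable (Fil (?g l))" if l: "l \<le> K" for l
    unfolding D_def[abs_def]
  proof (rule measurable_If[OF _ _ c_pred[OF l]])
    show "(\<lambda>\<omega>. h *\<^sub>R (a (u (?g l) \<omega>) - a (em K l \<omega>))) \<in> borel_measurable (Fil (?g l))"
      by (intro borel_measurable_scaleR borel_measurable_diff borel_measurable_const
          measurable_compose[OF ad(1)[OF order_refl l] a_measurable] measurable_compose[OF ad(3)[OF order_refl l] a_measurable])
  qed simp
  have \<theta>_ad: "\<theta> l i \<in> borel_measurable (Fil (?g l))" if l: "l \<le> K" for l i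
    unfolding \<theta>_def[abs_def]
  proof (rule measurable_If[OF _ _ c_pred[OF l]])
    show "(\<lambda>\<omega>. b i (u (?g l) \<omega>) - b i (em K l \<omega>)) \<in> borel_measurable (Fil (?g l))"
      by (intro borel_measurable_diff
          measurable_compose[OF ad(1)[OF order_refl l] b_measurable] measurable_compose[OF ad(3)[OF order_refl l] b_measurable])
  qed simp
  have S_ad: "S l \<in> borel_measurable (Fil (?g n))" if "l < n" "n \<le> K" for l n
    unfolding S_def[abs_def]
  proof (intro borel_measurable_sum borel_measurable_scaleR borel_measurable_diff)
    fix i
    have l: "l \<le> K" "Suc l \<le> K" using that by auto
    show "W i (?g (Suc l)) \<in> borel_measurable (Fil (?g n))" "W i (?g l) \<in> borel_measurable (Fil (?g n))"
      using gb[OF l(1)] gb[OF l(2)] gb[OF that(2)] gm[of l n] gm[of "Suc l" n] that by (auto intro!: W_adapted)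
    show "\<theta> l i \<in> borel_measurable (Fil (?g n))"
      by (rule measurable_Fil_mono[OF \<theta>_ad[OF l(1)]]) (use gb[OF l(1)] gb[OF that(2)] gm[of l n] that in auto)
  qed
  have e_ad: "e n \<in> borel_measurable (Fil (?g n))" if n: "n \<le> K" for n
    unfolding e_def[abs_def]
  proof (intro borel_measurable_sum borel_measurable_add)
    fix l assume "l \<in> {..<n}"
    then have l: "l < n" "l \<le> K" using n by auto
    show "D l \<in> borel_measurable (Fil (?g n))"
      by (rule measurable_Fil_mono[OF D_ad[OF l(2)]]) (use gb[OF l(2)] gb[OF n] gm[of l n] l n in auto)
    show "S l \<in> borel_measurable (Fil (?g n))" by (rule S_ad[OF l(1) n])
  qed
  have e_eq: "e n \<omega> = riemann K n \<omega> - em K n \<omega>" if "\<And>l. l < n \<Longrightarrow> c l \<omega>" for n \<omega>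
    using that
  proof (induction n)
    case 0
    then show ?case by (simp add: e_def riemann_def disc_ito_def)
  next
    case (Suc n)
    have "riemann K (Suc n) \<omega> = riemann K n \<omega> + h *\<^sub>R a (u (?g n) \<omega>)
        + (\<Sum>i\<in>UNIV. (W i (?g (Suc n)) \<omega> - W i (?g n) \<omega>) *\<^sub>R b i (u (?g n) \<omega>))"
      by (simp add: riemann_def disc_ito_def h_def sum.distrib)
    moreover have "e (Suc n) \<omega> = e n \<omega> + h *\<^sub>R a (u (?g n) \<omega>) - h *\<^sub>R a (em K n \<omega>)
        + ((\<Sum>i\<in>UNIV. (W i (?g (Suc n)) \<omega> - W i (?g n) \<omega>) *\<^sub>R b i (u (?g n) \<omega>))
        - (\<Sum>i\<in>UNIV. (W i (?g (Suc n)) \<omega> - W i (?g n) \<omega>) *\<^sub>R b i (em K n \<omega>)))"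
      using Suc.prems[of n] by (simp add: e_def D_def S_def \<theta>_def scaleR_diff_right sum_subtractf)
    ultimately show ?case using Suc by (simp add: h_def)
  qed
  have bound: "norm (u (?g l) \<omega> - em K l \<omega>) \<le> \<eta> + norm (e l \<omega>)" if "c l \<omega>" for l \<omega>
  proof -
    have "e l \<omega> = riemann K l \<omega> - em K l \<omega>" using that by (intro e_eq) (auto simp: c_def)
    moreover have "norm (u (?g l) \<omega> - riemann K l \<omega>) \<le> \<eta>" using that by (simp add: c_def)
    ultimately show ?thesis
      using norm_triangle_ineq[of "u (?g l) \<omega> - riemann K l \<omega>" "e l \<omega>"] by simp
  qed
  \<comment> \<open>The Lipschitz bound in terms of the stopped difference \<open>e\<close>.\<close>
  have lip: "(norm v)\<^sup>2 \<le> (2 * \<Lambda>\<^sup>2) * (\<eta>\<^sup>2 + (norm (e l \<omega>))\<^sup>2)"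
    if "c l \<omega>" "norm v \<le> \<Lambda> * norm (u (?g l) \<omega> - em K l \<omega>)" for l \<omega> and v :: "real^'d"
  proof -
    have "norm v \<le> \<Lambda> * (\<eta> + norm (e l \<omega>))"
      using that(2) mult_left_mono[OF bound[OF that(1)] Lambda_nonneg] by linarith
    then have "(norm v)\<^sup>2 \<le> (\<Lambda> * (\<eta> + norm (e l \<omega>)))\<^sup>2" by (intro power_mono) auto
    also have "\<dots> = \<Lambda>\<^sup>2 * (norm (\<eta> + norm (e l \<omega>)))\<^sup>2" by (simp add: power_mult_distrib)
    also have "\<dots> \<le> \<Lambda>\<^sup>2 * (2 * (norm \<eta>)\<^sup>2 + 2 * (norm (norm (e l \<omega>)))\<^sup>2)"
      by (intro mult_left_mono norm_add_square_le) simp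
    finally show ?thesis by (simp add: algebra_simps)
  qed
  have r0: "0 \<le> \<eta>\<^sup>2" by simp
  have gron: "L2 (e k) \<and> msq (e k) + \<eta>\<^sup>2 \<le> exp (C * (real k * h)) * (msq (e 0) + \<eta>\<^sup>2)"
    unfolding C_def
  proof (rule mean_square_gronwall[where e=e and G="\<lambda>l. Fil (?g l)", OF _ _ h r0 \<kappa>(1)])
    have "e 0 = (\<lambda>\<omega>. 0)" by (rule ext) (simp add: e_def)
    then show "L2 (e 0)" by simp
    fix l assume "l < k"
    then have l: "l < K" "l \<le> K" using K by auto
    show "e l \<in> borel_measurable (Fil (?g l))" by (rule e_ad[OF l(2)])
    assume L: "L2 (e l)"
    have Dm: "D l \<in> borel_measurable M" by (rule measurable_Fil_M[OF D_ad[OF l(2)]]) (use gb[OF l(2)] in auto)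
    have \<theta>m: "\<theta> l i \<in> borel_measurable M" for i by (rule measurable_Fil_M[OF \<theta>_ad[OF l(2)]]) (use gb[OF l(2)] in auto)
    have Dle: "(norm (D l \<omega>))\<^sup>2 \<le> (h\<^sup>2 * (2 * \<Lambda>\<^sup>2)) * (\<eta>\<^sup>2 + (norm (e l \<omega>))\<^sup>2)" for \<omega>
    proof (cases "c l \<omega>")
      case True
      have "(norm (D l \<omega>))\<^sup>2 = h\<^sup>2 * (norm (a (u (?g l) \<omega>) - a (em K l \<omega>)))\<^sup>2"
        using True by (simp add: D_def power_mult_distrib)
      also have "\<dots> \<le> h\<^sup>2 * ((2 * \<Lambda>\<^sup>2) * (\<eta>\<^sup>2 + (norm (e l \<omega>))\<^sup>2))"
        by (intro mult_left_mono lip[OF True a_lipschitz]) simp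
      finally show ?thesis by (simp only: mult.assoc)
    qed (simp add: D_def)
    have \<theta>le: "(norm (\<theta> l i \<omega>))\<^sup>2 \<le> (2 * \<Lambda>\<^sup>2) * (\<eta>\<^sup>2 + (norm (e l \<omega>))\<^sup>2)" for i \<omega>
      using lip[OF _ b_lipschitz[of i], of l \<omega>] by (cases "c l \<omega>") (simp_all add: \<theta>_def)
    note DL = L2_affine_bound[OF Dm L Dle] and \<theta>L = L2_affine_bound[OF \<theta>m L \<theta>le]
    have pos: "0 \<le> \<eta>\<^sup>2 + msq (e l)" by (simp add: add_nonneg_nonneg)
    have "h\<^sup>2 * (2 * \<Lambda>\<^sup>2) * (\<eta>\<^sup>2 + msq (e l)) \<le> h\<^sup>2 * \<kappa> * (\<eta>\<^sup>2 + msq (e l))"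
      using \<kappa>(2) pos by (intro mult_right_mono mult_left_mono) auto
    then have D2: "msq (D l) \<le> \<kappa> * h\<^sup>2 * (msq (e l) + \<eta>\<^sup>2)"
      using DL(2) by (simp add: mult_ac add.commute)
    have st: "0 \<le> ?g l" "?g l < ?g (Suc l)" "?g (Suc l) \<le> T"
      using gb[of l] gb[of "Suc l"] ugrid_less[OF T_pos K(1), of l] l by auto
    have "msq (S l) \<le> (real CARD('m))\<^sup>2 * h * ((2 * \<Lambda>\<^sup>2) * (\<eta>\<^sup>2 + msq (e l)))"
      unfolding S_def[abs_def] h_def
      using noise_increment(2)[OF st \<theta>_ad[OF l(2)] \<theta>L] by (simp only: ugrid_simps(3))
    also have "\<dots> = ((real CARD('m))\<^sup>2 * (2 * \<Lambda>\<^sup>2)) * (h * (\<eta>\<^sup>2 + msq (e l)))" by (simp only: mult_ac)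
    also have "\<dots> \<le> \<kappa> * (h * (\<eta>\<^sup>2 + msq (e l)))"
      using \<kappa>(3) pos h by (intro mult_right_mono mult_nonneg_nonneg) auto
    finally have S2: "msq (S l) \<le> \<kappa> * h * (msq (e l) + \<eta>\<^sup>2)" by (simp add: mult_ac add.commute)
    have S1: "mart_incr (Fil (?g l)) (S l)"
      unfolding S_def[abs_def] by (rule noise_increment(1)[OF st \<theta>_ad[OF l(2)] \<theta>L])
    show "drift_noise_split (Fil (?g l)) (\<lambda>\<omega>. e (Suc l) \<omega> - e l \<omega>)
      (\<kappa> * h\<^sup>2 * (msq (e l) + \<eta>\<^sup>2)) (\<kappa> * h * (msq (e l) + \<eta>\<^sup>2))"
    proof (rule drift_noise_splitI[OF _ DL(1) D2 S1 S2])
      show "e (Suc l) \<omega> - e l \<omega> = D l \<omega> + S l \<omega>" for \<omega> by (simp add: e_def)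
    qed
  qed
  have "real k * h \<le> T" using mesh_times_le[OF K(2)] by (simp add: h_def)
  then have "C * (real k * h) \<le> C * T" using C by (intro mult_left_mono)
  then have "exp (C * (real k * h)) * \<eta>\<^sup>2 \<le> exp (C * T) * \<eta>\<^sup>2" by (intro mult_right_mono) auto
  moreover have "e 0 = (\<lambda>\<omega>. 0)" by (rule ext) (simp add: e_def)
  then have z: "msq (e 0) = 0" by simp
  ultimately have msqe: "msq (e k) \<le> exp (C * T) * \<eta>\<^sup>2"
    using gron[unfolded z add_0] r0 by linarith
  have eM[measurable]: "e k \<in> borel_measurable M" by (rule L2_measurable) (use gron in blast)
  let ?B = "{\<omega>\<in>space M. \<exists>j\<le>K. \<eta> < norm (u (?g j) \<omega> - riemann K j \<omega>)}"
  let ?E = "{\<omega>\<in>space M. (\<epsilon>/2)\<^sup>2 \<le> (norm (e k \<omega>))\<^sup>2}"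
  have B: "?B \<in> events"
  proof -
    have "{\<omega>\<in>space M. \<eta> < norm (u (?g j) \<omega> - riemann K j \<omega>)} \<in> events" if j: "j \<in> {..K}" for j
    proof -
      have jK: "j \<le> K" using j by simp
      note u_measurable[OF gb[OF jK], measurable] riemann_measurable[OF jK, measurable]
      show ?thesis by measurable
    qed
    then have "(\<Union>j\<in>{..K}. {\<omega>\<in>space M. \<eta> < norm (u (?g j) \<omega> - riemann K j \<omega>)}) \<in> events"
      by (rule sets.finite_UN[OF finite_atMost])
    also have "(\<Union>j\<in>{..K}. {\<omega>\<in>space M. \<eta> < norm (u (?g j) \<omega> - riemann K j \<omega>)}) = ?B" by auto
    finally show ?thesis .
  qed
  have E: "?E \<in> events" by measurable
  have "prob {\<omega>\<in>space M. \<epsilon> < norm (u (?g k) \<omega> - em K k \<omega>)} \<le> prob (?B \<union> ?E)"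
  proof (rule finite_measure_mono[OF _ sets.Un[OF B E]])
    show "{\<omega>\<in>space M. \<epsilon> < norm (u (?g k) \<omega> - em K k \<omega>)} \<subseteq> ?B \<union> ?E"
    proof
      fix \<omega> assume w: "\<omega> \<in> {\<omega>\<in>space M. \<epsilon> < norm (u (?g k) \<omega> - em K k \<omega>)}"
      show "\<omega> \<in> ?B \<union> ?E"
      proof (cases "c k \<omega>")
        case True
        have "\<epsilon>/2 \<le> norm (e k \<omega>)" using bound[OF True] w eta by simp
        then have "(\<epsilon>/2)\<^sup>2 \<le> (norm (e k \<omega>))\<^sup>2" using eta by (intro power_mono) auto
        then show ?thesis using w by simp
      next
        case False
        then obtain j where "j \<le> k" "\<eta> < norm (u (?g j) \<omega> - riemann K j \<omega>)" by (auto simp: c_def not_le)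
        then have "\<exists>j\<le>K. \<eta> < norm (u (?g j) \<omega> - riemann K j \<omega>)" using K(2) by (intro exI[of _ j]) auto
        then show ?thesis using w by simp
      qed
    qed
  qed
  also have "\<dots> \<le> prob ?B + prob ?E" by (rule measure_Un_le[OF B E])
  also have "prob ?E \<le> msq (e k) / (\<epsilon>/2)\<^sup>2"
    using gron eta integral_Markov_inequality_measure[of M "\<lambda>\<omega>. (norm (e k \<omega>))\<^sup>2" "space M" "(\<epsilon>/2)\<^sup>2"]
    by (auto simp: L2_integrable_square)
  also have "\<dots> \<le> exp (C * T) * \<eta>\<^sup>2 / (\<epsilon>/2)\<^sup>2" using msqe by (intro divide_right_mono) auto
  also have "\<dots> = exp (C * T) * 4 * \<eta>\<^sup>2 / \<epsilon>\<^sup>2" by (simp add: power_divide)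
  finally show ?thesis by (simp add: C_def \<kappa>_def)
qed

lemma em_tendsto_in_prob:
  assumes k: "\<And>K. k K \<le> Suc K" and eps: "0 < \<epsilon>"
  shows "(\<lambda>K. prob {\<omega>\<in>space M. \<epsilon> < norm (u (ugrid T (Suc K) (k K)) \<omega> - em (Suc K) (k K) \<omega>)}) \<longlonglongrightarrow> 0"
proof (rule LIMSEQ_I)
  fix \<gamma> :: real assume \<gamma>: "0 < \<gamma>"
  define Q where "Q = exp (gronwall_rate difference_kappa T * T) * 4 / \<epsilon>\<^sup>2"
  have Q: "0 < Q" using eps by (simp add: Q_def)
  define \<eta> where "\<eta> = min (\<epsilon>/2) (sqrt (\<gamma> / (2 * Q)))"
  have \<eta>: "0 < \<eta>" "2 * \<eta> \<le> \<epsilon>" using eps \<gamma> Q by (auto simp: \<eta>_def)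
  have "\<eta>\<^sup>2 \<le> (sqrt (\<gamma> / (2 * Q)))\<^sup>2" using \<eta> by (intro power_mono) (auto simp: \<eta>_def)
  then have "Q * \<eta>\<^sup>2 \<le> Q * (\<gamma> / (2 * Q))" using Q \<gamma> by (intro mult_left_mono) auto
  then have Q\<eta>: "Q * \<eta>\<^sup>2 \<le> \<gamma> / 2" using Q by simp
  have "eventually (\<lambda>K. prob {\<omega>\<in>space M. \<exists>k\<le>Suc K. \<eta> < norm (u (ugrid T (Suc K) k) \<omega> - riemann (Suc K) k \<omega>)} < \<gamma> / 2) sequentially"
    using \<gamma> by (intro order_tendstoD(2)[OF riemann_max_tendsto[OF \<eta>(1)]]) simp
  then obtain K0 where K0: "\<And>K. K0 \<le> K \<Longrightarrow> prob {\<omega>\<in>space M. \<exists>k\<le>Suc K. \<eta> < norm (u (ugrid T (Suc K) k) \<omega> - riemann (Suc K) k \<omega>)} < \<gamma> / 2"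
    unfolding eventually_sequentially by blast
  show "\<exists>K0. \<forall>K\<ge>K0. norm (prob {\<omega>\<in>space M. \<epsilon> < norm (u (ugrid T (Suc K) (k K)) \<omega> - em (Suc K) (k K) \<omega>)} - 0) < \<gamma>"
  proof (intro exI[of _ K0] allI impI)
    fix K assume K: "K0 \<le> K"
    have "prob {\<omega>\<in>space M. \<epsilon> < norm (u (ugrid T (Suc K) (k K)) \<omega> - em (Suc K) (k K) \<omega>)}
      \<le> prob {\<omega>\<in>space M. \<exists>k\<le>Suc K. \<eta> < norm (u (ugrid T (Suc K) k) \<omega> - riemann (Suc K) k \<omega>)} + Q * \<eta>\<^sup>2"
      using em_close_in_prob[OF _ k \<eta>, of K] by (simp add: Q_def)
    then have "prob {\<omega>\<in>space M. \<epsilon> < norm (u (ugrid T (Suc K) (k K)) \<omega> - em (Suc K) (k K) \<omega>)} < \<gamma>"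
      using K0[OF K] Q\<eta> by linarith
    then show "norm (prob {\<omega>\<in>space M. \<epsilon> < norm (u (ugrid T (Suc K) (k K)) \<omega> - em (Suc K) (k K) \<omega>)} - 0) < \<gamma>"
      by simp
  qed
qed

end


section \<open>The matrix exponential\<close>

text \<open>The norm of the type of matrices is the Frobenius norm, which is compatible with both products by the inequality of
  Cauchy and Schwarz.\<close>

lemma norm_matrix_vector_le:
  fixes X :: "real^'n^'m" and x :: "real^'n"
  shows "norm (X *v x) \<le> norm X * norm x"
proof -
  have "norm (X *v x) = L2_set (\<lambda>i. norm ((X *v x) $ i)) UNIV" by (simp add: norm_vec_def)
  also have "\<dots> \<le> L2_set (\<lambda>i. norm (X $ i) * norm x) UNIV"
  proof (rule L2_set_mono)
    fix i
    have "(X *v x) $ i = X $ i \<bullet> x" by (simp add: matrix_vector_mult_def inner_vec_def)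
    then show "norm ((X *v x) $ i) \<le> norm (X $ i) * norm x" by (simp add: Cauchy_Schwarz_ineq2)
  qed simp
  also have "\<dots> = norm X * norm x" by (simp add: norm_vec_def[of X] L2_set_left_distrib)
  finally show ?thesis .
qed

lemma norm_matrix_matrix_le:
  fixes X :: "real^'n^'m" and Y :: "real^'k^'n"
  shows "norm (X ** Y) \<le> norm X * norm Y"
proof -
  have "norm (X ** Y) = L2_set (\<lambda>i. norm ((X ** Y) $ i)) UNIV" by (simp add: norm_vec_def)
  also have "\<dots> \<le> L2_set (\<lambda>i. norm (X $ i) * norm Y) UNIV"
  proof (rule L2_set_mono)
    fix i
    have "(X ** Y) $ i = (\<Sum>k\<in>UNIV. X $ i $ k *\<^sub>R Y $ k)"
      by (simp add: matrix_matrix_mult_def vec_eq_iff)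
    then have "norm ((X ** Y) $ i) \<le> (\<Sum>k\<in>UNIV. \<bar>X $ i $ k\<bar> * \<bar>norm (Y $ k)\<bar>)"
      by (simp add: sum_norm_le)
    also have "\<dots> \<le> L2_set (\<lambda>k. X $ i $ k) UNIV * L2_set (\<lambda>k. norm (Y $ k)) UNIV"
      by (rule L2_set_mult_ineq)
    also have "\<dots> = norm (X $ i) * norm Y"
      by (simp add: norm_vec_def L2_set_def)
    finally show "norm ((X ** Y) $ i) \<le> norm (X $ i) * norm Y" .
  qed simp
  also have "\<dots> = norm X * norm Y" by (simp add: norm_vec_def[of X] L2_set_left_distrib)
  finally show ?thesis .
qed

lemma bounded_bilinear_matrix_vector: "bounded_bilinear ((*v) :: real^'n^'m \<Rightarrow> real^'n \<Rightarrow> real^'m)"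
proof
  show "\<exists>K. \<forall>X x. norm ((X :: real^'n^'m) *v x) \<le> norm X * norm x * K"
    by (intro exI[of _ 1]) (simp add: norm_matrix_vector_le)
qed (simp_all add: matrix_vector_mult_def vec_eq_iff sum.distrib algebra_simps sum_distrib_left)

lemma bounded_bilinear_matrix_matrix: "bounded_bilinear ((**) :: real^'n^'m \<Rightarrow> real^'k^'n \<Rightarrow> real^'k^'m)"
proof
  show "\<exists>K. \<forall>X Y. norm ((X :: real^'n^'m) ** (Y :: real^'k^'n)) \<le> norm X * norm Y * K"
    by (intro exI[of _ 1]) (simp add: norm_matrix_matrix_le)
qed (simp_all add: matrix_matrix_mult_def vec_eq_iff sum.distrib algebra_simps sum_distrib_left)

lemma norm_matrix_pow_le:
  "norm (matrix_pow X k) \<le> norm (mat 1 :: real^'d^'d) * norm (X :: real^'d::finite^'d) ^ k"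
proof (induction k)
  case (Suc k)
  have "norm (matrix_pow X (Suc k)) \<le> norm X * norm (matrix_pow X k)"
    by (simp add: norm_matrix_matrix_le)
  also have "\<dots> \<le> norm X * (norm (mat 1 :: real^'d^'d) * norm X ^ k)"
    by (intro mult_left_mono Suc.IH) simp
  finally show ?case by (simp add: mult_ac)
qed simp

text \<open>The tail of the exponential series is dominated by \<open>|X|\<^sup>n\<close> times the series itself. The factor \<open>norm (mat 1)\<close> appears
  because the Frobenius norm of the unit matrix is not 1.\<close>

lemma matrix_exp_remainder:
  fixes X :: "real^'d::finite^'d"
  shows "norm (matrix_exp X - (\<Sum>k<n. (1 / fact k) *\<^sub>R matrix_pow X k))
    \<le> norm (mat 1 :: real^'d^'d) * norm X ^ n * exp (norm X)"
proof -
  define D where "D = norm (mat 1 :: real^'d^'d)"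
  let ?f = "\<lambda>k. (1 / fact k) *\<^sub>R matrix_pow X k"
  have se: "summable (\<lambda>k. norm X ^ k /\<^sub>R fact k)" by (rule summable_exp_generic)
  have fb: "norm (?f k) \<le> D * (norm X ^ k /\<^sub>R fact k)" for k
    using mult_left_mono[OF norm_matrix_pow_le, of "1 / fact k" X k] by (simp add: D_def divide_inverse mult_ac)
  have sf: "summable ?f"
    by (rule summable_comparison_test'[OF summable_mult[OF se] fb])
  have "matrix_exp X - (\<Sum>k<n. ?f k) = (\<Sum>k. ?f (k + n))"
    using suminf_split_initial_segment[OF sf, of n] by (simp add: matrix_exp_def)
  also have "norm \<dots> \<le> (\<Sum>k. (D * norm X ^ n) * (norm X ^ k /\<^sub>R fact k))"
  proof (rule norm_suminf_le)
    fix k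
    have "norm (?f (k + n)) \<le> D * (norm X ^ (k + n) /\<^sub>R fact (k + n))" by (rule fb)
    also have "\<dots> \<le> D * (norm X ^ (k + n) /\<^sub>R fact k)"
    proof (rule mult_left_mono)
      show "norm X ^ (k + n) /\<^sub>R fact (k + n) \<le> norm X ^ (k + n) /\<^sub>R fact k"
        by (intro scaleR_right_mono le_imp_inverse_le fact_mono) auto
    qed (simp add: D_def)
    also have "\<dots> = (D * norm X ^ n) * (norm X ^ k /\<^sub>R fact k)"
      by (simp add: power_add)
    finally show "norm (?f (k + n)) \<le> (D * norm X ^ n) * (norm X ^ k /\<^sub>R fact k)" .
  qed (rule summable_mult[OF se])
  also have "\<dots> = (D * norm X ^ n) * exp (norm X)"
    by (subst suminf_mult[OF se]) (simp add: exp_def)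
  finally show ?thesis by (simp add: D_def)
qed

lemma matrix_pow_measurable[measurable]: "(\<lambda>X :: real^'d::finite^'d. matrix_pow X k) \<in> borel_measurable borel"
proof -
  have "continuous_on UNIV (\<lambda>X :: real^'d^'d. matrix_pow X k)"
  proof (induction k)
    case (Suc k)
    then show ?case
      by (simp add: bounded_bilinear.continuous_on[OF bounded_bilinear_matrix_matrix continuous_on_id])
  qed simp
  then show ?thesis by (rule borel_measurable_continuous_onI)
qed

lemma matrix_exp_measurable[measurable]: "matrix_exp \<in> borel_measurable (borel :: (real^'d::finite^'d) measure)"
  unfolding matrix_exp_def[abs_def] by measurable


section \<open>Functions of a Brownian increment that are small in mean and in mean square\<close>

lemma power_le_fact_exp:
  fixes x :: real
  assumes "0 \<le> x"
  shows "x ^ n \<le> fact n * exp x"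
proof -
  have "(\<Sum>k\<in>{n}. x ^ k /\<^sub>R fact k) \<le> (\<Sum>k. x ^ k /\<^sub>R fact k)"
    by (rule sum_le_suminf[OF summable_exp_generic]) (use assms in auto)
  then have "x ^ n / fact n \<le> exp x" by (simp add: exp_def divide_inverse mult.commute)
  then show ?thesis by (simp add: divide_le_eq mult.commute)
qed

text \<open>The sum is at most \<open>CARD('i)\<close> times its largest term; this makes exponential moments of sums accessible without
  independence.\<close>

lemma exp_sum_le:
  fixes c :: "'i::finite \<Rightarrow> real"
  shows "exp (\<Sum>i\<in>UNIV. c i) \<le> (\<Sum>i\<in>UNIV. exp (real CARD('i) * c i))"
proof -
  obtain j where j: "\<And>i. c i \<le> c j"
  proof -
    have "Max (range c) \<in> range c" by (rule Max_in) auto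
    then obtain k where k: "Max (range c) = c k" by (rule rangeE)
    have "c i \<le> c k" for i unfolding k[symmetric] by (rule Max_ge) auto
    then show ?thesis by (rule that)
  qed
  have "(\<Sum>i\<in>UNIV. c i) \<le> real CARD('i) * c j"
    by (rule sum_bounded_above) (rule j)
  then have "exp (\<Sum>i\<in>UNIV. c i) \<le> exp (real CARD('i) * c j)" by simp
  also have "\<dots> \<le> (\<Sum>i\<in>UNIV. exp (real CARD('i) * c i))"
    by (rule member_le_sum) auto
  finally show ?thesis .
qed

text \<open>The size of an increment in units of \<open>sqrt h\<close>. Its distribution does not depend on \<open>h\<close>, so its exponential moments are bounded
  uniformly in the step size; the summand 1 makes it an upper bound for constants.\<close>

definition scaled_size :: "real \<Rightarrow> real^'m::finite \<Rightarrow> real" where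
  "scaled_size h z = 1 + (\<Sum>i\<in>UNIV. \<bar>z $ i\<bar> / sqrt h)"

lemma scaled_size_ge_1: "0 < h \<Longrightarrow> 1 \<le> scaled_size h z"
  by (simp add: scaled_size_def sum_nonneg)

lemma abs_le_scaled_size:
  assumes "0 < h" shows "\<bar>z $ i\<bar> \<le> sqrt h * scaled_size h z"
proof -
  have "\<bar>z $ i\<bar> / sqrt h \<le> (\<Sum>i\<in>UNIV. \<bar>z $ i\<bar> / sqrt h)"
    by (rule member_le_sum) (use assms in auto)
  then have "\<bar>z $ i\<bar> / sqrt h \<le> scaled_size h z" by (simp add: scaled_size_def)
  then show ?thesis using assms by (simp add: divide_le_eq mult.commute)
qed

lemma scaled_size_measurable[measurable]:
  "scaled_size h \<in> borel_measurable (borel :: (real^'m::finite) measure)"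
proof -
  have [measurable]: "(\<lambda>z :: real^'m::finite. z $ i) \<in> borel_measurable borel" for i
    by (intro borel_measurable_continuous_onI continuous_intros)
  show ?thesis unfolding scaled_size_def[abs_def] by measurable
qed

context brownian_noise
begin

lemma exp_scaled_size_moment:
  fixes \<rho> :: real
  defines "G \<equiv> exp \<rho> * (\<Sum>i\<in>(UNIV :: 'm set). 2 * exp ((real CARD('m) * \<rho>)\<^sup>2 / 2))"
  assumes "0 \<le> s" "s < t" "t \<le> T"
  shows "integrable M (\<lambda>\<omega>. exp (\<rho> * scaled_size (t - s) (incr s t \<omega>)))"
    "expectation (\<lambda>\<omega>. exp (\<rho> * scaled_size (t - s) (incr s t \<omega>))) \<le> G"
proof -
  let ?m = "real CARD('m)"
  let ?h = "t - s"
  have h: "0 < ?h" using assms by simp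
  note N = normal_exp_moment[OF h W_increment_normal[OF assms(2-4)], of "?m * \<rho>"]
  let ?f = "\<lambda>\<omega>. exp \<rho> * (\<Sum>i\<in>UNIV. exp ((?m * \<rho>) * (\<bar>W i t \<omega> - W i s \<omega>\<bar> / sqrt ?h)))"
  have le: "exp (\<rho> * scaled_size ?h (incr s t \<omega>)) \<le> ?f \<omega>" for \<omega>
  proof -
    have "exp (\<rho> * scaled_size ?h (incr s t \<omega>)) = exp \<rho> * exp (\<Sum>i\<in>UNIV. \<rho> * (\<bar>W i t \<omega> - W i s \<omega>\<bar> / sqrt ?h))"
      by (simp only: scaled_size_def incr_nth distrib_left mult_1_right exp_add sum_distrib_left)
    also have "\<dots> \<le> exp \<rho> * (\<Sum>i\<in>UNIV. exp (?m * (\<rho> * (\<bar>W i t \<omega> - W i s \<omega>\<bar> / sqrt ?h))))"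
      by (rule mult_left_mono[OF exp_sum_le]) simp
    finally show ?thesis by (simp only: mult.assoc)
  qed
  have fi: "integrable M ?f" by (intro integrable_mult_right Bochner_Integration.integrable_sum N(1))
  have m: "(\<lambda>\<omega>. exp (\<rho> * scaled_size ?h (incr s t \<omega>))) \<in> borel_measurable M"
    using incr_measurable[of s t] assms by (intro measurable_compose[OF _ borel_measurable_exp] borel_measurable_times
      measurable_compose[OF _ scaled_size_measurable]) auto
  have "AE \<omega> in M. norm (exp (\<rho> * scaled_size ?h (incr s t \<omega>))) \<le> norm (?f \<omega>)"
  proof (intro AE_I2)
    fix \<omega>
    have "norm (exp (\<rho> * scaled_size ?h (incr s t \<omega>))) = exp (\<rho> * scaled_size ?h (incr s t \<omega>))" by simp
    also have "\<dots> \<le> ?f \<omega>" by (rule le)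
    also have "\<dots> \<le> norm (?f \<omega>)" by simp
    finally show "norm (exp (\<rho> * scaled_size ?h (incr s t \<omega>))) \<le> norm (?f \<omega>)" .
  qed
  then show i: "integrable M (\<lambda>\<omega>. exp (\<rho> * scaled_size ?h (incr s t \<omega>)))"
    by (rule Bochner_Integration.integrable_bound[OF fi m])
  have "expectation (\<lambda>\<omega>. exp (\<rho> * scaled_size ?h (incr s t \<omega>))) \<le> expectation ?f"
    by (rule integral_mono[OF i fi le])
  also have "\<dots> = exp \<rho> * (\<Sum>i\<in>UNIV. expectation (\<lambda>\<omega>. exp ((?m * \<rho>) * (\<bar>W i t \<omega> - W i s \<omega>\<bar> / sqrt ?h))))"
    using N(1) by (subst integral_mult_right_zero, subst Bochner_Integration.integral_sum) auto
  also have "\<dots> \<le> G" unfolding G_def by (intro mult_left_mono sum_mono N(2)) simp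
  finally show "expectation (\<lambda>\<omega>. exp (\<rho> * scaled_size ?h (incr s t \<omega>))) \<le> G" .
qed

text \<open>The property required of the random matrices in the remainder of one step: after \<open>1 / h\<close> steps the means contribute
  \<open>O(sqrt h)\<close>, and so do the fluctuations, by orthogonality.\<close>

definition small_coeff :: "(real \<Rightarrow> real^'m \<Rightarrow> 'c::euclidean_space) \<Rightarrow> bool" where
  "small_coeff f \<longleftrightarrow> (\<exists>C\<ge>0. \<forall>s t. 0 \<le> s \<longrightarrow> s < t \<longrightarrow> t \<le> T \<longrightarrow>
     f (t - s) \<in> borel_measurable borel \<and> L2 (\<lambda>\<omega>. f (t - s) (incr s t \<omega>)) \<and>
     msq (\<lambda>\<omega>. f (t - s) (incr s t \<omega>)) \<le> C * (t - s)\<^sup>2 \<and>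
     (norm (expectation (\<lambda>\<omega>. f (t - s) (incr s t \<omega>))))\<^sup>2 \<le> C * (t - s) ^ 3)"

text \<open>The function \<open>p\<close> is the part of \<open>f\<close> of order \<open>h\<close>; it is a polynomial in the increment, and its mean is computed exactly.
  What remains is of order \<open>h powr (3/2)\<close> pathwise, up to the exponential weight.\<close>

lemma small_coeffI:
  fixes f p :: "real \<Rightarrow> real^'m \<Rightarrow> 'c::euclidean_space"
  assumes m: "\<And>h. f h \<in> borel_measurable borel"
    and c: "0 \<le> c" "0 \<le> \<rho>"
    and f: "\<And>h z. 0 < h \<Longrightarrow> h \<le> T \<Longrightarrow> norm (f h z) \<le> c * h * exp (\<rho> * scaled_size h z)"
    and q: "\<And>h z. 0 < h \<Longrightarrow> h \<le> T \<Longrightarrow> norm (f h z - p h z) \<le> c * sqrt h ^ 3 * exp (\<rho> * scaled_size h z)"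
    and p: "\<And>s t. 0 \<le> s \<Longrightarrow> s < t \<Longrightarrow> t \<le> T \<Longrightarrow> integrable M (\<lambda>\<omega>. p (t - s) (incr s t \<omega>)) \<and>
        norm (expectation (\<lambda>\<omega>. p (t - s) (incr s t \<omega>))) \<le> c * sqrt (t - s) ^ 3"
  shows "small_coeff f"
proof -
  define G where "G = exp (2 * \<rho>) * (\<Sum>i\<in>(UNIV :: 'm set). 2 * exp ((real CARD('m) * (2 * \<rho>))\<^sup>2 / 2))"
  have G: "0 \<le> G" unfolding G_def by (intro mult_nonneg_nonneg sum_nonneg) auto
  define C where "C = c\<^sup>2 * G + (c * (1 + G))\<^sup>2"
  have C: "0 \<le> C" using G by (simp add: C_def)
  have main: "f (t - s) \<in> borel_measurable borel \<and> L2 (\<lambda>\<omega>. f (t - s) (incr s t \<omega>)) \<and>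
     msq (\<lambda>\<omega>. f (t - s) (incr s t \<omega>)) \<le> C * (t - s)\<^sup>2 \<and>
     (norm (expectation (\<lambda>\<omega>. f (t - s) (incr s t \<omega>))))\<^sup>2 \<le> C * (t - s) ^ 3"
    if st: "0 \<le> s" "s < t" "t \<le> T" for s t
  proof -
    define h where "h = t - s"
    have h: "0 < h" "h \<le> T" using st by (auto simp: h_def)
    let ?z = "incr s t"
    let ?E = "\<lambda>\<omega>. exp (2 * \<rho> * scaled_size h (?z \<omega>))"
    have E: "integrable M ?E" "expectation ?E \<le> G"
      using exp_scaled_size_moment[OF st, of "2 * \<rho>"] by (auto simp: h_def G_def)
    have zm: "?z \<in> borel_measurable M" by (rule incr_measurable) (use st in auto)
    have fm: "(\<lambda>\<omega>. f h (?z \<omega>)) \<in> borel_measurable M" by (rule measurable_compose[OF zm m])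
    have sq: "(norm (f h (?z \<omega>)))\<^sup>2 \<le> (c * h)\<^sup>2 * ?E \<omega>" for \<omega>
    proof -
      have "(norm (f h (?z \<omega>)))\<^sup>2 \<le> (c * h * exp (\<rho> * scaled_size h (?z \<omega>)))\<^sup>2"
        by (intro power_mono f h) simp
      also have "\<dots> = (c * h)\<^sup>2 * ?E \<omega>"
        by (simp add: power_mult_distrib exp_double[symmetric] mult.assoc)
      finally show ?thesis .
    qed
    have iE: "integrable M (\<lambda>\<omega>. (c * h)\<^sup>2 * ?E \<omega>)" using E(1) by simp
    have L: "L2 (\<lambda>\<omega>. f h (?z \<omega>))" by (rule L2_dominated[OF fm iE sq])
    have "msq (\<lambda>\<omega>. f h (?z \<omega>)) \<le> (c * h)\<^sup>2 * expectation ?E"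
      using msq_dominated[OF fm iE sq] by simp
    also have "\<dots> \<le> (c * h)\<^sup>2 * G" by (intro mult_left_mono E(2)) simp
    also have "\<dots> = (c\<^sup>2 * G) * h\<^sup>2" by (simp add: power_mult_distrib)
    also have "\<dots> \<le> C * h\<^sup>2" by (intro mult_right_mono) (simp_all add: C_def)
    finally have M: "msq (\<lambda>\<omega>. f h (?z \<omega>)) \<le> C * h\<^sup>2" .
    have fi: "integrable M (\<lambda>\<omega>. f h (?z \<omega>))" by (rule L2_integrable[OF L])
    have pi: "integrable M (\<lambda>\<omega>. p h (?z \<omega>))" "norm (expectation (\<lambda>\<omega>. p h (?z \<omega>))) \<le> c * sqrt h ^ 3"
      using p[OF st] by (auto simp: h_def)
    have "norm (expectation (\<lambda>\<omega>. f h (?z \<omega>) - p h (?z \<omega>))) \<le> expectation (\<lambda>\<omega>. norm (f h (?z \<omega>) - p h (?z \<omega>)))"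
      by (rule integral_norm_bound)
    also have "\<dots> \<le> expectation (\<lambda>\<omega>. c * sqrt h ^ 3 * ?E \<omega>)"
    proof (rule integral_mono)
      show "integrable M (\<lambda>\<omega>. norm (f h (?z \<omega>) - p h (?z \<omega>)))"
        using fi pi(1) by (intro integrable_norm Bochner_Integration.integrable_diff)
      show "integrable M (\<lambda>\<omega>. c * sqrt h ^ 3 * ?E \<omega>)" using E(1) by simp
      fix \<omega>
      have "norm (f h (?z \<omega>) - p h (?z \<omega>)) \<le> c * sqrt h ^ 3 * exp (\<rho> * scaled_size h (?z \<omega>))" by (rule q[OF h])
      also have "\<dots> \<le> c * sqrt h ^ 3 * ?E \<omega>"
      proof (rule mult_left_mono)
        have "0 \<le> \<rho> * scaled_size h (?z \<omega>)" using c scaled_size_ge_1[OF h(1), of "?z \<omega>"] by simp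
        then show "exp (\<rho> * scaled_size h (?z \<omega>)) \<le> ?E \<omega>" by simp
      qed (use c h in simp)
      finally show "norm (f h (?z \<omega>) - p h (?z \<omega>)) \<le> c * sqrt h ^ 3 * ?E \<omega>" .
    qed
    also have "\<dots> = c * sqrt h ^ 3 * expectation ?E" by simp
    also have "\<dots> \<le> c * sqrt h ^ 3 * G" using c h by (intro mult_left_mono E(2)) simp
    finally have "norm (expectation (\<lambda>\<omega>. f h (?z \<omega>)) - expectation (\<lambda>\<omega>. p h (?z \<omega>))) \<le> c * sqrt h ^ 3 * G"
      by (simp add: Bochner_Integration.integral_diff[OF fi pi(1)])
    then have "norm (expectation (\<lambda>\<omega>. f h (?z \<omega>))) \<le> c * sqrt h ^ 3 * G + c * sqrt h ^ 3"
      using pi(2) norm_triangle_sub[of "expectation (\<lambda>\<omega>. f h (?z \<omega>))" "expectation (\<lambda>\<omega>. p h (?z \<omega>))"] by linarith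
    then have "norm (expectation (\<lambda>\<omega>. f h (?z \<omega>))) \<le> c * (1 + G) * sqrt h ^ 3" by (simp add: algebra_simps)
    then have "(norm (expectation (\<lambda>\<omega>. f h (?z \<omega>))))\<^sup>2 \<le> (c * (1 + G) * sqrt h ^ 3)\<^sup>2" by (intro power_mono) auto
    also have "\<dots> = (c * (1 + G))\<^sup>2 * h ^ 3"
    proof -
      have "(sqrt h ^ 3)\<^sup>2 = (sqrt h ^ 2) ^ 3" by (simp add: power_mult[symmetric])
      then have "(sqrt h ^ 3)\<^sup>2 = h ^ 3" using h by simp
      then show ?thesis by (simp add: power_mult_distrib)
    qed
    also have "\<dots> \<le> C * h ^ 3" using h G by (intro mult_right_mono) (simp_all add: C_def)
    finally show ?thesis using m L M by (simp add: h_def)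
  qed
  show ?thesis unfolding small_coeff_def using C main by blast
qed

lemma incr_second_moment:
  assumes st: "0 \<le> s" "s < t" "t \<le> T"
  shows "integrable M (\<lambda>\<omega>. incr s t \<omega> $ i * incr s t \<omega> $ j)"
    "expectation (\<lambda>\<omega>. incr s t \<omega> $ i * incr s t \<omega> $ j) = (if i = j then t - s else 0)"
  using W_increments_uncorrelated[OF st, of i j] W_increment_moments(3,4)[OF st, of i]
  by (auto simp: power2_eq_square)

end


section \<open>The matrix factor of the scheme\<close>

context brownian_noise
begin

context
  fixes X :: "real^'d::finite^'d" and B :: "'m \<Rightarrow> real^'d^'d"
begin

text \<open>The exponent of the transition matrix as a function of step size and increment.\<close>

definition expo :: "real \<Rightarrow> real^'m \<Rightarrow> real^'d^'d" where
  "expo h z = h *\<^sub>R X + (\<Sum>i\<in>UNIV. (z $ i) *\<^sub>R B i)"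

definition expo_bound :: real where
  "expo_bound = sqrt T * norm X + (\<Sum>i\<in>UNIV. norm (B i))"

lemma expo_bound_nonneg: "0 \<le> expo_bound"
  using T_pos unfolding expo_bound_def by (intro add_nonneg_nonneg mult_nonneg_nonneg sum_nonneg) auto

lemma norm_expo_le:
  assumes h: "0 < h" "h \<le> T"
  shows "norm (expo h z) \<le> expo_bound * (sqrt h * scaled_size h z)"
proof -
  let ?n = "sqrt h * scaled_size h z"
  have s1: "sqrt h * 1 \<le> ?n" using scaled_size_ge_1[OF h(1)] h by (intro mult_left_mono) auto
  have "h = sqrt h * sqrt h" using h by simp
  also have "\<dots> \<le> sqrt T * ?n" using s1 h by (intro mult_mono) auto
  finally have hn: "h \<le> sqrt T * ?n" .
  have "norm (expo h z) \<le> norm (h *\<^sub>R X) + norm (\<Sum>i\<in>UNIV. (z $ i) *\<^sub>R B i)"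
    unfolding expo_def by (rule norm_triangle_ineq)
  also have "norm (h *\<^sub>R X) \<le> (sqrt T * ?n) * norm X"
    using h hn by (simp add: mult_right_mono)
  also have "norm (\<Sum>i\<in>UNIV. (z $ i) *\<^sub>R B i) \<le> (\<Sum>i\<in>UNIV. ?n * norm (B i))"
    by (rule sum_norm_le) (simp add: mult_right_mono[OF abs_le_scaled_size[OF h(1)]])
  finally show ?thesis by (simp add: expo_bound_def sum_distrib_left algebra_simps)
qed

lemma expo_remainder:
  obtains c where "0 \<le> c" "\<And>h z. 0 < h \<Longrightarrow> h \<le> T \<Longrightarrow>
    norm (matrix_exp (expo h z) - (\<Sum>k<n. (1 / fact k) *\<^sub>R matrix_pow (expo h z) k))
      \<le> c * sqrt h ^ n * exp ((1 + expo_bound * sqrt T) * scaled_size h z)"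
proof -
  define D where "D = norm (mat 1 :: real^'d^'d)"
  have D: "0 \<le> D" by (simp add: D_def)
  have "norm (matrix_exp (expo h z) - (\<Sum>k<n. (1 / fact k) *\<^sub>R matrix_pow (expo h z) k))
      \<le> (D * expo_bound ^ n * fact n) * sqrt h ^ n * exp ((1 + expo_bound * sqrt T) * scaled_size h z)"
    if h: "0 < h" "h \<le> T" for h z
  proof -
    let ?v = "scaled_size h z"
    have v: "0 \<le> ?v" using scaled_size_ge_1[OF h(1), of z] by simp
    note ne = norm_expo_le[OF h, of z]
    have pw: "norm (expo h z) ^ n \<le> expo_bound ^ n * sqrt h ^ n * (fact n * exp ?v)"
    proof -
      have "norm (expo h z) ^ n \<le> (expo_bound * (sqrt h * ?v)) ^ n" by (rule power_mono[OF ne]) simp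
      also have "\<dots> = (expo_bound ^ n * sqrt h ^ n) * ?v ^ n" by (simp add: power_mult_distrib mult.assoc)
      also have "\<dots> \<le> (expo_bound ^ n * sqrt h ^ n) * (fact n * exp ?v)"
        using expo_bound_nonneg h by (intro mult_left_mono power_le_fact_exp v) simp
      finally show ?thesis .
    qed
    have ex: "exp (norm (expo h z)) \<le> exp (expo_bound * sqrt T * ?v)"
    proof -
      have "expo_bound * (sqrt h * ?v) \<le> expo_bound * (sqrt T * ?v)"
        using expo_bound_nonneg h v by (intro mult_left_mono mult_right_mono) auto
      then show ?thesis using ne by (simp add: mult.assoc)
    qed
    have "norm (matrix_exp (expo h z) - (\<Sum>k<n. (1 / fact k) *\<^sub>R matrix_pow (expo h z) k))
      \<le> D * norm (expo h z) ^ n * exp (norm (expo h z))"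
      unfolding D_def by (rule matrix_exp_remainder)
    also have "\<dots> \<le> D * (expo_bound ^ n * sqrt h ^ n * (fact n * exp ?v)) * exp (expo_bound * sqrt T * ?v)"
    proof (rule mult_mono[OF mult_left_mono[OF pw D] ex])
      show "0 \<le> D * (expo_bound ^ n * sqrt h ^ n * (fact n * exp ?v))"
        using D expo_bound_nonneg h by simp
    qed simp
    also have "\<dots> = (D * expo_bound ^ n * fact n) * sqrt h ^ n * (exp ?v * exp (expo_bound * sqrt T * ?v))"
      by (simp only: mult_ac)
    also have "exp ?v * exp (expo_bound * sqrt T * ?v) = exp ((1 + expo_bound * sqrt T) * ?v)"
      by (simp add: exp_add[symmetric] distrib_right)
    finally show ?thesis .
  qed
  then show ?thesis
    using that[of "D * expo_bound ^ n * fact n"] D expo_bound_nonneg by simp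
qed

lemma expo_measurable[measurable]: "expo h \<in> borel_measurable borel"
  unfolding expo_def[abs_def] by (intro borel_measurable_continuous_onI continuous_intros) 

lemma expo_pow:
  "(\<Sum>k<1. (1 / fact k) *\<^sub>R matrix_pow Z k) = mat 1"
  "(\<Sum>k<2. (1 / fact k) *\<^sub>R matrix_pow Z k) = mat 1 + Z"
  "(\<Sum>k<3. (1 / fact k) *\<^sub>R matrix_pow Z k) = mat 1 + Z + (1/2) *\<^sub>R (Z ** Z)"
  for Z :: "real^'d^'d"
  by (simp_all add: eval_nat_numeral)

lemma expo_bounds:
  obtains c \<rho> where "0 \<le> c" "0 \<le> \<rho>"
    "\<And>h z. 0 < h \<Longrightarrow> h \<le> T \<Longrightarrow> norm (matrix_exp (expo h z) - mat 1) \<le> c * sqrt h * exp (\<rho> * scaled_size h z)"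
    "\<And>h z. 0 < h \<Longrightarrow> h \<le> T \<Longrightarrow> norm (matrix_exp (expo h z) - (mat 1 + expo h z)) \<le> c * h * exp (\<rho> * scaled_size h z)"
    "\<And>h z. 0 < h \<Longrightarrow> h \<le> T \<Longrightarrow> norm (matrix_exp (expo h z) - (mat 1 + expo h z + (1/2) *\<^sub>R (expo h z ** expo h z)))
       \<le> c * sqrt h ^ 3 * exp (\<rho> * scaled_size h z)"
proof -
  define \<rho> where "\<rho> = 1 + expo_bound * sqrt T"
  have \<rho>: "0 \<le> \<rho>" using expo_bound_nonneg T_pos by (simp add: \<rho>_def)
  obtain c1 where c1: "0 \<le> c1" "\<And>h z. 0 < h \<Longrightarrow> h \<le> T \<Longrightarrow>
    norm (matrix_exp (expo h z) - mat 1) \<le> c1 * sqrt h ^ 1 * exp (\<rho> * scaled_size h z)"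
    using expo_remainder[of 1] unfolding expo_pow \<rho>_def by blast
  obtain c2 where c2: "0 \<le> c2" "\<And>h z. 0 < h \<Longrightarrow> h \<le> T \<Longrightarrow>
    norm (matrix_exp (expo h z) - (mat 1 + expo h z)) \<le> c2 * sqrt h ^ 2 * exp (\<rho> * scaled_size h z)"
    using expo_remainder[of 2] unfolding expo_pow \<rho>_def by blast
  obtain c3 where c3: "0 \<le> c3" "\<And>h z. 0 < h \<Longrightarrow> h \<le> T \<Longrightarrow>
    norm (matrix_exp (expo h z) - (mat 1 + expo h z + (1/2) *\<^sub>R (expo h z ** expo h z))) \<le> c3 * sqrt h ^ 3 * exp (\<rho> * scaled_size h z)"
    using expo_remainder[of 3] unfolding expo_pow \<rho>_def by blast
  define c where "c = max c1 (max c2 c3)"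
  have c: "0 \<le> c" "c1 \<le> c" "c2 \<le> c" "c3 \<le> c" using c1(1) by (auto simp: c_def)
  have up: "c' * r * exp y \<le> c * r * exp y" if "c' \<le> c" "0 \<le> r" for c' r y :: real
    using that by (intro mult_right_mono) auto
  show ?thesis
  proof (rule that[OF c(1) \<rho>])
    fix h :: real and z :: "real^'m" assume h: "0 < h" "h \<le> T"
    show "norm (matrix_exp (expo h z) - mat 1) \<le> c * sqrt h * exp (\<rho> * scaled_size h z)"
      by (rule order_trans[OF c1(2)[OF h, unfolded power_one_right] up]) (use c h in auto)
    have q: "sqrt h ^ 2 = h" using h by simp
    show "norm (matrix_exp (expo h z) - (mat 1 + expo h z)) \<le> c * h * exp (\<rho> * scaled_size h z)"
      by (rule order_trans[OF c2(2)[OF h, unfolded q] up]) (use c h in auto)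
    show "norm (matrix_exp (expo h z) - (mat 1 + expo h z + (1/2) *\<^sub>R (expo h z ** expo h z)))
       \<le> c * sqrt h ^ 3 * exp (\<rho> * scaled_size h z)"
      by (rule order_trans[OF c3(2)[OF h] up]) (use c h in auto)
  qed
qed

end

end

lemma vec_nth_measurable[measurable]: "(\<lambda>z :: real^'n::finite. z $ i) \<in> borel_measurable borel"
  by (intro borel_measurable_continuous_onI continuous_intros)

lemma mult_sqrt_eq_sqrt_cube:
  assumes "0 \<le> h" shows "h * sqrt h = sqrt h ^ 3"
  using assms by (simp add: power3_eq_cube)

context brownian_noise
begin

context
  fixes A :: "real^'d::finite^'d" and B :: "'m \<Rightarrow> real^'d^'d"
begin

definition X0 :: "real^'d^'d" where
  "X0 = A - (1/2) *\<^sub>R (\<Sum>i\<in>UNIV. B i ** B i)"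

lemma Phi_expo: "Phi A B W t s \<omega> = matrix_exp (expo X0 B (t - s) (incr s t \<omega>))"
  by (simp add: Phi_def expo_def X0_def)

text \<open>The three remainders collect what multiplies the current value, the modified drift and the noise coefficients in the scheme, beyond
  the Euler--Maruyama step.\<close>

definition linear_remainder :: "real \<Rightarrow> real^'m \<Rightarrow> real^'d^'d" where
  "linear_remainder h z = matrix_exp (expo X0 B h z) - mat 1 - h *\<^sub>R A - (\<Sum>i\<in>UNIV. (z $ i) *\<^sub>R B i)"

definition drift_remainder :: "real \<Rightarrow> real^'m \<Rightarrow> real^'d^'d" where
  "drift_remainder h z = h *\<^sub>R (matrix_exp (expo X0 B h z) - mat 1)"

definition noise_remainder :: "'m \<Rightarrow> real \<Rightarrow> real^'m \<Rightarrow> real^'d^'d" where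
  "noise_remainder i h z = (z $ i) *\<^sub>R (matrix_exp (expo X0 B h z) - mat 1) - h *\<^sub>R B i"

lemma expo_square:
  "expo X0 B h z ** expo X0 B h z = (h\<^sup>2) *\<^sub>R (X0 ** X0)
     + (\<Sum>i\<in>UNIV. (z $ i) *\<^sub>R (h *\<^sub>R (X0 ** B i + B i ** X0)))
     + (\<Sum>i\<in>UNIV. \<Sum>j\<in>UNIV. (z $ i * z $ j) *\<^sub>R (B i ** B j))"
proof -
  interpret bb: bounded_bilinear "(**) :: real^'d^'d \<Rightarrow> real^'d^'d \<Rightarrow> real^'d^'d"
    by (rule bounded_bilinear_matrix_matrix)
  let ?S = "\<Sum>i\<in>UNIV. (z $ i) *\<^sub>R B i"
  have 1: "?S ** ?S = (\<Sum>i\<in>UNIV. \<Sum>j\<in>UNIV. (z $ i * z $ j) *\<^sub>R (B i ** B j))"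
    by (simp only: bb.sum_left bb.scaleR_left,
        simp only: bb.sum_right bb.scaleR_right scaleR_sum_right scaleR_scaleR)
  have 2: "(h *\<^sub>R X0) ** ?S + ?S ** (h *\<^sub>R X0) = (\<Sum>i\<in>UNIV. (z $ i) *\<^sub>R (h *\<^sub>R (X0 ** B i + B i ** X0)))"
    by (simp only: bb.sum_left bb.sum_right bb.scaleR_left bb.scaleR_right scaleR_sum_right sum.distrib[symmetric]
        scaleR_add_right scaleR_scaleR mult.commute[of h])
  have "expo X0 B h z ** expo X0 B h z = (h *\<^sub>R X0) ** (h *\<^sub>R X0) + ((h *\<^sub>R X0) ** ?S + ?S ** (h *\<^sub>R X0)) + ?S ** ?S"
    unfolding expo_def by (simp add: bb.add_left bb.add_right)
  then show ?thesis unfolding 1 2 by (simp add: bb.scaleR_left bb.scaleR_right power2_eq_square)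
qed

lemma incr_integrable: "0 \<le> s \<Longrightarrow> s < t \<Longrightarrow> t \<le> T \<Longrightarrow> integrable M (\<lambda>\<omega>. incr s t \<omega> $ i)"
  and incr_mean: "0 \<le> s \<Longrightarrow> s < t \<Longrightarrow> t \<le> T \<Longrightarrow> expectation (\<lambda>\<omega>. incr s t \<omega> $ i) = 0"
  using W_increment_moments(1,2)[of s t i] by auto

text \<open>The increments of different components are uncorrelated, so only the squares \<open>B i ** B i\<close> survive.\<close>

lemma expo_square_mean:
  assumes st: "0 \<le> s" "s < t" "t \<le> T"
  shows "integrable M (\<lambda>\<omega>. expo X0 B (t - s) (incr s t \<omega>) ** expo X0 B (t - s) (incr s t \<omega>))"
    "expectation (\<lambda>\<omega>. expo X0 B (t - s) (incr s t \<omega>) ** expo X0 B (t - s) (incr s t \<omega>))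
      = (t - s)\<^sup>2 *\<^sub>R (X0 ** X0) + (t - s) *\<^sub>R (\<Sum>i\<in>UNIV. B i ** B i)"
proof -
  let ?h = "t - s"
  let ?z = "incr s t"
  have i1: "integrable M (\<lambda>\<omega>. (?z \<omega> $ i) *\<^sub>R C)" "expectation (\<lambda>\<omega>. (?z \<omega> $ i) *\<^sub>R C) = 0" for i and C :: "real^'d^'d"
    using incr_integrable[OF st, of i] incr_mean[OF st, of i] by (auto simp del: incr_nth)
  have i2: "integrable M (\<lambda>\<omega>. (?z \<omega> $ i * ?z \<omega> $ j) *\<^sub>R C)"
    "expectation (\<lambda>\<omega>. (?z \<omega> $ i * ?z \<omega> $ j) *\<^sub>R C) = (if i = j then ?h *\<^sub>R C else 0)" for i j and C :: "real^'d^'d"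
    using incr_second_moment[OF st, of i j] by (auto simp del: incr_nth)
  have I1: "integrable M (\<lambda>\<omega>. \<Sum>i\<in>UNIV. (?z \<omega> $ i) *\<^sub>R (?h *\<^sub>R (X0 ** B i + B i ** X0)))"
    by (intro Bochner_Integration.integrable_sum i1)
  have I2: "integrable M (\<lambda>\<omega>. \<Sum>i\<in>UNIV. \<Sum>j\<in>UNIV. (?z \<omega> $ i * ?z \<omega> $ j) *\<^sub>R (B i ** B j))"
    by (intro Bochner_Integration.integrable_sum i2)
  have I0: "integrable M (\<lambda>\<omega>. (?h\<^sup>2) *\<^sub>R (X0 ** X0))" by simp
  show "integrable M (\<lambda>\<omega>. expo X0 B ?h (?z \<omega>) ** expo X0 B ?h (?z \<omega>))"
    unfolding expo_square by (intro Bochner_Integration.integrable_add I0 I1 I2)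
  have E1: "expectation (\<lambda>\<omega>. \<Sum>i\<in>UNIV. (?z \<omega> $ i) *\<^sub>R (?h *\<^sub>R (X0 ** B i + B i ** X0))) = 0"
    by (subst Bochner_Integration.integral_sum[OF i1(1)]) (simp only: i1(2) sum.neutral_const)
  have E2: "expectation (\<lambda>\<omega>. \<Sum>i\<in>UNIV. \<Sum>j\<in>UNIV. (?z \<omega> $ i * ?z \<omega> $ j) *\<^sub>R (B i ** B j)) = ?h *\<^sub>R (\<Sum>i\<in>UNIV. B i ** B i)"
  proof -
    have "expectation (\<lambda>\<omega>. \<Sum>i\<in>UNIV. \<Sum>j\<in>UNIV. (?z \<omega> $ i * ?z \<omega> $ j) *\<^sub>R (B i ** B j))
      = (\<Sum>i\<in>UNIV. expectation (\<lambda>\<omega>. \<Sum>j\<in>UNIV. (?z \<omega> $ i * ?z \<omega> $ j) *\<^sub>R (B i ** B j)))"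
      by (rule Bochner_Integration.integral_sum) (intro Bochner_Integration.integrable_sum i2)
    also have "\<dots> = (\<Sum>i\<in>UNIV. \<Sum>j\<in>UNIV. expectation (\<lambda>\<omega>. (?z \<omega> $ i * ?z \<omega> $ j) *\<^sub>R (B i ** B j)))"
      by (rule sum.cong[OF refl], rule Bochner_Integration.integral_sum, rule i2(1))
    also have "\<dots> = ?h *\<^sub>R (\<Sum>i\<in>UNIV. B i ** B i)"
      unfolding i2(2) by (simp add: scaleR_sum_right)
    finally show ?thesis .
  qed
  have E0: "expectation (\<lambda>\<omega>. (?h\<^sup>2) *\<^sub>R (X0 ** X0)) = (?h\<^sup>2) *\<^sub>R (X0 ** X0)" by (simp add: prob_space)
  show "expectation (\<lambda>\<omega>. expo X0 B ?h (?z \<omega>) ** expo X0 B ?h (?z \<omega>))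
      = ?h\<^sup>2 *\<^sub>R (X0 ** X0) + ?h *\<^sub>R (\<Sum>i\<in>UNIV. B i ** B i)"
    unfolding expo_square
    by (subst Bochner_Integration.integral_add[OF Bochner_Integration.integrable_add[OF I0 I1] I2],
        subst Bochner_Integration.integral_add[OF I0 I1]) (simp only: E0 E1 E2 add_0_right)
qed

text \<open>The matrix \<open>X0\<close> contains \<open>- (1/2) \<Sum>B\<^sub>i\<^sup>2\<close>, which cancels the mean of the quadratic term of the exponential series.\<close>

lemma small_linear_remainder: "small_coeff linear_remainder"
proof -
  obtain c \<rho> where c: "0 \<le> c" and \<rho>: "0 \<le> \<rho>"
    and b2: "\<And>h z. 0 < h \<Longrightarrow> h \<le> T \<Longrightarrow> norm (matrix_exp (expo X0 B h z) - (mat 1 + expo X0 B h z)) \<le> c * h * exp (\<rho> * scaled_size h z)"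
    and b3: "\<And>h z. 0 < h \<Longrightarrow> h \<le> T \<Longrightarrow> norm (matrix_exp (expo X0 B h z) - (mat 1 + expo X0 B h z + (1/2) *\<^sub>R (expo X0 B h z ** expo X0 B h z)))
       \<le> c * sqrt h ^ 3 * exp (\<rho> * scaled_size h z)"
    using expo_bounds[of X0 B] by metis
  define p where "p h z = (1/2) *\<^sub>R (expo X0 B h z ** expo X0 B h z) + h *\<^sub>R (X0 - A)" for h z
  define c' where "c' = c + norm (X0 - A) + sqrt T * (norm X0)\<^sup>2"
  have c': "0 \<le> c'" "c \<le> c'" "c + norm (X0 - A) \<le> c'" "sqrt T * (norm X0)\<^sup>2 \<le> c'"
    using c T_pos by (auto simp: c'_def)
  show ?thesis
  proof (rule small_coeffI[where p=p and c=c' and \<rho>=\<rho>])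
    show "linear_remainder h \<in> borel_measurable borel" for h
      unfolding linear_remainder_def[abs_def]
      by (intro borel_measurable_diff borel_measurable_sum borel_measurable_scaleR borel_measurable_const
          measurable_compose[OF expo_measurable matrix_exp_measurable] vec_nth_measurable)
    show "0 \<le> c'" "0 \<le> \<rho>" using c' \<rho> by auto
    fix h :: real and z :: "real^'m" assume h: "0 < h" "h \<le> T"
    have e1: "1 \<le> exp (\<rho> * scaled_size h z)" using \<rho> scaled_size_ge_1[OF h(1), of z] by simp
    have eq: "linear_remainder h z = (matrix_exp (expo X0 B h z) - (mat 1 + expo X0 B h z)) + h *\<^sub>R (X0 - A)"
      by (simp add: linear_remainder_def expo_def algebra_simps)
    have "norm (linear_remainder h z) \<le> c * h * exp (\<rho> * scaled_size h z) + norm (h *\<^sub>R (X0 - A))"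
      unfolding eq using norm_triangle_ineq[of "matrix_exp (expo X0 B h z) - (mat 1 + expo X0 B h z)" "h *\<^sub>R (X0 - A)"] b2[OF h, of z]
      by linarith
    also have "norm (h *\<^sub>R (X0 - A)) \<le> norm (X0 - A) * h * exp (\<rho> * scaled_size h z)"
      using mult_left_mono[OF e1, of "norm (X0 - A) * h"] h by (simp add: mult.commute)
    also have "c * h * exp (\<rho> * scaled_size h z) + norm (X0 - A) * h * exp (\<rho> * scaled_size h z)
      = (c + norm (X0 - A)) * h * exp (\<rho> * scaled_size h z)" by (simp add: distrib_right)
    also have "\<dots> \<le> c' * h * exp (\<rho> * scaled_size h z)" using c' h by (intro mult_right_mono) auto
    finally show "norm (linear_remainder h z) \<le> c' * h * exp (\<rho> * scaled_size h z)" by simp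
    have "linear_remainder h z - p h z = matrix_exp (expo X0 B h z) - (mat 1 + expo X0 B h z + (1/2) *\<^sub>R (expo X0 B h z ** expo X0 B h z))"
      by (simp add: linear_remainder_def p_def expo_def[of X0 B h z] algebra_simps)
    then have "norm (linear_remainder h z - p h z) \<le> c * sqrt h ^ 3 * exp (\<rho> * scaled_size h z)" using b3[OF h, of z] by simp
    also have "\<dots> \<le> c' * sqrt h ^ 3 * exp (\<rho> * scaled_size h z)" using c' h by (intro mult_right_mono) auto
    finally show "norm (linear_remainder h z - p h z) \<le> c' * sqrt h ^ 3 * exp (\<rho> * scaled_size h z)" .
  next
    fix s t assume st: "0 \<le> s" "s < t" "t \<le> T"
    let ?h = "t - s"
    have h: "0 < ?h" "?h \<le> T" using st by auto
    have X0A: "X0 - A = - ((1/2) *\<^sub>R (\<Sum>i\<in>UNIV. B i ** B i))" by (simp add: X0_def)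
    note sq = expo_square_mean[OF st]
    have int: "integrable M (\<lambda>\<omega>. (1/2) *\<^sub>R (expo X0 B ?h (incr s t \<omega>) ** expo X0 B ?h (incr s t \<omega>)))" using sq(1) by simp
    have "expectation (\<lambda>\<omega>. p ?h (incr s t \<omega>)) = (1/2) *\<^sub>R (?h\<^sup>2 *\<^sub>R (X0 ** X0) + ?h *\<^sub>R (\<Sum>i\<in>UNIV. B i ** B i)) + ?h *\<^sub>R (X0 - A)"
      unfolding p_def by (subst Bochner_Integration.integral_add[OF int]) (simp_all add: sq(2) prob_space)
    also have "\<dots> = (1/2 * ?h\<^sup>2) *\<^sub>R (X0 ** X0)"
      unfolding X0A by (simp add: scaleR_add_right)
    finally have "norm (expectation (\<lambda>\<omega>. p ?h (incr s t \<omega>))) = 1/2 * ?h\<^sup>2 * norm (X0 ** X0)" by simp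
    also have "\<dots> \<le> ?h\<^sup>2 * (norm X0)\<^sup>2"
    proof -
      have "norm (X0 ** X0) \<le> (norm X0)\<^sup>2" using norm_matrix_matrix_le[of X0 X0] by (simp add: power2_eq_square)
      then have "(1/2 * ?h\<^sup>2) * norm (X0 ** X0) \<le> ?h\<^sup>2 * (norm X0)\<^sup>2" by (intro mult_mono) auto
      then show ?thesis .
    qed
    also have "?h\<^sup>2 * (norm X0)\<^sup>2 \<le> sqrt T * sqrt ?h ^ 3 * (norm X0)\<^sup>2"
    proof (rule mult_right_mono)
      have "?h\<^sup>2 = sqrt ?h * (?h * sqrt ?h)" using h by (simp add: power2_eq_square)
      also have "\<dots> = sqrt ?h * sqrt ?h ^ 3" using h by (simp only: mult_sqrt_eq_sqrt_cube)
      also have "\<dots> \<le> sqrt T * sqrt ?h ^ 3" using h by (intro mult_right_mono) auto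
      finally show "?h\<^sup>2 \<le> sqrt T * sqrt ?h ^ 3" .
    qed simp
    also have "\<dots> = sqrt T * (norm X0)\<^sup>2 * sqrt ?h ^ 3" by (simp only: mult_ac)
    also have "\<dots> \<le> c' * sqrt ?h ^ 3" using c' h by (intro mult_right_mono) auto
    finally have "norm (expectation (\<lambda>\<omega>. p ?h (incr s t \<omega>))) \<le> c' * sqrt ?h ^ 3" .
    moreover have "integrable M (\<lambda>\<omega>. p ?h (incr s t \<omega>))"
      unfolding p_def by (intro Bochner_Integration.integrable_add int) simp
    ultimately show "integrable M (\<lambda>\<omega>. p ?h (incr s t \<omega>)) \<and> norm (expectation (\<lambda>\<omega>. p ?h (incr s t \<omega>))) \<le> c' * sqrt ?h ^ 3" by blast
  qed
qed

text \<open>The factor \<open>h\<close> in front leaves only the first-order bound \<open>O(sqrt h)\<close> of the exponential to be used, and no cancellation.\<close>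

lemma small_drift_remainder: "small_coeff drift_remainder"
proof -
  obtain c \<rho> where c: "0 \<le> c" and \<rho>: "0 \<le> \<rho>"
    and b1: "\<And>h z. 0 < h \<Longrightarrow> h \<le> T \<Longrightarrow> norm (matrix_exp (expo X0 B h z) - mat 1) \<le> c * sqrt h * exp (\<rho> * scaled_size h z)"
    using expo_bounds[of X0 B] by metis
  define c' where "c' = c + c * sqrt T"
  have c': "0 \<le> c'" "c \<le> c'" "c * sqrt T \<le> c'" using c T_pos by (auto simp: c'_def)
  show ?thesis
  proof (rule small_coeffI[where p="\<lambda>h z. 0" and c=c' and \<rho>=\<rho>])
    show "drift_remainder h \<in> borel_measurable borel" for h
      unfolding drift_remainder_def[abs_def]
      by (intro borel_measurable_diff borel_measurable_scaleR borel_measurable_const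
          measurable_compose[OF expo_measurable matrix_exp_measurable])
    show "0 \<le> c'" "0 \<le> \<rho>" using c' \<rho> by auto
    fix h :: real and z :: "real^'m" assume h: "0 < h" "h \<le> T"
    let ?E = "exp (\<rho> * scaled_size h z)"
    have n: "norm (drift_remainder h z) \<le> h * (c * sqrt h * ?E)"
      unfolding drift_remainder_def using mult_left_mono[OF b1[OF h, of z], of h] h by simp
    also have "\<dots> = (c * sqrt h) * (h * ?E)" by (simp only: mult_ac)
    also have "\<dots> \<le> c' * (h * ?E)"
    proof (rule mult_right_mono)
      have "c * sqrt h \<le> c * sqrt T" using c h by (intro mult_left_mono) auto
      then show "c * sqrt h \<le> c'" using c' by linarith
    qed (use h in simp)
    finally show "norm (drift_remainder h z) \<le> c' * h * ?E" by (simp only: mult.assoc)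
    have "h * (c * sqrt h * ?E) = c * (h * sqrt h) * ?E" by (simp only: mult_ac)
    also have "\<dots> = c * sqrt h ^ 3 * ?E" using h by (simp only: mult_sqrt_eq_sqrt_cube less_imp_le)
    also have "\<dots> \<le> c' * sqrt h ^ 3 * ?E" using c' h by (intro mult_right_mono) auto
    finally show "norm (drift_remainder h z - 0) \<le> c' * sqrt h ^ 3 * ?E"
      unfolding diff_0_right by (rule order_trans[OF n])
  next
    fix s t assume st: "0 \<le> s" "s < t" "t \<le> T"
    then show "integrable M (\<lambda>\<omega>. 0 :: real^'d^'d) \<and> norm (expectation (\<lambda>\<omega>. 0 :: real^'d^'d)) \<le> c' * sqrt (t - s) ^ 3"
      using c' by simp
  qed
qed

text \<open>The mean of \<open>\<zeta>\<^sub>i\<close> times the linear term of the exponential series is \<open>h B\<^sub>i\<close>, which is subtracted.\<close>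

lemma small_noise_remainder: "small_coeff (noise_remainder i)"
proof -
  obtain c \<rho> where c: "0 \<le> c" and \<rho>: "0 \<le> \<rho>"
    and b1: "\<And>h z. 0 < h \<Longrightarrow> h \<le> T \<Longrightarrow> norm (matrix_exp (expo X0 B h z) - mat 1) \<le> c * sqrt h * exp (\<rho> * scaled_size h z)"
    and b2: "\<And>h z. 0 < h \<Longrightarrow> h \<le> T \<Longrightarrow> norm (matrix_exp (expo X0 B h z) - (mat 1 + expo X0 B h z)) \<le> c * h * exp (\<rho> * scaled_size h z)"
    using expo_bounds[of X0 B] by metis
  define p where "p h z = (z $ i) *\<^sub>R expo X0 B h z - h *\<^sub>R B i" for h and z :: "real^'m"
  define c' where "c' = c + norm (B i)"
  have c': "0 \<le> c'" "c \<le> c'" using c by (auto simp: c'_def)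
  show ?thesis
  proof (rule small_coeffI[where p=p and c=c' and \<rho>="\<rho> + 1"])
    show "noise_remainder i h \<in> borel_measurable borel" for h
      unfolding noise_remainder_def[abs_def]
      by (intro borel_measurable_diff borel_measurable_scaleR borel_measurable_const vec_nth_measurable
          measurable_compose[OF expo_measurable matrix_exp_measurable])
    show "0 \<le> c'" "0 \<le> \<rho> + 1" using c' \<rho> by auto
    fix h :: real and z :: "real^'m" assume h: "0 < h" "h \<le> T"
    let ?v = "scaled_size h z"
    let ?E = "exp (\<rho> * ?v)" and ?E' = "exp ((\<rho> + 1) * ?v)"
    have v: "1 \<le> ?v" by (rule scaled_size_ge_1[OF h(1)])
    have "?v \<le> exp ?v" using exp_ge_add_one_self[of ?v] by linarith
    then have "?v * ?E \<le> exp ?v * ?E" by (intro mult_right_mono) auto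
    also have "\<dots> = ?E'" by (simp add: exp_add[symmetric] algebra_simps)
    finally have vE: "?v * ?E \<le> ?E'" .
    have e1: "1 \<le> ?E'" using \<rho> v by simp
    have zi: "\<bar>z $ i\<bar> \<le> sqrt h * ?v" by (rule abs_le_scaled_size[OF h(1)])
    have "norm (noise_remainder i h z) \<le> \<bar>z $ i\<bar> * norm (matrix_exp (expo X0 B h z) - mat 1) + h * norm (B i)"
      unfolding noise_remainder_def using norm_triangle_ineq4[of "(z $ i) *\<^sub>R (matrix_exp (expo X0 B h z) - mat 1)" "h *\<^sub>R B i"] h
      by simp
    also have "\<bar>z $ i\<bar> * norm (matrix_exp (expo X0 B h z) - mat 1) \<le> (sqrt h * ?v) * (c * sqrt h * ?E)"
      using zi b1[OF h, of z] h v by (intro mult_mono) auto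
    also have "(sqrt h * ?v) * (c * sqrt h * ?E) = c * (sqrt h * sqrt h) * (?v * ?E)" by (simp only: mult_ac)
    also have "\<dots> = c * h * (?v * ?E)" using h by simp
    also have "\<dots> \<le> c * h * ?E'" using c h by (intro mult_left_mono vE) simp
    also have "h * norm (B i) \<le> norm (B i) * h * ?E'"
      using mult_left_mono[OF e1, of "norm (B i) * h"] h by (simp add: mult.commute)
    also have "c * h * ?E' + norm (B i) * h * ?E' = c' * h * ?E'" by (simp add: c'_def distrib_right)
    finally show "norm (noise_remainder i h z) \<le> c' * h * ?E'" by simp
    have "noise_remainder i h z - p h z = (z $ i) *\<^sub>R (matrix_exp (expo X0 B h z) - (mat 1 + expo X0 B h z))"
      by (simp add: noise_remainder_def p_def algebra_simps)
    then have "norm (noise_remainder i h z - p h z) = \<bar>z $ i\<bar> * norm (matrix_exp (expo X0 B h z) - (mat 1 + expo X0 B h z))"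
      by simp
    also have "\<dots> \<le> (sqrt h * ?v) * (c * h * ?E)"
      using zi b2[OF h, of z] h v by (intro mult_mono) auto
    also have "\<dots> = c * (h * sqrt h) * (?v * ?E)" by (simp only: mult_ac)
    also have "\<dots> = c * sqrt h ^ 3 * (?v * ?E)" using h by (simp only: mult_sqrt_eq_sqrt_cube less_imp_le)
    also have "\<dots> \<le> c * sqrt h ^ 3 * ?E'" using c h by (intro mult_left_mono vE) simp
    also have "\<dots> \<le> c' * sqrt h ^ 3 * ?E'" using c' h by (intro mult_right_mono) auto
    finally show "norm (noise_remainder i h z - p h z) \<le> c' * sqrt h ^ 3 * ?E'" .
  next
    fix s t assume st: "0 \<le> s" "s < t" "t \<le> T"
    let ?h = "t - s"
    let ?z = "incr s t"
    have "p ?h (?z \<omega>) = (?z \<omega> $ i) *\<^sub>R (?h *\<^sub>R X0) + (\<Sum>j\<in>UNIV. (?z \<omega> $ i * ?z \<omega> $ j) *\<^sub>R B j) - ?h *\<^sub>R B i" for \<omega>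
      unfolding p_def expo_def by (simp only: scaleR_add_right scaleR_sum_right scaleR_scaleR)
    then have pe: "(\<lambda>\<omega>. p ?h (?z \<omega>)) = (\<lambda>\<omega>. (?z \<omega> $ i) *\<^sub>R (?h *\<^sub>R X0) + (\<Sum>j\<in>UNIV. (?z \<omega> $ i * ?z \<omega> $ j) *\<^sub>R B j) - ?h *\<^sub>R B i)"
      by blast
    have i1: "integrable M (\<lambda>\<omega>. (?z \<omega> $ i) *\<^sub>R C)" "expectation (\<lambda>\<omega>. (?z \<omega> $ i) *\<^sub>R C) = 0" for C :: "real^'d^'d"
      using incr_integrable[OF st, of i] incr_mean[OF st, of i] by (auto simp del: incr_nth)
    have i2: "integrable M (\<lambda>\<omega>. (?z \<omega> $ i * ?z \<omega> $ j) *\<^sub>R C)"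
      "expectation (\<lambda>\<omega>. (?z \<omega> $ i * ?z \<omega> $ j) *\<^sub>R C) = (if i = j then ?h *\<^sub>R C else 0)" for j and C :: "real^'d^'d"
      using incr_second_moment[OF st, of i j] by (auto simp del: incr_nth)
    have I2: "integrable M (\<lambda>\<omega>. \<Sum>j\<in>UNIV. (?z \<omega> $ i * ?z \<omega> $ j) *\<^sub>R B j)"
      by (intro Bochner_Integration.integrable_sum i2)
    have E2: "expectation (\<lambda>\<omega>. \<Sum>j\<in>UNIV. (?z \<omega> $ i * ?z \<omega> $ j) *\<^sub>R B j) = ?h *\<^sub>R B i"
      by (subst Bochner_Integration.integral_sum[OF i2(1)]) (simp add: i2(2) del: incr_nth)
    have I0: "integrable M (\<lambda>\<omega>. ?h *\<^sub>R B i)" by simp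
    have E0: "expectation (\<lambda>\<omega>. ?h *\<^sub>R B i) = ?h *\<^sub>R B i" by (simp add: prob_space)
    have "integrable M (\<lambda>\<omega>. p ?h (?z \<omega>))"
      unfolding pe by (intro Bochner_Integration.integrable_diff Bochner_Integration.integrable_add i1 I2 I0)
    moreover have "expectation (\<lambda>\<omega>. p ?h (?z \<omega>)) = 0"
      unfolding pe
      by (subst Bochner_Integration.integral_diff[OF Bochner_Integration.integrable_add[OF i1(1) I2] I0],
          subst Bochner_Integration.integral_add[OF i1(1) I2]) (simp only: i1(2) E2 E0 add_0_left diff_self)
    ultimately show "integrable M (\<lambda>\<omega>. p ?h (?z \<omega>)) \<and> norm (expectation (\<lambda>\<omega>. p ?h (?z \<omega>))) \<le> c' * sqrt ?h ^ 3"
      using c' st by simp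
  qed
qed

end

text \<open>The matrix is split into its mean, which gives the drift part, and its centred part, which is independent of the past.\<close>

lemma small_coeff_apply:
  fixes f :: "real \<Rightarrow> real^'m \<Rightarrow> real^'d::finite^'d"
  assumes "small_coeff f"
  shows "\<exists>C\<ge>0. \<forall>s t Y \<gamma>. 0 \<le> s \<longrightarrow> s < t \<longrightarrow> t \<le> T \<longrightarrow>
    Y \<in> borel_measurable (Fil s) \<longrightarrow> L2 Y \<longrightarrow> msq Y \<le> \<gamma> \<longrightarrow>
    drift_noise_split (Fil s) (\<lambda>\<omega>. f (t - s) (incr s t \<omega>) *v Y \<omega>) (C * (t - s) ^ 3 * \<gamma>) (C * (t - s)\<^sup>2 * \<gamma>)"
proof -
  from assms obtain C where C: "0 \<le> C" and f: "\<And>s t. 0 \<le> s \<Longrightarrow> s < t \<Longrightarrow> t \<le> T \<Longrightarrow>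
     f (t - s) \<in> borel_measurable borel \<and> L2 (\<lambda>\<omega>. f (t - s) (incr s t \<omega>)) \<and>
     msq (\<lambda>\<omega>. f (t - s) (incr s t \<omega>)) \<le> C * (t - s)\<^sup>2 \<and>
     (norm (expectation (\<lambda>\<omega>. f (t - s) (incr s t \<omega>))))\<^sup>2 \<le> C * (t - s) ^ 3"
    unfolding small_coeff_def by blast
  show ?thesis
  proof (rule exI[of _ C], intro conjI C allI impI)
    fix s t and Y :: "'a \<Rightarrow> real^'d" and \<gamma> :: real
    assume st: "0 \<le> s" "s < t" "t \<le> T" and Y: "Y \<in> borel_measurable (Fil s)" "L2 Y" and \<gamma>: "msq Y \<le> \<gamma>"
    have \<gamma>0: "0 \<le> \<gamma>" by (rule order_trans[OF msq_nonneg \<gamma>])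
    let ?f = "\<lambda>\<omega>. f (t - s) (incr s t \<omega>)"
    define m where "m = expectation ?f"
    have fm: "f (t - s) \<in> borel_measurable borel" and fL: "L2 ?f" and f2: "msq ?f \<le> C * (t - s)\<^sup>2"
      and f3: "(norm m)\<^sup>2 \<le> C * (t - s) ^ 3"
      using f[OF st] by (auto simp: m_def)
    have sub: "subalgebra M (Fil s)" by (rule Fil_subalgebra) (use st in auto)
    have im: "incr s t \<in> borel_measurable M" by (rule incr_measurable) (use st in auto)
    have f'm: "(\<lambda>z. f (t - s) z - m) \<in> borel_measurable borel" using fm by (intro borel_measurable_diff) auto
    have f'L: "L2 (\<lambda>\<omega>. f (t - s) (incr s t \<omega>) - m)" by (rule L2_diff(1)[OF fL L2_const])
    have f'2: "msq (\<lambda>\<omega>. ?f \<omega> - m) \<le> C * (t - s)\<^sup>2"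
      using msq_centered_le[OF fL] f2 by (simp add: m_def)
    have f'0: "expectation (\<lambda>\<omega>. ?f \<omega> - m) = 0"
      using L2_integrable[OF fL] by (simp add: m_def prob_space)
    let ?D = "\<lambda>\<omega>. m *v Y \<omega>"
    let ?S = "\<lambda>\<omega>. (f (t - s) (incr s t \<omega>) - m) *v Y \<omega>"
    have Dm: "?D \<in> borel_measurable M"
      by (rule measurable_compose[OF L2_measurable[OF Y(2)]])
        (intro borel_measurable_continuous_onI linear_continuous_on
          bounded_bilinear.bounded_linear_right[OF bounded_bilinear_matrix_vector])
    have Db: "(norm (?D \<omega>))\<^sup>2 \<le> (norm m)\<^sup>2 * (0 + (norm (Y \<omega>))\<^sup>2)" for \<omega>
      using power_mono[OF norm_matrix_vector_le, of m "Y \<omega>" 2] by (simp add: power_mult_distrib)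
    note D = L2_affine_bound[OF Dm Y(2) Db]
    have "msq ?D \<le> (norm m)\<^sup>2 * msq Y" using D(2) by simp
    also have "\<dots> \<le> (C * (t - s) ^ 3) * \<gamma>" using f3 \<gamma> C st by (intro mult_mono) auto
    finally have D2: "msq ?D \<le> C * (t - s) ^ 3 * \<gamma>" .
    have S: "mart_incr (Fil s) ?S"
      by (rule indep_bilinear_mart_incr[OF bounded_bilinear_matrix_vector norm_matrix_vector_le incr_indep[OF st] sub im Y f'm f'L f'0])
    have "msq ?S \<le> msq (\<lambda>\<omega>. ?f \<omega> - m) * msq Y"
      by (rule indep_bilinear_L2(2)[OF bounded_bilinear_matrix_vector norm_matrix_vector_le incr_indep[OF st] sub im Y f'm f'L])
    also have "\<dots> \<le> (C * (t - s)\<^sup>2) * \<gamma>" using f'2 \<gamma> C st by (intro mult_mono) auto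
    finally have S2: "msq ?S \<le> C * (t - s)\<^sup>2 * \<gamma>" .
    show "drift_noise_split (Fil s) (\<lambda>\<omega>. f (t - s) (incr s t \<omega>) *v Y \<omega>) (C * (t - s) ^ 3 * \<gamma>) (C * (t - s)\<^sup>2 * \<gamma>)"
    proof (rule drift_noise_splitI[where D="?D" and S="?S"])
      show "?f \<omega> *v Y \<omega> = ?D \<omega> + ?S \<omega>" for \<omega>
        by (simp add: bounded_bilinear.diff_left[OF bounded_bilinear_matrix_vector])
    qed (rule D(1) D2 S S2)+
  qed
qed

lemma small_coeff_sum_apply:
  fixes f :: "'k::finite \<Rightarrow> real \<Rightarrow> real^'m \<Rightarrow> real^'d::finite^'d" and c :: "'k \<Rightarrow> real^'d \<Rightarrow> real^'d"
  assumes f: "\<And>k. small_coeff (f k)" and cm: "\<And>k. c k \<in> borel_measurable borel"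
    and \<Gamma>: "0 \<le> \<Gamma>" "\<And>k x. (norm (c k x))\<^sup>2 \<le> \<Gamma> * (1 + (norm x)\<^sup>2)"
  obtains C where "0 \<le> C" "\<And>s t Y. 0 \<le> s \<Longrightarrow> s < t \<Longrightarrow> t \<le> T \<Longrightarrow> Y \<in> borel_measurable (Fil s) \<Longrightarrow> L2 Y \<Longrightarrow>
    drift_noise_split (Fil s) (\<lambda>\<omega>. \<Sum>k\<in>UNIV. f k (t - s) (incr s t \<omega>) *v c k (Y \<omega>))
      (C * (t - s) ^ 3 * (1 + msq Y)) (C * (t - s)\<^sup>2 * (1 + msq Y))"
proof -
  have "\<forall>k. \<exists>C\<ge>0. \<forall>s t Y \<gamma>. 0 \<le> s \<longrightarrow> s < t \<longrightarrow> t \<le> T \<longrightarrow>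
    Y \<in> borel_measurable (Fil s) \<longrightarrow> L2 Y \<longrightarrow> msq Y \<le> \<gamma> \<longrightarrow>
    drift_noise_split (Fil s) (\<lambda>\<omega>. f k (t - s) (incr s t \<omega>) *v Y \<omega>) (C * (t - s) ^ 3 * \<gamma>) (C * (t - s)\<^sup>2 * \<gamma>)"
    by (intro allI small_coeff_apply f)
  from choice[OF this] obtain C where C: "\<forall>k. 0 \<le> C k \<and> (\<forall>s t Y \<gamma>. 0 \<le> s \<longrightarrow> s < t \<longrightarrow> t \<le> T \<longrightarrow>
    Y \<in> borel_measurable (Fil s) \<longrightarrow> L2 Y \<longrightarrow> msq Y \<le> \<gamma> \<longrightarrow>
    drift_noise_split (Fil s) (\<lambda>\<omega>. f k (t - s) (incr s t \<omega>) *v Y \<omega>) (C k * (t - s) ^ 3 * \<gamma>) (C k * (t - s)\<^sup>2 * \<gamma>))"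
    by blast
  have C0: "0 \<le> C k" for k using C by blast
  have CC: "drift_noise_split (Fil s) (\<lambda>\<omega>. f k (t - s) (incr s t \<omega>) *v Y \<omega>) (C k * (t - s) ^ 3 * \<gamma>) (C k * (t - s)\<^sup>2 * \<gamma>)"
    if "0 \<le> s" "s < t" "t \<le> T" "Y \<in> borel_measurable (Fil s)" "L2 Y" "msq Y \<le> \<gamma>" for k s t Y \<gamma>
    using C that by blast
  define C' where "C' = real CARD('k) * (\<Sum>k\<in>UNIV. C k) * \<Gamma>"
  have C': "0 \<le> C'" using C0 \<Gamma>(1) by (auto simp: C'_def intro!: mult_nonneg_nonneg sum_nonneg)
  show ?thesis
  proof (rule that[OF C'])
    fix s t and Y :: "'a \<Rightarrow> real^'d"
    assume st: "0 \<le> s" "s < t" "t \<le> T" and Y: "Y \<in> borel_measurable (Fil s)" "L2 Y"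
    let ?\<gamma> = "\<Gamma> * (1 + msq Y)"
    have Yk: "(\<lambda>\<omega>. c k (Y \<omega>)) \<in> borel_measurable (Fil s)" "L2 (\<lambda>\<omega>. c k (Y \<omega>))" "msq (\<lambda>\<omega>. c k (Y \<omega>)) \<le> ?\<gamma>" for k
      using measurable_compose[OF Y(1) cm] L2_affine_bound[OF measurable_compose[OF L2_measurable[OF Y(2)] cm] Y(2) \<Gamma>(2)] by auto
    have "drift_noise_split (Fil s) (\<lambda>\<omega>. \<Sum>k\<in>UNIV. f k (t - s) (incr s t \<omega>) *v c k (Y \<omega>))
      (real CARD('k) * (\<Sum>k\<in>UNIV. C k * (t - s) ^ 3 * ?\<gamma>)) (real CARD('k) * (\<Sum>k\<in>UNIV. C k * (t - s)\<^sup>2 * ?\<gamma>))"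
      by (rule drift_noise_split_sum) (rule CC[OF st Yk])
    moreover have "real CARD('k) * (\<Sum>k\<in>UNIV. C k * x * ?\<gamma>) = C' * x * (1 + msq Y)" for x
    proof -
      have "(\<Sum>k\<in>UNIV. C k * x * ?\<gamma>) = (\<Sum>k\<in>UNIV. C k) * x * ?\<gamma>"
        by (simp only: sum_distrib_right)
      then show ?thesis by (simp only: C'_def mult_ac)
    qed
    ultimately show "drift_noise_split (Fil s) (\<lambda>\<omega>. \<Sum>k\<in>UNIV. f k (t - s) (incr s t \<omega>) *v c k (Y \<omega>))
      (C' * (t - s) ^ 3 * (1 + msq Y)) (C' * (t - s)\<^sup>2 * (1 + msq Y))"
      by (simp only:)
  qed
qed

end


section \<open>Convergence of the scheme\<close>

lemma matrix_vector_measurable[measurable]: "(\<lambda>x. (C :: real^'d::finite^'d) *v x) \<in> borel_measurable borel"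
  by (intro borel_measurable_continuous_onI linear_continuous_on
      bounded_bilinear.bounded_linear_right[OF bounded_bilinear_matrix_vector])

lemma sum_UNIV_option:
  fixes f :: "'k::finite option \<Rightarrow> 'b::comm_monoid_add"
  shows "(\<Sum>k\<in>UNIV. f k) = f None + (\<Sum>k\<in>UNIV. f (Some k))"
  by (simp add: UNIV_option_conv sum.reindex)

locale ei0_problem = brownian_noise M Fil T W
  for M :: "'a measure" and Fil T and W :: "'m::finite \<Rightarrow> real \<Rightarrow> 'a \<Rightarrow> real" +
  fixes A :: "real^'d^'d" and B :: "'m \<Rightarrow> real^'d^'d"
    and F :: "real^'d \<Rightarrow> real^'d" and g :: "'m \<Rightarrow> real^'d \<Rightarrow> real^('d::finite)"
    and L :: real and u0 :: "real^'d" and u :: "real \<Rightarrow> 'a \<Rightarrow> real^'d"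
  assumes F_lipschitz: "norm (F x - F y) \<le> L * norm (x - y)"
    and g_lipschitz: "norm (g i x - g i y) \<le> L * norm (x - y)"
    and solves: "sde_solution M Fil T W (\<lambda>x. A *v x + F x) (\<lambda>i x. B i *v x + g i x) u0 u"
begin

definition total_lipschitz :: real where
  "total_lipschitz = norm A + (\<Sum>i\<in>UNIV. norm (B i)) + L"

lemma affine_lipschitz:
  assumes "norm (f x - f y) \<le> L * norm (x - y)" "norm C \<le> norm A + (\<Sum>i\<in>UNIV. norm (B i))"
  shows "norm ((C *v x + f x) - (C *v y + f y)) \<le> total_lipschitz * norm (x - y :: real^'d)"
proof -
  have eq: "(C *v x + f x) - (C *v y + f y) = C *v (x - y) + (f x - f y)"
    by (simp add: bounded_bilinear.diff_right[OF bounded_bilinear_matrix_vector])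
  have "norm ((C *v x + f x) - (C *v y + f y)) \<le> norm (C *v (x - y)) + norm (f x - f y)"
    unfolding eq by (rule norm_triangle_ineq)
  also have "norm (C *v (x - y)) \<le> norm C * norm (x - y)" by (rule norm_matrix_vector_le)
  also have "\<dots> \<le> (norm A + (\<Sum>i\<in>UNIV. norm (B i))) * norm (x - y)" by (rule mult_right_mono[OF assms(2)]) simp
  finally show ?thesis using assms(1) by (simp add: total_lipschitz_def distrib_right)
qed

sublocale lipschitz_sde M Fil T W "\<lambda>x. A *v x + F x" "\<lambda>i x. B i *v x + g i x" u0 u total_lipschitz
proof
  show "norm ((A *v x + F x) - (A *v y + F y)) \<le> total_lipschitz * norm (x - y)" for x y
    by (rule affine_lipschitz[OF F_lipschitz]) (simp add: sum_nonneg)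
  show "norm ((B i *v x + g i x) - (B i *v y + g i y)) \<le> total_lipschitz * norm (x - y)" for i x y
  proof (rule affine_lipschitz[OF g_lipschitz])
    have "norm (B i) \<le> (\<Sum>i\<in>UNIV. norm (B i))" by (rule member_le_sum) auto
    then show "norm (B i) \<le> norm A + (\<Sum>i\<in>UNIV. norm (B i))" by (simp add: add_increasing)
  qed
qed (rule solves)

lemma L_nonneg: "0 \<le> L"
proof -
  obtain x :: "real^'d" where x: "x \<in> Basis" using nonempty_Basis by blast
  have "0 \<le> L * norm (x - 0)" using F_lipschitz[of x 0] norm_ge_zero order_trans by blast
  then show ?thesis using x by simp
qed

lemma F_measurable[measurable]: "F \<in> borel_measurable borel"
proof -
  have "L-lipschitz_on UNIV F" using L_nonneg by (intro lipschitz_onI) (auto simp: dist_norm F_lipschitz)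
  then show ?thesis by (intro borel_measurable_continuous_onI lipschitz_on_continuous_on)
qed

lemma g_measurable[measurable]: "g i \<in> borel_measurable borel"
proof -
  have "L-lipschitz_on UNIV (g i)" using L_nonneg by (intro lipschitz_onI) (auto simp: dist_norm g_lipschitz)
  then show ?thesis by (intro borel_measurable_continuous_onI lipschitz_on_continuous_on)
qed

lemma f_tilde_measurable: "f_tilde B F g \<in> borel_measurable borel"
  unfolding f_tilde_def[abs_def]
  by (intro borel_measurable_diff borel_measurable_sum F_measurable measurable_compose[OF g_measurable matrix_vector_measurable])

text \<open>The two kinds of remainder without index and the one for each noise component are indexed by one finite type, so that the
  remainder of a step is a single sum.\<close>

definition rem_matrix :: "'m option option \<Rightarrow> real \<Rightarrow> real^'m \<Rightarrow> real^'d^'d" where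
  "rem_matrix k = (case k of None \<Rightarrow> linear_remainder A B | Some None \<Rightarrow> drift_remainder A B
     | Some (Some i) \<Rightarrow> noise_remainder A B i)"

definition rem_coeff :: "'m option option \<Rightarrow> real^'d \<Rightarrow> real^'d" where
  "rem_coeff k = (case k of None \<Rightarrow> (\<lambda>x. x) | Some None \<Rightarrow> f_tilde B F g | Some (Some i) \<Rightarrow> g i)"

text \<open>The term \<open>- h \<Sum>B\<^sub>i g\<^sub>i\<close> of the modified drift is absorbed by the subtraction of \<open>h B\<^sub>i\<close> in \<^const>\<open>noise_remainder\<close>.\<close>

lemma EI0_step:
  "Phi A B W t s \<omega> *v (y + (t - s) *\<^sub>R f_tilde B F g y + (\<Sum>i\<in>UNIV. (W i t \<omega> - W i s \<omega>) *\<^sub>R g i y))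
   = y + (t - s) *\<^sub>R (A *v y + F y) + (\<Sum>i\<in>UNIV. (W i t \<omega> - W i s \<omega>) *\<^sub>R (B i *v y + g i y))
     + (\<Sum>k\<in>UNIV. rem_matrix k (t - s) (incr s t \<omega>) *v rem_coeff k y)"
proof -
  interpret mv: bounded_bilinear "(*v) :: real^'d^'d \<Rightarrow> real^'d \<Rightarrow> real^'d"
    by (rule bounded_bilinear_matrix_vector)
  define h where "h = t - s"
  define \<zeta> where "\<zeta> i = W i t \<omega> - W i s \<omega>" for i
  define P where "P = Phi A B W t s \<omega>"
  have P: "matrix_exp (expo (X0 A B) B h (incr s t \<omega>)) = P" by (simp add: P_def Phi_expo h_def)
  have one: "mat 1 *v x = x" for x :: "real^'d" by simp
  have r0: "rem_matrix None h (incr s t \<omega>) *v rem_coeff None y = P *v y - y - h *\<^sub>R (A *v y) - (\<Sum>i\<in>UNIV. \<zeta> i *\<^sub>R (B i *v y))"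
    by (simp add: rem_matrix_def rem_coeff_def linear_remainder_def P \<zeta>_def mv.diff_left mv.sum_left mv.scaleR_left)
  have r1: "rem_matrix (Some None) h (incr s t \<omega>) *v rem_coeff (Some None) y = h *\<^sub>R (P *v f_tilde B F g y) - h *\<^sub>R f_tilde B F g y"
    by (simp add: rem_matrix_def rem_coeff_def drift_remainder_def P mv.diff_left mv.scaleR_left scaleR_diff_right)
  have r2: "rem_matrix (Some (Some i)) h (incr s t \<omega>) *v rem_coeff (Some (Some i)) y
      = \<zeta> i *\<^sub>R (P *v g i y) - \<zeta> i *\<^sub>R g i y - h *\<^sub>R (B i *v g i y)" for i
    by (simp add: rem_matrix_def rem_coeff_def noise_remainder_def P \<zeta>_def mv.diff_left mv.scaleR_left scaleR_diff_right)
  have ft: "h *\<^sub>R f_tilde B F g y = h *\<^sub>R F y - (\<Sum>i\<in>UNIV. h *\<^sub>R (B i *v g i y))"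
    by (simp add: f_tilde_def scaleR_diff_right scaleR_sum_right)
  have lhs: "P *v (y + h *\<^sub>R f_tilde B F g y + (\<Sum>i\<in>UNIV. \<zeta> i *\<^sub>R g i y))
    = P *v y + h *\<^sub>R (P *v f_tilde B F g y) + (\<Sum>i\<in>UNIV. \<zeta> i *\<^sub>R (P *v g i y))"
    by (simp only: mv.add_right mv.sum_right mv.scaleR_right)
  have rs: "(\<Sum>k\<in>UNIV. rem_matrix k h (incr s t \<omega>) *v rem_coeff k y)
    = (P *v y - y - h *\<^sub>R (A *v y) - (\<Sum>i\<in>UNIV. \<zeta> i *\<^sub>R (B i *v y)))
      + ((h *\<^sub>R (P *v f_tilde B F g y) - h *\<^sub>R f_tilde B F g y)
      + ((\<Sum>i\<in>UNIV. \<zeta> i *\<^sub>R (P *v g i y)) - (\<Sum>i\<in>UNIV. \<zeta> i *\<^sub>R g i y) - (\<Sum>i\<in>UNIV. h *\<^sub>R (B i *v g i y))))"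
    by (simp only: sum_UNIV_option r0 r1 r2 sum_subtractf)
  have "P *v (y + h *\<^sub>R f_tilde B F g y + (\<Sum>i\<in>UNIV. \<zeta> i *\<^sub>R g i y))
    = y + h *\<^sub>R (A *v y + F y) + (\<Sum>i\<in>UNIV. \<zeta> i *\<^sub>R (B i *v y + g i y))
     + (\<Sum>k\<in>UNIV. rem_matrix k h (incr s t \<omega>) *v rem_coeff k y)"
    unfolding lhs rs unfolding ft scaleR_add_right sum.distrib by simp
  then show ?thesis by (simp only: P_def h_def \<zeta>_def)
qed

lemma rem_matrix_small: "small_coeff (rem_matrix k)"
  unfolding rem_matrix_def
  by (auto split: option.split simp: small_linear_remainder small_drift_remainder small_noise_remainder)

lemma rem_coeff_measurable: "rem_coeff k \<in> borel_measurable borel"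
  unfolding rem_coeff_def by (auto split: option.split simp: f_tilde_measurable)

lemma rem_coeff_growth:
  obtains \<Gamma> where "0 \<le> \<Gamma>" "\<And>k x. (norm (rem_coeff k x))\<^sup>2 \<le> \<Gamma> * (1 + (norm x)\<^sup>2)"
proof -
  have ft: "norm (f_tilde B F g x - f_tilde B F g y) \<le> (L + (\<Sum>i\<in>UNIV. norm (B i) * L)) * norm (x - y)" for x y
  proof -
    have "f_tilde B F g x - f_tilde B F g y = (F x - F y) - (\<Sum>i\<in>UNIV. B i *v (g i x - g i y))"
      by (simp add: f_tilde_def bounded_bilinear.diff_right[OF bounded_bilinear_matrix_vector] sum_subtractf)
    then have "norm (f_tilde B F g x - f_tilde B F g y) \<le> norm (F x - F y) + norm (\<Sum>i\<in>UNIV. B i *v (g i x - g i y))"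
      by (simp add: norm_triangle_ineq4)
    also have "norm (\<Sum>i\<in>UNIV. B i *v (g i x - g i y)) \<le> (\<Sum>i\<in>UNIV. (norm (B i) * L) * norm (x - y))"
    proof (rule sum_norm_le)
      fix i
      have "norm (B i *v (g i x - g i y)) \<le> norm (B i) * norm (g i x - g i y)" by (rule norm_matrix_vector_le)
      also have "\<dots> \<le> norm (B i) * (L * norm (x - y))" by (intro mult_left_mono g_lipschitz) simp
      finally show "norm (B i *v (g i x - g i y)) \<le> (norm (B i) * L) * norm (x - y)" by (simp only: mult.assoc)
    qed
    finally show ?thesis using F_lipschitz[of x y] by (simp add: sum_distrib_right distrib_right)
  qed
  define K where "K = 1 + L + (\<Sum>i\<in>UNIV. norm (B i) * L)"
  have KL: "L \<le> K" "1 \<le> K" "L + (\<Sum>i\<in>UNIV. norm (B i) * L) \<le> K"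
    using L_nonneg by (auto simp: K_def sum_nonneg)
  have lip: "norm (rem_coeff k x - rem_coeff k y) \<le> K * norm (x - y)" for k x y
  proof -
    have up: "c * norm (x - y) \<le> K * norm (x - y)" if "c \<le> K" for c using that by (intro mult_right_mono) auto
    consider "k = None" | "k = Some None" | i where "k = Some (Some i)" by (metis option.exhaust)
    then show ?thesis
    proof cases
      case 1
      then show ?thesis using up[OF KL(2)] by (simp add: rem_coeff_def)
    next
      case 2
      then show ?thesis using order_trans[OF ft up[OF KL(3)]] by (simp add: rem_coeff_def)
    next
      case 3
      then show ?thesis using order_trans[OF g_lipschitz up[OF KL(1)]] by (simp add: rem_coeff_def)
    qed
  qed
  define S where "S = (\<Sum>k\<in>UNIV. (norm (rem_coeff k 0))\<^sup>2)"
  show ?thesis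
  proof (rule that[of "2 * S + 2 * K\<^sup>2"])
    show "0 \<le> 2 * S + 2 * K\<^sup>2" by (simp add: S_def sum_nonneg)
    fix k x
    have "(norm (rem_coeff k x))\<^sup>2 \<le> (2 * (norm (rem_coeff k 0))\<^sup>2 + 2 * K\<^sup>2) * (1 + (norm x)\<^sup>2)"
      by (rule lipschitz_square_growth[OF lip])
    also have "\<dots> \<le> (2 * S + 2 * K\<^sup>2) * (1 + (norm x)\<^sup>2)"
    proof (rule mult_right_mono)
      have "(norm (rem_coeff k 0))\<^sup>2 \<le> S" unfolding S_def by (rule member_le_sum) auto
      then show "2 * (norm (rem_coeff k 0))\<^sup>2 + 2 * K\<^sup>2 \<le> 2 * S + 2 * K\<^sup>2" by simp
    qed simp
    finally show "(norm (rem_coeff k x))\<^sup>2 \<le> (2 * S + 2 * K\<^sup>2) * (1 + (norm x)\<^sup>2)" .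
  qed
qed

definition ei0 :: "nat \<Rightarrow> nat \<Rightarrow> 'a \<Rightarrow> real^'d" where
  "ei0 N = EI0 A B F g W (ugrid T N) (T / real N) u0"

lemma ei0_Suc:
  "ei0 N (Suc n) \<omega> = ei0 N n \<omega> + (T / real N) *\<^sub>R (A *v ei0 N n \<omega> + F (ei0 N n \<omega>))
    + (\<Sum>i\<in>UNIV. (W i (ugrid T N (Suc n)) \<omega> - W i (ugrid T N n) \<omega>) *\<^sub>R (B i *v ei0 N n \<omega> + g i (ei0 N n \<omega>)))
    + (\<Sum>k\<in>UNIV. rem_matrix k (T / real N) (incr (ugrid T N n) (ugrid T N (Suc n)) \<omega>) *v rem_coeff k (ei0 N n \<omega>))"
  using EI0_step[of "ugrid T N (Suc n)" "ugrid T N n" \<omega> "ei0 N n \<omega>"]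
  unfolding ugrid_simps(3) by (simp add: ei0_def)

lemma ei0_adapted:
  assumes N: "0 < N"
  shows "n \<le> N \<Longrightarrow> ei0 N n \<in> borel_measurable (Fil (ugrid T N n))"
proof (induction n)
  case 0
  then show ?case by (simp add: ei0_def)
next
  case (Suc n)
  have gb: "0 \<le> ugrid T N n" "ugrid T N n \<le> ugrid T N (Suc n)" "ugrid T N (Suc n) \<le> T"
    using ugrid_T_bounds[of n N] ugrid_T_bounds[of "Suc n" N] ugrid_less[OF T_pos N, of n] Suc.prems by auto
  let ?G = "Fil (ugrid T N (Suc n))"
  have Y: "ei0 N n \<in> borel_measurable ?G"
    by (rule measurable_Fil_mono[OF Suc.IH]) (use Suc.prems gb in auto)
  have w: "W i (ugrid T N n) \<in> borel_measurable ?G" "W i (ugrid T N (Suc n)) \<in> borel_measurable ?G" for i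
    using gb by (auto intro!: W_adapted)
  have inc: "incr (ugrid T N n) (ugrid T N (Suc n)) \<in> borel_measurable ?G"
    by (rule incr_adapted) (use gb in auto)
  have P: "(\<lambda>\<omega>. Phi A B W (ugrid T N (Suc n)) (ugrid T N n) \<omega>) \<in> borel_measurable ?G"
    unfolding Phi_expo
    by (rule measurable_compose[OF inc measurable_compose[OF expo_measurable matrix_exp_measurable]])
  have V: "(\<lambda>\<omega>. ei0 N n \<omega> + (T / real N) *\<^sub>R f_tilde B F g (ei0 N n \<omega>)
      + (\<Sum>i\<in>UNIV. (W i (ugrid T N (Suc n)) \<omega> - W i (ugrid T N n) \<omega>) *\<^sub>R g i (ei0 N n \<omega>))) \<in> borel_measurable ?G"
    by (intro borel_measurable_add borel_measurable_sum borel_measurable_scaleR borel_measurable_diff borel_measurable_const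
        Y w measurable_compose[OF Y f_tilde_measurable] measurable_compose[OF Y g_measurable])
  have mv: "(\<lambda>p :: (real^'d^'d) \<times> (real^'d). fst p *v snd p) \<in> borel_measurable (borel \<Otimes>\<^sub>M borel)"
    unfolding borel_prod
    by (intro borel_measurable_continuous_onI bounded_bilinear.continuous_on[OF bounded_bilinear_matrix_vector] continuous_intros)
  show ?case
    unfolding ei0_def EI0.simps
    using measurable_compose[OF measurable_Pair[OF P V] mv] unfolding ei0_def by simp
qed

lemma em_block:
  "em K (j + l) \<omega> = em K j \<omega> + (\<Sum>q<l. (T / real K) *\<^sub>R (A *v em K (j + q) \<omega> + F (em K (j + q) \<omega>)))
    + (\<Sum>q<l. \<Sum>i\<in>UNIV. (W i (ugrid T K (Suc (j + q))) \<omega> - W i (ugrid T K (j + q)) \<omega>) *\<^sub>R (B i *v em K (j + q) \<omega> + g i (em K (j + q) \<omega>)))"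
proof (induction l)
  case (Suc l)
  let ?D = "(T / real K) *\<^sub>R (A *v em K (j + l) \<omega> + F (em K (j + l) \<omega>))"
  let ?S = "\<Sum>i\<in>UNIV. (W i (ugrid T K (Suc (j + l))) \<omega> - W i (ugrid T K (j + l)) \<omega>) *\<^sub>R (B i *v em K (j + l) \<omega> + g i (em K (j + l) \<omega>))"
  have "em K (j + Suc l) \<omega> = em K (j + l) \<omega> + ?D + ?S" by simp
  also have "\<dots> = (em K j \<omega> + (\<Sum>q<l. (T / real K) *\<^sub>R (A *v em K (j + q) \<omega> + F (em K (j + q) \<omega>)))
    + (\<Sum>q<l. \<Sum>i\<in>UNIV. (W i (ugrid T K (Suc (j + q))) \<omega> - W i (ugrid T K (j + q)) \<omega>) *\<^sub>R (B i *v em K (j + q) \<omega> + g i (em K (j + q) \<omega>)))) + ?D + ?S"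
    by (rule arg_cong[where f="\<lambda>x. x + ?D + ?S", OF Suc.IH])
  finally show ?case by (simp only: sum.lessThan_Suc add_ac)
qed simp

lemma noise_block:
  "W i (ugrid T N (Suc n)) \<omega> - W i (ugrid T N n) \<omega>
    = (\<Sum>q<R. W i (ugrid T (N * R) (Suc (n * R + q))) \<omega> - W i (ugrid T (N * R) (n * R + q)) \<omega>)" if "0 < R"
proof -
  let ?w = "\<lambda>l. W i (ugrid T (N * R) (n * R + l)) \<omega>"
  have "(\<Sum>q<R. ?w (Suc q) - ?w q) = ?w R - ?w 0" by (rule sum_lessThan_telescope)
  moreover have "?w R = W i (ugrid T N (Suc n)) \<omega>"
    using ugrid_refine[OF that, of N "Suc n"] by (simp add: add.commute)
  moreover have "?w 0 = W i (ugrid T N n) \<omega>" using ugrid_refine[OF that, of N n] by simp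
  ultimately show ?thesis by simp
qed

definition fine_error :: "nat \<Rightarrow> nat \<Rightarrow> nat \<Rightarrow> 'a \<Rightarrow> real^'d" where
  "fine_error N R n \<omega> = em (N * R) (n * R) \<omega> - ei0 N n \<omega>"

definition drift_error :: "nat \<Rightarrow> nat \<Rightarrow> nat \<Rightarrow> nat \<Rightarrow> 'a \<Rightarrow> real^'d" where
  "drift_error N R n q \<omega> = (A *v em (N * R) (n * R + q) \<omega> + F (em (N * R) (n * R + q) \<omega>)) - (A *v ei0 N n \<omega> + F (ei0 N n \<omega>))"

definition noise_error :: "nat \<Rightarrow> nat \<Rightarrow> nat \<Rightarrow> nat \<Rightarrow> 'm \<Rightarrow> 'a \<Rightarrow> real^'d" where
  "noise_error N R n q i \<omega> = (B i *v em (N * R) (n * R + q) \<omega> + g i (em (N * R) (n * R + q) \<omega>)) - (B i *v ei0 N n \<omega> + g i (ei0 N n \<omega>))"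

text \<open>Drift and noise of the coarse step are distributed over the substeps, to be compared term by term with the fine path.\<close>

lemma fine_error_Suc:
  assumes R: "0 < R" and N: "0 < N"
  shows "fine_error N R (Suc n) \<omega> = fine_error N R n \<omega>
    + (\<Sum>q<R. (T / real (N * R)) *\<^sub>R drift_error N R n q \<omega>)
    + (\<Sum>q<R. \<Sum>i\<in>UNIV. (W i (ugrid T (N * R) (Suc (n * R + q))) \<omega> - W i (ugrid T (N * R) (n * R + q)) \<omega>) *\<^sub>R noise_error N R n q i \<omega>)
    - (\<Sum>k\<in>UNIV. rem_matrix k (T / real N) (incr (ugrid T N n) (ugrid T N (Suc n)) \<omega>) *v rem_coeff k (ei0 N n \<omega>))"
proof -
  have idx: "Suc n * R = n * R + R" by simp
  let ?y = "ei0 N n \<omega>"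
  have d: "(T / real N) *\<^sub>R (A *v ?y + F ?y) = (\<Sum>q<R. (T / real (N * R)) *\<^sub>R (A *v ?y + F ?y))"
  proof -
    have "(\<Sum>q<R. T / real (N * R)) = T / real N" using R by simp
    then have "(T / real N) *\<^sub>R (A *v ?y + F ?y) = (\<Sum>q<R. T / real (N * R)) *\<^sub>R (A *v ?y + F ?y)" by (simp only:)
    also have "\<dots> = (\<Sum>q<R. (T / real (N * R)) *\<^sub>R (A *v ?y + F ?y))" by (rule scaleR_sum_left)
    finally show ?thesis .
  qed
  have s: "(\<Sum>i\<in>UNIV. (W i (ugrid T N (Suc n)) \<omega> - W i (ugrid T N n) \<omega>) *\<^sub>R (B i *v ?y + g i ?y))
    = (\<Sum>q<R. \<Sum>i\<in>UNIV. (W i (ugrid T (N * R) (Suc (n * R + q))) \<omega> - W i (ugrid T (N * R) (n * R + q)) \<omega>) *\<^sub>R (B i *v ?y + g i ?y))"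
  proof -
    have "(\<Sum>i\<in>UNIV. (W i (ugrid T N (Suc n)) \<omega> - W i (ugrid T N n) \<omega>) *\<^sub>R (B i *v ?y + g i ?y))
      = (\<Sum>i\<in>UNIV. \<Sum>q<R. (W i (ugrid T (N * R) (Suc (n * R + q))) \<omega> - W i (ugrid T (N * R) (n * R + q)) \<omega>) *\<^sub>R (B i *v ?y + g i ?y))"
      by (rule sum.cong[OF refl]) (simp only: noise_block[OF R, of _ N n] scaleR_sum_left)
    also have "\<dots> = (\<Sum>q<R. \<Sum>i\<in>UNIV. (W i (ugrid T (N * R) (Suc (n * R + q))) \<omega> - W i (ugrid T (N * R) (n * R + q)) \<omega>) *\<^sub>R (B i *v ?y + g i ?y))"
      by (rule sum.swap)
    finally show ?thesis .
  qed
  let ?x = "\<lambda>q. em (N * R) (n * R + q) \<omega>"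
  let ?w = "\<lambda>q i. W i (ugrid T (N * R) (Suc (n * R + q))) \<omega> - W i (ugrid T (N * R) (n * R + q)) \<omega>"
  have e1: "em (N * R) (Suc n * R) \<omega> = em (N * R) (n * R) \<omega> + (\<Sum>q<R. (T / real (N * R)) *\<^sub>R (A *v ?x q + F (?x q)))
      + (\<Sum>q<R. \<Sum>i\<in>UNIV. ?w q i *\<^sub>R (B i *v ?x q + g i (?x q)))"
    unfolding idx by (rule em_block)
  have DE: "(\<Sum>q<R. (T / real (N * R)) *\<^sub>R drift_error N R n q \<omega>)
      = (\<Sum>q<R. (T / real (N * R)) *\<^sub>R (A *v ?x q + F (?x q))) - (\<Sum>q<R. (T / real (N * R)) *\<^sub>R (A *v ?y + F ?y))"
    by (simp only: drift_error_def scaleR_diff_right sum_subtractf)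
  have SE: "(\<Sum>q<R. \<Sum>i\<in>UNIV. ?w q i *\<^sub>R noise_error N R n q i \<omega>)
      = (\<Sum>q<R. \<Sum>i\<in>UNIV. ?w q i *\<^sub>R (B i *v ?x q + g i (?x q))) - (\<Sum>q<R. \<Sum>i\<in>UNIV. ?w q i *\<^sub>R (B i *v ?y + g i ?y))"
    by (simp only: noise_error_def scaleR_diff_right sum_subtractf)
  have regroup: "(e + a + b) - (y + a' + b' + r) = (e - y) + (a - a') + (b - b') - r" for e a b y a' b' r :: "real^'d"
    by simp
  show ?thesis
    unfolding fine_error_def e1 ei0_Suc d s DE SE by (rule regroup)
qed

definition osc_const :: real where
  "osc_const = 2 * (em_bound * em_rate * exp (em_rate * T) + 1)"

lemma osc_const_nonneg: "0 \<le> osc_const"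
  using em_bound_ge_1 em_rate_pos by (simp add: osc_const_def add_nonneg_nonneg)

lemma fine_grid_index:
  fixes n N q R :: nat
  assumes "n < N" "q < R" shows "n * R + q < N * R"
proof -
  have "n * R + q < Suc n * R" using assms by simp
  also have "\<dots> \<le> N * R" using assms by (intro mult_le_mono1) simp
  finally show ?thesis .
qed

lemma fine_mesh: "0 < R \<Longrightarrow> real R * (T / real (N * R)) = T / real N"
  by simp

text \<open>Within one coarse step the fine path moves by \<open>O(sqrt h)\<close> in mean square; this limits the rate to \<open>1/2\<close>.\<close>

lemma fine_path_error:
  assumes N: "0 < N" and R: "0 < R" and n: "n < N" and q: "q < R" and L: "L2 (fine_error N R n)"
  shows "L2 (ei0 N n)" "L2 (\<lambda>\<omega>. em (N * R) (n * R + q) \<omega> - ei0 N n \<omega>)"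
    "msq (\<lambda>\<omega>. em (N * R) (n * R + q) \<omega> - ei0 N n \<omega>) \<le> osc_const * (msq (fine_error N R n) + T / real N)"
proof -
  have K: "0 < N * R" using N R by simp
  have i: "n * R + q \<le> N * R" "n * R \<le> N * R" using fine_grid_index[OF n q] n by auto
  have L0: "L2 (em (N * R) (n * R))" and Lq: "L2 (em (N * R) (n * R + q))"
    by (rule em_moment[OF K i(2)], rule em_moment[OF K i(1)])
  have "ei0 N n = (\<lambda>\<omega>. em (N * R) (n * R) \<omega> - fine_error N R n \<omega>)" by (simp add: fine_error_def fun_eq_iff)
  then show LY: "L2 (ei0 N n)" using L2_diff(1)[OF L0 L] by simp
  show "L2 (\<lambda>\<omega>. em (N * R) (n * R + q) \<omega> - ei0 N n \<omega>)" by (rule L2_diff(1)[OF Lq LY])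
  let ?d = "\<lambda>\<omega>. em (N * R) (n * R + q) \<omega> - em (N * R) (n * R) \<omega>"
  let ?c = "em_bound * em_rate * exp (em_rate * T)"
  have "msq ?d \<le> ?c * (real q * (T / real (N * R)))" by (rule em_increment[OF K i(1)])
  also have "\<dots> \<le> ?c * (T / real N)"
  proof (rule mult_left_mono)
    have "real q * (T / real (N * R)) \<le> real R * (T / real (N * R))"
      using q T_pos by (intro mult_right_mono) auto
    then show "real q * (T / real (N * R)) \<le> T / real N" unfolding fine_mesh[OF R] .
  qed (use em_bound_ge_1 em_rate_pos in simp)
  finally have d: "msq ?d \<le> ?c * (T / real N)" .
  have "msq (\<lambda>\<omega>. ?d \<omega> + fine_error N R n \<omega>) \<le> 2 * msq ?d + 2 * msq (fine_error N R n)"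
    by (rule L2_add(2)[OF L2_diff(1)[OF Lq L0] L])
  also have "(\<lambda>\<omega>. ?d \<omega> + fine_error N R n \<omega>) = (\<lambda>\<omega>. em (N * R) (n * R + q) \<omega> - ei0 N n \<omega>)"
    by (simp add: fine_error_def fun_eq_iff)
  finally have "msq (\<lambda>\<omega>. em (N * R) (n * R + q) \<omega> - ei0 N n \<omega>) \<le> 2 * (?c * (T / real N)) + 2 * msq (fine_error N R n)"
    using d by linarith
  also have "\<dots> \<le> osc_const * (msq (fine_error N R n) + T / real N)"
  proof -
    have "0 \<le> 2 * ?c * msq (fine_error N R n) + 2 * (T / real N)"
      using em_bound_ge_1 em_rate_pos T_pos by (intro add_nonneg_nonneg mult_nonneg_nonneg) auto
    then show ?thesis unfolding osc_const_def by (simp add: algebra_simps)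
  qed
  finally show "msq (\<lambda>\<omega>. em (N * R) (n * R + q) \<omega> - ei0 N n \<omega>) \<le> osc_const * (msq (fine_error N R n) + T / real N)" .
qed

lemma fine_step_split:
  assumes N: "0 < N" and R: "0 < R" and n: "n < N" and L: "L2 (fine_error N R n)"
  defines "x \<equiv> msq (fine_error N R n)" and "h \<equiv> T / real N"
  shows "drift_noise_split (Fil (ugrid T N n))
    (\<lambda>\<omega>. (\<Sum>q<R. (T / real (N * R)) *\<^sub>R drift_error N R n q \<omega>)
      + (\<Sum>q<R. \<Sum>i\<in>UNIV. (W i (ugrid T (N * R) (Suc (n * R + q))) \<omega> - W i (ugrid T (N * R) (n * R + q)) \<omega>) *\<^sub>R noise_error N R n q i \<omega>))
    (total_lipschitz\<^sup>2 * osc_const * h\<^sup>2 * (x + h)) ((real CARD('m))\<^sup>2 * (total_lipschitz\<^sup>2 * osc_const) * h * (x + h))"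
proof (rule drift_noise_splitI)
  define K where "K = N * R"
  define \<delta> where "\<delta> = T / real K"
  define \<gamma> where "\<gamma> = total_lipschitz\<^sup>2 * (osc_const * (x + h))"
  have K: "0 < K" using N R by (simp add: K_def)
  have \<delta>: "0 < \<delta>" "real R * \<delta> = h" using mesh_pos[OF K] fine_mesh[OF R, of N] by (auto simp: \<delta>_def K_def h_def)
  let ?G = "\<lambda>q. Fil (ugrid T K (n * R + q))"
  have idx: "n * R + q < K" if "q < R" for q using fine_grid_index[OF n that] by (simp add: K_def)
  have idR: "n * R + R \<le> K"
  proof -
    have "Suc n * R \<le> N * R" using n by (intro mult_le_mono1) simp
    then show ?thesis by (simp add: K_def add.commute)
  qed
  have gb: "0 \<le> ugrid T K l" "ugrid T K l \<le> T" if "l \<le> K" for l using ugrid_T_bounds[OF that] by auto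
  have gm: "ugrid T K l \<le> ugrid T K l'" if "l \<le> l'" "l' \<le> K" for l l'
    by (rule grid_mono[of K]) (use that ugrid_less[OF T_pos K] in auto)
  have base: "ugrid T N n = ugrid T K (n * R)" unfolding K_def by (rule ugrid_refine[OF R, symmetric])
  have e_m: "em K (n * R + q) \<in> borel_measurable (?G q)" if "q < R" for q
    by (rule em_adapted[OF K]) (use idx[OF that] in simp)
  have y_m: "ei0 N n \<in> borel_measurable (?G q)" if q: "q < R" for q
  proof (rule measurable_Fil_mono[where s="ugrid T K (n * R)"])
    show "ei0 N n \<in> borel_measurable (Fil (ugrid T K (n * R)))"
      unfolding base[symmetric] by (rule ei0_adapted[OF N]) (use n in simp)
    show "0 \<le> ugrid T K (n * R)" "ugrid T K (n * R) \<le> ugrid T K (n * R + q)" "ugrid T K (n * R + q) \<le> T"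
      using gb[of "n * R"] gb[of "n * R + q"] gm[of "n * R" "n * R + q"] idx[OF q] by auto
  qed
  note fpe = fine_path_error[OF N R n _ L, folded x_def h_def K_def]
  have lip: "(norm v)\<^sup>2 \<le> total_lipschitz\<^sup>2 * (0 + (norm w)\<^sup>2)" if "norm v \<le> total_lipschitz * norm w" for v w :: "real^'d"
    using power_mono[OF that, of 2] by (simp add: power_mult_distrib)
  have dm: "drift_error N R n q \<in> borel_measurable (?G q)" if "q < R" for q
    unfolding drift_error_def[abs_def] K_def[symmetric]
    by (intro borel_measurable_diff measurable_compose[OF e_m[OF that] a_measurable] measurable_compose[OF y_m[OF that] a_measurable])
  have nm: "noise_error N R n q i \<in> borel_measurable (?G q)" if "q < R" for q i
    unfolding noise_error_def[abs_def] K_def[symmetric]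
    by (intro borel_measurable_diff measurable_compose[OF e_m[OF that] b_measurable] measurable_compose[OF y_m[OF that] b_measurable])
  have toM: "f \<in> borel_measurable M" if "f \<in> borel_measurable (?G q)" "q < R" for f :: "'a \<Rightarrow> real^'d" and q
    by (rule measurable_Fil_M[OF that(1)]) (use gb idx[OF that(2)] in auto)
  have D: "L2 (drift_error N R n q)" "msq (drift_error N R n q) \<le> \<gamma>" if q: "q < R" for q
  proof -
    have le: "(norm (drift_error N R n q \<omega>))\<^sup>2 \<le> total_lipschitz\<^sup>2 * (0 + (norm (em K (n * R + q) \<omega> - ei0 N n \<omega>))\<^sup>2)" for \<omega>
      unfolding drift_error_def K_def by (rule lip[OF a_lipschitz])
    note * = L2_affine_bound[OF toM[OF dm[OF q] q] fpe(2)[OF q] le]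
    show "L2 (drift_error N R n q)" by (rule *(1))
    have "msq (drift_error N R n q) \<le> total_lipschitz\<^sup>2 * msq (\<lambda>\<omega>. em K (n * R + q) \<omega> - ei0 N n \<omega>)" using *(2) by simp
    also have "\<dots> \<le> \<gamma>" unfolding \<gamma>_def by (intro mult_left_mono fpe(3)[OF q]) simp
    finally show "msq (drift_error N R n q) \<le> \<gamma>" .
  qed
  have V: "L2 (noise_error N R n q i)" "msq (noise_error N R n q i) \<le> \<gamma>" if q: "q < R" for q i
  proof -
    have le: "(norm (noise_error N R n q i \<omega>))\<^sup>2 \<le> total_lipschitz\<^sup>2 * (0 + (norm (em K (n * R + q) \<omega> - ei0 N n \<omega>))\<^sup>2)" for \<omega>
      unfolding noise_error_def K_def by (rule lip[OF b_lipschitz])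
    note * = L2_affine_bound[OF toM[OF nm[OF q] q] fpe(2)[OF q] le]
    show "L2 (noise_error N R n q i)" by (rule *(1))
    have "msq (noise_error N R n q i) \<le> total_lipschitz\<^sup>2 * msq (\<lambda>\<omega>. em K (n * R + q) \<omega> - ei0 N n \<omega>)" using *(2) by simp
    also have "\<dots> \<le> \<gamma>" unfolding \<gamma>_def by (intro mult_left_mono fpe(3)[OF q]) simp
    finally show "msq (noise_error N R n q i) \<le> \<gamma>" .
  qed
  let ?D = "\<lambda>\<omega>. \<Sum>q<R. \<delta> *\<^sub>R drift_error N R n q \<omega>"
  define S where "S q \<omega> = (\<Sum>i\<in>UNIV. (W i (ugrid T K (Suc (n * R + q))) \<omega> - W i (ugrid T K (n * R + q)) \<omega>) *\<^sub>R noise_error N R n q i \<omega>)" for q \<omega>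
  show "(\<Sum>q<R. (T / real (N * R)) *\<^sub>R drift_error N R n q \<omega>)
      + (\<Sum>q<R. \<Sum>i\<in>UNIV. (W i (ugrid T (N * R) (Suc (n * R + q))) \<omega> - W i (ugrid T (N * R) (n * R + q)) \<omega>) *\<^sub>R noise_error N R n q i \<omega>)
      = ?D \<omega> + (\<Sum>q<R. S q \<omega>)" for \<omega>
    by (simp only: S_def \<delta>_def K_def)
  have dL: "L2 (\<lambda>\<omega>. \<delta> *\<^sub>R drift_error N R n q \<omega>)" if "q \<in> {..<R}" for q
    by (rule L2_scaleR[OF D(1)]) (use that in simp)
  show "L2 ?D" by (rule L2_sum(1)[OF finite_lessThan dL])
  have "msq ?D \<le> real (card {..<R}) * (\<Sum>q<R. msq (\<lambda>\<omega>. \<delta> *\<^sub>R drift_error N R n q \<omega>))"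
    by (rule L2_sum(2)[OF finite_lessThan dL])
  also have "\<dots> = real R * (\<Sum>q<R. \<delta>\<^sup>2 * msq (drift_error N R n q))" by (simp only: msq_scaleR card_lessThan)
  also have "\<dots> \<le> real R * (\<Sum>q<R. \<delta>\<^sup>2 * \<gamma>)" using D(2) by (intro mult_left_mono sum_mono) auto
  also have "\<dots> = (real R * \<delta>)\<^sup>2 * \<gamma>" by (simp add: power2_eq_square)
  also have "\<dots> = total_lipschitz\<^sup>2 * osc_const * h\<^sup>2 * (x + h)" unfolding \<delta>(2) \<gamma>_def by (simp only: mult_ac)
  finally show "msq ?D \<le> total_lipschitz\<^sup>2 * osc_const * h\<^sup>2 * (x + h)" .
  have st: "0 \<le> ugrid T K (n * R + q)" "ugrid T K (n * R + q) < ugrid T K (Suc (n * R + q))" "ugrid T K (Suc (n * R + q)) \<le> T"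
    if "q < R" for q
    using gb[of "n * R + q"] gb[of "Suc (n * R + q)"] ugrid_less[OF T_pos K] idx[OF that] by auto
  have Sq: "mart_incr (?G q) (S q)" "msq (S q) \<le> (real CARD('m))\<^sup>2 * \<delta> * \<gamma>" if q: "q < R" for q
    unfolding S_def[abs_def] \<delta>_def
    using noise_increment[OF st[OF q] nm[OF q] V[OF q]] by (simp_all only: ugrid_simps(3))
  have S_m: "S l \<in> borel_measurable (?G q)" if "l < q" "q < R" for l q
  proof -
    have l: "l < R" using that by simp
    have "W i (ugrid T K (Suc (n * R + l))) \<in> borel_measurable (?G q)" "W i (ugrid T K (n * R + l)) \<in> borel_measurable (?G q)" for i
      using that gb[of "n * R + l"] gb[of "Suc (n * R + l)"] gb[of "n * R + q"] idx[OF that(2)]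
        gm[of "n * R + l" "n * R + q"] gm[of "Suc (n * R + l)" "n * R + q"] by (auto intro!: W_adapted)
    moreover have "noise_error N R n l i \<in> borel_measurable (?G q)" for i
      by (rule measurable_Fil_mono[OF nm[OF l]])
        (use that gb[of "n * R + l"] gb[of "n * R + q"] idx[OF that(2)] gm[of "n * R + l" "n * R + q"] in auto)
    ultimately show ?thesis
      unfolding S_def[abs_def] by (intro borel_measurable_sum borel_measurable_scaleR borel_measurable_diff)
  qed
  show "mart_incr (Fil (ugrid T N n)) (\<lambda>\<omega>. \<Sum>q<R. S q \<omega>)"
  proof (rule mart_incr_sum[OF finite_lessThan])
    fix q assume "q \<in> {..<R}"
    then have q: "q < R" by simp
    have bnd: "0 \<le> ugrid T K (n * R)" "ugrid T K (n * R) \<le> ugrid T K (n * R + q)" "ugrid T K (n * R + q) \<le> T" "ugrid T K (n * R) \<le> T"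
      using gb[of "n * R"] gb[of "n * R + q"] gm[of "n * R" "n * R + q"] idx[OF q] by auto
    show "mart_incr (Fil (ugrid T N n)) (S q)"
      unfolding base
    proof (rule mart_incr_mono[OF Sq(1)[OF q]])
      show "sets (Fil (ugrid T K (n * R))) \<subseteq> sets (?G q)" by (rule Fil_mono[OF bnd(1-3)])
      show "space (Fil (ugrid T K (n * R))) = space (?G q)"
        using Fil_space[OF bnd(1,4)] Fil_space[of "ugrid T K (n * R + q)"] bnd by simp
    qed
  qed
  have "msq (\<lambda>\<omega>. \<Sum>q<R. S q \<omega>) = (\<Sum>q<R. msq (S q))"
  proof -
    have "(\<lambda>\<omega>. \<Sum>l<q. S l \<omega>) \<in> borel_measurable (?G q)" if "q < R" for q
      by (rule borel_measurable_sum) (use S_m that in auto)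
    then show ?thesis
      using msq_mart_sum[of R ?G S] Sq(1) by blast
  qed
  also have "\<dots> \<le> (\<Sum>q<R. (real CARD('m))\<^sup>2 * \<delta> * \<gamma>)" by (rule sum_mono) (use Sq(2) in simp)
  also have "\<dots> = (real CARD('m))\<^sup>2 * (real R * \<delta>) * \<gamma>" by simp
  also have "\<dots> = (real CARD('m))\<^sup>2 * (total_lipschitz\<^sup>2 * osc_const) * h * (x + h)" unfolding \<delta>(2) \<gamma>_def by (simp only: mult_ac)
  finally show "msq (\<lambda>\<omega>. \<Sum>q<R. S q \<omega>) \<le> (real CARD('m))\<^sup>2 * (total_lipschitz\<^sup>2 * osc_const) * h * (x + h)" .
qed

text \<open>All mean squares are absorbed into multiples of \<open>E|e|\<^sup>2 + h\<close>, uniformly in the number of substeps. The second moment of the scheme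
  itself is bounded by that of the Euler--Maruyama scheme and the error.\<close>

lemma fine_error_bound:
  obtains C where "0 \<le> C" "\<And>N R n. 0 < N \<Longrightarrow> 0 < R \<Longrightarrow> n \<le> N \<Longrightarrow>
    L2 (fine_error N R n) \<and> msq (fine_error N R n) \<le> C * (T / real N)"
proof -
  obtain \<Gamma> where \<Gamma>: "0 \<le> \<Gamma>" "\<And>k x. (norm (rem_coeff k x))\<^sup>2 \<le> \<Gamma> * (1 + (norm x)\<^sup>2)"
    by (rule rem_coeff_growth) (rule that)
  obtain Cr where Cr: "0 \<le> Cr" and rem: "\<And>s t Y. 0 \<le> s \<Longrightarrow> s < t \<Longrightarrow> t \<le> T \<Longrightarrow> Y \<in> borel_measurable (Fil s) \<Longrightarrow> L2 Y \<Longrightarrow>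
    drift_noise_split (Fil s) (\<lambda>\<omega>. \<Sum>k\<in>UNIV. rem_matrix k (t - s) (incr s t \<omega>) *v rem_coeff k (Y \<omega>))
      (Cr * (t - s) ^ 3 * (1 + msq Y)) (Cr * (t - s)\<^sup>2 * (1 + msq Y))"
    by (rule small_coeff_sum_apply[of rem_matrix rem_coeff \<Gamma>, OF rem_matrix_small rem_coeff_measurable \<Gamma>]) (rule that)
  define m where "m = (real CARD('m))\<^sup>2"
  define \<alpha> where "\<alpha> = total_lipschitz\<^sup>2 * osc_const"
  define \<beta> where "\<beta> = Cr * (1 + 2 * em_bound + 2 * T)"
  define \<kappa> where "\<kappa> = 2 * \<alpha> * (1 + m) + 2 * \<beta>"
  define C where "C = gronwall_rate \<kappa> T"
  have m: "0 \<le> m" by (simp add: m_def)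
  have \<alpha>: "0 \<le> \<alpha>" using osc_const_nonneg by (simp add: \<alpha>_def)
  have \<beta>: "0 \<le> \<beta>" using Cr em_bound_ge_1 T_pos by (simp add: \<beta>_def)
  have \<kappa>: "0 \<le> \<kappa>" "2 * \<alpha> + 2 * \<beta> \<le> \<kappa>" "2 * (m * \<alpha>) + 2 * \<beta> \<le> \<kappa>"
    using m \<alpha> \<beta> by (auto simp: \<kappa>_def algebra_simps)
  have C: "0 \<le> C" using \<kappa> T_pos by (simp add: C_def gronwall_rate_def)
  have main: "L2 (fine_error N R n) \<and> msq (fine_error N R n) \<le> exp (C * T) * (T / real N)"
    if N: "0 < N" and R: "0 < R" and n: "n \<le> N" for N R n
  proof -
    define h where "h = T / real N"
    have h: "0 < h" "h \<le> T" using mesh_pos[OF N] mesh_le[OF N] by (auto simp: h_def)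
    let ?e = "fine_error N R"
    let ?G = "\<lambda>j. Fil (ugrid T N j)"
    have e0: "?e 0 = (\<lambda>\<omega>. 0)" by (simp add: fine_error_def ei0_def fun_eq_iff)
    have ad: "?e j \<in> borel_measurable (?G j)" if "j \<le> N" for j
    proof -
      have "em (N * R) (j * R) \<in> borel_measurable (Fil (ugrid T (N * R) (j * R)))"
        by (rule em_adapted) (use N R that in auto)
      then show ?thesis
        unfolding ugrid_refine[OF R] fine_error_def[abs_def]
        by (intro borel_measurable_diff ei0_adapted[OF N that])
    qed
    have split: "drift_noise_split (?G j) (\<lambda>\<omega>. ?e (Suc j) \<omega> - ?e j \<omega>)
        (\<kappa> * h\<^sup>2 * (msq (?e j) + h)) (\<kappa> * h * (msq (?e j) + h))" if j: "j < N" and L: "L2 (?e j)" for j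
    proof -
      let ?x = "msq (?e j)"
      have x: "0 \<le> ?x" by (rule msq_nonneg)
      have LY: "L2 (ei0 N j)" using fine_path_error(1)[OF N R j R L] .
      have yb: "1 + msq (ei0 N j) \<le> 1 + 2 * em_bound + 2 * ?x"
      proof -
        have K: "0 < N * R" "j * R \<le> N * R" using N R j by auto
        have "msq (\<lambda>\<omega>. em (N * R) (j * R) \<omega> - ?e j \<omega>) \<le> 2 * msq (em (N * R) (j * R)) + 2 * ?x"
          by (rule L2_diff(2)[OF em_moment(1)[OF K] L])
        moreover have "msq (\<lambda>\<omega>. em (N * R) (j * R) \<omega> - ?e j \<omega>) = msq (ei0 N j)" by (simp add: fine_error_def)
        ultimately show ?thesis using em_moment(2)[OF K] by linarith
      qed
      have st: "0 \<le> ugrid T N j" "ugrid T N j < ugrid T N (Suc j)" "ugrid T N (Suc j) \<le> T"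
        using ugrid_T_bounds[of j N] ugrid_T_bounds[of "Suc j" N] ugrid_less[OF T_pos N, of j] j by auto
      have ym: "ei0 N j \<in> borel_measurable (?G j)" by (rule ei0_adapted[OF N]) (use j in simp)
      obtain D1 S1 where 1: "\<And>\<omega>. (\<Sum>q<R. (T / real (N * R)) *\<^sub>R drift_error N R j q \<omega>)
          + (\<Sum>q<R. \<Sum>i\<in>UNIV. (W i (ugrid T (N * R) (Suc (j * R + q))) \<omega> - W i (ugrid T (N * R) (j * R + q)) \<omega>) *\<^sub>R noise_error N R j q i \<omega>) = D1 \<omega> + S1 \<omega>"
        "L2 D1" "msq D1 \<le> \<alpha> * h\<^sup>2 * (?x + h)" "mart_incr (?G j) S1" "msq S1 \<le> m * \<alpha> * h * (?x + h)"
        by (rule drift_noise_splitE[OF fine_step_split[OF N R j L, folded \<alpha>_def m_def h_def]]) (rule that)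
      obtain D2 S2 where 2: "\<And>\<omega>. (\<Sum>k\<in>UNIV. rem_matrix k h (incr (ugrid T N j) (ugrid T N (Suc j)) \<omega>) *v rem_coeff k (ei0 N j \<omega>)) = D2 \<omega> + S2 \<omega>"
        "L2 D2" "msq D2 \<le> Cr * h ^ 3 * (1 + msq (ei0 N j))" "mart_incr (?G j) S2" "msq S2 \<le> Cr * h\<^sup>2 * (1 + msq (ei0 N j))"
        by (rule drift_noise_splitE[OF rem[OF st ym LY, unfolded ugrid_simps(3), folded h_def]]) (rule that)
      \<comment> \<open>The remainder carries an additional factor \<open>h\<close> compared with what the recursion allows.\<close>
      have absorb: "h * (1 + msq (ei0 N j)) \<le> (1 + 2 * em_bound + 2 * T) * (?x + h)"
      proof -
        have "h * (1 + msq (ei0 N j)) \<le> h * (1 + 2 * em_bound) + 2 * (h * ?x)"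
          using mult_left_mono[OF yb, of h] h by (simp add: algebra_simps)
        also have "h * ?x \<le> T * ?x" using h x by (intro mult_right_mono) auto
        also have "h * (1 + 2 * em_bound) + 2 * (T * ?x) \<le> (1 + 2 * em_bound + 2 * T) * (?x + h)"
          using h x em_bound_ge_1 T_pos by (simp add: algebra_simps add_nonneg_nonneg)
        finally show ?thesis by simp
      qed
      have "Cr * h ^ 3 * (1 + msq (ei0 N j)) = (Cr * h\<^sup>2) * (h * (1 + msq (ei0 N j)))"
        by (simp add: power2_eq_square power3_eq_cube)
      also have "\<dots> \<le> (Cr * h\<^sup>2) * ((1 + 2 * em_bound + 2 * T) * (?x + h))"
        using Cr by (intro mult_left_mono absorb) simp
      also have "\<dots> = \<beta> * h\<^sup>2 * (?x + h)" by (simp only: \<beta>_def mult_ac)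
      finally have D2: "msq D2 \<le> \<beta> * h\<^sup>2 * (?x + h)" using 2(3) by linarith
      have "Cr * h\<^sup>2 * (1 + msq (ei0 N j)) = (Cr * h) * (h * (1 + msq (ei0 N j)))"
        by (simp add: power2_eq_square)
      also have "\<dots> \<le> (Cr * h) * ((1 + 2 * em_bound + 2 * T) * (?x + h))"
        using Cr h by (intro mult_left_mono absorb) simp
      also have "\<dots> = \<beta> * h * (?x + h)" by (simp only: \<beta>_def mult_ac)
      finally have S2: "msq S2 \<le> \<beta> * h * (?x + h)" using 2(5) by linarith
      show ?thesis
      proof (rule drift_noise_splitI[where D="\<lambda>\<omega>. D1 \<omega> - D2 \<omega>" and S="\<lambda>\<omega>. S1 \<omega> + - S2 \<omega>"])
        show "?e (Suc j) \<omega> - ?e j \<omega> = D1 \<omega> - D2 \<omega> + (S1 \<omega> + - S2 \<omega>)" for \<omega>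
          using fine_error_Suc[OF R N, of j \<omega>] 1(1)[of \<omega>] 2(1)[of \<omega>] unfolding h_def by (simp add: algebra_simps)
        show "L2 (\<lambda>\<omega>. D1 \<omega> - D2 \<omega>)" by (rule L2_diff(1)[OF 1(2) 2(2)])
        show "mart_incr (?G j) (\<lambda>\<omega>. S1 \<omega> + - S2 \<omega>)" by (rule mart_incr_add[OF 1(4) mart_incr_uminus[OF 2(4)]])
        have pos: "0 \<le> h\<^sup>2 * (?x + h)" "0 \<le> h * (?x + h)" using h x by auto
        have "msq (\<lambda>\<omega>. D1 \<omega> - D2 \<omega>) \<le> 2 * msq D1 + 2 * msq D2" by (rule L2_diff(2)[OF 1(2) 2(2)])
        also have "\<dots> \<le> (2 * \<alpha> + 2 * \<beta>) * (h\<^sup>2 * (?x + h))" using 1(3) D2 by (simp add: algebra_simps)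
        also have "\<dots> \<le> \<kappa> * (h\<^sup>2 * (?x + h))" by (rule mult_right_mono[OF \<kappa>(2) pos(1)])
        finally show "msq (\<lambda>\<omega>. D1 \<omega> - D2 \<omega>) \<le> \<kappa> * h\<^sup>2 * (?x + h)" by (simp only: mult.assoc)
        have "msq (\<lambda>\<omega>. S1 \<omega> + - S2 \<omega>) \<le> 2 * msq S1 + 2 * msq S2"
          using L2_diff(2)[OF mart_incr_L2[OF 1(4)] mart_incr_L2[OF 2(4)]] by simp
        also have "\<dots> \<le> (2 * (m * \<alpha>) + 2 * \<beta>) * (h * (?x + h))" using 1(5) S2 by (simp add: algebra_simps)
        also have "\<dots> \<le> \<kappa> * (h * (?x + h))" by (rule mult_right_mono[OF \<kappa>(3) pos(2)])
        finally show "msq (\<lambda>\<omega>. S1 \<omega> + - S2 \<omega>) \<le> \<kappa> * h * (?x + h)" by (simp only: mult.assoc)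
      qed
    qed
    have gron: "L2 (?e n) \<and> msq (?e n) + h \<le> exp (C * (real n * h)) * (msq (?e 0) + h)"
      unfolding C_def
    proof (rule mean_square_gronwall[where e="?e" and G="?G", OF _ _ h less_imp_le[OF h(1)] \<kappa>(1) split])
      show "L2 (?e 0)" unfolding e0 by simp
    qed (use ad n in auto)
    have "C * (real n * h) \<le> C * T" using mesh_times_le[OF n] C by (intro mult_left_mono) (auto simp: h_def)
    then have "exp (C * (real n * h)) * h \<le> exp (C * T) * h" using h by (intro mult_right_mono) auto
    moreover have "msq (?e 0) = 0" unfolding e0 by simp
    ultimately show ?thesis using gron h by (simp add: h_def)
  qed
  show ?thesis by (rule that[of "exp (C * T)"]) (use main in auto)
qed

text \<open>The fine grids with \<open>N * Suc j\<close> points form a subsequence of all uniform grids; the index \<open>k\<close> is set to 0 on grids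
  that do not contain \<open>n * T / N\<close>. Choosing \<open>\<epsilon> = sqrt h\<close> in \<open>L2_limit_in_prob\<close> costs no more than the bound itself.\<close>

theorem ei0_mean_square_error:
  obtains K where "0 < K" "\<And>N n. 0 < N \<Longrightarrow> n \<le> N \<Longrightarrow>
    L2 (\<lambda>\<omega>. u (ugrid T N n) \<omega> - ei0 N n \<omega>) \<and> msq (\<lambda>\<omega>. u (ugrid T N n) \<omega> - ei0 N n \<omega>) \<le> K * (T / real N)"
proof -
  obtain C where C: "0 \<le> C" and fine: "\<And>N R n. 0 < N \<Longrightarrow> 0 < R \<Longrightarrow> n \<le> N \<Longrightarrow>
    L2 (fine_error N R n) \<and> msq (fine_error N R n) \<le> C * (T / real N)"
    by (rule fine_error_bound) (rule that)
  have main: "L2 (\<lambda>\<omega>. u (ugrid T N n) \<omega> - ei0 N n \<omega>) \<and> msq (\<lambda>\<omega>. u (ugrid T N n) \<omega> - ei0 N n \<omega>) \<le> (2 * C + 2) * (T / real N)"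
    if N: "0 < N" and n: "n \<le> N" for N n
  proof -
    define h where "h = T / real N"
    have h: "0 < h" using mesh_pos[OF N] by (simp add: h_def)
    have um: "u (ugrid T N n) \<in> borel_measurable M" by (rule u_measurable) (use ugrid_T_bounds[OF n] in auto)
    have ym: "ei0 N n \<in> borel_measurable M"
      by (rule measurable_Fil_M[OF ei0_adapted[OF N n]]) (use ugrid_T_bounds[OF n] in auto)
    let ?R = "\<lambda>j. Suc j"
    let ?X = "\<lambda>\<omega>. u (ugrid T N n) \<omega> - ei0 N n \<omega>"
    have Xm: "?X \<in> borel_measurable M" using um ym by (rule borel_measurable_diff)
    define k where "k K = (if N dvd Suc K then n * (Suc K div N) else 0)" for K
    have k: "k K \<le> Suc K" for K
    proof (cases "N dvd Suc K")
      case True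
      then have "Suc K = N * (Suc K div N)" by simp
      then show ?thesis using True mult_le_mono1[OF n, of "Suc K div N"] by (simp add: k_def)
    qed (simp add: k_def)
    have lim: "(\<lambda>K. prob {\<omega>\<in>space M. sqrt h < norm (u (ugrid T (Suc K) (k K)) \<omega> - em (Suc K) (k K) \<omega>)}) \<longlonglongrightarrow> 0"
      by (rule em_tendsto_in_prob[OF k]) (use h in simp)
    define \<sigma> where "\<sigma> j = N * Suc j - 1" for j
    have \<sigma>: "Suc (\<sigma> j) = N * Suc j" for j using N by (simp add: \<sigma>_def)
    have "filterlim \<sigma> sequentially sequentially"
    proof (rule filterlim_subseq)
      have "\<sigma> j < \<sigma> (Suc j)" for j
      proof -
        have "Suc (\<sigma> j) < Suc (\<sigma> (Suc j))" unfolding \<sigma> using N by simp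
        then show ?thesis by simp
      qed
      then show "strict_mono \<sigma>" by (simp add: strict_mono_Suc_iff)
    qed
    then have "(\<lambda>j. prob {\<omega>\<in>space M. sqrt h < norm (u (ugrid T (Suc (\<sigma> j)) (k (\<sigma> j))) \<omega> - em (Suc (\<sigma> j)) (k (\<sigma> j)) \<omega>)}) \<longlonglongrightarrow> 0"
      by (rule filterlim_compose[OF lim])
    moreover have "k (\<sigma> j) = n * Suc j" for j
      unfolding k_def \<sigma> using N by (simp del: mult_Suc_right)
    ultimately have "(\<lambda>j. prob {\<omega>\<in>space M. sqrt h < norm (u (ugrid T N n) \<omega> - em (N * Suc j) (n * Suc j) \<omega>)}) \<longlonglongrightarrow> 0"
      unfolding \<sigma> using ugrid_refine[of "Suc _" N n] by simp
    moreover have "u (ugrid T N n) \<omega> - em (N * Suc j) (n * Suc j) \<omega> = ?X \<omega> - fine_error N (Suc j) n \<omega>" for j \<omega>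
      by (simp add: fine_error_def)
    ultimately have lim': "(\<lambda>j. prob {\<omega>\<in>space M. sqrt h < norm (?X \<omega> - fine_error N (Suc j) n \<omega>)}) \<longlonglongrightarrow> 0"
      by (simp only:)
    have fe: "L2 (fine_error N (Suc j) n)" "msq (fine_error N (Suc j) n) \<le> C * h" for j
      using fine[OF N _ n, of "Suc j"] by (auto simp: h_def)
    note * = L2_limit_in_prob[OF Xm fe lim']
    have "2 * (C * h) + 2 * (sqrt h)\<^sup>2 = (2 * C + 2) * h" using h by (simp add: algebra_simps)
    then show ?thesis using * by (simp add: h_def)
  qed
  show ?thesis by (rule that[of "2 * C + 2"]) (use main C in auto)
qed

end

text \<open>A partition with constant step is the uniform grid, on which the two versions of the scheme agree.\<close>

theorem theorem1:
  fixes M :: "'a measure" and Fil :: "real \<Rightarrow> 'a measure"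
    and W :: "'m::finite \<Rightarrow> real \<Rightarrow> 'a \<Rightarrow> real"
    and A :: "real^'d^'d" and B :: "'m \<Rightarrow> real^'d^'d"
    and F :: "real^'d \<Rightarrow> real^'d" and g :: "'m \<Rightarrow> real^'d \<Rightarrow> real^('d::finite)"
    and u0 :: "real^'d" and u :: "real \<Rightarrow> 'a \<Rightarrow> real^'d" and T L :: real
  assumes "prob_space M" and "T > 0" and "filtration_upto M Fil T"
    and "indep_brownian_motions M Fil T W"
    and "\<And>i. commutator A (B i) = 0" and "\<And>i j. commutator (B j) (B i) = 0"
    and "L > 0"
    and "\<And>x. (norm (F x))\<^sup>2 \<le> L * (1 + (norm x)\<^sup>2)"
    and "\<And>i x. (norm (g i x))\<^sup>2 \<le> L * (1 + (norm x)\<^sup>2)"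
    and "\<And>x y. norm (F x - F y) \<le> L * norm (x - y)"
    and "\<And>i x y. norm (g i x - g i y) \<le> L * norm (x - y)"
    and "sde_solution M Fil T W (\<lambda>x. A *v x + F x) (\<lambda>i x. B i *v x + g i x) u0 u"
  shows "\<exists>K>0. \<forall>N t \<Delta>t. uniform_partition T N t \<Delta>t \<longrightarrow>
           (\<forall>n\<in>{0..N}. square_integrable M (\<lambda>\<omega>. u (t n) \<omega> - EI0 A B F g W t \<Delta>t u0 n \<omega>)) \<and>
           (SUP n\<in>{0..N}. L2_norm M (\<lambda>\<omega>. u (t n) \<omega> - EI0 A B F g W t \<Delta>t u0 n \<omega>))
             \<le> K * \<Delta>t powr (1/2)"
proof -
  interpret prob_space M by fact
  interpret ei0_problem M Fil T W A B F g L u0 u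
    by unfold_locales (use assms in auto)
  obtain K where K: "0 < K" and err: "\<And>N n. 0 < N \<Longrightarrow> n \<le> N \<Longrightarrow>
    L2 (\<lambda>\<omega>. u (ugrid T N n) \<omega> - ei0 N n \<omega>) \<and> msq (\<lambda>\<omega>. u (ugrid T N n) \<omega> - ei0 N n \<omega>) \<le> K * (T / real N)"
    by (rule ei0_mean_square_error) (rule that)
  show ?thesis
  proof (intro exI[of _ "sqrt K"] conjI allI impI)
    show "0 < sqrt K" using K by simp
    fix N t \<Delta>t assume part: "uniform_partition T N t \<Delta>t"
    have tn: "t n = real n * \<Delta>t" if "n \<le> N" for n
      using that
    proof (induction n)
      case (Suc n)
      then have "n < N" by simp
      then have "t (Suc n) - t n = \<Delta>t" using part unfolding uniform_partition_def by blast
      then show ?case using Suc by (simp add: distrib_right)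
    qed (use part in \<open>simp add: uniform_partition_def\<close>)
    have NT: "real N * \<Delta>t = T" using tn[of N] part by (simp add: uniform_partition_def)
    then have N: "0 < N" using \<open>T > 0\<close> by (cases N) auto
    have dt: "\<Delta>t = T / real N" using NT N by (simp add: field_simps)
    have tu: "t n = ugrid T N n" if "n \<le> N" for n using tn[OF that] by (simp add: dt ugrid_def)
    have y: "EI0 A B F g W t \<Delta>t u0 n = ei0 N n" if "n \<le> N" for n
      using that
    proof (induction n)
      case (Suc n)
      then show ?case using tu[of n] tu[of "Suc n"] by (simp add: ei0_def dt)
    qed (simp add: ei0_def)
    have e: "L2 (\<lambda>\<omega>. u (t n) \<omega> - EI0 A B F g W t \<Delta>t u0 n \<omega>)"
      "msq (\<lambda>\<omega>. u (t n) \<omega> - EI0 A B F g W t \<Delta>t u0 n \<omega>) \<le> K * \<Delta>t" if "n \<le> N" for n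
      using err[OF N that] unfolding dt[symmetric] tu[OF that, symmetric] y[OF that, symmetric] by auto
    show "\<forall>n\<in>{0..N}. L2 (\<lambda>\<omega>. u (t n) \<omega> - EI0 A B F g W t \<Delta>t u0 n \<omega>)" using e(1) by simp
    show "(SUP n\<in>{0..N}. L2_norm M (\<lambda>\<omega>. u (t n) \<omega> - EI0 A B F g W t \<Delta>t u0 n \<omega>)) \<le> sqrt K * \<Delta>t powr (1/2)"
    proof (rule cSUP_least)
      fix n assume "n \<in> {0..N}"
      then have "L2_norm M (\<lambda>\<omega>. u (t n) \<omega> - EI0 A B F g W t \<Delta>t u0 n \<omega>) \<le> sqrt (K * \<Delta>t)"
        unfolding L2_norm_def using e(2) by (intro real_sqrt_le_mono) simp
      also have "\<dots> = sqrt K * \<Delta>t powr (1/2)"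
        using part by (simp add: real_sqrt_mult powr_half_sqrt uniform_partition_def)
      finally show "L2_norm M (\<lambda>\<omega>. u (t n) \<omega> - EI0 A B F g W t \<Delta>t u0 n \<omega>) \<le> sqrt K * \<Delta>t powr (1/2)" .
    qed simp
  qed
qed

end
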